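(* Let $n\ge1$, $a\ge0$, $n_a=n+a$, $p\ge1$ and, for $p>1$, $q=p/(p-1)$. For any $f\in W^{1,p}(\Omega,\omega)$ such that $\int_\Omega|f|^p\,\omega\,dx=1$, $$\int_\Omega|f(x)|^p\ln(|f(x)|^p)\,\omega(x)\,dx\le\frac{n_a}p\ln\left[\mathcal L_{n,a}(p)\int_\Omega\|\nabla f\|_*^p\,\omega(x)\,dx\right],$$ where $$\mathcal L_{n,a}(p)=\begin{cases}\dfrac p{n_a}\left(\dfrac{p-1}e\right)^{p-1}\left[\Gamma(\tfrac{n_a}q+1)\displaystyle\int_{B\cap\Omega}x_n^a\,dx\right]^{-\frac p{n_a}}&\text{if }p>1,\\[2mm]\dfrac1{n_a}\left[\displaystyle\int_{B\cap\Omega}x_n^a\,dx\right]^{-\frac1{n_a}}&\text{if }p=1.\end{cases}$$ Equality holds if $$f(x)=b\,e^{-\kappa\|x-(\overline x_0,0)\|^q}$$ for some $\kappa>0$, $\overline x_0\in\mathbb R^{n-1}$ and $|b|^{-p}=\int_\Omega e^{-p\kappa\|x\|^q}\omega(x)\,dx$ when $p>1$, and if $$f(x)=b\,\mathbf 1_B(\kappa(\overline x-\overline x_0,x_n))$$ for some $\kappa>0$, $\overline x_0\in\mathbb R^{n-1}$ and $|b|=\kappa^{\frac{n_a}p}\left(\int_{B\cap\Omega}x_n^a\,dx\right)^{-\frac1p}$ when $p=1$ (in this last case $\int_\Omega\|\nabla f\|_*\,\omega\,dx$ is understood as $\int_\Omega\omega\,\|\nu_f\|_*\,d|Df|$).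
   Context: $\Omega=\{x=(\overline x,x_n)\in\mathbb R^{n-1}\times\mathbb R:x_n>0\}$ and $\omega(x)=x_n^a$. $\|\cdot\|$ is an arbitrary norm on $\mathbb R^n$, $B=\{x\in\mathbb R^n:\|x\|\le1\}$, $\|x\|_*=\sup_{\|y\|\le1}x\cdot y$. $W^{1,p}(\Omega,\omega)$ is the space of functions $f$ with $\int_\Omega|f|^p\omega\,dx<\infty$ and distributional gradient satisfying $\int_\Omega\|\nabla f\|_*^p\,\omega\,dx<\infty$. For $f$ of locally bounded variation on $\Omega$, $Df$ is its distributional derivative (a vector valued Radon measure on $\Omega$), $|Df|$ its total variation, and $\nu_f$ the $|Df|$-measurable unit vector field with $dDf=\nu_f\,d|Df|$. Convention: $0\ln0=0$. *)

theory Defs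
  imports "HOL-Analysis.Analysis"
begin

section \<open>Arbitrary norms and their duals\<close>

definition is_norm :: "(real^'n \<Rightarrow> real) \<Rightarrow> bool" where
  "is_norm N \<longleftrightarrow> (\<forall>x. 0 \<le> N x) \<and> (\<forall>x. N x = 0 \<longleftrightarrow> x = 0) \<and>
     (\<forall>c x. N (c *\<^sub>R x) = \<bar>c\<bar> * N x) \<and> (\<forall>x y. N (x + y) \<le> N x + N y)"

definition dual_norm :: "(real^'n \<Rightarrow> real) \<Rightarrow> real^'n \<Rightarrow> real" where
  "dual_norm N x = (SUP y\<in>{y. N y \<le> 1}. x \<bullet> y)"

definition unit_ball :: "(real^'n \<Rightarrow> real) \<Rightarrow> (real^'n) set" where
  "unit_ball N = {x. N x \<le> 1}"


section \<open>The weighted half-space\<close>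

text \<open>The dimension is \<open>n = CARD('n)\<close>, which ranges over all \<open>n \<ge> 1\<close>. Since the index type
  carries no order, the coordinate called \<open>x\<^sub>n\<close> in the mathematical text is an arbitrary fixed
  coordinate \<open>k\<close>; points \<open>(x', 0)\<close> of \<open>\<real>\<^sup>n\<^sup>-\<^sup>1 \<times> {0}\<close> are the vectors with vanishing
  \<open>k\<close>-th coordinate.\<close>

definition half_space :: "'n::finite \<Rightarrow> (real^'n) set" where
  "half_space k = {x. 0 < x $ k}"

definition weight :: "'n::finite \<Rightarrow> real \<Rightarrow> real^'n \<Rightarrow> real" where
  "weight k a x = (x $ k) powr a"

definition eff_dim :: "'n::finite itself \<Rightarrow> real \<Rightarrow> real" where
  "eff_dim _ a = real CARD('n) + a"

definition half_ball_mass :: "'n::finite \<Rightarrow> real \<Rightarrow> (real^'n \<Rightarrow> real) \<Rightarrow> real" where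
  "half_ball_mass k a N = (LINT x:(unit_ball N \<inter> half_space k)|lebesgue. weight k a x)"


section \<open>Test functions and distributional gradients\<close>

definition partial :: "'n::finite \<Rightarrow> (real^'n \<Rightarrow> real) \<Rightarrow> real^'n \<Rightarrow> real" where
  "partial i \<phi> x = frechet_derivative \<phi> (at x) (axis i 1)"

fun C_k :: "nat \<Rightarrow> (real^'n::finite \<Rightarrow> real) \<Rightarrow> bool" where
  "C_k 0 \<phi> \<longleftrightarrow> continuous_on UNIV \<phi>"
| "C_k (Suc m) \<phi> \<longleftrightarrow> (\<forall>x. \<phi> differentiable (at x)) \<and> (\<forall>i. C_k m (partial i \<phi>))"

definition test_function :: "(real^'n::finite) set \<Rightarrow> (real^'n \<Rightarrow> real) \<Rightarrow> bool" where
  "test_function \<Omega> \<phi> \<longleftrightarrow> (\<forall>m. C_k m \<phi>) \<and>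
     compact (closure {x. \<phi> x \<noteq> 0}) \<and> closure {x. \<phi> x \<noteq> 0} \<subseteq> \<Omega>"

definition locally_integrable ::
    "(real^'n::finite) set \<Rightarrow> (real^'n \<Rightarrow> 'b::{banach, second_countable_topology}) \<Rightarrow> bool" where
  "locally_integrable \<Omega> f \<longleftrightarrow> (\<forall>K. compact K \<and> K \<subseteq> \<Omega> \<longrightarrow> set_integrable lebesgue K f)"

definition is_weak_gradient ::
    "(real^'n::finite) set \<Rightarrow> (real^'n \<Rightarrow> real) \<Rightarrow> (real^'n \<Rightarrow> real^'n) \<Rightarrow> bool" where
  "is_weak_gradient \<Omega> f g \<longleftrightarrow> locally_integrable \<Omega> f \<and> locally_integrable \<Omega> g \<and>
     (\<forall>\<phi> i. test_function \<Omega> \<phi> \<longrightarrow>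
        (LINT x:\<Omega>|lebesgue. f x * partial i \<phi> x) = - (LINT x:\<Omega>|lebesgue. g x $ i * \<phi> x))"

text \<open>A weak gradient is determined up to a null set of \<open>\<Omega>\<close>, so the choice does not affect
  integrals over \<open>\<Omega>\<close>.\<close>

definition weak_gradient ::
    "(real^'n::finite) set \<Rightarrow> (real^'n \<Rightarrow> real) \<Rightarrow> real^'n \<Rightarrow> real^'n" where
  "weak_gradient \<Omega> f = (SOME g. is_weak_gradient \<Omega> f g)"

text \<open>The space \<open>W\<^sup>1\<^sup>,\<^sup>p(\<Omega>, \<omega>)\<close> for the half-space \<open>\<Omega>\<close> and \<open>\<omega>(x) = x\<^sub>k\<^sup>a\<close>, with functions on \<open>\<Omega>\<close>
  represented by total functions whose values off \<open>\<Omega>\<close> are irrelevant.\<close>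

definition weighted_sobolev ::
    "'n::finite \<Rightarrow> real \<Rightarrow> real \<Rightarrow> (real^'n \<Rightarrow> real) \<Rightarrow> (real^'n \<Rightarrow> real) set" where
  "weighted_sobolev k a p N = {f.
     f \<in> borel_measurable (lebesgue_on (half_space k)) \<and>
     set_integrable lebesgue (half_space k) (\<lambda>x. \<bar>f x\<bar> powr p * weight k a x) \<and>
     (\<exists>g. is_weak_gradient (half_space k) f g) \<and>
     set_integrable lebesgue (half_space k)
       (\<lambda>x. dual_norm N (weak_gradient (half_space k) f x) powr p * weight k a x)}"

definition mass_p :: "'n::finite \<Rightarrow> real \<Rightarrow> real \<Rightarrow> (real^'n \<Rightarrow> real) \<Rightarrow> real" where
  "mass_p k a p f = (LINT x:half_space k|lebesgue. \<bar>f x\<bar> powr p * weight k a x)"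

definition gradient_energy ::
    "'n::finite \<Rightarrow> real \<Rightarrow> real \<Rightarrow> (real^'n \<Rightarrow> real) \<Rightarrow> (real^'n \<Rightarrow> real) \<Rightarrow> real" where
  "gradient_energy k a p N f = (LINT x:half_space k|lebesgue.
     dual_norm N (weak_gradient (half_space k) f x) powr p * weight k a x)"


section \<open>Entropy\<close>

text \<open>The entropy integrand need not be integrable: the integral of its negative part may be
  infinite, so the integral is taken in the extended reals. (\<open>ennreal\<close> truncates negative
  numbers to \<open>0\<close>.) In \<open>ereal\<close> we have \<open>\<infinity> - \<infinity> = \<infinity>\<close>, hence an upper bound \<open>< \<infinity>\<close>
  on this quantity includes the finiteness of the integral of the positive part.\<close>

definition extended_integral :: "'b measure \<Rightarrow> 'b set \<Rightarrow> ('b \<Rightarrow> real) \<Rightarrow> ereal" where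
  "extended_integral M A h =
     enn2ereal (\<integral>\<^sup>+x\<in>A. ennreal (h x) \<partial>M) - enn2ereal (\<integral>\<^sup>+x\<in>A. ennreal (- h x) \<partial>M)"

text \<open>Library conventions give \<open>0 * ln 0 = 0\<close> here.\<close>

definition entropy_p :: "'n::finite \<Rightarrow> real \<Rightarrow> real \<Rightarrow> (real^'n \<Rightarrow> real) \<Rightarrow> ereal" where
  "entropy_p k a p f = extended_integral lebesgue (half_space k)
     (\<lambda>x. \<bar>f x\<bar> powr p * ln (\<bar>f x\<bar> powr p) * weight k a x)"

text \<open>The logarithm with \<open>ln 0 = -\<infinity>\<close>, as opposed to the library's \<open>ln 0 = 0\<close>.\<close>

definition extended_ln :: "real \<Rightarrow> ereal" where
  "extended_ln t = (if 0 < t then ereal (ln t) else - \<infinity>)"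

definition log_sobolev_const :: "'n::finite \<Rightarrow> real \<Rightarrow> (real^'n \<Rightarrow> real) \<Rightarrow> real \<Rightarrow> real" where
  "log_sobolev_const k a N p =
     (let na = eff_dim TYPE('n) a; q = p / (p - 1) in
      if p = 1 then 1 / na * half_ball_mass k a N powr (- (1 / na))
      else p / na * ((p - 1) / exp 1) powr (p - 1) *
           (Gamma (na / q + 1) * half_ball_mass k a N) powr (- (p / na)))"


section \<open>Functions of locally bounded variation\<close>

text \<open>An \<open>\<real>\<^sup>n\<close>-valued Radon measure on \<open>\<Omega>\<close> is a set function on the Borel sets contained in a
  compact subset of \<open>\<Omega>\<close>, countably additive there; its values on other sets are irrelevant.\<close>

definition bounded_borel :: "(real^'n::finite) set \<Rightarrow> (real^'n) set set" where
  "bounded_borel \<Omega> = {A \<in> sets borel. \<exists>K. compact K \<and> K \<subseteq> \<Omega> \<and> A \<subseteq> K}"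

definition vector_radon_measure ::
    "(real^'n::finite) set \<Rightarrow> ((real^'n) set \<Rightarrow> real^'n) \<Rightarrow> bool" where
  "vector_radon_measure \<Omega> D \<longleftrightarrow>
     (\<forall>A::nat \<Rightarrow> (real^'n) set. range A \<subseteq> bounded_borel \<Omega> \<and> disjoint_family A \<and>
        (\<Union>i. A i) \<in> bounded_borel \<Omega> \<longrightarrow> (\<lambda>i. D (A i)) sums D (\<Union>i. A i))"

text \<open>The total variation \<open>|D|\<close>: the supremum of \<open>\<Sum>\<^sub>i |D(A\<^sub>i)|\<close> (Euclidean norm) over
  countable Borel partitions, completed so that measurability means \<open>|D|\<close>-measurability.\<close>

definition total_variation ::
    "(real^'n::finite) set \<Rightarrow> ((real^'n) set \<Rightarrow> real^'n) \<Rightarrow> (real^'n) measure" where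
  "total_variation \<Omega> D = completion (measure_of \<Omega> {E \<in> sets borel. E \<subseteq> \<Omega>}
     (\<lambda>E. SUP A\<in>{A::nat \<Rightarrow> (real^'n) set.
                   range A \<subseteq> bounded_borel \<Omega> \<and> disjoint_family A \<and> (\<Union>i. A i) = E}.
            \<Sum>i. ennreal (norm (D (A i)))))"

definition is_polar_field ::
    "(real^'n::finite) set \<Rightarrow> ((real^'n) set \<Rightarrow> real^'n) \<Rightarrow> (real^'n \<Rightarrow> real^'n) \<Rightarrow> bool" where
  "is_polar_field \<Omega> D \<nu> \<longleftrightarrow> \<nu> \<in> borel_measurable (total_variation \<Omega> D) \<and>
     (AE x in total_variation \<Omega> D. norm (\<nu> x) = 1) \<and>
     (\<forall>A\<in>bounded_borel \<Omega>. set_integrable (total_variation \<Omega> D) A \<nu> \<and>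
        D A = (LINT x:A|total_variation \<Omega> D. \<nu> x))"

text \<open>\<open>D\<close> is the distributional derivative of \<open>f\<close> on \<open>\<Omega>\<close> and \<open>dD = \<nu> d|D|\<close>. The integral of a
  test function against the vector measure \<open>D\<close> is expressed through its polar decomposition.
  A locally integrable \<open>f\<close> is of locally bounded variation iff such a pair exists; then \<open>D\<close> is
  unique on the sets in \<open>bounded_borel \<Omega>\<close> and \<open>\<nu>\<close> is unique \<open>|D|\<close>-almost everywhere.\<close>

definition is_BV_derivative ::
    "(real^'n::finite) set \<Rightarrow> (real^'n \<Rightarrow> real) \<Rightarrow>
     ((real^'n) set \<Rightarrow> real^'n) \<Rightarrow> (real^'n \<Rightarrow> real^'n) \<Rightarrow> bool" where
  "is_BV_derivative \<Omega> f D \<nu> \<longleftrightarrow> locally_integrable \<Omega> f \<and>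
     vector_radon_measure \<Omega> D \<and> is_polar_field \<Omega> D \<nu> \<and>
     (\<forall>\<phi> i. test_function \<Omega> \<phi> \<longrightarrow>
        (LINT x:\<Omega>|lebesgue. f x * partial i \<phi> x) =
        - (LINT x|total_variation \<Omega> D. \<phi> x * \<nu> x $ i))"

definition locally_BV :: "(real^'n::finite) set \<Rightarrow> (real^'n \<Rightarrow> real) \<Rightarrow> bool" where
  "locally_BV \<Omega> f \<longleftrightarrow> (\<exists>D \<nu>. is_BV_derivative \<Omega> f D \<nu>)"

end

theory Submission
 imports Defs
begin

text \<open>
 The inequality is the infinitesimal form of the Prekopa--Leindler inequality. Let \<open>u \<ge> 0\<close> be smooth,
 \<open>F = u\<^sup>p\<close>, and let \<open>v\<close> be a radial cost. Applied to \<open>F \<omega>\<close> and \<open>exp (- v \<circ> N) \<omega>\<close> on the half-space, with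
 weights \<open>1 - l\<close> and \<open>l\<close>, Prekopa--Leindler bounds \<open>(\<integral>F)\<^sup>1\<^sup>-\<^sup>l Z\<^sup>l\<close>, where \<open>Z = \<integral>exp (- v \<circ> N) \<omega>\<close>, by the integral of a
 sup-convolution. Two facts make this work for the weight \<open>\<omega>(x) = x\<^sub>k\<^sup>a\<close>: its logarithm is concave,
 in the geometric form that \<open>\<omega>\<close> of a convex combination is at least the geometric mean, and it is
 homogeneous, which is where the effective dimension \<open>n + a\<close> enters, through the scaling factor
 \<open>(1 - l)\<^sup>n\<^sup>+\<^sup>a\<close>. Both sides agree at \<open>l = 0\<close>. The derivative of the sup-convolution there is at most
 \<open>K \<parallel>\<nabla>u\<parallel>\<^sub>*\<^sup>p - F ln F\<close> because of Young's inequality \<open>p A t - v t <= K A\<^sup>p\<close>, so that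
 \<open>\<integral>F ln F <= K \<integral>\<parallel>\<nabla>u\<parallel>\<^sub>*\<^sup>p - (n + a) - ln Z\<close> when \<open>\<integral>F = 1\<close> (\<open>first_variation.entropy_le\<close>).

 A general Sobolev function is reduced to this case by three regularisations. It is mollified with kernels whose
 support lies strictly inside the half-space, so that values off the half-space are never used; for such
 shifts \<open>\<omega>\<close> only grows, hence weighted integrals only decrease. It is multiplied by
 a cutoff. Finally it is passed through a smooth approximation of \<open>\<bar>t\<bar>\<close> that vanishes
 quadratically at zero, which makes the first-order expansion uniform on the zero set.
 The limits use only dominated convergence and Fatou's lemma (\<open>entropy_profile.entropy_le\<close>). Choosing
 \<open>v t = c t\<^sup>q\<close> for \<open>p > 1\<close>, and \<open>v = 0\<close> on a ball for \<open>p = 1\<close>, and optimising over the free parameter (\<open>c\<close>, respectively the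
 radius) gives the constant (\<open>log_sobolev_inequality\<close>).

 The equality cases are computed. The one analytic input is that \<open>N\<close> has a gradient
 almost everywhere and that this gradient has dual norm one (\<open>dual_norm_norm_gradient_AE\<close>); it follows from convexity, since
 the left and right partial derivatives of \<open>N\<close> are both weak derivatives. For \<open>p > 1\<close> this
 yields the weak gradient of a radial profile, and all integrals reduce to Gamma values
 (\<open>exponential_equality\<close>). For \<open>p = 1\<close> the derivative of the indicator of a ball is the surface
 measure, obtained as a limit of thin shells and written as a radial image of a measure on
 the solid ball (\<open>norm_ball_gauss_green\<close>); no parametrisation of the sphere is used. Its total variation is read off from its
 polar decomposition, and any other pair that represents the derivative agrees with
 this one because test functions determine set functions on relatively compact Borel sets
 (\<open>ball_equality\<close>).
\<close>

section \<open>The Prekopa--Leindler inequality\<close>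

text \<open>A single point is null, so a set loses no measure when it is cut just below its supremum.\<close>

lemma emeasure_eq_SUP_below:
 fixes A :: "real set"
 assumes [measurable]: "A \<in> sets borel" and ne: "A ~= {}"
 shows "emeasure lborel A <= (SUP a\<in>A. emeasure lborel (A \<inter> {..<a}))"
proof (cases "bdd_above A")
 case False
 have "emeasure lborel A = emeasure lborel (\<Union>n::nat. A \<inter> {..<real n})"
  by (intro arg_cong[where f="emeasure lborel"]) (auto intro: reals_Archimedean2)
 also have "\<dots> = (SUP n::nat. emeasure lborel (A \<inter> {..<real n}))"
  by (intro SUP_emeasure_incseq[symmetric]) (auto simp: incseq_def)
 also have "\<dots> <= (SUP a\<in>A. emeasure lborel (A \<inter> {..<a}))"
 proof (rule SUP_mono)
  fix n :: nat
  obtain a where "a \<in> A" "a > real n"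
  using False by (auto simp: bdd_above_def not_le)
  then show "\<exists>a\<in>A. emeasure lborel (A \<inter> {..<real n}) <= emeasure lborel (A \<inter> {..<a})"
  by (intro bexI[of _ a] emeasure_mono) auto
 qed
 finally show ?thesis .
next
 case True
 define s where "s = Sup A"
 have s: "x <= s" if "x \<in> A" for x
  using that True by (auto simp: s_def intro: cSup_upper)
 have "emeasure lborel A <= emeasure lborel ((A \<inter> {..<s}) \<union> {s})"
  by (intro emeasure_mono) (use s in \<open>auto simp: order_le_less\<close>)
 also have "\<dots> <= emeasure lborel (A \<inter> {..<s}) + emeasure lborel {s}"
  by (intro emeasure_subadditive) auto
 also have "\<dots> = emeasure lborel (\<Union>n::nat. A \<inter> {..<s - 1 / Suc n})"
 proof -
  have "A \<inter> {..<s} = (\<Union>n::nat. A \<inter> {..<s - 1 / Suc n})"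
  proof (safe)
  fix x assume "x \<in> A" "x < s"
  then obtain n where "inverse (real (Suc n)) < s - x"
  using reals_Archimedean[of "s - x"] by auto
  then show "x \<in> (\<Union>n. A \<inter> {..<s - 1 / real (Suc n)})"
  using \<open>x \<in> A\<close> by (auto simp: inverse_eq_divide intro!: exI[of _ n])
  next
  fix x :: real and n :: nat assume "x < s - 1 / real (Suc n)"
  moreover have "0 < 1 / real (Suc n)" by simp
  ultimately show "x < s" by linarith
  qed
  then show ?thesis by simp
 qed
 also have "\<dots> = (SUP n::nat. emeasure lborel (A \<inter> {..<s - 1 / Suc n}))"
  by (intro SUP_emeasure_incseq[symmetric])
  (auto simp: incseq_def elim!: less_le_trans intro!: divide_left_mono)
 also have "\<dots> <= (SUP a\<in>A. emeasure lborel (A \<inter> {..<a}))"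
 proof (rule SUP_mono)
  fix n :: nat
  have "s - 1 / Suc n < Sup A" by (simp add: s_def)
  then obtain a where "a \<in> A" "a > s - 1 / Suc n"
  using less_cSup_iff[OF ne True] by auto
  then show "\<exists>a\<in>A. emeasure lborel (A \<inter> {..<s - 1 / Suc n}) <= emeasure lborel (A \<inter> {..<a})"
  by (intro bexI[of _ a] emeasure_mono) auto
 qed
 finally show ?thesis .
qed

lemma emeasure_lborel_vimage_affine:
 fixes A :: "real set"
 assumes [measurable]: "A \<in> sets borel" and "c ~= 0"
 shows "emeasure lborel {z. (z - t) / c \<in> A} = ennreal \<bar>c\<bar> * emeasure lborel A"
proof -
 have "emeasure lborel {z. (z - t) / c \<in> A} = (\<integral>\<^sup>+z. indicator A ((z - t) / c) \<partial>lborel)"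
  using nn_integral_indicator[of "{z. (z - t) / c \<in> A}" lborel] by (simp add: indicator_def)
 also have "\<dots> = ennreal \<bar>c\<bar> * (\<integral>\<^sup>+z. indicator A z \<partial>lborel)"
  using assms by (subst nn_integral_real_affine[where c=c and t=t]) auto
 finally show ?thesis by simp
qed

lemma emeasure_eq_SUP_above:
 fixes A :: "real set"
 assumes [measurable]: "A \<in> sets borel" and ne: "A ~= {}"
 shows "emeasure lborel A <= (SUP a\<in>A. emeasure lborel (A \<inter> {a..}))"
proof -
 let ?B = "{z. (z - 0) / (-1) \<in> A}"
 have B: "?B \<in> sets borel" by measurable
 have "?B ~= {}" using ne by (auto intro: exI[of _ "- x" for x])
 have "emeasure lborel A = emeasure lborel ?B"
  by (subst emeasure_lborel_vimage_affine) auto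
 also have "\<dots> <= (SUP a\<in>?B. emeasure lborel (?B \<inter> {..<a}))"
  by (rule emeasure_eq_SUP_below) fact+
 also have "\<dots> <= (SUP a\<in>A. emeasure lborel (A \<inter> {a..}))"
 proof (rule SUP_mono)
  fix a assume a: "a \<in> ?B"
  have "emeasure lborel (?B \<inter> {..<a}) = emeasure lborel {z. (z - 0) / (-1) \<in> A \<inter> {-a<..}}"
  by (intro arg_cong[where f="emeasure lborel"]) auto
  also have "\<dots> = emeasure lborel (A \<inter> {-a<..})"
  by (subst emeasure_lborel_vimage_affine) auto
  also have "\<dots> <= emeasure lborel (A \<inter> {-a..})"
  by (intro emeasure_mono) auto
  finally show "\<exists>b\<in>A. emeasure lborel (?B \<inter> {..<a}) <= emeasure lborel (A \<inter> {b..})"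
  using a by auto
 qed
 finally show ?thesis .
qed

text \<open>In one dimension, translates of \<open>A\<close> and \<open>B\<close> that are cut at a common point overlap at most in that point; this avoids any appeal to measurability of the Minkowski sum.\<close>

lemma brunn_minkowski_real:
 fixes A B S :: "real set"
 assumes [measurable]: "A \<in> sets borel" "B \<in> sets borel" "S \<in> sets borel"
  and ne: "A ~= {}" "B ~= {}" and sub: "!!a b. a \<in> A ==> b \<in> B ==> a + b \<in> S"
 shows "emeasure lborel A + emeasure lborel B <= emeasure lborel S"
proof -
 have *: "emeasure lborel (A \<inter> {..<a}) + emeasure lborel (B \<inter> {b..}) <= emeasure lborel S"
  if ab: "a \<in> A" "b \<in> B" for a b
 proof -
  let ?A = "{z. (z - b) / 1 \<in> A \<inter> {..<a}}" and ?B = "{z. (z - a) / 1 \<in> B \<inter> {b..}}"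
  have "emeasure lborel (A \<inter> {..<a}) + emeasure lborel (B \<inter> {b..}) = emeasure lborel ?A + emeasure lborel ?B"
  using emeasure_lborel_vimage_affine[of "A \<inter> {..<a}" 1 b] emeasure_lborel_vimage_affine[of "B \<inter> {b..}" 1 a]
  by simp
  also have "\<dots> = emeasure lborel (?A \<union> ?B)"
  by (rule plus_emeasure) auto
  also have "\<dots> <= emeasure lborel S"
  proof (intro emeasure_mono)
  show "?A \<union> ?B \<subseteq> S"
  proof safe
  fix x assume "(x - b) / 1 \<in> A" then show "x \<in> S" using sub[of "x - b" b] ab by simp
  next
  fix x assume "(x - a) / 1 \<in> B" then show "x \<in> S" using sub[of a "x - a"] ab by simp
  qed
  qed auto
  finally show ?thesis .
 qed
 have "emeasure lborel A + emeasure lborel B <=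
  (SUP a\<in>A. emeasure lborel (A \<inter> {..<a})) + (SUP a\<in>B. emeasure lborel (B \<inter> {a..}))"
  by (intro add_mono emeasure_eq_SUP_below emeasure_eq_SUP_above ne) auto
 also have "\<dots> <= emeasure lborel S"
 proof -
  have "emeasure lborel (A \<inter> {..<a}) + (SUP b\<in>B. emeasure lborel (B \<inter> {b..})) <= emeasure lborel S" if "a \<in> A" for a
  using ne that by (subst ennreal_SUP_add_right) (auto intro!: SUP_least *)
  then show ?thesis
  using ne by (subst ennreal_SUP_add_left[symmetric]) (auto intro!: SUP_least)
 qed
 finally show ?thesis .
qed

lemma nn_integral_layer_cake_01:
 fixes f :: "real => real"
 assumes [measurable]: "f \<in> borel_measurable borel" and f: "!!x. 0 <= f x" "!!x. f x <= 1"
 shows "(\<integral>\<^sup>+x. ennreal (f x) \<partial>lborel) = (\<integral>\<^sup>+t. indicator {0<..<1::real} t * emeasure lborel {x. t < f x} \<partial>lborel)"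
proof -
 have "(\<integral>\<^sup>+x. ennreal (f x) \<partial>lborel) = (\<integral>\<^sup>+x. \<integral>\<^sup>+t. indicator {0<..<1::real} t * indicator {x. t < f x} x \<partial>lborel \<partial>lborel)"
 proof (intro nn_integral_cong)
  fix x :: real
  have "(\<integral>\<^sup>+t. indicator {0<..<1::real} t * indicator {x. t < f x} x \<partial>lborel) = emeasure lborel {0<..<f x}"
  proof -
  have "(%t. indicator {0<..<1::real} t * indicator {x. t < f x} x :: ennreal) = indicator {0<..<f x}"
  using f[of x] by (auto simp: indicator_def fun_eq_iff)
  then show ?thesis by simp
  qed
  then show "ennreal (f x) = (\<integral>\<^sup>+t. indicator {0<..<1::real} t * indicator {x. t < f x} x \<partial>lborel)"
  using f by simp
 qed
 also have "\<dots> = (\<integral>\<^sup>+t. \<integral>\<^sup>+x. indicator {0<..<1::real} t * indicator {x. t < f x} x \<partial>lborel \<partial>lborel)"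
  by (rule lborel_pair.Fubini'[symmetric]) (simp add: indicator_def cong: if_cong)
 also have "\<dots> = (\<integral>\<^sup>+t. indicator {0<..<1::real} t * emeasure lborel {x. t < f x} \<partial>lborel)"
  by (intro nn_integral_cong, subst nn_integral_cmult) auto
 finally show ?thesis .
qed

text \<open>The hypothesis of Prekopa--Leindler is stated for strict real lower bounds of \<open>f x\<close> and \<open>g y\<close>, so that powers are only taken of positive finite numbers although the functions may be infinite.\<close>

definition sup_convolution_bound :: "real => ('a::real_vector => ennreal) => ('a => ennreal) => ('a => ennreal) => bool" where
 "sup_convolution_bound l f g h \<longleftrightarrow> (\<forall>x y \<alpha> \<beta>. 0 < \<alpha> --> 0 < \<beta> --> ennreal \<alpha> < f x --> ennreal \<beta> < g y -->
  ennreal (\<alpha> powr (1 - l) * \<beta> powr l) <= h ((1 - l) *\<^sub>R x + l *\<^sub>R y))"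

lemma truncated_integral_gt:
 fixes f :: "real => ennreal"
 assumes [measurable]: "f \<in> borel_measurable borel" and "0 < \<alpha>" "ennreal \<alpha> < (\<integral>\<^sup>+x. f x \<partial>lborel)"
 obtains F and M :: real where "F \<in> borel_measurable borel" "0 < M" "!!x. 0 <= F x" "!!x. F x <= 1" "!!t. t < 1 ==> \<exists>x. t < F x"
  "!!x. ennreal (M * F x) <= f x" "ennreal (\<alpha> / M) < (\<integral>\<^sup>+x. ennreal (F x) \<partial>lborel)"
proof -
 have "(\<integral>\<^sup>+x. f x \<partial>lborel) = (\<integral>\<^sup>+x. (SUP n::nat. min (f x) (of_nat n)) \<partial>lborel)"
 proof (intro nn_integral_cong)
  fix x
  have "f x <= (SUP n::nat. min (f x) (of_nat n))"
  proof (cases "f x = top")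
  case True then show ?thesis by (simp add: ennreal_SUP_of_nat_eq_top)
  next
  case False
  then obtain n :: nat where "f x <= of_nat n"
  by (metis ennreal_Ex_less_of_nat less_imp_le top.not_eq_extremum)
  then show ?thesis by (intro SUP_upper2[of n]) (auto simp: min_def)
  qed
  then show "f x = (SUP n::nat. min (f x) (of_nat n))"
  by (intro antisym SUP_least) auto
 qed
 also have "\<dots> = (SUP n::nat. \<integral>\<^sup>+x. min (f x) (of_nat n) \<partial>lborel)"
  by (rule nn_integral_monotone_convergence_SUP)
  (auto simp: incseq_def le_fun_def intro: min.coboundedI2)
 finally obtain n :: nat where n: "ennreal \<alpha> < (\<integral>\<^sup>+x. min (f x) (of_nat n) \<partial>lborel)"
  using assms(3) by (auto simp: less_SUP_iff)
 define F0 where "F0 x = enn2real (min (f x) (of_nat n))" for x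
 have F0: "ennreal (F0 x) = min (f x) (of_nat n)" for x
  unfolding F0_def by (subst ennreal_enn2real) (auto simp: min_def less_top[symmetric] top_unique)
 have [measurable]: "F0 \<in> borel_measurable borel"
  unfolding F0_def by measurable
 have F0n: "0 <= F0 x" "F0 x <= real n" for x
  using F0[of x] by (auto simp: F0_def ennreal_of_nat_eq_real_of_nat intro!: enn2real_leI)
 define M where "M = (SUP x. F0 x)"
 have bdd: "bdd_above (range F0)" using F0n by (auto intro!: bdd_aboveI)
 have FM: "F0 x <= M" for x unfolding M_def by (rule cSUP_upper) (use bdd in auto)
 have "\<exists>x. F0 x > 0"
 proof (rule ccontr)
  assume "\<not> ?thesis"
  then have "!!x. F0 x = 0" using F0n by (metis less_eq_real_def)
  then have "(\<integral>\<^sup>+x. min (f x) (of_nat n) \<partial>lborel) = 0" by (simp flip: F0)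
  then show False using n by auto
 qed
 then have M: "0 < M" using FM less_le_trans by blast
 show thesis
 proof (rule that[of "%x. F0 x / M" M])
  fix t :: real assume "t < 1"
  then have "t * M < M" using M by simp
  then obtain x where "t * M < F0 x"
  unfolding M_def using less_cSUP_iff[OF _ bdd] by auto
  then show "\<exists>x. t < F0 x / M" using M by (auto simp: field_simps)
 next
  have "ennreal (\<alpha> / M) * ennreal M < (\<integral>\<^sup>+x. ennreal (F0 x / M) \<partial>lborel) * ennreal M"
  using n M assms(2) F0n by (simp flip: F0 ennreal_mult nn_integral_multc)
  then show "ennreal (\<alpha> / M) < (\<integral>\<^sup>+x. ennreal (F0 x / M) \<partial>lborel)"
  by (meson leD leI mult_right_mono zero_le)
 qed (use M F0n FM in \<open>auto simp: F0 field_simps\<close>)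
qed

text \<open>After normalisation of the truncated functions, the superlevel sets satisfy the one-dimensional Brunn--Minkowski inequality, and the layer-cake formula together with the arithmetic-geometric mean inequality concludes.\<close>

lemma prekopa_leindler_real:
 fixes f g h :: "real => ennreal"
 assumes [measurable]: "f \<in> borel_measurable borel" "g \<in> borel_measurable borel" "h \<in> borel_measurable borel"
  and l: "0 < l" "l < 1" and H: "sup_convolution_bound l f g h"
  and \<alpha>: "0 < \<alpha>" "ennreal \<alpha> < (\<integral>\<^sup>+x. f x \<partial>lborel)" and \<beta>: "0 < \<beta>" "ennreal \<beta> < (\<integral>\<^sup>+x. g x \<partial>lborel)"
 shows "ennreal (\<alpha> powr (1 - l) * \<beta> powr l) <= (\<integral>\<^sup>+x. h x \<partial>lborel)"
proof -
 obtain F A where [measurable]: "F \<in> borel_measurable borel" and A: "0 < A" and F: "!!x. 0 <= F x" "!!x. F x <= 1"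
  "!!t. t < 1 ==> \<exists>x. t < F x" "!!x. ennreal (A * F x) <= f x" "ennreal (\<alpha> / A) < (\<integral>\<^sup>+x. ennreal (F x) \<partial>lborel)"
  by (rule truncated_integral_gt[OF _ \<alpha>]) auto
 obtain G B where [measurable]: "G \<in> borel_measurable borel" and B: "0 < B" and G: "!!x. 0 <= G x" "!!x. G x <= 1"
  "!!t. t < 1 ==> \<exists>x. t < G x" "!!x. ennreal (B * G x) <= g x" "ennreal (\<beta> / B) < (\<integral>\<^sup>+x. ennreal (G x) \<partial>lborel)"
  by (rule truncated_integral_gt[OF _ \<beta>]) auto
 define c where "c = A powr (1 - l) * B powr l"
 have c: "0 < c" using A B by (simp add: c_def)
 define H0 where "H0 x = enn2real (min (h x) (ennreal c)) / c" for x
 have H0: "ennreal (c * H0 x) = min (h x) (ennreal c)" for x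
  using c unfolding H0_def by (simp, subst ennreal_enn2real) (auto simp: min_def less_top[symmetric] top_unique)
 have [measurable]: "H0 \<in> borel_measurable borel"
  unfolding H0_def by measurable
 have H01: "0 <= H0 x" "H0 x <= 1" for x
  using c by (auto simp: H0_def intro!: enn2real_leI)
 have level: "(1 - l) * emeasure lborel {x. t < F x} + l * emeasure lborel {x. t < G x} <= emeasure lborel {x. t < H0 x}"
  if t: "0 < t" "t < 1" for t
 proof -
  let ?A = "{z. (z - 0) / (1 - l) \<in> {x. t < F x}}" and ?B = "{z. (z - 0) / l \<in> {x. t < G x}}"
  have "(1 - l) * emeasure lborel {x. t < F x} + l * emeasure lborel {x. t < G x} = emeasure lborel ?A + emeasure lborel ?B"
  using l emeasure_lborel_vimage_affine[of "{x. t < F x}" "1 - l" 0] emeasure_lborel_vimage_affine[of "{x. t < G x}" l 0]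
  by simp
  also have "\<dots> <= emeasure lborel {x. t < H0 x}"
  proof (rule brunn_minkowski_real)
  show "?A \<in> sets borel" "?B \<in> sets borel" "{x. t < H0 x} \<in> sets borel" by measurable
  obtain x y where "t < F x" "t < G y" using F(3) G(3) t by blast
  then have "(1 - l) * x \<in> ?A" "l * y \<in> ?B" using l by auto
  then show "?A ~= {}" "?B ~= {}" by blast+
  fix a b assume ab: "a \<in> ?A" "b \<in> ?B"
  define x y where "x = a / (1 - l)" and "y = b / l"
  have "t < min (F x) (G y)" using ab by (auto simp: x_def y_def)
  then obtain s where s: "t < s" "s < F x" "s < G y" using dense by (metis min_less_iff_conj)
  have "ennreal (A * s) < f x"
  using s t A F(4)[of x] by (intro less_le_trans[OF _ F(4)[of x]] ennreal_lessI) auto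
  moreover have "ennreal (B * s) < g y"
  using s t B by (intro less_le_trans[OF _ G(4)[of y]] ennreal_lessI) auto
  ultimately have "ennreal ((A * s) powr (1 - l) * (B * s) powr l) <= h ((1 - l) *\<^sub>R x + l *\<^sub>R y)"
  using H A B s t by (auto simp: sup_convolution_bound_def)
  also have "(A * s) powr (1 - l) * (B * s) powr l = c * s"
  using A B s t by (simp add: c_def powr_mult powr_add[symmetric])
  also have "(1 - l) *\<^sub>R x + l *\<^sub>R y = a + b" using l by (simp add: x_def y_def)
  finally have "ennreal (c * s) <= h (a + b)" .
  moreover have "s <= 1" using s F(2)[of x] by simp
  ultimately have "ennreal (c * s) <= ennreal (c * H0 (a + b))" unfolding H0 using c by (auto intro: ennreal_leI)
  then have "s <= H0 (a + b)" using c H01 by (subst (asm) ennreal_le_iff) auto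
  then show "a + b \<in> {x. t < H0 x}" using s t H01 by simp
  qed
  finally show ?thesis .
 qed
 have "ennreal (\<alpha> powr (1 - l) * \<beta> powr l) = c * ennreal ((\<alpha> / A) powr (1 - l) * (\<beta> / B) powr l)"
  using c A B \<alpha> \<beta> by (simp flip: ennreal_mult add: c_def powr_divide)
 also have "\<dots> <= c * ennreal ((1 - l) * (\<alpha> / A) + l * (\<beta> / B))"
  using c A B \<alpha> \<beta> l by (intro mult_left_mono ennreal_leI Youngs_inequality_0) auto
 also have "\<dots> = c * ((1 - l) * ennreal (\<alpha> / A) + l * ennreal (\<beta> / B))"
  using A B \<alpha> \<beta> l by (simp flip: ennreal_mult ennreal_plus)
 also have "\<dots> <= c * ((1 - l) * (\<integral>\<^sup>+x. ennreal (F x) \<partial>lborel) + l * (\<integral>\<^sup>+x. ennreal (G x) \<partial>lborel))"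
  using F(5) G(5) by (intro mult_left_mono add_mono) auto
 also have "\<dots> = c * (\<integral>\<^sup>+t. indicator {0<..<1::real} t * ((1 - l) * emeasure lborel {x. t < F x} + l * emeasure lborel {x. t < G x}) \<partial>lborel)"
 proof -
  have [measurable]: "(%t. emeasure lborel {x. t < F x}) \<in> borel_measurable borel"
  "(%t. emeasure lborel {x. t < G x}) \<in> borel_measurable borel"
  by measurable
  show ?thesis
  apply (subst (1 2) nn_integral_layer_cake_01)
  using F G apply simp_all
  apply (subst (1 2) nn_integral_cmult[symmetric])
  apply simp_all
  apply (subst nn_integral_add[symmetric])
  apply simp_all
  apply (rule arg_cong[where f="%x. ennreal c * x"])
  apply (intro nn_integral_cong)
  apply (auto simp: indicator_def distrib_left)
  done
 qed
 also have "\<dots> <= c * (\<integral>\<^sup>+t. indicator {0<..<1::real} t * emeasure lborel {x. t < H0 x} \<partial>lborel)"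
 proof (rule mult_left_mono, rule nn_integral_mono)
  fix t :: real
  show "indicator {0<..<1::real} t * ((1 - l) * emeasure lborel {x. t < F x} + l * emeasure lborel {x. t < G x})
  <= indicator {0<..<1::real} t * emeasure lborel {x. t < H0 x}"
  using level[of t] by (cases "0 < t & t < 1") (auto simp: indicator_def)
 qed auto
 also have "\<dots> = (\<integral>\<^sup>+x. c * ennreal (H0 x) \<partial>lborel)"
  by (subst nn_integral_layer_cake_01[symmetric]) (auto simp: H01 nn_integral_cmult)
 also have "\<dots> <= (\<integral>\<^sup>+x. h x \<partial>lborel)"
 proof (intro nn_integral_mono)
  fix x
  have "ennreal c * ennreal (H0 x) = min (h x) (ennreal c)"
  unfolding H0[symmetric] using c H01 by (simp add: ennreal_mult)
  also have "\<dots> <= h x" by simp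
  finally show "ennreal c * ennreal (H0 x) <= h x" .
 qed
 finally show ?thesis .
qed


text \<open>Induction on the number of coordinates: the marginals of \<open>f\<close>, \<open>g\<close>, \<open>h\<close> in one coordinate again satisfy the hypothesis, by the inequality for the remaining coordinates.\<close>

lemma prekopa_leindler_PiM:
 fixes f g h :: "('i => real) => ennreal"
 assumes I: "finite I" and l: "0 < l" "l < 1"
  and meas: "f \<in> borel_measurable (PiM I (%_. lborel))" "g \<in> borel_measurable (PiM I (%_. lborel))"
  "h \<in> borel_measurable (PiM I (%_. lborel))"
  and H: "!!x y \<alpha> \<beta>. x \<in> space (PiM I (%_. lborel)) ==> y \<in> space (PiM I (%_. lborel)) ==>
  0 < \<alpha> ==> 0 < \<beta> ==> ennreal \<alpha> < f x ==> ennreal \<beta> < g y ==>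
  ennreal (\<alpha> powr (1 - l) * \<beta> powr l) <= h (\<lambda>i\<in>I. (1 - l) * x i + l * y i)"
  and \<alpha>: "0 < \<alpha>" "ennreal \<alpha> < (\<integral>\<^sup>+x. f x \<partial>PiM I (%_. lborel))"
  and \<beta>: "0 < \<beta>" "ennreal \<beta> < (\<integral>\<^sup>+x. g x \<partial>PiM I (%_. lborel))"
 shows "ennreal (\<alpha> powr (1 - l) * \<beta> powr l) <= (\<integral>\<^sup>+x. h x \<partial>PiM I (%_. lborel))"
 using I meas H \<alpha> \<beta>
proof (induction I arbitrary: f g h \<alpha> \<beta> rule: finite_induct)
 case empty
 have *: "(\<integral>\<^sup>+x. u x \<partial>PiM {} (%_. lborel)) = u (%_. undefined)" for u :: "('i => real) => ennreal"
 proof -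
  have "(\<integral>\<^sup>+x. u x \<partial>PiM {} (%_. lborel)) = (\<integral>\<^sup>+x. u (%_. undefined) \<partial>PiM {} (%_::'i. lborel :: real measure))"
  by (intro nn_integral_cong) (simp add: space_PiM)
  then show ?thesis by (simp add: space_PiM_empty)
 qed
 show ?case
  using empty.prems(4)[of "%_. undefined" "%_. undefined" \<alpha> \<beta>] empty.prems
  by (simp add: * space_PiM restrict_def)
next
 case (insert i I)
 interpret product_sigma_finite "%_::'i. lborel :: real measure" ..
 note [measurable] = insert.prems(1-3)
 let ?P = "PiM I (%_. lborel) :: ('i => real) measure"
 have int: "(\<integral>\<^sup>+x. u x \<partial>PiM (insert i I) (%_. lborel)) = (\<integral>\<^sup>+x. \<integral>\<^sup>+y. u (x(i := y)) \<partial>lborel \<partial>?P)"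
  if "u \<in> borel_measurable (PiM (insert i I) (%_. lborel))" for u :: "('i => real) => ennreal"
  using that insert.hyps by (intro product_nn_integral_insert) auto
 have m: "(%x. \<integral>\<^sup>+y. u (x(i := y)) \<partial>lborel) \<in> borel_measurable ?P"
  if [measurable]: "u \<in> borel_measurable (PiM (insert i I) (%_. lborel))" for u :: "('i => real) => ennreal"
  by measurable
 have sl: "(%y. u (x(i := y))) \<in> borel_measurable borel"
  if [measurable]: "u \<in> borel_measurable (PiM (insert i I) (%_. lborel))" and "x \<in> space ?P"
  for u :: "('i => real) => ennreal" and x
 proof -
  have "(%y. x(i := y)) \<in> measurable lborel (PiM (insert i I) (%_. lborel))"
  using that(2) by (intro measurable_fun_upd) (auto simp: space_PiM)
  from measurable_compose[OF this that(1)] show ?thesis by simp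
 qed
 show ?case
  unfolding int[OF insert.prems(3)]
 proof (rule insert.IH[OF m[OF insert.prems(1)] m[OF insert.prems(2)] m[OF insert.prems(3)]])
  show "0 < \<alpha>" "0 < \<beta>" by fact+
  show "ennreal \<alpha> < (\<integral>\<^sup>+x. \<integral>\<^sup>+y. f (x(i := y)) \<partial>lborel \<partial>?P)" "ennreal \<beta> < (\<integral>\<^sup>+x. \<integral>\<^sup>+y. g (x(i := y)) \<partial>lborel \<partial>?P)"
  using insert.prems(6,8) by (simp_all add: int)
  fix x y :: "'i => real" and \<alpha> \<beta> :: real
  assume xy: "x \<in> space ?P" "y \<in> space ?P"
  and a: "0 < \<alpha>" "0 < \<beta>" "ennreal \<alpha> < (\<integral>\<^sup>+t. f (x(i := t)) \<partial>lborel)" "ennreal \<beta> < (\<integral>\<^sup>+t. g (y(i := t)) \<partial>lborel)"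
  let ?z = "\<lambda>j\<in>I. (1 - l) * x j + l * y j"
  show "ennreal (\<alpha> powr (1 - l) * \<beta> powr l) <= (\<integral>\<^sup>+t. h (?z(i := t)) \<partial>lborel)"
  proof (rule prekopa_leindler_real[OF sl[OF insert.prems(1) xy(1)] sl[OF insert.prems(2) xy(2)] sl[OF insert.prems(3)] l _ a(1,3,2,4)])
  show "?z \<in> space ?P" by (simp add: space_PiM)
  have z: "(\<lambda>j\<in>insert i I. (1 - l) * (x(i := s)) j + l * (y(i := t)) j) = ?z(i := (1 - l) * s + l * t)" for s t
  using insert.hyps by (auto simp: fun_eq_iff)
  have sp: "x(i := s) \<in> space (PiM (insert i I) (%_. lborel))" "y(i := s) \<in> space (PiM (insert i I) (%_. lborel))" for s
  using xy by (auto simp: space_PiM PiE_def extensional_def)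
  show "sup_convolution_bound l (%t. f (x(i := t))) (%t. g (y(i := t))) (%t. h (?z(i := t)))"
  unfolding sup_convolution_bound_def
  proof (intro allI impI)
  fix s t \<alpha> \<beta> :: real
  assume "0 < \<alpha>" "0 < \<beta>" "ennreal \<alpha> < f (x(i := s))" "ennreal \<beta> < g (y(i := t))"
  from insert.prems(4)[OF sp(1)[of s] sp(2)[of t] this] z[of s t]
  show "ennreal (\<alpha> powr (1 - l) * \<beta> powr l) <= h (?z(i := (1 - l) *\<^sub>R s + l *\<^sub>R t))"
  by (simp only: real_scaleR_def)
  qed
  qed
 qed
qed

theorem prekopa_leindler:
 fixes f g h :: "'a::euclidean_space => ennreal"
 assumes [measurable]: "f \<in> borel_measurable borel" "g \<in> borel_measurable borel" "h \<in> borel_measurable borel"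
  and l: "0 < l" "l < 1" and H: "sup_convolution_bound l f g h"
  and \<alpha>: "0 < \<alpha>" "ennreal \<alpha> < (\<integral>\<^sup>+x. f x \<partial>lborel)" and \<beta>: "0 < \<beta>" "ennreal \<beta> < (\<integral>\<^sup>+x. g x \<partial>lborel)"
 shows "ennreal (\<alpha> powr (1 - l) * \<beta> powr l) <= (\<integral>\<^sup>+x. h x \<partial>lborel)"
proof -
 let ?P = "PiM Basis (%_. lborel) :: ('a => real) measure" and ?v = "%x. \<Sum>b\<in>Basis. x b *\<^sub>R b :: 'a"
 have [measurable]: "?v \<in> measurable ?P borel" by measurable
 have int: "(\<integral>\<^sup>+x. u x \<partial>lborel) = (\<integral>\<^sup>+x. u (?v x) \<partial>?P)" if "u \<in> borel_measurable borel" for u :: "'a => ennreal"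
  using that by (subst lborel_eq, subst nn_integral_distr) auto
 show ?thesis
  unfolding int[OF assms(3)]
 proof (rule prekopa_leindler_PiM[OF finite_Basis l])
  show "ennreal \<alpha> < (\<integral>\<^sup>+x. f (?v x) \<partial>?P)" "ennreal \<beta> < (\<integral>\<^sup>+x. g (?v x) \<partial>?P)"
  using \<alpha> \<beta> by (simp_all add: int)
  fix x y :: "'a => real" and \<alpha> \<beta> :: real
  assume a: "0 < \<alpha>" "0 < \<beta>" "ennreal \<alpha> < f (?v x)" "ennreal \<beta> < g (?v y)"
  have "?v (\<lambda>i\<in>Basis. (1 - l) * x i + l * y i) = (1 - l) *\<^sub>R ?v x + l *\<^sub>R ?v y"
  by (simp add: scaleR_add_left sum.distrib scaleR_sum_right)
  then show "ennreal (\<alpha> powr (1 - l) * \<beta> powr l) <= h (?v (\<lambda>i\<in>Basis. (1 - l) * x i + l * y i))"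
  using H a by (simp add: sup_convolution_bound_def)
 qed (use \<alpha> \<beta> in \<open>auto\<close>)
qed

section \<open>Norms and the weighted measure on the half-space\<close>

lemma is_normD:
 assumes "is_norm N"
 shows is_norm_nonneg: "0 <= N x" and is_norm_eq_0: "N x = 0 \<longleftrightarrow> x = 0"
  and is_norm_scale: "N (c *\<^sub>R x) = \<bar>c\<bar> * N x" and is_norm_triangle: "N (x + y) <= N x + N y"
  and is_norm_zero: "N 0 = 0" and is_norm_minus: "N (- x) = N x"
  and is_norm_pos: "x ~= 0 ==> 0 < N x"
proof -
 have 1: "\<forall>x. 0 <= N x" "\<forall>x. N x = 0 \<longleftrightarrow> x = 0" "\<forall>c x. N (c *\<^sub>R x) = \<bar>c\<bar> * N x"
  "\<forall>x y. N (x + y) <= N x + N y"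
  using assms unfolding is_norm_def by blast+
 show "0 <= N x" "N x = 0 \<longleftrightarrow> x = 0" "N (c *\<^sub>R x) = \<bar>c\<bar> * N x" "N (x + y) <= N x + N y" "N 0 = 0"
  using 1 by blast+
 have "N ((- 1) *\<^sub>R x) = \<bar>- 1\<bar> * N x" using 1(3) by blast
 then show "N (- x) = N x" by simp
 show "x ~= 0 ==> 0 < N x" using 1(1,2) by (metis less_eq_real_def)
qed

lemma is_norm_upper:
 fixes N :: "real^'n => real"
 assumes "is_norm N"
 shows "\<exists>C>0. (\<forall>x. N x <= C * norm x) & (\<forall>x y. \<bar>N x - N y\<bar> <= C * norm (x - y))"
proof -
 note N = is_normD[OF assms]
 define C where "C = (\<Sum>i\<in>UNIV. N (axis i 1)) + 1"
 have sum: "N (sum f S) <= (\<Sum>i\<in>S. N (f i))" if "finite S" for f and S :: "'n set"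
  using that
 proof (induction S)
  case (insert x F)
  then show ?case using N(4)[of "f x" "sum f F"] by auto
 qed (simp add: N)
 have *: "N x <= C * norm x" for x
 proof -
  have "N x = N (\<Sum>i\<in>UNIV. (x $ i) *\<^sub>R axis i 1)"
  by (simp add: basis_expansion flip: scalar_mult_eq_scaleR)
  also have "\<dots> <= (\<Sum>i\<in>UNIV. \<bar>x $ i\<bar> * N (axis i 1))"
  using sum[of UNIV "%i. (x $ i) *\<^sub>R axis i 1"] by (simp add: N)
  also have "\<dots> <= (\<Sum>i\<in>UNIV. norm x * N (axis i 1))"
  by (intro sum_mono mult_right_mono component_le_norm_cart N(1))
  also have "\<dots> = norm x * (C - 1)" by (simp add: C_def sum_distrib_left)
  also have "\<dots> <= C * norm x" by (simp add: right_diff_distrib mult.commute)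
  finally show ?thesis .
 qed
 show ?thesis
 proof (intro exI[of _ C] conjI allI)
  show "0 < C" unfolding C_def by (intro add_nonneg_pos sum_nonneg N(1)) auto
  show "N x <= C * norm x" for x by fact
  show "\<bar>N x - N y\<bar> <= C * norm (x - y)" for x y
  using N(4)[of "x - y" y] N(4)[of "y - x" x] *[of "x - y"] *[of "y - x"] by (simp add: norm_minus_commute)
 qed
qed

lemma is_norm_continuous:
 fixes N :: "real^'n => real"
 assumes "is_norm N" shows "continuous_on S N"
proof -
 obtain C where "0 < C" "!!x. N x <= C * norm x" "!!x y. \<bar>N x - N y\<bar> <= C * norm (x - y)"
  using is_norm_upper[OF assms] by blast
 then have "C-lipschitz_on S N" by (intro lipschitz_onI) (auto simp: dist_norm)
 then show ?thesis by (rule lipschitz_on_continuous_on)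
qed

lemma is_norm_borel:
 fixes N :: "real^'n => real"
 assumes "is_norm N" shows "N \<in> borel_measurable borel"
 by (rule borel_measurable_continuous_onI[OF is_norm_continuous[OF assms(1)]])

lemma is_norm_lower:
 fixes N :: "real^'n => real"
 assumes "is_norm N"
 obtains c where "0 < c" "!!x. norm x <= c * N x"
proof -
 note N = is_normD[OF assms]
 have ne: "sphere (0::real^'n) 1 ~= {}" by simp
 obtain z where z: "z \<in> sphere 0 1" "!!x. x \<in> sphere 0 1 ==> N z <= N x"
  using continuous_attains_inf[OF compact_sphere ne is_norm_continuous[OF assms]] by blast
 have Nz: "N z > 0" using z by (intro N(7)) auto
 show thesis
 proof (rule that[of "1 / N z"])
  show "0 < 1 / N z" using Nz by simp
  show "norm x <= 1 / N z * N x" for x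
  proof (cases "x = 0")
  case False
  then have "N z <= N ((1 / norm x) *\<^sub>R x)" by (intro z) simp
  then show ?thesis using False Nz by (simp add: N field_simps)
  qed (simp add: N)
 qed
qed

lemma is_norm_mult_pos:
 assumes "is_norm N" "0 < \<kappa>" shows "is_norm (%x. \<kappa> * N x)"
 unfolding is_norm_def
 using assms is_normD[OF assms(1)]
 by (auto simp: mult.left_commute simp flip: distrib_left intro!: mult_left_mono)

lemma dual_norm_bdd:
 fixes N :: "real^'n => real"
 assumes "is_norm N" shows "bdd_above ((%y. x \<bullet> y) ` {y. N y <= 1})"
proof -
 obtain c where c: "0 < c" "!!x. norm x <= c * N x" using is_norm_lower[OF assms] by blast
 show ?thesis
 proof (rule bdd_aboveI2)
  fix y assume "y \<in> {y. N y <= 1}"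
  then have "norm y <= c" using c(2)[of y] c(1) by (auto intro: order_trans mult_left_mono[of _ 1 c])
  then show "x \<bullet> y <= norm x * c" using norm_cauchy_schwarz[of x y] by (meson mult_left_mono norm_ge_zero order_trans)
 qed
qed

lemma dual_norm_ge: "is_norm N ==> N y <= 1 ==> x \<bullet> y <= dual_norm N x"
 unfolding dual_norm_def by (intro cSUP_upper dual_norm_bdd) auto

lemma dual_norm_le:
 assumes "is_norm N" "!!y. N y <= 1 ==> x \<bullet> y <= c" shows "dual_norm N x <= c"
 unfolding dual_norm_def using assms is_normD(5)[OF assms(1)] by (intro cSUP_least) (auto intro!: exI[of _ 0])

lemma dual_norm_inner_le:
 assumes "is_norm N" shows "x \<bullet> y <= dual_norm N x * N y"
proof (cases "y = 0")
 case False
 then have Ny: "0 < N y" using is_normD(7)[OF assms] by blast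
 have "x \<bullet> ((1 / N y) *\<^sub>R y) <= dual_norm N x"
  using Ny by (intro dual_norm_ge assms) (simp add: is_normD[OF assms])
 then show ?thesis using Ny by (simp add: field_simps)
qed (simp add: is_normD[OF assms])

text \<open>That the dual norm is itself a norm gives its continuity, hence measurability and an upper bound by the Euclidean norm.\<close>

lemma is_norm_dual_norm:
 fixes N :: "real^'n => real"
 assumes "is_norm N" shows "is_norm (dual_norm N)"
proof -
 note N = is_normD[OF assms]
 have nn: "0 <= dual_norm N x" for x using dual_norm_ge[OF assms, of 0 x] by (simp add: N)
 have z: "x = 0" if "dual_norm N x = 0" for x
  using dual_norm_inner_le[OF assms, of x x] that by (metis inner_gt_zero_iff mult_zero_left not_less)
 have z0: "dual_norm N 0 = 0"
  by (intro antisym nn dual_norm_le assms) simp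
 have sc: "dual_norm N (c *\<^sub>R x) <= \<bar>c\<bar> * dual_norm N x" for c x
 proof (intro dual_norm_le assms)
  fix y assume "N y <= 1"
  then have "x \<bullet> y <= dual_norm N x" "x \<bullet> (- y) <= dual_norm N x"
  by (auto intro!: dual_norm_ge assms simp: N simp del: inner_minus_right)
  then show "c *\<^sub>R x \<bullet> y <= \<bar>c\<bar> * dual_norm N x"
  using mult_left_mono[of "x \<bullet> y" "dual_norm N x" c] mult_left_mono[of "x \<bullet> (- y)" "dual_norm N x" "- c"]
  by (cases "0 <= c") auto
 qed
 have sc2: "\<bar>c\<bar> * dual_norm N x <= dual_norm N (c *\<^sub>R x)" for c x
 proof (cases "c = 0")
  case False
  then have "dual_norm N x <= \<bar>1 / c\<bar> * dual_norm N (c *\<^sub>R x)"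
  using sc[of "1 / c" "c *\<^sub>R x"] by simp
  then show ?thesis using False by (simp add: field_simps)
 qed (simp add: nn)
 have tri: "dual_norm N (x + y) <= dual_norm N x + dual_norm N y" for x y
  by (intro dual_norm_le assms) (auto simp: inner_add_left intro!: add_mono dual_norm_ge assms)
 show ?thesis
  unfolding is_norm_def using nn z z0 tri antisym[OF sc sc2] by blast
qed

lemma half_space_measurable [measurable]: "half_space k \<in> sets borel"
 unfolding half_space_def by measurable

lemma open_half_space: "open (half_space k)"
 unfolding half_space_def by (intro open_Collect_less continuous_intros)

lemma weight_measurable [measurable]: "weight k a \<in> borel_measurable borel"
 unfolding weight_def by measurable

lemma weight_pos: "x \<in> half_space k ==> 0 < weight k a x" and weight_nonneg: "0 <= weight k a x"
 by (auto simp: weight_def half_space_def)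

text \<open>The measure \<open>\<omega> dx\<close> on the half-space, extended by zero; carrying it on Borel sets of the whole space keeps all measurability questions routine.\<close>

definition hs_meas :: "'n::finite => real => (real^'n) measure" where
 "hs_meas k a = density lborel (%x. ennreal (indicator (half_space k) x * weight k a x))"

lemma sets_hs_meas [measurable_cong, simp]: "sets (hs_meas k a) = sets borel"
 and space_hs_meas [simp]: "space (hs_meas k a) = UNIV"
 by (simp_all add: hs_meas_def)

lemma nn_integral_hs_meas:
 "f \<in> borel_measurable borel ==> (\<integral>\<^sup>+x. f x \<partial>hs_meas k a) =
  (\<integral>\<^sup>+x. ennreal (indicator (half_space k) x * weight k a x) * f x \<partial>lborel)"
 unfolding hs_meas_def by (subst nn_integral_density) auto

lemma AE_hs_meas:
 assumes [measurable]: "Measurable.pred borel P"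
 shows "(AE x in hs_meas k a. P x) \<longleftrightarrow> (AE x in lborel. x \<in> half_space k --> P x)"
 unfolding hs_meas_def
 by (subst AE_density) (auto intro!: AE_cong simp: ennreal_zero_less_mult_iff weight_pos split: split_indicator)

lemma AE_hs_measI:
 "AE x in lborel. P x ==> AE x in hs_meas k a. P x"
 unfolding hs_meas_def by (subst AE_density) auto

lemma hs_meas_in: "AE x in hs_meas k a. x \<in> half_space k"
 by (subst AE_hs_meas) auto

lemma nn_integral_lborel_scale:
 fixes f :: "'a::euclidean_space => ennreal"
 assumes [measurable]: "f \<in> borel_measurable borel" and "c ~= 0"
 shows "(\<integral>\<^sup>+x. f x \<partial>lborel) = ennreal (\<bar>c\<bar> ^ DIM('a)) * (\<integral>\<^sup>+x. f (t + c *\<^sub>R x) \<partial>lborel)"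
 by (subst lborel_affine[OF assms(2), of t], subst nn_integral_density)
  (auto simp: nn_integral_distr nn_integral_cmult)

text \<open>The homogeneity of degree \<open>a\<close> of the weight, on top of the Lebesgue scaling, is the only source of the effective dimension.\<close>

lemma nn_integral_hs_meas_scale:
 fixes k :: "'n::finite"
 assumes [measurable]: "f \<in> borel_measurable borel" and c: "0 < c"
 shows "(\<integral>\<^sup>+x. f (c *\<^sub>R x) \<partial>hs_meas k a) =
  ennreal (c powr - eff_dim TYPE('n) a) * (\<integral>\<^sup>+x. f x \<partial>hs_meas k a)"
proof -
 let ?w = "%x. indicator (half_space k) x * weight k a x :: real"
 have w: "?w (c *\<^sub>R x) = c powr a * ?w x" for x
  using c by (auto simp: half_space_def weight_def indicator_def powr_mult zero_less_mult_iff)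
 have "(\<integral>\<^sup>+x. f x \<partial>hs_meas k a) = (\<integral>\<^sup>+x. ennreal (?w x) * f x \<partial>lborel)"
  by (rule nn_integral_hs_meas) simp
 also have "\<dots> = ennreal (c ^ CARD('n)) * (\<integral>\<^sup>+x. ennreal (c powr a * ?w x) * f (c *\<^sub>R x) \<partial>lborel)"
  using c by (subst nn_integral_lborel_scale[where c=c and t=0]) (auto simp: w)
 also have "\<dots> = ennreal (c ^ CARD('n)) * (ennreal (c powr a) * (\<integral>\<^sup>+x. ennreal (?w x) * f (c *\<^sub>R x) \<partial>lborel))"
  by (subst nn_integral_cmult[symmetric])
  (auto intro!: nn_integral_cong arg_cong2[where f="(*)"] simp: ennreal_mult weight_nonneg mult_ac)
 also have "(\<integral>\<^sup>+x. ennreal (?w x) * f (c *\<^sub>R x) \<partial>lborel) = (\<integral>\<^sup>+x. f (c *\<^sub>R x) \<partial>hs_meas k a)"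
  by (rule nn_integral_hs_meas[symmetric]) simp
 finally have "(\<integral>\<^sup>+x. f x \<partial>hs_meas k a) =
  ennreal (c powr eff_dim TYPE('n) a) * (\<integral>\<^sup>+x. f (c *\<^sub>R x) \<partial>hs_meas k a)"
  using c by (simp add: eff_dim_def powr_add powr_realpow ennreal_mult mult.assoc)
 then have "ennreal (c powr - eff_dim TYPE('n) a) * (\<integral>\<^sup>+x. f x \<partial>hs_meas k a) =
  ennreal (c powr - eff_dim TYPE('n) a * c powr eff_dim TYPE('n) a) * (\<integral>\<^sup>+x. f (c *\<^sub>R x) \<partial>hs_meas k a)"
  by (simp add: ennreal_mult mult.assoc)
 then show ?thesis using c by (simp flip: powr_add)
qed

lemma nn_integral_hs_meas_translate:
 fixes k :: "'n::finite"
 assumes [measurable]: "f \<in> borel_measurable borel" and "v $ k = 0"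
 shows "(\<integral>\<^sup>+x. f (x - v) \<partial>hs_meas k a) = (\<integral>\<^sup>+x. f x \<partial>hs_meas k a)"
proof -
 let ?w = "%x. indicator (half_space k) x * weight k a x :: real"
 have w: "?w (v + x) = ?w x" for x
  using assms(2) by (auto simp: half_space_def weight_def indicator_def)
 have "(\<integral>\<^sup>+x. f (x - v) \<partial>hs_meas k a) = (\<integral>\<^sup>+x. ennreal (?w x) * f (x - v) \<partial>lborel)"
  by (rule nn_integral_hs_meas) simp
 also have "\<dots> = (\<integral>\<^sup>+x. ennreal (?w x) * f x \<partial>lborel)"
  by (subst nn_integral_lborel_scale[where c=1 and t=v]) (auto simp: w)
 finally show ?thesis by (subst nn_integral_hs_meas) auto
qed

lemma emeasure_hs_meas_bounded:
 fixes k :: "'n::finite"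
 assumes "bounded A" and A: "A \<in> sets borel" and "0 <= a"
 shows "emeasure (hs_meas k a) A < \<infinity>"
proof -
 obtain R where R: "!!x. x \<in> A ==> norm x <= R" "0 < R" using assms(1) bounded_pos by blast
 have "emeasure (hs_meas k a) A = (\<integral>\<^sup>+x. ennreal (indicator (half_space k) x * weight k a x) * indicator A x \<partial>lborel)"
  using A unfolding hs_meas_def by (subst emeasure_density) auto
 also have "\<dots> <= (\<integral>\<^sup>+x. ennreal (R powr a) * indicator A x \<partial>lborel)"
 proof (intro nn_integral_mono, goal_cases)
  case (1 x)
  show ?case
  proof (cases "x \<in> A & x \<in> half_space k")
  case True
  then have "x $ k <= R" using R(1)[of x] component_le_norm_cart[of x k] by auto
  then show ?thesis using True assms(3) by (auto simp: weight_def half_space_def intro!: ennreal_leI powr_mono2)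
  qed (auto simp: indicator_def)
 qed
 also have "\<dots> = ennreal (R powr a) * emeasure lborel A"
  using A by (subst nn_integral_cmult_indicator) auto
 also have "\<dots> < \<infinity>"
  using emeasure_bounded_finite[OF assms(1)] by (simp add: ennreal_mult_less_top)
 finally show ?thesis .
qed

lemma integral_hs_meas:
 fixes F :: "real^'n::finite => real"
 assumes [measurable]: "F \<in> borel_measurable borel"
 shows "(LINT x:half_space k|lebesgue. F x * weight k a x) = (\<integral>x. F x \<partial>hs_meas k a)"
  and "set_integrable lebesgue (half_space k) (%x. F x * weight k a x) \<longleftrightarrow> integrable (hs_meas k a) F"
proof -
 have "(LINT x:half_space k|lebesgue. F x * weight k a x) = (\<integral>x. indicator (half_space k) x *\<^sub>R (F x * weight k a x) \<partial>lborel)"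
  unfolding set_lebesgue_integral_def by (subst integral_completion) auto
 also have "\<dots> = (\<integral>x. F x \<partial>hs_meas k a)"
  unfolding hs_meas_def
  by (subst integral_density) (auto intro!: Bochner_Integration.integral_cong simp: weight_nonneg split: split_indicator)
 finally show "(LINT x:half_space k|lebesgue. F x * weight k a x) = (\<integral>x. F x \<partial>hs_meas k a)" .
 have "set_integrable lebesgue (half_space k) (%x. F x * weight k a x) \<longleftrightarrow> integrable lborel (%x. indicator (half_space k) x *\<^sub>R (F x * weight k a x))"
  unfolding set_integrable_def by (subst integrable_completion) auto
 also have "\<dots> \<longleftrightarrow> integrable (hs_meas k a) F"
  unfolding hs_meas_def
  by (subst integrable_density) (auto intro!: Bochner_Integration.integrable_cong simp: weight_nonneg split: split_indicator)
 finally show "set_integrable lebesgue (half_space k) (%x. F x * weight k a x) \<longleftrightarrow> integrable (hs_meas k a) F" .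
qed

lemma unit_ball_measurable: "is_norm N ==> unit_ball N \<in> sets borel"
 unfolding unit_ball_def using is_norm_borel[of N] by measurable

lemma norm_ball_bounded:
 fixes N :: "real^'n => real"
 assumes "is_norm N" shows "bounded {x. N x <= r}"
proof -
 obtain c where c: "0 < c" "!!x. norm x <= c * N x" using is_norm_lower[OF assms] by blast
 show ?thesis
 proof (rule boundedI)
  fix x assume "x \<in> {x. N x <= r}"
  then show "norm x <= c * r" using c(2)[of x] c(1) by (auto intro: order_trans mult_left_mono)
 qed
qed

lemma half_ball_mass_eq:
 fixes k :: "'n::finite"
 assumes N: "is_norm N" "0 <= a"
 shows "ennreal (half_ball_mass k a N) = emeasure (hs_meas k a) (unit_ball N)"
  and "0 < half_ball_mass k a N"
proof -
 note [measurable] = unit_ball_measurable[OF N(1)] is_norm_borel[OF N(1)]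
 have "half_ball_mass k a N = (LINT x:half_space k|lebesgue. indicator (unit_ball N) x * weight k a x)"
  unfolding half_ball_mass_def set_lebesgue_integral_def
  by (intro Bochner_Integration.integral_cong) (auto split: split_indicator)
 also have "\<dots> = measure (hs_meas k a) (unit_ball N)"
  by (subst integral_hs_meas) auto
 finally have *: "half_ball_mass k a N = measure (hs_meas k a) (unit_ball N)" .
 have fin: "emeasure (hs_meas k a) (unit_ball N) < \<infinity>"
  using norm_ball_bounded[OF N(1)] N by (intro emeasure_hs_meas_bounded) (auto simp: unit_ball_def)
 then show eq: "ennreal (half_ball_mass k a N) = emeasure (hs_meas k a) (unit_ball N)"
  unfolding * by (simp add: emeasure_eq_ennreal_measure)
 have "emeasure (hs_meas k a) (unit_ball N) ~= 0"
 proof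
  assume "emeasure (hs_meas k a) (unit_ball N) = 0"
  then have "AE x in hs_meas k a. x \<notin> unit_ball N"
  by (intro AE_I[of _ _ "unit_ball N"]) auto
  then have "AE x in lborel. x \<in> half_space k --> x \<notin> unit_ball N"
  by (subst (asm) AE_hs_meas) auto
  then have "AE x in lborel. x \<notin> half_space k \<inter> {x. N x < 1}"
  by eventually_elim (auto simp: unit_ball_def)
  then have "emeasure lborel (half_space k \<inter> {x. N x < 1}) = 0"
  by (subst (asm) AE_iff_measurable[OF _ refl]) (auto simp: Int_def)
  moreover have "open (half_space k \<inter> {x. N x < 1})"
  by (intro open_Int open_half_space open_Collect_less is_norm_continuous N continuous_intros)
  moreover have "half_space k \<inter> {x. N x < 1} ~= {}"
  proof -
  obtain C where C: "0 < C" "!!x. N x <= C * norm x" "!!x y. \<bar>N x - N y\<bar> <= C * norm (x - y)"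
  using is_norm_upper[OF N(1)] by blast
  have "N ((1 / (2 * C)) *\<^sub>R axis k 1) <= C * norm ((1 / (2 * C)) *\<^sub>R axis k 1 :: real^'n)"
  using C(2) by blast
  also have "\<dots> < 1" using C(1) by (simp add: norm_axis_1)
  finally have "(1 / (2 * C)) *\<^sub>R axis k 1 \<in> half_space k \<inter> {x. N x < 1}"
  using C(1) by (simp add: half_space_def)
  then show ?thesis by blast
  qed
  ultimately show False
  using open_not_negligible[of "half_space k \<inter> {x. N x < 1}"]
  by (metis borel_open null_setsI null_sets_completionI negligible_iff_null_sets sets_lborel)
 qed
 then show "0 < half_ball_mass k a N"
  unfolding eq[symmetric] by (simp add: ennreal_eq_0_iff not_le)
qed

lemma emeasure_norm_ball:
 fixes k :: "'n::finite"
 assumes N: "is_norm N" "0 <= a" and r: "0 < r"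
 shows "emeasure (hs_meas k a) {x. N x <= r} = ennreal (r powr eff_dim TYPE('n) a * half_ball_mass k a N)"
proof -
 note [measurable] = unit_ball_measurable[OF N(1)] is_norm_borel[OF N(1)]
 have "emeasure (hs_meas k a) {x. N x <= r} = (\<integral>\<^sup>+x. indicator (unit_ball N) ((1 / r) *\<^sub>R x) \<partial>hs_meas k a)"
 proof -
  have "(%x. indicator (unit_ball N) ((1 / r) *\<^sub>R x) :: ennreal) = indicator {x. N x <= r}"
  using r by (auto simp: unit_ball_def is_norm_scale[OF N(1)] field_simps indicator_def fun_eq_iff)
  then show ?thesis by simp
 qed
 also have "\<dots> = ennreal ((1 / r) powr - eff_dim TYPE('n) a) * emeasure (hs_meas k a) (unit_ball N)"
  using r N by (subst nn_integral_hs_meas_scale) auto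
 also have "(1 / r) powr - eff_dim TYPE('n) a = r powr eff_dim TYPE('n) a"
  using r by (simp add: powr_minus powr_divide)
 also have "emeasure (hs_meas k a) (unit_ball N) = ennreal (half_ball_mass k a N)"
  by (rule half_ball_mass_eq(1)[OF N, symmetric])
 finally show ?thesis using half_ball_mass_eq(2)[OF N, of k] by (simp add: ennreal_mult)
qed

section \<open>The first variation of the sup-convolution\<close>

lemma powr_shift_le:
 fixes t l :: real
 assumes "0 <= t" "0 < l" "l <= 1/2" shows "t powr (1 - l) <= t + 2 * l"
proof (cases "t = 0 \<or> 1 <= t")
 case True
 then show ?thesis
 proof
  assume "1 <= t"
  then have "t powr (1 - l) <= t powr 1" using assms by (intro powr_mono) auto
  then show ?thesis using \<open>1 <= t\<close> assms by simp
 qed (use assms in auto)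
next
 case False
 then have t: "0 < t" "t < 1" using assms by auto
 have "1 + l * ln t <= t powr l" using t exp_ge_add_one_self[of "l * ln t"] by (simp add: powr_def)
 moreover have "- ln t <= 2 * t powr (-1/2)"
  using ln_le_minus_one[of "t powr (-1/2)"] t by (simp add: ln_powr)
 ultimately have "1 - t powr l <= l * (2 * t powr (-1/2))"
  using assms mult_left_mono[of "- ln t" "2 * t powr (-1/2)" l] by simp
 then have "t powr (1 - l) * (1 - t powr l) <= t powr (1 - l) * (l * (2 * t powr (-1/2)))"
  by (intro mult_left_mono) auto
 also have "\<dots> = 2 * l * t powr (1/2 - l)"
  using t by (simp add: powr_add[symmetric] mult.assoc mult.left_commute)
 also have "\<dots> <= 2 * l * 1"
  using t assms by (intro mult_left_mono powr_le1) auto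
 also have "t powr (1 - l) * (1 - t powr l) = t powr (1 - l) - t"
  using t by (simp add: right_diff_distrib powr_add[symmetric])
 finally show ?thesis by simp
qed

lemma powr_diff_le:
 fixes r t U p :: real
 assumes "0 <= r" "r <= t" "t <= U" "1 <= p"
 shows "t powr p - r powr p <= p * U powr (p - 1) * (t - r)"
proof (cases "r = t")
 case False
 then have rt: "r < t" using assms by simp
 have cont: "continuous_on {r..t} (%x. x powr p)"
  using assms by (intro continuous_on_powr' continuous_intros) auto
 obtain z where z: "r < z" "z < t" "t powr p - r powr p = (t - r) * (p * z powr (p - 1))"
 proof (rule mvt[OF rt cont])
  fix x assume "r < x"
  then have "((%x. x powr p) has_real_derivative p * x powr (p - 1)) (at x)"
  using assms by (auto intro!: derivative_eq_intros simp: powr_diff)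
  then show "((%x. x powr p) has_derivative (%h. h * (p * x powr (p - 1)))) (at x)"
  unfolding has_field_derivative_def by (rule has_derivative_eq_rhs) (simp add: fun_eq_iff mult.commute)
 next
  fix z assume "r < z" "z < t" "t powr p - r powr p = (t - r) * (p * z powr (p - 1))"
  then show thesis by (rule that)
 qed
 have "z powr (p - 1) <= U powr (p - 1)" using z assms by (intro powr_mono2) auto
 then show ?thesis using z(3) rt assms by (simp add: mult.commute mult_left_mono)
qed simp

text \<open>The regularity that makes the expansion of the sup-convolution uniform: \<open>u\<close> is Lipschitz with bounded support, grows at most quadratically away from its zeros, and is differentiable where it is positive. The cost \<open>v\<close> enters only through Young's inequality on \<open>[0, \<rho>)\<close>, which covers \<open>p = 1\<close> (with \<open>v = 0\<close>) and \<open>p > 1\<close> alike.\<close>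

locale first_variation =
 fixes k :: "'n::finite" and a p L U C R B K \<rho> :: real and N :: "real^'n => real"
  and u :: "real^'n => real" and D :: "real^'n => real^'n" and v :: "real => real"
 assumes N: "is_norm N" and a: "0 <= a" and p: "1 <= p"
  and u_meas: "u \<in> borel_measurable borel" and D_meas: "D \<in> borel_measurable borel" and v_meas: "v \<in> borel_measurable borel"
  and u_nonneg: "!!x. x \<in> half_space k ==> 0 <= u x" and u_le: "!!x. x \<in> half_space k ==> u x <= U"
  and L: "0 <= L" and u_lip: "!!x y. x \<in> half_space k ==> y \<in> half_space k ==> \<bar>u x - u y\<bar> <= L * norm (x - y)"
  and u_supp: "!!x. x \<in> half_space k ==> R < norm x ==> u x = 0" and R: "0 <= R"
  and C: "0 <= C" and u_quad: "!!x y. x \<in> half_space k ==> y \<in> half_space k ==> u x = 0 ==> u y <= C * (norm (x - y))\<^sup>2"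
  and u_diff: "!!x. x \<in> half_space k ==> 0 < u x ==> (u has_derivative (%h. D x \<bullet> h)) (at x)"
  and D_int: "integrable (hs_meas k a) (%x. dual_norm N (D x) powr p)"
  and v: "!!t. 0 <= t ==> 0 <= v t" and K: "0 <= K"
  and young: "!!A t. 0 <= A ==> 0 <= t ==> t < \<rho> ==> p * A * t - v t <= K * A powr p"
begin

abbreviation "\<Omega> \<equiv> half_space k"
abbreviation "\<mu> \<equiv> hs_meas k a"
abbreviation "S \<equiv> {y \<in> \<Omega>. N y < \<rho>}"

definition "F x = u x powr p"
text \<open>The upper bound for the derivative of the sup-convolution at \<open>l = 0\<close>.\<close>

definition "\<Psi> x = K * dual_norm N (D x) powr p - F x * ln (F x)"

text \<open>The variables are rescaled such that \<open>sup_conv l w\<close> tends to \<open>F w\<close>: writing the point of the convex combination as \<open>(1 - l) w\<close>, the first argument of the combination is \<open>w - (l / (1 - l)) y\<close>.\<close>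

definition sup_conv :: "real => real^'n => ennreal" where
 "sup_conv l w = (SUP y\<in>{y \<in> S. w - (l / (1 - l)) *\<^sub>R y \<in> \<Omega>}.
  ennreal (u (w - (l / (1 - l)) *\<^sub>R y) powr (p * (1 - l)) * exp (- l * v (N y))))"

lemma [measurable]: "N \<in> borel_measurable borel" "dual_norm N \<in> borel_measurable borel"
 "u \<in> borel_measurable borel" "D \<in> borel_measurable borel" "v \<in> borel_measurable borel"
 by (intro is_norm_borel is_norm_dual_norm N u_meas D_meas v_meas)+

lemma F_measurable [measurable]: "F \<in> borel_measurable borel"
 unfolding F_def by measurable

lemma \<Psi>_measurable [measurable]: "\<Psi> \<in> borel_measurable borel"
 unfolding \<Psi>_def by measurable

lemma u_continuous: "continuous_on \<Omega> u"
 using u_lip L by (intro lipschitz_on_continuous_on[of L] lipschitz_onI) (auto simp: dist_norm)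

lemma sup_conv_measurable [measurable]:
 assumes l: "0 < l" "l < 1" shows "sup_conv l \<in> borel_measurable borel"
proof (rule borel_measurableI_greater)
 fix t :: ennreal
 let ?s = "l / (1 - l)"
 let ?t = "%w y. u (w - ?s *\<^sub>R y) powr (p * (1 - l)) * exp (- l * v (N y))"
 have "{w \<in> space borel. t < sup_conv l w} = (\<Union>y\<in>S. {w. w - ?s *\<^sub>R y \<in> \<Omega> & t < ennreal (?t w y)})"
  by (auto simp: sup_conv_def less_SUP_iff)
 moreover have "open {w. w - ?s *\<^sub>R y \<in> \<Omega> & t < ennreal (?t w y)}" for y
 proof (cases "t = top")
  case False
  then obtain r where r: "0 <= r" "t = ennreal r" by (cases t) auto
  have cu: "continuous_on {w. w - ?s *\<^sub>R y \<in> \<Omega>} (%w. u (w - ?s *\<^sub>R y))"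
  by (rule continuous_on_compose2[OF u_continuous]) (auto intro!: continuous_intros)
  have "continuous_on {w. w - ?s *\<^sub>R y \<in> \<Omega>} (%w. ?t w y)"
  using l p u_nonneg by (intro continuous_intros continuous_on_powr' cu) auto
  moreover have op: "open {w. w - ?s *\<^sub>R y \<in> \<Omega>}"
  proof -
  have "continuous_on UNIV (%w. w - ?s *\<^sub>R y)" by (intro continuous_intros)
  from open_vimage[OF open_half_space this] show ?thesis by (simp add: vimage_def)
  qed
  ultimately have "open ((%w. ?t w y) -` {r<..} \<inter> {w. w - ?s *\<^sub>R y \<in> \<Omega>})"
  by (intro continuous_on_open_vimage[THEN iffD1, rule_format]) auto
  also have "(%w. ?t w y) -` {r<..} \<inter> {w. w - ?s *\<^sub>R y \<in> \<Omega>} = {w. w - ?s *\<^sub>R y \<in> \<Omega> & t < ennreal (?t w y)}"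
  using r by (auto simp: ennreal_less_iff)
  finally show ?thesis .
 qed simp
 ultimately show "{w \<in> space borel. t < sup_conv l w} \<in> sets borel"
  by (auto intro!: borel_open)
qed

lemma sup_conv_leI:
 assumes "!!y. y \<in> S ==> w - (l / (1 - l)) *\<^sub>R y \<in> \<Omega> ==>
  u (w - (l / (1 - l)) *\<^sub>R y) powr (p * (1 - l)) * exp (- l * v (N y)) <= c"
 shows "sup_conv l w <= ennreal c"
 unfolding sup_conv_def by (intro SUP_least ennreal_leI assms) auto

text \<open>The geometric concavity of the weight lets it be absorbed into the three functions; undoing the dilation by \<open>1 - l\<close> then produces the power of \<open>1 - l\<close>.\<close>

lemma prekopa_leindler_half_space:
 assumes l: "0 < l" "l < 1" and M: "ennreal M = (\<integral>\<^sup>+x. ennreal (F x) \<partial>\<mu>)" "0 < M"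
  and Z: "ennreal Z = (\<integral>\<^sup>+y. ennreal (exp (- v (N y))) * indicator {y. N y < \<rho>} y \<partial>\<mu>)" "0 < Z"
 shows "ennreal (M powr (1 - l) * Z powr l) <= ennreal ((1 - l) powr eff_dim TYPE('n) a) * (\<integral>\<^sup>+w. sup_conv l w \<partial>\<mu>)"
proof -
 let ?w = "%x. indicator \<Omega> x * weight k a x :: real"
 let ?f = "%x. ennreal (?w x) * ennreal (F x)"
 let ?g = "%y. ennreal (?w y) * (ennreal (exp (- v (N y))) * indicator {y. N y < \<rho>} y)"
 let ?h = "%z. ennreal (?w z) * sup_conv l ((1 / (1 - l)) *\<^sub>R z)"
 have [measurable]: "sup_conv l \<in> borel_measurable borel" by (rule sup_conv_measurable[OF l])
 have f: "(\<integral>\<^sup>+x. ?f x \<partial>lborel) = ennreal M" and g: "(\<integral>\<^sup>+x. ?g x \<partial>lborel) = ennreal Z"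
  unfolding M(1) Z(1) by (subst nn_integral_hs_meas; simp)+
 have h: "(\<integral>\<^sup>+x. ?h x \<partial>lborel) = ennreal ((1 - l) powr eff_dim TYPE('n) a) * (\<integral>\<^sup>+w. sup_conv l w \<partial>\<mu>)"
 proof -
  have "(\<integral>\<^sup>+x. ?h x \<partial>lborel) = (\<integral>\<^sup>+z. sup_conv l ((1 / (1 - l)) *\<^sub>R z) \<partial>\<mu>)"
  by (subst nn_integral_hs_meas) auto
  also have "\<dots> = ennreal ((1 / (1 - l)) powr - eff_dim TYPE('n) a) * (\<integral>\<^sup>+w. sup_conv l w \<partial>\<mu>)"
  using l by (intro nn_integral_hs_meas_scale) auto
  also have "(1 / (1 - l)) powr - eff_dim TYPE('n) a = (1 - l) powr eff_dim TYPE('n) a" using l by (simp add: powr_minus powr_divide)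
  finally show ?thesis .
 qed
 have conv: "sup_convolution_bound l ?f ?g ?h"
  unfolding sup_convolution_bound_def
 proof (intro allI impI)
  fix x y :: "real^'n" and \<alpha> \<beta> :: real
  assume pos: "0 < \<alpha>" "0 < \<beta>" and fg: "ennreal \<alpha> < ?f x" "ennreal \<beta> < ?g y"
  have x: "x \<in> \<Omega>" and y: "y \<in> S" using fg by (auto split: split_indicator_asm)
  have \<alpha>: "\<alpha> < weight k a x * F x"
  using fg(1) x pos by (simp add: F_def weight_nonneg flip: ennreal_mult) (simp add: ennreal_less_iff)
  have \<beta>: "\<beta> < weight k a y * exp (- v (N y))"
  using fg(2) y pos by (simp add: weight_nonneg flip: ennreal_mult) (simp add: ennreal_less_iff)
  let ?z = "(1 - l) *\<^sub>R x + l *\<^sub>R y"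
  have xk: "0 < x $ k" "0 < y $ k" using x y by (auto simp: half_space_def)
  have z: "?z \<in> \<Omega>" using xk l by (auto simp: half_space_def intro!: add_pos_pos)
  have eq: "(1 / (1 - l)) *\<^sub>R ?z - (l / (1 - l)) *\<^sub>R y = x"
  using l by (simp add: scaleR_add_right)
  have "weight k a x powr (1 - l) * weight k a y powr l = ((x $ k) powr (1 - l) * (y $ k) powr l) powr a"
  using xk by (simp add: weight_def powr_powr powr_mult mult.commute)
  also have "\<dots> <= weight k a ?z"
  unfolding weight_def using Youngs_inequality_0[of "1 - l" l "x $ k" "y $ k"] xk l a
  by (intro powr_mono2) auto
  finally have w: "weight k a x powr (1 - l) * weight k a y powr l <= weight k a ?z" .
  have "\<alpha> powr (1 - l) * \<beta> powr l <= (weight k a x * F x) powr (1 - l) * (weight k a y * exp (- v (N y))) powr l"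
  using \<alpha> \<beta> pos l by (intro mult_mono powr_mono2) auto
  also have "\<dots> = (weight k a x powr (1 - l) * weight k a y powr l) * (u x powr (p * (1 - l)) * exp (- l * v (N y)))"
  by (simp add: F_def powr_mult weight_nonneg powr_powr powr_def[of "exp _"] mult_ac)
  also have "\<dots> <= weight k a ?z * (u x powr (p * (1 - l)) * exp (- l * v (N y)))"
  by (intro mult_right_mono w) auto
  finally have st1: "ennreal (\<alpha> powr (1 - l) * \<beta> powr l) <= ennreal (weight k a ?z) * ennreal (u x powr (p * (1 - l)) * exp (- l * v (N y)))"
  by (subst ennreal_mult[symmetric]) (auto intro!: ennreal_leI weight_nonneg)
  have st2: "ennreal (u x powr (p * (1 - l)) * exp (- l * v (N y))) <= sup_conv l ((1 / (1 - l)) *\<^sub>R ?z)"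
  unfolding sup_conv_def using y x eq by (intro SUP_upper2[of y]) auto
  show "ennreal (\<alpha> powr (1 - l) * \<beta> powr l) <= ?h ?z"
  using z order_trans[OF st1 mult_left_mono[OF st2]] by simp
 qed
 have *: "ennreal (\<theta> * (M powr (1 - l) * Z powr l)) <= (\<integral>\<^sup>+x. ?h x \<partial>lborel)" if \<theta>: "0 < \<theta>" "\<theta> < 1" for \<theta>
 proof -
  have "ennreal ((\<theta> * M) powr (1 - l) * (\<theta> * Z) powr l) <= (\<integral>\<^sup>+x. ?h x \<partial>lborel)"
  proof (rule prekopa_leindler[OF _ _ _ l conv])
  show "ennreal (\<theta> * M) < integral\<^sup>N lborel ?f" "ennreal (\<theta> * Z) < integral\<^sup>N lborel ?g"
  unfolding f g using \<theta> M(2) Z(2) by (auto intro!: ennreal_lessI)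
  qed (use \<theta> M Z in auto)
  also have "(\<theta> * M) powr (1 - l) * (\<theta> * Z) powr l = \<theta> * (M powr (1 - l) * Z powr l)"
  using \<theta> M(2) Z(2) by (simp add: powr_mult powr_add[symmetric])
  finally show ?thesis .
 qed
 show ?thesis
 proof (cases "(\<integral>\<^sup>+x. ?h x \<partial>lborel)")
  case (real r)
  have "M powr (1 - l) * Z powr l <= r"
  proof (rule field_le_mult_one_interval)
  fix \<theta> :: real assume "0 < \<theta>" "\<theta> < 1"
  from *[OF this] show "\<theta> * (M powr (1 - l) * Z powr l) <= r"
  unfolding real by (simp add: ennreal_le_iff real(1))
  qed
  then show ?thesis unfolding h[symmetric] real by (rule ennreal_leI)
 qed (simp add: h[symmetric])
qed


lemma step_bounds:
 fixes l :: real
 assumes "0 < l" "l <= 1/2"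
 shows "0 < l / (1 - l)" "l / (1 - l) <= 2 * l" "(1 - l) * (l / (1 - l)) = l"
proof -
 show "0 < l / (1 - l)" "(1 - l) * (l / (1 - l)) = l" using assms by auto
 have "l * 1 <= l * (2 * (1 - l))" using assms by (intro mult_left_mono) auto
 then show "l / (1 - l) <= 2 * l" using assms by (simp add: divide_le_eq mult_ac)
qed

lemma S_bounded: "\<exists>c>0. (\<forall>y\<in>S. norm y <= c * N y & norm y <= c * max 1 \<rho>)"
proof -
 obtain c where c: "0 < c" "!!x. norm x <= c * N x" using is_norm_lower[OF N] by blast
 have "norm y <= c * max 1 \<rho>" if "y \<in> S" for y
  using c(1) that by (intro order_trans[OF c(2)[of y]] mult_left_mono) auto
 then show ?thesis using c by blast
qed

lemma F_nonneg: "0 <= F x"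
 by (simp add: F_def)

lemma F_le: "x \<in> \<Omega> ==> F x <= U powr p"
 unfolding F_def using u_le u_nonneg p by (intro powr_mono2) auto

text \<open>The linear bound in \<open>l\<close> dominates the difference quotients in the passage to the limit.\<close>

lemma sup_conv_bound:
 "\<exists>B0\<ge>0. \<exists>R1\<ge>0. \<forall>l w. 0 < l --> l <= 1/2 --> w \<in> \<Omega> -->
  sup_conv l w <= ennreal (F w + B0 * l) & (R1 < norm w --> sup_conv l w = 0)"
proof -
 obtain c where c: "c > 0" "!!y. y \<in> S ==> norm y <= c * max 1 \<rho>" using S_bounded by blast
 define c0 where "c0 = c * max 1 \<rho>"
 have c0: "0 < c0" "!!y. y \<in> S ==> norm y <= c0" using c by (auto simp: c0_def)
 define B0 where "B0 = 2 + \<bar>p * U powr (p - 1)\<bar> * (L * (2 * c0))"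
 have "sup_conv l w <= ennreal (F w + B0 * l) & (R + c0 < norm w --> sup_conv l w = 0)"
  if l: "0 < l" "l <= 1/2" and w: "w \<in> \<Omega>" for l w
 proof (intro conjI impI)
  let ?s = "l / (1 - l)"
  note s = step_bounds[OF l]
  have exp1: "exp (- l * v (N y)) <= 1" for y using l v[OF is_normD(1)[OF N]] by (simp add: mult_nonneg_nonneg)
  have ny: "norm (?s *\<^sub>R y) <= 2 * l * c0" if "y \<in> S" for y
  unfolding norm_scaleR abs_of_pos[OF s(1)] using s c0 that by (intro mult_mono) auto
  show "sup_conv l w <= ennreal (F w + B0 * l)"
  proof (intro sup_conv_leI)
  fix y assume y: "y \<in> S" and x: "w - ?s *\<^sub>R y \<in> \<Omega>"
  let ?x = "w - ?s *\<^sub>R y"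
  have "u ?x powr (p * (1 - l)) * exp (- l * v (N y)) <= F ?x powr (1 - l)"
  using exp1[of y] by (simp add: F_def powr_powr mult_left_le)
  also have "\<dots> <= F ?x + 2 * l"
  using l by (intro powr_shift_le) (auto simp: F_def)
  also have "F ?x <= F w + \<bar>p * U powr (p - 1)\<bar> * (L * (2 * c0)) * l"
  proof (cases "u w <= u ?x")
  case True
  have "F ?x - F w <= p * U powr (p - 1) * (u ?x - u w)"
  unfolding F_def using True x w u_nonneg u_le p by (intro powr_diff_le) auto
  also have "\<dots> <= \<bar>p * U powr (p - 1)\<bar> * (L * (2 * l * c0))"
  proof (intro mult_mono)
  have "u ?x - u w <= L * norm (?x - w)" using u_lip[OF x w] by simp
  also have "\<dots> <= L * (2 * l * c0)" using ny[OF y] L by (intro mult_left_mono) (simp_all del: norm_scaleR)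
  finally show "u ?x - u w <= L * (2 * l * c0)" .
  qed (use True p in auto)
  finally show ?thesis by (simp add: mult_ac)
  next
  case False
  then have "F ?x <= F w" unfolding F_def using x u_nonneg p by (intro powr_mono2) auto
  then show ?thesis using L l c0 p by (intro order_trans[OF _ add_increasing2[OF _ order_refl]]) auto
  qed
  finally show "u ?x powr (p * (1 - l)) * exp (- l * v (N y)) <= F w + B0 * l"
  by (simp add: B0_def algebra_simps)
  qed
  assume far: "R + c0 < norm w"
  have "sup_conv l w <= ennreal 0"
  proof (intro sup_conv_leI)
  fix y assume y: "y \<in> S" and x: "w - ?s *\<^sub>R y \<in> \<Omega>"
  have "norm w <= norm (w - ?s *\<^sub>R y) + norm (?s *\<^sub>R y)" by (metis diff_add_cancel norm_triangle_ineq)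
  moreover have "2 * l * c0 <= c0" using l c0 by (simp add: mult_left_le_one_le)
  ultimately have "R < norm (w - ?s *\<^sub>R y)" using far ny[OF y] by linarith
  then show "u (w - ?s *\<^sub>R y) powr (p * (1 - l)) * exp (- l * v (N y)) <= 0" using u_supp[OF x] by simp
  qed
  then show "sup_conv l w = 0" by simp
 qed
 moreover have "0 <= B0" "0 <= R + c0" using L c0 R by (auto simp: B0_def)
 ultimately show ?thesis by blast
qed

text \<open>At a zero of \<open>u\<close> the quadratic growth makes the sup-convolution \<open>o(l)\<close>, since \<open>p (1 - l)\<close> stays above one half.\<close>

lemma sup_conv_limit_zero:
 assumes w: "w \<in> \<Omega>" and e: "0 < e" and z: "u w = 0"
 shows "\<forall>\<^sub>F l in at_right 0. sup_conv l w <= ennreal (l * e)"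
proof -
 obtain c where c: "c > 0" "!!y. y \<in> S ==> norm y <= c * max 1 \<rho>" using S_bounded by blast
 define c0 where "c0 = c * max 1 \<rho>"
 have c0: "0 < c0" "!!y. y \<in> S ==> norm y <= c0" using c by (auto simp: c0_def)
 define C1 where "C1 = C * (2 * c0)\<^sup>2"
 have C1: "0 <= C1" using C by (auto simp: C1_def)
 have ev: "\<forall>\<^sub>F l in at_right (0::real). 0 < l & l < 1/4 & C1 * l\<^sup>2 < 1 & C1 powr (3/4) * l powr (1/2) < e"
 proof (intro eventually_conj)
  show "\<forall>\<^sub>F l in at_right (0::real). 0 < l" by (simp add: eventually_at_right_less)
  show "\<forall>\<^sub>F l in at_right (0::real). l < 1/4" by (rule order_tendstoD) (auto intro!: tendsto_eq_intros)
  have "((%l::real. C1 * l\<^sup>2) \<longlongrightarrow> 0) (at_right 0)" by (auto intro!: tendsto_eq_intros)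
  then show "\<forall>\<^sub>F l in at_right (0::real). C1 * l\<^sup>2 < 1" by (rule order_tendstoD) simp
  have "((%l::real. C1 powr (3/4) * l powr (1/2)) \<longlongrightarrow> C1 powr (3/4) * 0 powr (1/2)) (at_right 0)"
  by (intro tendsto_intros tendsto_powr') (auto simp: eventually_at_filter)
  then show "\<forall>\<^sub>F l in at_right (0::real). C1 powr (3/4) * l powr (1/2) < e" using e by (auto intro: order_tendstoD)
 qed
 show ?thesis
  using ev
 proof eventually_elim
  case (elim l)
  then have l: "0 < l" "l <= 1/2" "l < 1/4" by auto
  let ?s = "l / (1 - l)"
  note s = step_bounds[OF l(1,2)]
  show ?case
  proof (intro sup_conv_leI)
  fix y assume y: "y \<in> S" and x: "w - ?s *\<^sub>R y \<in> \<Omega>"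
  have exp1: "exp (- l * v (N y)) <= 1" using l v[OF is_normD(1)[OF N]] by (simp add: mult_nonneg_nonneg)
  have ny: "norm (?s *\<^sub>R y) <= 2 * l * c0"
  unfolding norm_scaleR abs_of_pos[OF s(1)] using s c0 y by (intro mult_mono) auto
  have "u (w - ?s *\<^sub>R y) <= C * (norm (?s *\<^sub>R y))\<^sup>2" using u_quad[OF w x z] by simp
  also have "\<dots> <= C * (2 * l * c0)\<^sup>2" using ny C by (intro mult_left_mono power_mono) auto
  also have "\<dots> = C1 * l\<^sup>2" by (simp add: C1_def power_mult_distrib mult_ac)
  finally have ux: "u (w - ?s *\<^sub>R y) <= C1 * l\<^sup>2" .
  have pl: "3/4 <= p * (1 - l)"
  using mult_mono[of 1 p "3/4" "1 - l"] p l by simp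
  have "u (w - ?s *\<^sub>R y) powr (p * (1 - l)) * exp (- l * v (N y)) <= u (w - ?s *\<^sub>R y) powr (p * (1 - l))"
  using exp1 by (simp add: mult_left_le)
  also have "\<dots> <= (C1 * l\<^sup>2) powr (p * (1 - l))"
  using ux pl u_nonneg[OF x] by (intro powr_mono2) auto
  also have "\<dots> <= (C1 * l\<^sup>2) powr (3/4)"
  using pl elim C1 by (intro powr_mono') auto
  also have "\<dots> = C1 powr (3/4) * (l powr 2) powr (3/4)"
  using C1 l by (simp add: powr_mult)
  also have "\<dots> = l * (C1 powr (3/4) * l powr (1/2))"
  proof -
  have "l powr (3/2) = l powr 1 * l powr (1/2)" by (subst powr_add[symmetric]) simp
  moreover have "(l powr 2) powr (3/4) = l powr (3/2)" by (simp only: powr_powr) simp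
  ultimately show ?thesis using l by (simp only: powr_one) simp
  qed
  also have "\<dots> <= l * e" using elim by (intro mult_left_mono) auto
  finally show "u (w - ?s *\<^sub>R y) powr (p * (1 - l)) * exp (- l * v (N y)) <= l * e" .
  qed
 qed
qed

text \<open>Where \<open>u\<close> is positive, the first-order expansion of \<open>u\<close> gives the term \<open>p A t - v t\<close> with \<open>A\<close> proportional to the dual norm of the gradient, to which Young's inequality applies; the exponent \<open>p (1 - l)\<close> contributes \<open>- F ln F\<close>.\<close>

lemma sup_conv_limit_pos:
 assumes w: "w \<in> \<Omega>" and e: "0 < e" and pos: "0 < u w"
 shows "\<forall>\<^sub>F l in at_right 0. sup_conv l w <= ennreal (F w + l * (\<Psi> w + e))"
proof -
 obtain c where c: "c > 0" "!!y. y \<in> S ==> norm y <= c * N y" "!!y. y \<in> S ==> norm y <= c * max 1 \<rho>"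
  using S_bounded by blast
 define c0 where "c0 = c * max 1 \<rho>"
 have c0: "0 < c0" "!!y. y \<in> S ==> norm y <= c0" using c by (auto simp: c0_def)
 define A where "A = dual_norm N (D w)"
 have A: "0 <= A" unfolding A_def by (rule is_normD(1)[OF is_norm_dual_norm[OF N]])
 have "((%\<eta>. K * (A + \<eta>) powr p) \<longlongrightarrow> K * (A + 0) powr p) (at_right 0)"
  using p A by (intro tendsto_intros tendsto_powr') (auto simp: eventually_at_filter)
 then have "\<forall>\<^sub>F \<eta> in at_right 0. K * (A + \<eta>) powr p < K * A powr p + e / 2"
  using e by (intro order_tendstoD) auto
 moreover have "\<forall>\<^sub>F \<eta> in at_right (0::real). 0 < \<eta>" by (simp add: eventually_at_right_less)
 ultimately have "\<forall>\<^sub>F \<eta> in at_right (0::real). 0 < \<eta> & K * (A + \<eta>) powr p < K * A powr p + e / 2"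
  by eventually_elim simp
 then obtain \<eta> where \<eta>: "0 < \<eta>" "K * (A + \<eta>) powr p < K * A powr p + e / 2"
  using eventually_happens[of _ "at_right (0::real)"] by (auto simp: trivial_limit_at_right_real)
 obtain d where d: "0 < d" "!!y. norm (y - w) < d ==> norm (u y - u w - D w \<bullet> (y - w)) <= (\<eta> / c) * norm (y - w)"
  using u_diff[OF w pos] \<eta> c(1) unfolding has_derivative_at_alt by (meson divide_pos_pos)
 define A' where "A' = (A + \<eta>) / u w"
 have A': "0 <= A'" using A \<eta> pos by (simp add: A'_def)
 have key: "u w + A * (\<sigma> * n) + (\<eta> / c) * (\<sigma> * (c * n)) = u w * (1 + \<sigma> * A' * n)" for \<sigma> n
  using pos c(1) by (simp add: A'_def field_simps)
 have Fw: "0 < F w" using pos by (simp add: F_def)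
 define b where "b = K * A' powr p - ln (F w)"
 have FA': "F w * A' powr p = (A + \<eta>) powr p"
  using pos A \<eta> by (simp add: F_def A'_def powr_divide)
 have Fb: "F w * b <= \<Psi> w + e / 2"
 proof -
  have "F w * b = K * (F w * A' powr p) - F w * ln (F w)" by (simp add: b_def algebra_simps)
  also have "\<dots> <= K * A powr p + e / 2 - F w * ln (F w)" unfolding FA' using \<eta>(2) by simp
  finally show ?thesis by (simp add: \<Psi>_def A_def)
 qed
 have "((%l. exp (l * b)) has_real_derivative b) (at 0)" by (auto intro!: derivative_eq_intros)
 then have "((%l. (exp (l * b) - 1) / l) \<longlongrightarrow> b) (at_right 0)"
  unfolding DERIV_def by (auto intro: tendsto_mono[OF at_le])
 then have ev1: "\<forall>\<^sub>F l in at_right 0. (exp (l * b) - 1) / l < b + e / (2 * F w)"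
  using e Fw by (intro order_tendstoD) auto
 have ev2: "\<forall>\<^sub>F l in at_right (0::real). 0 < l & l < 1/2 & 2 * l * c0 < d"
 proof (intro eventually_conj)
  show "\<forall>\<^sub>F l in at_right (0::real). 0 < l" by (simp add: eventually_at_right_less)
  show "\<forall>\<^sub>F l in at_right (0::real). l < 1/2" by (rule order_tendstoD) (auto intro!: tendsto_eq_intros)
  have "((%l::real. 2 * l * c0) \<longlongrightarrow> 0) (at_right 0)" by (auto intro!: tendsto_eq_intros)
  then show "\<forall>\<^sub>F l in at_right (0::real). 2 * l * c0 < d" using d by (auto intro: order_tendstoD)
 qed
 show ?thesis
  using ev1 ev2
 proof eventually_elim
  case (elim l)
  then have l: "0 < l" "l <= 1/2" by auto
  let ?s = "l / (1 - l)"
  note s = step_bounds[OF l]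
  show ?case
  proof (intro sup_conv_leI)
  fix y assume y: "y \<in> S" and x: "w - ?s *\<^sub>R y \<in> \<Omega>"
  let ?x = "w - ?s *\<^sub>R y"
  have Ny: "0 <= N y" "N y < \<rho>" using y is_normD(1)[OF N] by auto
  have "norm (?s *\<^sub>R y) <= 2 * l * c0"
  unfolding norm_scaleR abs_of_pos[OF s(1)] using s c0 y by (intro mult_mono) auto
  then have "norm (?x - w) < d" using elim by simp
  from d(2)[OF this] have "u ?x <= u w + D w \<bullet> (- (?s *\<^sub>R y)) + (\<eta> / c) * norm (?s *\<^sub>R y)" by simp
  also have "D w \<bullet> (- (?s *\<^sub>R y)) <= A * N (- (?s *\<^sub>R y))"
  unfolding A_def by (rule dual_norm_inner_le[OF N])
  also have "N (- (?s *\<^sub>R y)) = ?s * N y" using s l by (simp add: is_normD[OF N])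
  also have "(\<eta> / c) * norm (?s *\<^sub>R y) <= (\<eta> / c) * (?s * (c * N y))"
  unfolding norm_scaleR abs_of_pos[OF s(1)] using s \<eta> c(1) c(2)[OF y] by (intro mult_left_mono mult_mono) auto
  also have "u w + A * (?s * N y) + (\<eta> / c) * (?s * (c * N y)) = u w * (1 + ?s * A' * N y)"
  by (rule key)
  also have "\<dots> <= u w * exp (?s * A' * N y)"
  using pos by (intro mult_left_mono exp_ge_add_one_self) auto
  finally have "u ?x powr (p * (1 - l)) <= (u w * exp (?s * A' * N y)) powr (p * (1 - l))"
  using u_nonneg[OF x] p l by (intro powr_mono2) auto
  also have "\<dots> = u w powr (p * (1 - l)) * exp (p * A' * ((1 - l) * ?s) * N y)"
  using pos by (simp add: powr_mult powr_def[of "exp _"] mult_ac)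
  finally have ux: "u ?x powr (p * (1 - l)) <= u w powr (p * (1 - l)) * exp (p * A' * l * N y)"
  unfolding s(3) .
  have "u ?x powr (p * (1 - l)) * exp (- l * v (N y)) <= u w powr (p * (1 - l)) * exp (p * A' * l * N y) * exp (- l * v (N y))"
  by (intro mult_right_mono ux) auto
  also have "\<dots> = u w powr (p * (1 - l)) * exp (l * (p * A' * N y - v (N y)))"
  by (simp add: exp_add[symmetric] algebra_simps mult.assoc)
  also have "\<dots> <= u w powr (p * (1 - l)) * exp (l * (K * A' powr p))"
  using young[OF A' Ny] l by (intro mult_left_mono) auto
  also have "u w powr (p * (1 - l)) = F w * exp (- l * ln (F w))"
  using pos by (simp add: F_def powr_def ln_exp exp_add[symmetric] algebra_simps)
  also have "F w * exp (- l * ln (F w)) * exp (l * (K * A' powr p)) = F w * exp (l * b)"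
  by (simp add: b_def mult.assoc exp_add[symmetric] algebra_simps)
  also have "\<dots> <= F w * (1 + l * (b + e / (2 * F w)))"
  using elim Fw by (intro mult_left_mono) (auto simp: field_simps)
  also have "\<dots> = F w + l * (F w * b + e / 2)" using Fw by (simp add: field_simps)
  also have "\<dots> <= F w + l * (\<Psi> w + e)" using Fb l by (intro add_left_mono mult_left_mono) auto
  finally show "u ?x powr (p * (1 - l)) * exp (- l * v (N y)) <= F w + l * (\<Psi> w + e)" .
  qed
 qed
qed


lemma integrable_of_bounded_support:
 fixes f :: "real^'n => real"
 assumes [measurable]: "f \<in> borel_measurable borel"
  and "!!x. x \<in> \<Omega> ==> \<bar>f x\<bar> <= c" "!!x. x \<in> \<Omega> ==> r < norm x ==> f x = 0"
 shows "integrable \<mu> f"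
proof (rule Bochner_Integration.integrable_bound)
 have "emeasure \<mu> (cball 0 r) < \<infinity>"
  using a by (intro emeasure_hs_meas_bounded) auto
 then show "integrable \<mu> (%x. c * indicator (cball 0 r) x)" by simp
 show "AE x in \<mu>. norm (f x) <= norm (c * indicator (cball 0 r) x)"
  using hs_meas_in
 proof eventually_elim
  case (elim x)
  then show ?case using assms(2,3)[OF elim] by (cases "norm x <= r") (auto simp: indicator_def)
 qed
qed simp

lemma F_ln_F_le: "x \<in> \<Omega> ==> \<bar>F x * ln (F x)\<bar> <= (U powr p)\<^sup>2 + 1"
proof -
 assume x: "x \<in> \<Omega>"
 show ?thesis
 proof (cases "F x = 0")
  case False
  then have F: "0 < F x" using F_nonneg[of x] by simp
  have "F x * ln (F x) <= F x * F x"
  using ln_le_minus_one[OF F] F by (intro mult_left_mono) auto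
  also have "\<dots> <= U powr p * U powr p"
  using F_le[OF x] F by (intro mult_mono) auto
  finally have 1: "F x * ln (F x) <= (U powr p)\<^sup>2" by (simp add: power2_eq_square)
  have "F x * - ln (F x) = F x * ln (1 / F x)" using F by (simp add: ln_div)
  also have "\<dots> <= F x * (1 / F x)"
  using ln_le_minus_one[of "1 / F x"] F by (intro mult_left_mono) auto
  finally have "- (F x * ln (F x)) <= 1" using F by simp
  moreover have "0 <= (U powr p)\<^sup>2" by simp
  ultimately show ?thesis using 1 unfolding abs_le_iff by linarith
 qed simp
qed

lemma F_support: "x \<in> \<Omega> ==> R < norm x ==> F x = 0"
 using u_supp by (simp add: F_def)

lemma F_integrable: "integrable \<mu> F" and F_ln_F_integrable: "integrable \<mu> (%x. F x * ln (F x))"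
proof -
 show "integrable \<mu> F"
  using F_le F_nonneg F_support by (intro integrable_of_bounded_support[where c="U powr p" and r=R]) auto
 show "integrable \<mu> (%x. F x * ln (F x))"
  using F_ln_F_le F_support by (intro integrable_of_bounded_support[where c="(U powr p)\<^sup>2 + 1" and r=R]) auto
qed

lemma \<Psi>_nonneg: "u x = 0 ==> 0 <= \<Psi> x"
 using K by (simp add: \<Psi>_def F_def)

lemma sup_conv_limit:
 assumes w: "w \<in> \<Omega>" and e: "0 < e"
 shows "\<forall>\<^sub>F l in at_right 0. sup_conv l w <= ennreal (F w + l * (\<Psi> w + e)) & 0 <= F w + l * (\<Psi> w + e)"
proof (cases "u w = 0")
 case True
 have ev: "\<forall>\<^sub>F l in at_right (0::real). 0 < l" by (simp add: eventually_at_right_less)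
 from sup_conv_limit_zero[OF w e True] ev show ?thesis
 proof eventually_elim
  case (elim l)
  have "l * e <= F w + l * (\<Psi> w + e)" using \<Psi>_nonneg[OF True] F_nonneg[of w] elim by (intro add_increasing mult_left_mono) auto
  moreover have "0 <= l * e" using elim e by simp
  ultimately show ?case using elim by (meson order_trans ennreal_leI)
 qed
next
 case False
 then have pos: "0 < u w" using u_nonneg[OF w] by simp
 then have "0 < F w" by (simp add: F_def)
 have "((%l. F w + l * (\<Psi> w + e)) \<longlongrightarrow> F w) (at_right 0)" by (auto intro!: tendsto_eq_intros)
 then have "\<forall>\<^sub>F l in at_right 0. 0 < F w + l * (\<Psi> w + e)" by (rule order_tendstoD) fact
 with sup_conv_limit_pos[OF w e pos] show ?thesis by eventually_elim auto
qed

theorem entropy_le: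
 assumes M: "M = (\<integral>x. F x \<partial>\<mu>)" "0 < M"
  and Z: "ennreal Z = (\<integral>\<^sup>+y. ennreal (exp (- v (N y))) * indicator {y. N y < \<rho>} y \<partial>\<mu>)" "0 < Z"
 shows "(\<integral>x. F x * ln (F x) \<partial>\<mu>) <=
  M * ln M - eff_dim TYPE('n) a * M - M * ln Z + K * (\<integral>x. dual_norm N (D x) powr p \<partial>\<mu>)"
proof -
 let ?n = "eff_dim TYPE('n) a"
 obtain B0 R1 where B0: "0 <= B0" and bound: "!!l w. 0 < l ==> l <= 1/2 ==> w \<in> \<Omega> ==> sup_conv l w <= ennreal (F w + B0 * l)"
  and far: "!!l w. 0 < l ==> l <= 1/2 ==> w \<in> \<Omega> ==> R1 < norm w ==> sup_conv l w = 0"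
  using sup_conv_bound by blast
 define l where "l j = 1 / (real j + 2)" for j :: nat
 have l: "0 < l j" "l j <= 1/2" "l j < 1" for j by (auto simp: l_def field_simps)
 have l0: "l \<longlonglongrightarrow> 0"
  unfolding l_def by real_asymp
 have lim: "filterlim l (at_right 0) sequentially"
  using l0 l(1) less_imp_neq[OF l(1), symmetric] by (auto simp: filterlim_at)
 define h where "h j w = enn2real (sup_conv (l j) w)" for j w
 have [measurable]: "sup_conv (l j) \<in> borel_measurable borel" for j by (rule sup_conv_measurable) (use l in auto)
 have [measurable]: "h j \<in> borel_measurable borel" for j unfolding h_def by measurable
 have h: "ennreal (h j w) = sup_conv (l j) w" if "w \<in> \<Omega>" for j w
  unfolding h_def using bound[OF l(1,2) that, of j] by (intro ennreal_enn2real) (auto simp: less_top[symmetric] top_unique)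
 have h_nonneg: "0 <= h j w" for j w by (simp add: h_def)
 have h_le: "h j w <= F w + B0 * l j" if "w \<in> \<Omega>" for j w
  using bound[OF l(1,2) that, of j] F_nonneg[of w] B0 l(1)[of j] unfolding h[OF that, symmetric]
  by (subst (asm) ennreal_le_iff) (auto intro: add_nonneg_nonneg mult_nonneg_nonneg less_imp_le)
 have h_far: "h j w = 0" if "w \<in> \<Omega>" "R1 < norm w" for j w
  using far[OF l(1,2) that] by (simp add: h_def)
 define E where "E j w = max 0 ((h j w - F w) / l j - \<Psi> w)" for j w
 have [measurable]: "E j \<in> borel_measurable borel" for j unfolding E_def by measurable
 define T where "T = B0 + (U powr p)\<^sup>2 + 1"
 have E_le: "\<bar>E j w\<bar> <= T * indicator (cball 0 (max R R1)) w" if "w \<in> \<Omega>" for j w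
 proof (cases "norm w <= max R R1")
  case True
  have "(h j w - F w) / l j <= B0" using h_le[OF that, of j] l(1)[of j] by (simp add: divide_le_eq)
  moreover have "- \<Psi> w <= (U powr p)\<^sup>2 + 1"
  proof -
  have "- \<Psi> w <= F w * ln (F w)" using K by (simp add: \<Psi>_def)
  then show ?thesis using F_ln_F_le[OF that] by linarith
  qed
  moreover have "0 <= T" using B0 by (simp add: T_def add_nonneg_nonneg)
  ultimately show ?thesis using True by (auto simp: E_def T_def)
 next
  case False
  then have "u w = 0" "F w = 0" "h j w = 0" using u_supp F_support h_far that by auto
  then show ?thesis using \<Psi>_nonneg[of w] False by (simp add: E_def)
 qed
 have E_lim: "(%j. E j w) \<longlonglongrightarrow> 0" if w: "w \<in> \<Omega>" for w
 proof (rule order_tendstoI)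
  fix e :: real assume "e < 0" then show "\<forall>\<^sub>F j in sequentially. e < E j w" by (auto simp: E_def less_max_iff_disj)
 next
  fix e :: real assume e: "0 < e"
  have "\<forall>\<^sub>F j in sequentially. sup_conv (l j) w <= ennreal (F w + l j * (\<Psi> w + e / 2)) & 0 <= F w + l j * (\<Psi> w + e / 2)"
  using sup_conv_limit[OF w, of "e / 2"] e by (intro eventually_compose_filterlim[OF _ lim]) auto
  then show "\<forall>\<^sub>F j in sequentially. E j w < e"
  proof eventually_elim
  case (elim j)
  then have "h j w <= F w + l j * (\<Psi> w + e / 2)" unfolding h[OF w, symmetric] using ennreal_le_iff by blast
  then have "(h j w - F w) / l j <= \<Psi> w + e / 2" using l(1)[of j] by (simp add: divide_le_eq mult.commute)
  then show ?case using e by (simp add: E_def)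
  qed
 qed
 have fin: "integrable \<mu> (%x. T * indicator (cball 0 (max R R1)) x)"
  using emeasure_hs_meas_bounded[OF bounded_cball _ a, of 0 "max R R1" k] by simp
 have E_int: "integrable \<mu> (E j)" for j
  using hs_meas_in[of k a]
  by (intro Bochner_Integration.integrable_bound[OF fin]) (auto elim!: eventually_mono intro: order_trans[OF E_le abs_ge_self])
 have "(%j. \<integral>w. E j w \<partial>\<mu>) \<longlonglongrightarrow> (\<integral>w. 0 \<partial>\<mu>)"
  using E_le E_lim hs_meas_in[of k a]
  by (intro integral_dominated_convergence[OF _ _ fin]) (auto elim!: eventually_mono)
 then have E0: "(%j. \<integral>w. E j w \<partial>\<mu>) \<longlonglongrightarrow> 0" by simp
 have \<Psi>_int: "integrable \<mu> \<Psi>"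
  unfolding \<Psi>_def using D_int F_ln_F_integrable by auto
 have h_int: "integrable \<mu> (h j)" for j
 proof (rule integrable_of_bounded_support[where c="U powr p + B0" and r=R1])
  fix x assume x: "x \<in> \<Omega>"
  have "B0 * l j <= B0" using B0 l(3)[of j] by (simp add: mult_left_le)
  then show "\<bar>h j x\<bar> <= U powr p + B0" using h_le[OF x, of j] h_nonneg[of j x] F_le[OF x] by simp
 qed (use h_far in auto)
 have key: "(M powr (1 - l j) * Z powr l j * (1 - l j) powr - ?n - M) / l j <= (\<integral>x. \<Psi> x \<partial>\<mu>) + (\<integral>x. E j x \<partial>\<mu>)" for j
 proof -
  have "ennreal (M powr (1 - l j) * Z powr l j) <= ennreal ((1 - l j) powr ?n) * (\<integral>\<^sup>+w. sup_conv (l j) w \<partial>\<mu>)"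
  using M Z F_integrable F_nonneg
  by (intro prekopa_leindler_half_space l) (auto simp: nn_integral_eq_integral)
  also have "(\<integral>\<^sup>+w. sup_conv (l j) w \<partial>\<mu>) = (\<integral>\<^sup>+w. ennreal (h j w) \<partial>\<mu>)"
  using hs_meas_in[of k a] by (intro nn_integral_cong_AE) (auto elim!: eventually_mono simp: h)
  also have "\<dots> = ennreal (\<integral>w. h j w \<partial>\<mu>)"
  using h_int h_nonneg by (intro nn_integral_eq_integral) auto
  finally have 1: "M powr (1 - l j) * Z powr l j <= (1 - l j) powr ?n * (\<integral>w. h j w \<partial>\<mu>)"
  using h_nonneg by (simp add: integral_nonneg_AE ennreal_mult[symmetric] ennreal_le_iff)
  have "M powr (1 - l j) * Z powr l j * (1 - l j) powr - ?n <= (1 - l j) powr ?n * (\<integral>w. h j w \<partial>\<mu>) * (1 - l j) powr - ?n"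
  by (intro mult_right_mono 1) auto
  also have "\<dots> = (\<integral>w. h j w \<partial>\<mu>)"
  using l(3)[of j] by (simp add: powr_minus)
  also have "\<dots> <= (\<integral>w. F w + l j * (\<Psi> w + E j w) \<partial>\<mu>)"
  proof (rule integral_mono_AE)
  show "AE w in \<mu>. h j w <= F w + l j * (\<Psi> w + E j w)"
  proof (rule AE_I2)
  fix w
  have "(h j w - F w) / l j <= \<Psi> w + E j w" by (simp add: E_def)
  then show "h j w <= F w + l j * (\<Psi> w + E j w)" using l(1)[of j] by (simp add: divide_le_eq mult.commute)
  qed
  qed (use h_int F_integrable \<Psi>_int E_int in auto)
  also have "\<dots> = M + l j * ((\<integral>x. \<Psi> x \<partial>\<mu>) + (\<integral>x. E j x \<partial>\<mu>))"
  using F_integrable \<Psi>_int E_int M by simp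
  finally show ?thesis using l(1)[of j] by (simp add: divide_le_eq mult.commute)
 qed
 define \<phi> where "\<phi> t = exp ((1 - t) * ln M + t * ln Z - ?n * ln (1 - t))" for t :: real
 have \<phi>: "M powr (1 - l j) * Z powr l j * (1 - l j) powr - ?n = \<phi> (0 + l j)" for j
  using M(2) Z(2) l(3)[of j] by (simp add: powr_def \<phi>_def exp_add[symmetric])
 have \<phi>0: "\<phi> 0 = M" using M(2) by (simp add: \<phi>_def)
 have "(\<phi> has_real_derivative M * (- ln M + ln Z + ?n)) (at 0)"
  unfolding \<phi>_def using M(2) by (auto intro!: derivative_eq_intros)
 then have "((%t. (\<phi> (0 + t) - \<phi> 0) / t) \<longlongrightarrow> M * (- ln M + ln Z + ?n)) (at 0)"
  by (simp only: DERIV_def)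
 then have "((%t. (\<phi> (0 + t) - \<phi> 0) / t) \<longlongrightarrow> M * (- ln M + ln Z + ?n)) (at_right 0)"
  by (rule tendsto_mono[OF at_le[OF subset_UNIV]])
 from filterlim_compose[OF this lim]
 have "(%j. (\<phi> (0 + l j) - M) / l j) \<longlonglongrightarrow> M * (- ln M + ln Z + ?n)" by (simp add: \<phi>0)
 moreover have "(%j. (\<integral>x. \<Psi> x \<partial>\<mu>) + (\<integral>x. E j x \<partial>\<mu>)) \<longlonglongrightarrow> (\<integral>x. \<Psi> x \<partial>\<mu>) + 0"
  by (intro tendsto_intros E0)
 ultimately have "M * (- ln M + ln Z + ?n) <= (\<integral>x. \<Psi> x \<partial>\<mu>) + 0"
  using key by (intro LIMSEQ_le) (auto simp: \<phi>)
 also have "(\<integral>x. \<Psi> x \<partial>\<mu>) = K * (\<integral>x. dual_norm N (D x) powr p \<partial>\<mu>) - (\<integral>x. F x * ln (F x) \<partial>\<mu>)"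
  unfolding \<Psi>_def using D_int F_ln_F_integrable by simp
 finally show ?thesis by (simp add: algebra_simps)
qed

end

section \<open>Smooth bumps and their separating power\<close>

text \<open>The derivatives of \<open>exp (- 1 / t)\<close> are polynomials in \<open>1 / t\<close> times the same exponential; carrying the polynomial makes the family closed under differentiation.\<close>

definition flat_fun :: "real poly => real => real" where
 "flat_fun P t = (if t <= 0 then 0 else poly P (1 / t) * exp (- 1 / t))"

lemma tendsto_poly_div_exp: "((%x::real. poly P x / exp x) \<longlongrightarrow> 0) at_top"
proof -
 have "((%x::real. \<Sum>i\<le>degree P. coeff P i * (x ^ i / exp x)) \<longlongrightarrow> (\<Sum>i\<le>degree P. coeff P i * 0)) at_top"
  by (intro tendsto_intros tendsto_power_div_exp_0)
 then show ?thesis by (simp add: poly_altdef sum_divide_distrib)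
qed

lemma flat_fun_derivative:
 "(flat_fun P has_real_derivative flat_fun ([:0, 0, 1:] * (P - pderiv P)) t) (at t)"
proof -
 consider "t < 0" | "t > 0" | "t = 0" by linarith
 then show ?thesis
 proof cases
  case 1
  have "((%_. 0) has_real_derivative 0) (at t)" by simp
  then have "(flat_fun P has_real_derivative 0) (at t)"
  by (rule has_field_derivative_transform_within_open[where S="{..<0}"]) (use 1 in \<open>auto simp: flat_fun_def\<close>)
  then show ?thesis using 1 by (simp add: flat_fun_def)
 next
  case 2
  have "((%t. poly P (1 / t) * exp (- 1 / t)) has_real_derivative
  poly P (1 / t) * (exp (- 1 / t) * (1 / t\<^sup>2)) + poly (pderiv P) (1 / t) * (- 1 / t\<^sup>2) * exp (- 1 / t)) (at t)"
  using 2 by (auto intro!: derivative_eq_intros DERIV_chain'[OF _ poly_DERIV] simp: power2_eq_square field_simps)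
  then have "(flat_fun P has_real_derivative
  poly P (1 / t) * (exp (- 1 / t) * (1 / t\<^sup>2)) + poly (pderiv P) (1 / t) * (- 1 / t\<^sup>2) * exp (- 1 / t)) (at t)"
  by (rule has_field_derivative_transform_within_open[where S="{0<..}"]) (use 2 in \<open>auto simp: flat_fun_def\<close>)
  then show ?thesis using 2 by (simp add: flat_fun_def power2_eq_square field_simps)
 next
  case 3
  have "((%h. flat_fun P h / h) \<longlongrightarrow> 0) (at_right 0)"
  proof -
  have "((%s. poly ([:0, 1:] * P) s / exp s) \<longlongrightarrow> 0) at_top" by (rule tendsto_poly_div_exp)
  then have "((%h. poly ([:0, 1:] * P) (inverse h) / exp (inverse h)) \<longlongrightarrow> 0) (at_right 0)"
  by (rule filterlim_compose[OF _ filterlim_inverse_at_top_right])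
  then show ?thesis
  by (rule Lim_transform_eventually)
  (auto simp: eventually_at_filter flat_fun_def exp_minus field_simps intro!: always_eventually)
  qed
  moreover have "((%h. flat_fun P h / h) \<longlongrightarrow> 0) (at_left 0)"
  by (rule Lim_transform_eventually[OF tendsto_const]) (auto simp: eventually_at_filter flat_fun_def)
  ultimately have "((%h. flat_fun P h / h) \<longlongrightarrow> 0) (at 0)" by (rule filterlim_split_at[rotated])
  then show ?thesis using 3 by (simp add: DERIV_def flat_fun_def)
 qed
qed

lemma partial_eq:
 assumes "(\<phi> has_derivative \<phi>') (at x)" shows "partial i \<phi> x = \<phi>' (axis i 1)"
 unfolding partial_def by (simp add: frechet_derivative_at[OF assms, symmetric])

lemma differentiable_has_derivative_partial:
 fixes \<phi> :: "real^'n::finite => real"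
 assumes "\<phi> differentiable (at x)"
 shows "(\<phi> has_derivative (%h. (\<chi> i. partial i \<phi> x) \<bullet> h)) (at x)"
proof -
 obtain \<phi>' where d: "(\<phi> has_derivative \<phi>') (at x)" using assms by (auto simp: differentiable_def)
 then interpret bounded_linear \<phi>' by (rule has_derivative_bounded_linear)
 have "\<phi>' h = (\<chi> i. partial i \<phi> x) \<bullet> h" for h
 proof -
  have "\<phi>' h = \<phi>' (\<Sum>i\<in>UNIV. (h $ i) *\<^sub>R axis i 1)"
  by (simp add: basis_expansion flip: scalar_mult_eq_scaleR)
  also have "\<dots> = (\<chi> i. partial i \<phi> x) \<bullet> h"
  by (simp add: sum scaleR inner_vec_def partial_eq[OF d] mult.commute)
  finally show ?thesis .
 qed
 then have "\<phi>' = (%h. (\<chi> i. partial i \<phi> x) \<bullet> h)" by auto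
 then show ?thesis using d by simp
qed

lemma C_k_continuous: "C_k m \<phi> ==> continuous_on UNIV \<phi>"
 by (cases m) (auto intro!: differentiable_imp_continuous_on simp: differentiable_on_def)

lemma C_k_Suc_imp: "C_k (Suc m) \<phi> ==> C_k m \<phi>"
proof (induction m arbitrary: \<phi>)
 case 0
 then show ?case using C_k_continuous[of "Suc 0" \<phi>] by simp
qed auto

lemma C_k_const: "C_k m (%_. c)"
proof (induction m arbitrary: c)
 case (Suc m)
 have "partial i (%_. c) = (%_. 0)" for i :: 'a
  by (rule ext, subst partial_eq[OF has_derivative_const]) simp
 then show ?case using Suc by simp
qed simp

lemma C_k_add: "C_k m \<phi> ==> C_k m \<psi> ==> C_k m (%x. \<phi> x + \<psi> x)"
proof (induction m arbitrary: \<phi> \<psi>)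
 case (Suc m)
 have "partial i (%x. \<phi> x + \<psi> x) = (%x. partial i \<phi> x + partial i \<psi> x)" for i
 proof
  fix x
  obtain \<phi>' \<psi>' where d: "(\<phi> has_derivative \<phi>') (at x)" "(\<psi> has_derivative \<psi>') (at x)"
  using Suc.prems by (auto simp: differentiable_def) blast
  show "partial i (%x. \<phi> x + \<psi> x) x = partial i \<phi> x + partial i \<psi> x"
  by (simp add: partial_eq[OF has_derivative_add[OF d]] partial_eq[OF d(1)] partial_eq[OF d(2)])
 qed
 then show ?case using Suc by auto
qed (auto intro: continuous_intros)

lemma C_k_mult: "C_k m \<phi> ==> C_k m \<psi> ==> C_k m (%x. \<phi> x * \<psi> x)"
proof (induction m arbitrary: \<phi> \<psi>)
 case (Suc m)
 have "partial i (%x. \<phi> x * \<psi> x) = (%x. \<phi> x * partial i \<psi> x + partial i \<phi> x * \<psi> x)" for i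
 proof
  fix x
  obtain \<phi>' \<psi>' where d: "(\<phi> has_derivative \<phi>') (at x)" "(\<psi> has_derivative \<psi>') (at x)"
  using Suc.prems by (auto simp: differentiable_def) blast
  show "partial i (%x. \<phi> x * \<psi> x) x = \<phi> x * partial i \<psi> x + partial i \<phi> x * \<psi> x"
  by (simp add: partial_eq[OF has_derivative_mult[OF d]] partial_eq[OF d(1)] partial_eq[OF d(2)])
 qed
 then show ?case using Suc C_k_Suc_imp[OF Suc.prems(1)] C_k_Suc_imp[OF Suc.prems(2)] by (auto intro!: C_k_add)
qed (auto intro: continuous_intros)

lemma C_k_prod: "finite I ==> (!!i. i \<in> I ==> C_k m (\<phi> i)) ==> C_k m (%x. \<Prod>i\<in>I. \<phi> i x)"
 by (induction rule: finite_induct) (auto intro: C_k_const C_k_mult)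

lemma C_k_flat_fun: "C_k m (%x::real^'n::finite. flat_fun P (c * (x $ j - \<alpha>)))"
proof (induction m arbitrary: P)
 case 0
 have "continuous_on UNIV (flat_fun P)"
  using flat_fun_derivative by (auto simp: continuous_on_eq_continuous_at intro: DERIV_isCont)
 then show ?case by (auto intro!: continuous_on_compose2[of UNIV "flat_fun P"] continuous_intros)
next
 case (Suc m)
 let ?Q = "[:0, 0, 1:] * (P - pderiv P)"
 have d: "((%x::real^'n. flat_fun P (c * (x $ j - \<alpha>))) has_derivative (%h. flat_fun ?Q (c * (x $ j - \<alpha>)) * (c * h $ j))) (at x)" for x
 proof -
  have "((%x::real^'n. c * (x $ j - \<alpha>)) has_derivative (%h. c * h $ j)) (at x)"
  by (auto intro!: derivative_eq_intros bounded_linear_imp_has_derivative)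
  from has_derivative_compose[OF this flat_fun_derivative[of P "c * (x $ j - \<alpha>)", unfolded has_field_derivative_def]]
  show ?thesis by simp
 qed
 have "partial i (%x::real^'n. flat_fun P (c * (x $ j - \<alpha>))) = (%x. (c * axis i 1 $ j) * flat_fun ?Q (c * (x $ j - \<alpha>)))" for i
  by (rule ext, subst partial_eq[OF d]) (simp add: mult.commute)
 then show ?case using d by (auto simp: differentiable_def intro!: C_k_mult C_k_const Suc simp del: mult_pCons_left)
qed

definition bump :: "real^'n::finite => real^'n => real => real^'n => real" where
 "bump \<alpha> \<beta> c x = (\<Prod>i\<in>UNIV. flat_fun 1 (c * (x $ i - \<alpha> $ i)) * flat_fun 1 ((- c) * (x $ i - \<beta> $ i)))"

lemma C_k_bump: "C_k m (bump \<alpha> \<beta> c)"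
 unfolding bump_def by (intro C_k_prod C_k_mult C_k_flat_fun) auto

lemma flat_fun_1: "0 <= flat_fun 1 t" "flat_fun 1 t <= 1" "flat_fun 1 t ~= 0 \<longleftrightarrow> 0 < t"
 by (auto simp: flat_fun_def)

lemma bump_bounds: "0 <= bump \<alpha> \<beta> c x" "bump \<alpha> \<beta> c x <= 1"
 unfolding bump_def by (auto intro!: prod_nonneg prod_le_1 mult_nonneg_nonneg mult_le_one simp: flat_fun_1)

lemma bump_nonzero_iff:
 assumes "0 < c" shows "bump \<alpha> \<beta> c x ~= 0 \<longleftrightarrow> x \<in> box \<alpha> \<beta>"
 using assms by (auto simp: bump_def flat_fun_1 mem_box_cart zero_less_mult_iff mult_less_0_iff)

lemma tendsto_flat_fun_1: "(%m. flat_fun 1 (real (Suc m) * t)) \<longlonglongrightarrow> (if 0 < t then 1 else 0)"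
proof (cases "0 < t")
 case True
 have "(%m. exp (- (inverse (real (Suc m)) * inverse t))) \<longlonglongrightarrow> exp (- (0 * inverse t))"
  by (intro tendsto_intros LIMSEQ_inverse_real_of_nat)
 moreover have "flat_fun 1 (real (Suc m) * t) = exp (- (inverse (real (Suc m)) * inverse t))" for m
 proof -
  have "0 < real (Suc m) * t" using True by (intro mult_pos_pos) auto
  then have "\<not> real (Suc m) * t <= 0" by simp
  then show ?thesis unfolding flat_fun_def by (simp only: if_False) (simp add: divide_inverse)
 qed
 ultimately show ?thesis using True by simp
qed (simp add: flat_fun_def mult_le_0_iff)

lemma tendsto_bump: "(%m. bump \<alpha> \<beta> (real (Suc m)) x) \<longlonglongrightarrow> indicator (box \<alpha> \<beta>) x"
proof -
 have "(%m. bump \<alpha> \<beta> (real (Suc m)) x) \<longlonglongrightarrow>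
  (\<Prod>i\<in>UNIV. (if 0 < x $ i - \<alpha> $ i then 1 else 0) * (if 0 < \<beta> $ i - x $ i then 1 else 0))"
  unfolding bump_def
 proof (intro tendsto_intros)
  fix i :: 'a
  show "(%m. flat_fun 1 (real (Suc m) * (x $ i - \<alpha> $ i))) \<longlonglongrightarrow> (if 0 < x $ i - \<alpha> $ i then 1 else 0)"
  by (rule tendsto_flat_fun_1)
  show "(%m. flat_fun 1 (- real (Suc m) * (x $ i - \<beta> $ i))) \<longlonglongrightarrow> (if 0 < \<beta> $ i - x $ i then 1 else 0)"
  using tendsto_flat_fun_1[of "\<beta> $ i - x $ i"] by (simp add: algebra_simps)
 qed
 also have "(\<Prod>i\<in>UNIV. (if 0 < x $ i - \<alpha> $ i then 1 else 0) * (if 0 < \<beta> $ i - x $ i then 1 else 0)) = (indicator (box \<alpha> \<beta>) x :: real)"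
  by (auto simp: indicator_def mem_box_cart)
 finally show ?thesis .
qed

lemma test_function_bump:
 assumes "0 < c" "cbox \<alpha> \<beta> \<subseteq> \<Omega>" shows "test_function \<Omega> (%x. s * bump \<alpha> \<beta> c x)"
proof -
 let ?X = "{x. s * bump \<alpha> \<beta> c x ~= 0}"
 have "?X \<subseteq> box \<alpha> \<beta>" using bump_nonzero_iff[OF assms(1)] by auto
 then have X: "?X \<subseteq> cbox \<alpha> \<beta>" using box_subset_cbox by blast
 then have "closure ?X \<subseteq> cbox \<alpha> \<beta>" by (rule closure_minimal[OF _ closed_cbox])
 moreover have "compact (closure ?X)" using bounded_subset[OF bounded_cbox X] by (simp only: compact_closure)
 ultimately show ?thesis using assms(2) C_k_mult[OF C_k_const C_k_bump] unfolding test_function_def by blast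
qed

lemma bump_measurable [measurable]: "bump \<alpha> \<beta> c \<in> borel_measurable borel"
 using C_k_bump[of 0] by (intro borel_measurable_continuous_onI) simp

text \<open>Boxes suffice to exhaust the half-space, so products of one-variable bumps are all the test functions that are needed.\<close>

lemma compact_subset_half_space_box:
 fixes k :: "'n::finite"
 assumes "compact K" "K \<subseteq> half_space k"
 obtains c d where "K \<subseteq> box c d" "cbox c d \<subseteq> half_space k"
proof (cases "K = {}")
 case True
 show thesis by (rule that[of "axis k 1" "axis k 1"]) (auto simp: True half_space_def mem_box_cart dest: spec[of _ k])
next
 case False
 have "continuous_on K (%x. x $ k)" by (intro continuous_intros)
 from continuous_attains_inf[OF assms(1) False this] obtain z where z: "z \<in> K" "!!x. x \<in> K ==> z $ k <= x $ k" by blast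
 have zk: "0 < z $ k" using z assms by (auto simp: half_space_def)
 obtain r where r: "!!x. x \<in> K ==> norm x <= r" using compact_imp_bounded[OF assms(1)] bounded_pos by blast
 show thesis
 proof (rule that[of "\<chi> i. if i = k then z $ k / 2 else - r - 1" "\<chi> i. r + 1"])
  show "K \<subseteq> box (\<chi> i. if i = k then z $ k / 2 else - r - 1) (\<chi> i. r + 1)"
  proof
  fix x assume x: "x \<in> K"
  have "\<bar>x $ i\<bar> <= r" for i using component_le_norm_cart[of x i] r[OF x] by linarith
  then have "- r - 1 < x $ i & x $ i < r + 1" for i by (simp add: abs_le_iff) (smt (verit))
  then show "x \<in> box (\<chi> i. if i = k then z $ k / 2 else - r - 1) (\<chi> i. r + 1)"
  using z(2)[OF x] zk by (auto simp: mem_box_cart)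
  qed
  show "cbox (\<chi> i. if i = k then z $ k / 2 else - r - 1) (\<chi> i. r + 1) \<subseteq> half_space k"
  using zk by (force simp: half_space_def mem_box_cart dest: spec[of _ k])
 qed
qed

text \<open>Bumps tend to indicators of boxes, boxes generate the Borel sets, and Dynkin's lemma extends the equality. The two measures may differ, which is needed to compare two representations of the same distribution.\<close>

lemma set_integral_determined_by_tests:
 fixes M1 M2 :: "(real^'n::finite) measure" and r1 r2 :: "real^'n => real"
 assumes M: "(%x. x) \<in> measurable M1 borel" "(%x. x) \<in> measurable M2 borel"
  "half_space k \<subseteq> space M1" "half_space k \<subseteq> space M2"
  and int: "!!A. A \<in> bounded_borel (half_space k) ==> set_integrable M1 A r1"
  "!!A. A \<in> bounded_borel (half_space k) ==> set_integrable M2 A r2"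
  and eq: "!!\<phi>. test_function (half_space k) \<phi> ==> (LINT x|M1. \<phi> x * r1 x) = (LINT x|M2. \<phi> x * r2 x)"
  and A: "A \<in> bounded_borel (half_space k)"
 shows "(LINT x:A|M1. r1 x) = (LINT x:A|M2. r2 x)"
proof -
 let ?\<Omega> = "half_space k"
 have cb: "cbox \<alpha> \<beta> \<subseteq> ?\<Omega> ==> cbox \<alpha> \<beta> \<in> bounded_borel ?\<Omega>" for \<alpha> \<beta>
  by (auto simp: bounded_borel_def intro!: exI[of _ "cbox \<alpha> \<beta>"])
 have sub: "B \<in> bounded_borel ?\<Omega>" if "B \<in> sets borel" "B \<subseteq> B'" "B' \<in> bounded_borel ?\<Omega>" for B B'
  using that by (auto simp: bounded_borel_def)
 have lim: "(%m. LINT x|M. bump \<alpha> \<beta> (real (Suc m)) x * r x) \<longlonglongrightarrow> (LINT x:box \<alpha> \<beta>|M. r x)"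
  if M: "(%x. x) \<in> measurable M borel" and int: "!!A. A \<in> bounded_borel ?\<Omega> ==> set_integrable M A r"
  and \<Omega>: "cbox \<alpha> \<beta> \<subseteq> ?\<Omega>" for M :: "(real^'n) measure" and r :: "real^'n => real" and \<alpha> \<beta>
 proof -
  have I: "integrable M (%x. indicator (cbox \<alpha> \<beta>) x *\<^sub>R r x)"
  using int[OF cb[OF \<Omega>]] by (simp add: set_integrable_def)
  have b: "bump \<alpha> \<beta> c \<in> borel_measurable M" for c
  by (rule measurable_compose[OF M bump_measurable])
  have eq: "bump \<alpha> \<beta> (real (Suc m)) x * r x = bump \<alpha> \<beta> (real (Suc m)) x * (indicator (cbox \<alpha> \<beta>) x *\<^sub>R r x)" for m x
  using bump_nonzero_iff[of "real (Suc m)" \<alpha> \<beta> x] box_subset_cbox[of \<alpha> \<beta>] by (auto simp: indicator_def)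
  have eq2: "indicator (box \<alpha> \<beta>) x *\<^sub>R r x = indicator (box \<alpha> \<beta>) x * (indicator (cbox \<alpha> \<beta>) x *\<^sub>R r x)" for x
  using box_subset_cbox[of \<alpha> \<beta>] by (auto simp: indicator_def)
  have bi: "(%x. indicator (box \<alpha> \<beta>) x :: real) \<in> borel_measurable M"
  by (rule measurable_compose[OF M]) simp
  show ?thesis
  unfolding set_lebesgue_integral_def
  proof (rule integral_dominated_convergence)
  show "(%x. indicator (box \<alpha> \<beta>) x *\<^sub>R r x) \<in> borel_measurable M"
  unfolding eq2 by (intro borel_measurable_times bi borel_measurable_integrable[OF I])
  show "(%x. bump \<alpha> \<beta> (real (Suc m)) x * r x) \<in> borel_measurable M" for m
  unfolding eq by (intro borel_measurable_times b borel_measurable_integrable[OF I])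
  show "integrable M (%x. norm (indicator (cbox \<alpha> \<beta>) x *\<^sub>R r x))" using I by (rule integrable_norm)
  show "AE x in M. (%m. bump \<alpha> \<beta> (real (Suc m)) x * r x) \<longlonglongrightarrow> indicator (box \<alpha> \<beta>) x *\<^sub>R r x"
  unfolding real_scaleR_def by (intro AE_I2 tendsto_mult tendsto_bump tendsto_const)
  show "AE x in M. norm (bump \<alpha> \<beta> (real (Suc m)) x * r x) <= norm (indicator (cbox \<alpha> \<beta>) x *\<^sub>R r x)" for m
  unfolding eq using bump_bounds[of \<alpha> \<beta> "real (Suc m)"] by (auto simp: abs_mult intro!: mult_left_le_one_le)
  qed
 qed
 have box_eq: "(LINT x:box \<alpha> \<beta>|M1. r1 x) = (LINT x:box \<alpha> \<beta>|M2. r2 x)" if "cbox \<alpha> \<beta> \<subseteq> ?\<Omega>" for \<alpha> \<beta>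
 proof (rule LIMSEQ_unique[OF lim[OF M(1) int(1) that]])
  have "(LINT x|M1. bump \<alpha> \<beta> (real (Suc m)) x * r1 x) = (LINT x|M2. bump \<alpha> \<beta> (real (Suc m)) x * r2 x)" for m
  using eq[OF test_function_bump[OF _ that, of "real (Suc m)" 1]] by simp
  then show "(%m. LINT x|M1. bump \<alpha> \<beta> (real (Suc m)) x * r1 x) \<longlonglongrightarrow> (LINT x:box \<alpha> \<beta>|M2. r2 x)"
  using lim[OF M(2) int(2) that] by simp
 qed auto
 obtain K where K: "A \<in> sets borel" "compact K" "K \<subseteq> ?\<Omega>" "A \<subseteq> K" using A by (auto simp: bounded_borel_def)
 obtain c d where cd: "K \<subseteq> box c d" "cbox c d \<subseteq> ?\<Omega>" by (rule compact_subset_half_space_box[OF K(2,3)])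
 let ?Q = "box c d"
 have Q: "?Q \<in> bounded_borel ?\<Omega>" by (rule sub[OF _ box_subset_cbox cb[OF cd(2)]]) auto
 have BQ: "B \<inter> ?Q \<in> bounded_borel ?\<Omega>" if "B \<in> sets borel" for B using that by (intro sub[OF _ _ Q]) auto
 have sM: "B \<in> sets M1" "B \<in> sets M2" if "B \<in> bounded_borel ?\<Omega>" for B
 proof -
  have B: "B \<in> sets borel" "B \<subseteq> ?\<Omega>" using that by (auto simp: bounded_borel_def)
  have "(%x. x) -` B \<inter> space M1 \<in> sets M1" "(%x. x) -` B \<inter> space M2 \<in> sets M2"
  using measurable_sets[OF M(1) B(1)] measurable_sets[OF M(2) B(1)] .
  moreover have "(%x. x) -` B \<inter> space M1 = B" "(%x. x) -` B \<inter> space M2 = B" using B(2) M(3,4) by auto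
  ultimately show "B \<in> sets M1" "B \<in> sets M2" by simp_all
 qed
 have borel_gen: "sets borel = sigma_sets UNIV (range (%(a, b). box a b :: (real^'n) set))"
  by (simp add: borel_eq_box)
 have "(LINT x:B \<inter> ?Q|M1. r1 x) = (LINT x:B \<inter> ?Q|M2. r2 x)" if "B \<in> sets borel" for B
 proof -
  have stable: "Int_stable (range (%(a, b). box a b :: (real^'n) set))"
  by (auto simp: Int_stable_def box_Int_box)
  have sub': "range (%(a, b). box a b :: (real^'n) set) \<subseteq> Pow UNIV" by simp
  have "B \<in> sigma_sets UNIV (range (%(a, b). box a b :: (real^'n) set))" using that borel_gen by simp
  then show ?thesis
  proof (induction rule: sigma_sets_induct_disjoint[OF stable sub', consumes 1, case_names basic empty compl union])
  case (basic B)
  then obtain a b where B: "B = box a b" by auto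
  obtain a' b' where ab: "box a b \<inter> ?Q = box a' b'" using box_Int_box[of a b c d] by blast
  show ?case
  proof (cases "box a' b' = {}")
  case False
  have "cbox a' b' = closure (box a' b')" using False by (simp add: closure_box)
  also have "\<dots> \<subseteq> cbox c d"
  using ab box_subset_cbox[of c d] by (intro closure_minimal) (auto simp: closed_cbox)
  finally show ?thesis using cd(2) unfolding B ab by (intro box_eq) auto
  qed (simp add: B ab set_lebesgue_integral_def)
  next
  case empty show ?case by (simp add: set_lebesgue_integral_def)
  next
  case (compl B)
  have B: "B \<in> sets borel" using compl borel_gen by simp
  have "(LINT x:(UNIV - B) \<inter> ?Q|M. r x) = (LINT x:?Q|M. r x) - (LINT x:B \<inter> ?Q|M. r x)"
  if "set_integrable M ?Q r" "set_integrable M (B \<inter> ?Q) r" for M :: "(real^'n) measure" and r :: "real^'n => real"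
  proof -
  have "(LINT x:(UNIV - B) \<inter> ?Q|M. r x) = (LINT x|M. indicator ?Q x *\<^sub>R r x - indicator (B \<inter> ?Q) x *\<^sub>R r x)"
  unfolding set_lebesgue_integral_def by (intro Bochner_Integration.integral_cong) (auto simp: indicator_def)
  then show ?thesis using that unfolding set_lebesgue_integral_def set_integrable_def by simp
  qed
  then show ?case using int BQ[OF B] Q compl box_eq[OF cd(2)] by simp
  next
  case (union B)
  have B: "B i \<in> sets borel" for i using union borel_gen by auto
  have "(LINT x:(\<Union>i. B i) \<inter> ?Q|M. r x) = (\<Sum>i. LINT x:B i \<inter> ?Q|M. r x)"
  if "!!A. A \<in> bounded_borel ?\<Omega> ==> set_integrable M A r" "!!B. B \<in> bounded_borel ?\<Omega> ==> B \<in> sets M"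
  for M :: "(real^'n) measure" and r :: "real^'n => real"
  proof -
  have eqU: "(\<Union>i. B i) \<inter> ?Q = (\<Union>i. B i \<inter> ?Q)" by auto
  have U: "(\<Union>i. B i \<inter> ?Q) \<in> bounded_borel ?\<Omega>"
  unfolding eqU[symmetric] using B by (intro BQ) auto
  show ?thesis
  unfolding eqU
  proof (rule lebesgue_integral_countable_add)
  show "B i \<inter> ?Q \<in> sets M" for i by (intro that BQ B)
  show "(B i \<inter> ?Q) \<inter> (B j \<inter> ?Q) = {}" if "i ~= j" for i j
  using union(1) that by (auto simp: disjoint_family_on_def)
  show "set_integrable M (\<Union>i. B i \<inter> ?Q) r" by (intro that U)
  qed
  qed
  from this[OF int(1) sM(1)] this[OF int(2) sM(2)] show ?case using union by simp
  qed
 qed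
 from this[OF K(1)] show ?thesis using K(4) cd(1) by (simp add: Int_absorb2 subset_trans[of A K])
qed


definition hs_exh :: "'n::finite => nat => (real^'n) set" where
 "hs_exh k m = cball 0 (real m) \<inter> {x. 1 / real (Suc m) <= x $ k}"

lemma hs_exh:
 shows compact_hs_exh: "compact (hs_exh k m)"
  and hs_exh_subset: "hs_exh k m \<subseteq> half_space k"
  and hs_exh_mono: "hs_exh k m \<subseteq> hs_exh k (Suc m)"
  and UN_hs_exh: "(\<Union>m. hs_exh k m) = half_space k"
proof -
 show "compact (hs_exh k m)"
  unfolding hs_exh_def by (intro compact_Int_closed compact_cball closed_Collect_le continuous_intros)
 have sub: "hs_exh k m \<subseteq> half_space k" for m
  unfolding hs_exh_def half_space_def by (auto intro: less_le_trans[rotated])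
 show "hs_exh k m \<subseteq> half_space k" by (rule sub)
 have "1 / real (Suc (Suc m)) <= 1 / real (Suc m)" by (simp add: field_simps)
 then show "hs_exh k m \<subseteq> hs_exh k (Suc m)"
  unfolding hs_exh_def by (auto intro: order_trans)
 have "\<exists>m. x \<in> hs_exh k m" if "x \<in> half_space k" for x
 proof -
  have "0 < x $ k" using that by (simp add: half_space_def)
  from reals_Archimedean[OF this] obtain m1 :: nat where m1: "inverse (real (Suc m1)) < x $ k" by blast
  obtain m2 :: nat where m2: "norm x <= real m2" using real_arch_simple by blast
  have "1 / real (Suc (max m1 m2)) <= inverse (real (Suc m1))" by (simp add: field_simps)
  then have "x \<in> hs_exh k (max m1 m2)"
  using m1 m2 by (auto simp: hs_exh_def)
  then show ?thesis ..
 qed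
 then show "(\<Union>m. hs_exh k m) = half_space k" using sub by auto
qed

lemma AE_zero_of_set_integrals:
 fixes r :: "'a => real"
 assumes "sigma_finite_measure M" and r: "integrable (completion M) r"
  and z: "!!A. A \<in> sets M ==> (LINT x:A|completion M. r x) = 0"
 shows "AE x in completion M. r x = 0"
proof -
 interpret sigma_finite_measure M by fact
 obtain r' where r': "r' \<in> borel_measurable M" and "AE x in M. r x = r' x"
  using completion_ex_borel_measurable_real[OF borel_measurable_integrable[OF r]] by blast
 then have ae: "AE x in completion M. r x = r' x" by (auto intro: AE_completion)
 have r'c: "r' \<in> borel_measurable (completion M)" using r' by (rule measurable_completion)
 have "integrable (completion M) r'" using r integrable_cong_AE[OF borel_measurable_integrable[OF r] r'c ae] by simp
 then have int: "integrable M r'" using r' by (simp add: integrable_completion)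
 have "(LINT x:A|M. r' x) = 0" if A: "A \<in> sets M" for A
 proof -
  have [measurable]: "A \<in> sets (completion M)" "r' \<in> borel_measurable (completion M)" "r \<in> borel_measurable (completion M)"
  using A r'c borel_measurable_integrable[OF r] by auto
  have "(LINT x:A|M. r' x) = (LINT x:A|completion M. r' x)"
  unfolding set_lebesgue_integral_def using r' A by (subst integral_completion) auto
  also have "\<dots> = (LINT x:A|completion M. r x)"
  unfolding set_lebesgue_integral_def using ae by (intro integral_cong_AE) auto
  finally show ?thesis using z[OF A] by simp
 qed
 then have "AE x in M. r' x = 0" by (intro density_zero int)
 then have "AE x in completion M. r' x = 0" by (rule AE_completion)
 then show ?thesis using ae by eventually_elim simp
qed

lemma test_function_support:
 assumes "test_function \<Omega> \<phi>" "x \<notin> \<Omega>"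
 shows "\<phi> x = 0"
 using assms closure_subset[of "{x. \<phi> x ~= 0}"] by (auto simp: test_function_def)

lemma weak_gradient_unique:
 fixes g g' :: "real^'n::finite => real^'n"
 assumes g: "is_weak_gradient (half_space k) f g" "is_weak_gradient (half_space k) f g'"
 shows "AE x in lebesgue. x \<in> half_space k --> g x = g' x"
proof -
 let ?\<Omega> = "half_space k"
 have li: "set_integrable lebesgue A (%x. h x $ i)" if h: "is_weak_gradient ?\<Omega> f h" and A: "A \<in> bounded_borel ?\<Omega>" for h A i
 proof -
  obtain K where K: "A \<in> sets borel" "compact K" "K \<subseteq> ?\<Omega>" "A \<subseteq> K" using A by (auto simp: bounded_borel_def)
  have "set_integrable lebesgue K h" using h K by (auto simp: is_weak_gradient_def locally_integrable_def)
  then have "set_integrable lebesgue A h" by (rule set_integrable_subset) (use K in auto)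
  then have "integrable lebesgue (%x. (indicator A x *\<^sub>R h x) \<bullet> axis i 1)"
  unfolding set_integrable_def by (intro integrable_inner_left)
  then show ?thesis by (simp add: set_integrable_def inner_axis cong: if_cong)
 qed
 have eq: "(LINT x:A|lebesgue. g x $ i) = (LINT x:A|lebesgue. g' x $ i)" if A: "A \<in> bounded_borel ?\<Omega>" for A i
 proof (rule set_integral_determined_by_tests[OF _ _ _ _ li[OF g(1)] li[OF g(2)] _ A])
  fix \<phi> assume t: "test_function ?\<Omega> \<phi>"
  have "(LINT x|lebesgue. \<phi> x * h x $ i) = (LINT x:?\<Omega>|lebesgue. h x $ i * \<phi> x)" for h :: "real^'n => real^'n"
  unfolding set_lebesgue_integral_def
  by (intro Bochner_Integration.integral_cong) (auto simp: indicator_def test_function_support[OF t])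
  then show "(LINT x|lebesgue. \<phi> x * g x $ i) = (LINT x|lebesgue. \<phi> x * g' x $ i)"
  using g t by (simp add: is_weak_gradient_def)
 qed (auto simp: measurable_completion)
 have ae: "AE x in lebesgue. indicator (hs_exh k m) x * (g x $ i - g' x $ i) = 0" for m i
 proof (rule AE_zero_of_set_integrals)
  let ?K = "hs_exh k m"
  have Kc: "compact ?K" "?K \<subseteq> ?\<Omega>" "?K \<in> sets borel"
  using hs_exh_subset[of k m] compact_hs_exh[of k m] by (auto intro: borel_compact)
  have K: "A \<inter> ?K \<in> bounded_borel ?\<Omega>" if "A \<in> sets borel" for A
  using sets.Int[OF that Kc(3)] Kc(1,2) unfolding bounded_borel_def by blast
  have K': "?K \<in> bounded_borel ?\<Omega>" using K[of UNIV] by simp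
  show "sigma_finite_measure (lborel :: (real^'n) measure)" by (rule sigma_finite_lborel)
  show "integrable lebesgue (%x. indicator ?K x * (g x $ i - g' x $ i))"
  using li[OF g(1) K', of i] li[OF g(2) K', of i] by (simp add: set_integrable_def right_diff_distrib)
  fix A :: "(real^'n) set" assume "A \<in> sets lborel"
  then have A: "A \<in> sets borel" by simp
  have "(LINT x:A|lebesgue. indicator ?K x * (g x $ i - g' x $ i)) =
  (LINT x|lebesgue. indicator (A \<inter> ?K) x *\<^sub>R (g x $ i) - indicator (A \<inter> ?K) x *\<^sub>R (g' x $ i))"
  unfolding set_lebesgue_integral_def by (intro Bochner_Integration.integral_cong) (auto simp: indicator_def)
  also have "\<dots> = (LINT x:A \<inter> ?K|lebesgue. g x $ i) - (LINT x:A \<inter> ?K|lebesgue. g' x $ i)"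
  using li[OF g(1) K[OF A], of i] li[OF g(2) K[OF A], of i]
  unfolding set_lebesgue_integral_def set_integrable_def by (rule Bochner_Integration.integral_diff)
  finally show "(LINT x:A|lebesgue. indicator ?K x * (g x $ i - g' x $ i)) = 0" using eq[OF K[OF A]] by simp
 qed
 have "AE x in lebesgue. \<forall>m i. indicator (hs_exh k m) x * (g x $ i - g' x $ i) = 0"
  by (intro AE_all_countable[THEN iffD2] allI AE_finite_allI[of UNIV, simplified] ae) auto
 then show ?thesis
 proof eventually_elim
  case (elim x)
  show ?case
  proof
  assume "x \<in> ?\<Omega>"
  then obtain m where "x \<in> hs_exh k m" using UN_hs_exh[of k] by blast
  then show "g x = g' x" using elim by (auto simp: vec_eq_iff dest!: spec[of _ m])
  qed
 qed
qed

section \<open>Mollification inside the half-space\<close>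

lemma continuous_compact_support_uniform:
 fixes \<psi> :: "real^'n::finite => 'b::real_normed_vector"
 assumes cont: "continuous_on UNIV \<psi>" and supp: "!!x. r < norm x ==> \<psi> x = 0" and e: "0 < e"
 shows "\<exists>d>0. \<forall>x y. norm (x - y) < d --> norm (\<psi> x - \<psi> y) < e"
proof -
 have "uniformly_continuous_on (cball 0 (r + 1)) \<psi>"
  by (intro compact_uniformly_continuous continuous_on_subset[OF cont]) auto
 then obtain d where d: "0 < d" "!!x y. x \<in> cball 0 (r + 1) ==> y \<in> cball 0 (r + 1) ==> dist y x < d ==> dist (\<psi> y) (\<psi> x) < e"
  using e unfolding uniformly_continuous_on_def by blast
 have "norm (\<psi> x - \<psi> y) < e" if xy: "norm (x - y) < min d 1" for x y
 proof (cases "norm x <= r \<or> norm y <= r")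
  case True
  have "norm x <= norm y + 1" "norm y <= norm x + 1"
  using xy norm_triangle_ineq2[of x y] norm_triangle_ineq2[of y x] by (auto simp: norm_minus_commute)
  then show ?thesis using True d(2)[of y x] xy by (auto simp: dist_norm)
 next
  case False
  then show ?thesis using supp[of x] supp[of y] e by simp
 qed
 then show ?thesis using d(1) by (intro exI[of _ "min d 1"]) auto
qed

definition grad :: "(real^'n::finite => real) => real^'n => real^'n" where
 "grad \<phi> x = (\<chi> i. partial i \<phi> x)"

lemma C_k_has_derivative: "C_k (Suc m) \<phi> ==> (\<phi> has_derivative (%h. grad \<phi> x \<bullet> h)) (at x)"
 unfolding grad_def by (rule differentiable_has_derivative_partial) simp

lemma grad_continuous: "C_k (Suc m) \<phi> ==> continuous_on UNIV (grad \<phi>)"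
 unfolding grad_def by (intro continuous_on_vec_lambda C_k_continuous[of m]) auto

lemma grad_zero_off_support:
 assumes "closed K" "!!x. x \<notin> K ==> \<phi> x = 0" "x \<notin> K"
 shows "grad \<phi> x = 0"
proof -
 have "((%_. 0) has_derivative (%_. 0)) (at x)" by (rule has_derivative_const)
 then have "(\<phi> has_derivative (%_. 0)) (at x)"
  by (rule has_derivative_transform_within_open[OF _ open_Compl[OF assms(1)]]) (use assms in auto)
 from partial_eq[OF this] show ?thesis by (simp add: grad_def vec_eq_iff)
qed

lemma uniform_first_order:
 assumes C: "C_k (Suc m) \<phi>" and supp: "!!x. r < norm x ==> \<phi> x = 0" and e: "0 < e"
 shows "\<exists>d>0. \<forall>x h. norm h < d --> \<bar>\<phi> (x + h) - \<phi> x - grad \<phi> x \<bullet> h\<bar> <= e * norm h"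
proof -
 have "grad \<phi> x = 0" if "r < norm x" for x
  using that supp by (intro grad_zero_off_support[of "cball 0 r"]) auto
 then obtain d where d: "0 < d" "!!x y. norm (x - y) < d ==> norm (grad \<phi> x - grad \<phi> y) < e"
  using continuous_compact_support_uniform[OF grad_continuous[OF C] _ e] by blast
 have "\<bar>\<phi> (x + h) - \<phi> x - grad \<phi> x \<bullet> h\<bar> <= e * norm h" if h: "norm h < d" for x h
 proof -
  have "norm (\<phi> (x + h) - \<phi> x - grad \<phi> x \<bullet> (x + h - x)) <= norm (x + h - x) * e"
  proof (rule differentiable_bound_linearization[where S="ball x d" and f'="%y h. grad \<phi> y \<bullet> h"])
  show "x + t *\<^sub>R (x + h - x) \<in> ball x d" if "t \<in> {0..1}" for t
  proof -
  have "\<bar>t\<bar> * norm h <= 1 * norm h" using that by (intro mult_right_mono) auto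
  then show ?thesis using h by (simp add: dist_norm)
  qed
  show "(\<phi> has_derivative (%h. grad \<phi> y \<bullet> h)) (at y within ball x d)" for y
  by (rule has_derivative_at_withinI[OF C_k_has_derivative[OF C]])
  show "onorm ((%h. grad \<phi> y \<bullet> h) - (%h. grad \<phi> x \<bullet> h)) <= e" if "y \<in> ball x d" for y
  proof (rule onorm_le)
  fix z
  have "norm (((%h. grad \<phi> y \<bullet> h) - (%h. grad \<phi> x \<bullet> h)) z) = \<bar>(grad \<phi> y - grad \<phi> x) \<bullet> z\<bar>"
  by (simp add: inner_diff_left)
  also have "\<dots> <= norm (grad \<phi> y - grad \<phi> x) * norm z" by (rule Cauchy_Schwarz_ineq2)
  also have "\<dots> <= e * norm z"
  using d(2)[of y x] that by (intro mult_right_mono) (auto simp: dist_norm norm_minus_commute)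
  finally show "norm (((%h. grad \<phi> y \<bullet> h) - (%h. grad \<phi> x \<bullet> h)) z) <= e * norm z" .
  qed
  qed (use d in auto)
  then show ?thesis by (simp add: mult.commute)
 qed
 then show ?thesis using d(1) by blast
qed

text \<open>All coordinates of a point in the support are positive, so that \<open>x + y\<close> stays in the half-space and the weight does not decrease along the shift.\<close>

definition mker :: "real => real^'n::finite => real" where
 "mker d = (%x. (1 / (\<integral>y. bump (\<chi> i. d) (\<chi> i. 2 * d) 1 (y::real^'n) \<partial>lborel)) * bump (\<chi> i. d) (\<chi> i. 2 * d) 1 (x::real^'n))"

lemma bump_integral:
 fixes \<alpha> \<beta> :: "real^'n::finite"
 shows "integrable lborel (bump \<alpha> \<beta> 1)" and "(!!i. \<alpha> $ i < \<beta> $ i) ==> 0 < (\<integral>x. bump \<alpha> \<beta> 1 x \<partial>lborel)"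
proof -
 show int: "integrable lborel (bump \<alpha> \<beta> 1)"
 proof (rule Bochner_Integration.integrable_bound)
  show "integrable lborel (indicator (cbox \<alpha> \<beta>) :: real^'n => real)"
  using emeasure_bounded_finite[OF bounded_cbox, of \<alpha> \<beta>] by (intro integrable_real_indicator) auto
  show "AE x in lborel. norm (bump \<alpha> \<beta> 1 x) <= norm (indicator (cbox \<alpha> \<beta>) x :: real)"
  proof (rule AE_I2)
  fix x
  show "norm (bump \<alpha> \<beta> 1 x) <= norm (indicator (cbox \<alpha> \<beta>) x :: real)"
  proof (cases "bump \<alpha> \<beta> 1 x = 0")
  case False
  then have "x \<in> cbox \<alpha> \<beta>" using bump_nonzero_iff[of 1 \<alpha> \<beta> x] box_subset_cbox[of \<alpha> \<beta>] by auto
  then show ?thesis using bump_bounds[of \<alpha> \<beta> 1 x] by simp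
  qed simp
  qed
 qed simp
 assume ab: "!!i. \<alpha> $ i < \<beta> $ i"
 have "(\<integral>x. bump \<alpha> \<beta> 1 x \<partial>lborel) ~= 0"
 proof
  assume "(\<integral>x. bump \<alpha> \<beta> 1 x \<partial>lborel) = 0"
  then have "AE x in lborel. bump \<alpha> \<beta> 1 x = 0"
  using integral_nonneg_eq_0_iff_AE[OF int AE_I2[OF bump_bounds(1)]] by simp
  then have "AE x in lborel. x \<notin> box \<alpha> \<beta>"
  by eventually_elim (use bump_nonzero_iff[of 1 \<alpha> \<beta>] in auto)
  then have "emeasure lborel (box \<alpha> \<beta>) = 0"
  by (subst (asm) AE_iff_measurable[OF _ refl]) auto
  moreover have "emeasure lborel (box \<alpha> \<beta>) = ennreal (\<Prod>b\<in>Basis. (\<beta> - \<alpha>) \<bullet> b)"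
  using ab by (intro emeasure_lborel_box) (auto simp: Basis_vec_def inner_axis less_imp_le)
  moreover have "0 < (\<Prod>b\<in>Basis. (\<beta> - \<alpha>) \<bullet> b)"
  using ab by (intro prod_pos) (auto simp: Basis_vec_def inner_axis)
  ultimately show False by (metis ennreal_eq_0_iff not_le)
 qed
 moreover have "0 <= (\<integral>x. bump \<alpha> \<beta> 1 x \<partial>lborel)" by (intro integral_nonneg_AE AE_I2 bump_bounds)
 ultimately show "0 < (\<integral>x. bump \<alpha> \<beta> 1 x \<partial>lborel)" by simp
qed

lemma mker:
 fixes d :: real and x v :: "real^'n::finite"
 assumes d: "0 < d"
 shows mker_C_k: "C_k m (mker d :: real^'n => real)"
  and mker_nonneg: "0 <= mker d x"
  and mker_support: "mker d x ~= 0 ==> d < x $ i & x $ i < 2 * d"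
  and mker_integrable: "integrable lborel (mker d :: real^'n => real)"
  and mker_integral: "(\<integral>y. mker d (y::real^'n) \<partial>lborel) = 1"
  and mker_measurable: "(mker d :: real^'n => real) \<in> borel_measurable borel"
  and mker_bounded: "\<exists>B. \<forall>y::real^'n. mker d y <= B"
  and mker_test: "v \<in> half_space k ==> test_function (half_space k) (%y. mker d (y - v))"
proof -
 let ?\<alpha> = "\<chi> i. d :: real^'n" and ?\<beta> = "\<chi> i. 2 * d :: real^'n"
 let ?I = "\<integral>y. bump ?\<alpha> ?\<beta> 1 y \<partial>lborel"
 have I: "0 < ?I" using d by (intro bump_integral) auto
 show "C_k m (mker d :: real^'n => real)"
  unfolding mker_def by (intro C_k_mult C_k_const C_k_bump)
 show "0 <= mker d x" using I bump_bounds[of ?\<alpha> ?\<beta> 1 x] by (simp add: mker_def)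
 show "mker d x ~= 0 ==> d < x $ i & x $ i < 2 * d"
  using bump_nonzero_iff[of 1 ?\<alpha> ?\<beta> x] by (auto simp: mker_def mem_box_cart)
 show "integrable lborel (mker d :: real^'n => real)"
  unfolding mker_def by (intro integrable_mult_right bump_integral)
 show "(\<integral>y. mker d (y::real^'n) \<partial>lborel) = 1"
  unfolding mker_def using I bump_integral(1)[of ?\<alpha> ?\<beta>] by simp
 show "(mker d :: real^'n => real) \<in> borel_measurable borel"
  unfolding mker_def by measurable
 show "\<exists>B. \<forall>y::real^'n. mker d y <= B"
  unfolding mker_def using I bump_bounds(2)[of ?\<alpha> ?\<beta> 1]
  by (intro exI[of _ "1 / ?I"]) (auto simp: divide_le_cancel)
 assume v: "v \<in> half_space k"
 have "mker d (y - v) = (1 / ?I) * bump (?\<alpha> + v) (?\<beta> + v) 1 y" for y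
  by (simp add: mker_def bump_def algebra_simps)
 moreover have "cbox (?\<alpha> + v) (?\<beta> + v) \<subseteq> half_space k"
  using v d by (auto simp: half_space_def mem_box_cart dest!: spec[of _ k])
 ultimately show "test_function (half_space k) (%y. mker d (y - v))"
  by (simp only:) (intro test_function_bump, auto)
qed

definition mollify :: "real => (real^'n::finite => 'b::{banach, second_countable_topology}) => real^'n => 'b" where
 "mollify d f x = (\<integral>y. mker d y *\<^sub>R f (x + y) \<partial>lborel)"

lemma mollify_measurable:
 assumes "0 < d" and [measurable]: "f \<in> borel_measurable borel" shows "mollify d f \<in> borel_measurable borel"
proof -
 note [measurable] = mker_measurable[OF assms(1)]
 show ?thesis unfolding mollify_def[abs_def] by measurable
qed

lemma lborel_integral_translate:
 fixes f :: "'a::euclidean_space => 'b::{banach, second_countable_topology}"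
 shows "(\<integral>x. f (t + x) \<partial>lborel) = (\<integral>x. f x \<partial>lborel)" and "integrable lborel (%x. f (t + x)) \<longleftrightarrow> integrable lborel f"
proof -
 have d: "distr lborel borel ((+) t) = (lborel :: 'a measure)" by (rule lborel_distr_plus)
 show "(\<integral>x. f (t + x) \<partial>lborel) = (\<integral>x. f x \<partial>lborel)"
 proof (cases "f \<in> borel_measurable borel")
  case True
  then show ?thesis by (subst (2) d[symmetric], subst integral_distr) auto
 next
  case False
  have "\<not> integrable lborel f" using False borel_measurable_integrable by force
  moreover have "\<not> integrable lborel (%x. f (t + x))"
  proof
  assume "integrable lborel (%x. f (t + x))"
  then have "(%x. f (t + x)) \<in> borel_measurable borel" by (auto dest: borel_measurable_integrable)
  then have "(%x. f (t + (- t + x))) \<in> borel_measurable borel" by (rule measurable_compose[rotated]) simp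
  then show False using False by simp
  qed
  ultimately show ?thesis by (simp add: not_integrable_integral_eq)
 qed
 show "integrable lborel (%x. f (t + x)) \<longleftrightarrow> integrable lborel f"
 proof
  assume "integrable lborel f"
  then show "integrable lborel (%x. f (t + x))"
  by (subst (asm) d[symmetric], subst (asm) integrable_distr_eq) (auto dest: borel_measurable_integrable)
 next
  have d': "distr lborel borel ((+) (- t)) = (lborel :: 'a measure)" by (rule lborel_distr_plus)
  assume i: "integrable lborel (%x. f (t + x))"
  then have "integrable (distr lborel borel ((+) (- t))) (%x. f (t + x))" by (simp only: d')
  then show "integrable lborel f"
  using borel_measurable_integrable[OF i] by (subst (asm) integrable_distr_eq) auto
 qed
qed

text \<open>The weight is monotone in the \<open>k\<close>-th coordinate and the kernel only shifts upwards.\<close>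

lemma shift_average_le:
 fixes H :: "real^'n::finite => ennreal"
 assumes [measurable]: "H \<in> borel_measurable borel" and d: "0 < d" and a: "0 <= a"
 shows "(\<integral>\<^sup>+x. (\<integral>\<^sup>+y. ennreal (mker d y) * H (x + y) \<partial>lborel) \<partial>hs_meas k a) <= (\<integral>\<^sup>+x. H x \<partial>hs_meas k a)"
proof -
 note [measurable] = mker_measurable[OF d]
 let ?w = "%x. indicator (half_space k) x * weight k a x :: real"
 let ?m = "mker d :: real^'n => real"
 have "(\<integral>\<^sup>+x. (\<integral>\<^sup>+y. ennreal (?m y) * H (x + y) \<partial>lborel) \<partial>hs_meas k a) =
  (\<integral>\<^sup>+x. (\<integral>\<^sup>+y. ennreal (?w x) * (ennreal (?m y) * H (x + y)) \<partial>lborel) \<partial>lborel)"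
  by (subst nn_integral_hs_meas) (auto intro!: nn_integral_cong nn_integral_cmult[symmetric])
 also have "\<dots> = (\<integral>\<^sup>+y. (\<integral>\<^sup>+x. ennreal (?w x) * (ennreal (?m y) * H (x + y)) \<partial>lborel) \<partial>lborel)"
  by (rule lborel_pair.Fubini') measurable
 also have "\<dots> <= (\<integral>\<^sup>+y. ennreal (?m y) * (\<integral>\<^sup>+x. H x \<partial>hs_meas k a) \<partial>lborel)"
 proof (intro nn_integral_mono)
  fix y :: "real^'n"
  show "(\<integral>\<^sup>+x. ennreal (?w x) * (ennreal (?m y) * H (x + y)) \<partial>lborel) <= ennreal (?m y) * (\<integral>\<^sup>+x. H x \<partial>hs_meas k a)"
  proof (cases "?m y = 0")
  case False
  then have y: "0 < y $ k" using mker_support[OF d, of y k] d by auto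
  have w: "?w x <= ?w (y + x)" for x
  using y a by (auto simp: half_space_def weight_def indicator_def intro!: powr_mono2)
  have "(\<integral>\<^sup>+x. ennreal (?w x) * (ennreal (?m y) * H (x + y)) \<partial>lborel) <= (\<integral>\<^sup>+x. ennreal (?m y) * (ennreal (?w (y + x)) * H (y + x)) \<partial>lborel)"
  using w by (intro nn_integral_mono) (auto simp: mult_ac add.commute[of _ y] intro!: mult_left_mono mult_right_mono ennreal_leI)
  also have "\<dots> = ennreal (?m y) * (\<integral>\<^sup>+x. ennreal (?w (y + x)) * H (y + x) \<partial>lborel)"
  by (rule nn_integral_cmult) measurable
  also have "(\<integral>\<^sup>+x. ennreal (?w (y + x)) * H (y + x) \<partial>lborel) = (\<integral>\<^sup>+x. ennreal (?w x) * H x \<partial>lborel)"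
  by (subst nn_integral_lborel_scale[where c=1 and t=y and f="%x. ennreal (?w x) * H x"]) auto
  also have "\<dots> = (\<integral>\<^sup>+x. H x \<partial>hs_meas k a)" by (subst nn_integral_hs_meas) auto
  finally show ?thesis .
  qed simp
 qed
 also have "\<dots> = (\<integral>\<^sup>+x. H x \<partial>hs_meas k a)"
 proof -
  have "(\<integral>\<^sup>+y. ennreal (?m y) \<partial>lborel) = 1"
  using nn_integral_eq_integral[OF mker_integrable[OF d] AE_I2[OF mker_nonneg[OF d]]]
  by (simp add: mker_integral[OF d])
  then show ?thesis by (subst nn_integral_multc) auto
 qed
 finally show ?thesis .
qed

lemma powr_tangent:
 fixes r t p :: real
 assumes "0 <= r" "0 < t" "1 <= p" shows "t powr p + p * t powr (p - 1) * (r - t) <= r powr p"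
proof (cases "r = 0")
 case True
 then show ?thesis using assms mult_right_mono[of 1 p "t powr p"] by (simp add: powr_diff)
next
 case False
 then have r: "0 < r" using assms by simp
 have "(r powr p) powr (1 / p) * (t powr p) powr ((p - 1) / p) <= (1 / p) * r powr p + ((p - 1) / p) * t powr p"
  using assms r by (intro Youngs_inequality_0) (auto simp: field_simps)
 then have "p * (r * t powr (p - 1)) <= p * ((1 / p) * r powr p + ((p - 1) / p) * t powr p)"
  using assms r by (intro mult_left_mono) (auto simp: powr_powr)
 also have "\<dots> = r powr p + (p - 1) * t powr p" using assms by (simp add: field_simps)
 finally have "p * (r * t powr (p - 1)) <= r powr p + (p - 1) * t powr p" .
 moreover have "t powr (p - 1) * t = t powr p" using assms by (simp add: powr_diff)
 ultimately show ?thesis by (simp add: algebra_simps)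
qed

lemma jensen_powr:
 fixes H \<kappa> :: "'a => real"
 assumes [measurable]: "H \<in> borel_measurable M" and \<kappa>: "integrable M \<kappa>" "!!y. 0 <= \<kappa> y" "(\<integral>y. \<kappa> y \<partial>M) = 1"
  and H: "!!y. 0 <= H y" and p: "1 <= p"
 shows "ennreal ((\<integral>y. \<kappa> y * H y \<partial>M) powr p) <= (\<integral>\<^sup>+y. ennreal (\<kappa> y) * ennreal (H y powr p) \<partial>M)"
proof (cases "(\<integral>\<^sup>+y. ennreal (\<kappa> y) * ennreal (H y powr p) \<partial>M) = top \<or> (\<integral>y. \<kappa> y * H y \<partial>M) = 0")
 case False
 let ?t = "\<integral>y. \<kappa> y * H y \<partial>M"
 have [measurable]: "\<kappa> \<in> borel_measurable M" using \<kappa>(1) by auto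
 have t: "0 < ?t"
 proof -
  have "0 <= ?t" using \<kappa> H by (intro integral_nonneg_AE) auto
  then show ?thesis using False by simp
 qed
 have i1: "integrable M (%y. \<kappa> y * H y)" using False not_integrable_integral_eq by blast
 have i2: "integrable M (%y. \<kappa> y * H y powr p)"
  using False \<kappa>(2) by (intro integrableI_nonneg) (auto simp: ennreal_mult less_top)
 have eqf: "(%y. \<kappa> y * (?t powr p + p * ?t powr (p - 1) * (H y - ?t))) =
  (%y. (?t powr p - p * ?t powr (p - 1) * ?t) * \<kappa> y + p * ?t powr (p - 1) * (\<kappa> y * H y))"
  by (auto simp: algebra_simps)
 have "(\<integral>y. \<kappa> y * (?t powr p + p * ?t powr (p - 1) * (H y - ?t)) \<partial>M) <= (\<integral>y. \<kappa> y * H y powr p \<partial>M)"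
 proof (rule integral_mono[OF _ i2])
  show "integrable M (%y. \<kappa> y * (?t powr p + p * ?t powr (p - 1) * (H y - ?t)))"
  unfolding eqf using i1 \<kappa>(1) by (intro Bochner_Integration.integrable_add integrable_mult_right)
  show "\<kappa> y * (?t powr p + p * ?t powr (p - 1) * (H y - ?t)) <= \<kappa> y * H y powr p" for y
  using powr_tangent[OF H t p] \<kappa>(2) by (intro mult_left_mono) auto
 qed
 also have "(\<integral>y. \<kappa> y * (?t powr p + p * ?t powr (p - 1) * (H y - ?t)) \<partial>M) =
  (\<integral>y. (?t powr p - p * ?t powr (p - 1) * ?t) * \<kappa> y + p * ?t powr (p - 1) * (\<kappa> y * H y) \<partial>M)"
  unfolding eqf ..
 also have "\<dots> = ?t powr p" using i1 \<kappa> by simp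
 finally have "ennreal (?t powr p) <= ennreal (\<integral>y. \<kappa> y * H y powr p \<partial>M)" by (rule ennreal_leI)
 also have "\<dots> = (\<integral>\<^sup>+y. ennreal (\<kappa> y) * ennreal (H y powr p) \<partial>M)"
  using i2 \<kappa>(2) by (subst nn_integral_eq_integral[symmetric]) (auto simp: ennreal_mult)
 finally show ?thesis .
qed (use p in auto)


lemma mker_abs: "0 < d ==> \<bar>mker d y\<bar> = mker d y"
 by (simp add: mker_nonneg)

lemma integrable_mult_compact_support:
 fixes h :: "real^'n::finite => 'b::{banach, second_countable_topology}" and \<psi> :: "real^'n => real"
 assumes h: "integrable lborel (%x. indicator K x *\<^sub>R h x)" and [measurable]: "h \<in> borel_measurable borel" "\<psi> \<in> borel_measurable borel"
  and \<psi>: "!!y. \<bar>\<psi> y\<bar> <= B" "!!y. y \<notin> K ==> \<psi> y = 0"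
 shows "integrable lborel (%y. \<psi> y *\<^sub>R h y)"
proof (rule Bochner_Integration.integrable_bound)
 show "integrable lborel (%x. B *\<^sub>R (indicator K x *\<^sub>R h x))" using h by (rule integrable_scaleR_right)
 have "0 <= B" using \<psi>(1)[of 0] by linarith
 then show "AE y in lborel. norm (\<psi> y *\<^sub>R h y) <= norm (B *\<^sub>R (indicator K y *\<^sub>R h y))"
  using \<psi> by (intro AE_I2) (auto simp: indicator_def intro!: mult_right_mono)
qed simp

lemma mollify_translate: "mollify d h x = (\<integral>y. mker d (y - x) *\<^sub>R h y \<partial>lborel)"
 unfolding mollify_def
 using lborel_integral_translate(1)[of "%y. mker d (y - x) *\<^sub>R h y" x] by simp

lemma norm_le_of_components:
 fixes y :: "real^'n::finite"
 assumes "!!i. \<bar>y $ i\<bar> <= c" shows "norm y <= real CARD('n) * c"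
 using norm_le_l1_cart[of y] sum_bounded_above[of UNIV "%i. \<bar>y $ i\<bar>" c] assms by simp

lemma mker_norm:
 assumes "0 < d" "mker d (y :: real^'n::finite) ~= 0" shows "norm y <= real CARD('n) * (2 * d)"
proof (rule norm_le_of_components)
 fix i show "\<bar>y $ i\<bar> <= 2 * d" using mker_support[OF assms, of i] assms(1) by simp
qed

definition loc_int :: "'n::finite => (real^'n => 'b::{banach, second_countable_topology}) => bool" where
 "loc_int k h \<longleftrightarrow> h \<in> borel_measurable borel &
  (\<forall>K. compact K --> K \<subseteq> half_space k --> integrable lborel (%x. indicator K x *\<^sub>R h x))"

lemma mollify_bounded:
 fixes h :: "real^'n::finite => 'b::{banach, second_countable_topology}"
 assumes h: "loc_int k h" and d: "0 < d"
 shows "\<exists>B. \<forall>x\<in>half_space k. norm x <= R --> norm (mollify d h x) <= B"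
proof -
 let ?K = "cball 0 (R + real CARD('n) * (2 * d)) \<inter> {y::real^'n. d <= y $ k}"
 obtain B where B: "!!y::real^'n. mker d y <= B" using mker_bounded[OF d] by blast
 have K: "compact ?K" by (intro compact_Int_closed compact_cball closed_Collect_le continuous_intros)
 have K\<Omega>: "?K \<subseteq> half_space k" using d by (auto simp: half_space_def)
 have hK: "integrable lborel (%x. indicator ?K x *\<^sub>R h x)"
  using h K K\<Omega> by (auto simp: loc_int_def)
 have [measurable]: "h \<in> borel_measurable borel" using h by (simp add: loc_int_def)
 note [measurable] = mker_measurable[OF d]
 have "norm (mollify d h x) <= (\<integral>y. B * norm (indicator ?K y *\<^sub>R h y) \<partial>lborel)" if x: "x \<in> half_space k" "norm x <= R" for x
 proof -
  have z: "mker d (y - x) = 0" if "y \<notin> ?K" for y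
  proof (rule ccontr)
  assume nz: "mker d (y - x) ~= 0"
  have "norm y <= norm x + norm (y - x)" by (metis add.commute diff_add_cancel norm_triangle_ineq)
  then have "norm y <= R + real CARD('n) * (2 * d)" using mker_norm[OF d nz] x(2) by linarith
  moreover have "d <= y $ k" using mker_support[OF d nz, of k] x(1) by (simp add: half_space_def)
  ultimately show False using that by simp
  qed
  have "norm (mollify d h x) <= (\<integral>y. norm (mker d (y - x) *\<^sub>R h y) \<partial>lborel)"
  unfolding mollify_translate by (rule integral_norm_bound)
  also have "\<dots> <= (\<integral>y. B * norm (indicator ?K y *\<^sub>R h y) \<partial>lborel)"
  proof (rule integral_mono)
  show "integrable lborel (%y. norm (mker d (y - x) *\<^sub>R h y))"
  by (intro integrable_norm integrable_mult_compact_support[OF hK, where B=B]) (simp_all add: mker_abs[OF d] B z del: mem_Collect_eq Int_iff)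
  show "integrable lborel (%y. B * norm (indicator ?K y *\<^sub>R h y))" using hK by (intro integrable_mult_right integrable_norm)
  show "norm (mker d (y - x) *\<^sub>R h y) <= B * norm (indicator ?K y *\<^sub>R h y)" for y
  proof (cases "y \<in> ?K")
  case True
  then show ?thesis using B[of "y - x"] mker_nonneg[OF d, of "y - x"] by (auto intro: mult_right_mono)
  qed (simp add: z)
  qed
  finally show ?thesis .
 qed
 then show ?thesis by blast
qed

lemma mker_gradient_bounded:
 assumes d: "0 < d"
 shows "\<exists>B. \<forall>y::real^'n::finite. norm (grad (mker d) y) <= B"
  and "grad (mker d) (y::real^'n::finite) ~= 0 ==> d <= y $ i & y $ i <= 2 * d"
proof -
 let ?K = "cbox (\<chi> i. d) (\<chi> i. 2 * d) :: (real^'n) set"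
 have z: "grad (mker d) y = 0" if "y \<notin> ?K" for y :: "real^'n"
 proof (rule grad_zero_off_support[OF closed_cbox _ that])
  fix x :: "real^'n" assume x: "x \<notin> ?K"
  show "mker d x = 0"
  proof (rule ccontr)
  assume "mker d x ~= 0"
  then have "!!i. d < x $ i & x $ i < 2 * d" using mker_support[OF d] by blast
  then show False using x by (auto simp: mem_box_cart less_imp_le)
  qed
 qed
 show "grad (mker d) y ~= 0 ==> d <= y $ i & y $ i <= 2 * d" for y :: "real^'n" and i
  using z[of y] by (auto simp: mem_box_cart)
 have "continuous_on ?K (grad (mker d))"
  by (rule continuous_on_subset[OF grad_continuous[OF mker_C_k[OF d, of "Suc 0"]]]) simp
 then have "bounded (grad (mker d) ` ?K)"
  by (intro compact_imp_bounded compact_continuous_image compact_cbox)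
 then obtain B where B: "!!y. y \<in> ?K ==> norm (grad (mker d) y) <= B" by (auto simp: bounded_iff)
 then have "norm (grad (mker d) y) <= max B 0" for y :: "real^'n"
  using z[of y] by (cases "y \<in> ?K") (auto simp: le_max_iff_disj)
 then show "\<exists>B. \<forall>y::real^'n::finite. norm (grad (mker d) y) <= B" by blast
qed

lemma grad_translate:
 assumes "C_k (Suc m) \<phi>" shows "grad (%y. \<phi> (y - x)) y = grad \<phi> (y - x)"
proof -
 have "((%y. \<phi> (y - x)) has_derivative (%h. grad \<phi> (y - x) \<bullet> h)) (at y)"
 proof -
  have "((%y. y - x) has_derivative (%h. h)) (at y)" by (auto intro!: derivative_eq_intros)
  from has_derivative_compose[OF this C_k_has_derivative[OF assms]] show ?thesis .
 qed
 from partial_eq[OF this] have "partial i (%y. \<phi> (y - x)) y = grad \<phi> (y - x) $ i" for i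
  by (simp add: inner_axis)
 then show ?thesis by (simp add: grad_def[of "%y. \<phi> (y - x)"])
qed

lemma mollify_has_derivative:
 fixes f :: "real^'n::finite => real" and g :: "real^'n => real^'n"
 assumes f: "loc_int k f" and g: "loc_int k g"
  and weak: "!!\<phi> i. test_function (half_space k) \<phi> ==>
  (\<integral>x. f x * partial i \<phi> x \<partial>lborel) = - (\<integral>x. g x $ i * \<phi> x \<partial>lborel)"
  and d: "0 < d" and x: "x \<in> half_space k"
 shows "(mollify d f has_derivative (%h. mollify d g x \<bullet> h)) (at x)"
 unfolding has_derivative_at_alt
proof (intro conjI allI impI)
 show "bounded_linear (%h. mollify d g x \<bullet> h)" by (rule bounded_linear_inner_right)
 fix e :: real assume e: "0 < e"
 let ?\<kappa> = "mker d :: real^'n => real"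
 let ?K = "cbox (\<chi> i. x $ i + d / 2) (\<chi> i. x $ i + 3 * d)"
 have K: "compact ?K" "?K \<subseteq> half_space k"
  using x d by (auto simp: half_space_def mem_box_cart compact_cbox dest!: spec[of _ k])
 have [measurable]: "f \<in> borel_measurable borel" "g \<in> borel_measurable borel"
  using f g by (simp_all add: loc_int_def)
 note [measurable] = mker_measurable[OF d]
 have C: "C_k (Suc m) ?\<kappa>" for m by (rule mker_C_k[OF d])
 have [measurable]: "grad ?\<kappa> \<in> borel_measurable borel"
  by (rule borel_measurable_continuous_onI[OF grad_continuous[OF C]])
 have fK: "integrable lborel (%x. indicator ?K x *\<^sub>R f x)" and gK: "integrable lborel (%x. indicator ?K x *\<^sub>R g x)"
  using f g K by (auto simp: loc_int_def)
 define J where "J = (\<integral>y. \<bar>indicator ?K y *\<^sub>R f y\<bar> \<partial>lborel)"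
 have J: "0 <= J" unfolding J_def by (intro integral_nonneg_AE) auto
 obtain Bk where Bk: "!!y. ?\<kappa> y <= Bk" using mker_bounded[OF d] by blast
 obtain Bg where Bg: "!!y. norm (grad ?\<kappa> y) <= Bg" using mker_gradient_bounded(1)[OF d] by blast
 have ksupp: "?\<kappa> x = 0" if "real CARD('n) * (2 * d) < norm x" for x
  using mker_norm[OF d, of x] that by force
 have "0 < e / (J + 1)" using e J by simp
 from uniform_first_order[OF C[of 0] ksupp this] obtain r where r: "0 < r" "!!z h. norm h < r ==> \<bar>?\<kappa> (z + h) - ?\<kappa> z - grad ?\<kappa> z \<bullet> h\<bar> <= e / (J + 1) * norm h" by blast
 have \<kappa>supp: "?\<kappa> (y - (x + h)) = 0" if "y \<notin> ?K" "norm h < d / 2" for y h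
 proof (rule ccontr)
  assume nz: "?\<kappa> (y - (x + h)) ~= 0"
  have "x $ i + d / 2 <= y $ i & y $ i <= x $ i + 3 * d" for i
  using mker_support[OF d nz, of i] component_le_norm_cart[of h i] that(2) d by (auto simp: abs_le_iff)
  then show False using that(1) by (simp add: mem_box_cart)
 qed
 have gsupp: "grad ?\<kappa> (y - x) = 0" if "y \<notin> ?K" for y
 proof (rule ccontr)
  assume nz: "grad ?\<kappa> (y - x) ~= 0"
  have "x $ i + d / 2 <= y $ i & y $ i <= x $ i + 3 * d" for i
  using mker_gradient_bounded(2)[OF d nz, of i] d by auto
  then show False using that(1) by (simp add: mem_box_cart)
 qed
 have i\<kappa>: "integrable lborel (%y. ?\<kappa> (y - (x + h)) *\<^sub>R f y)" if "norm h < d / 2" for h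
  using \<kappa>supp[OF _ that] by (intro integrable_mult_compact_support[OF fK, where B=Bk]) (simp_all add: mker_abs[OF d] Bk)
 have ig: "integrable lborel (%y. (grad ?\<kappa> (y - x) \<bullet> h) *\<^sub>R f y)" for h
 proof (rule integrable_mult_compact_support[OF fK, where B="Bg * norm h"])
  show "\<bar>grad ?\<kappa> (y - x) \<bullet> h\<bar> <= Bg * norm h" for y
  by (rule order_trans[OF Cauchy_Schwarz_ineq2 mult_right_mono[OF Bg]]) simp
 qed (auto simp: gsupp)
 have gx: "mollify d g x \<bullet> h = - (\<integral>y. (grad ?\<kappa> (y - x) \<bullet> h) *\<^sub>R f y \<partial>lborel)" for h
 proof -
  have ig': "integrable lborel (%y. ?\<kappa> (y - x) *\<^sub>R g y)"
  using \<kappa>supp[of _ 0] d by (intro integrable_mult_compact_support[OF gK, where B=Bk]) (simp_all add: mker_abs[OF d] Bk)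
  have comp: "mollify d g x $ i = - (\<integral>y. (grad ?\<kappa> (y - x) \<bullet> axis i 1) *\<^sub>R f y \<partial>lborel)" for i
  proof -
  have "mollify d g x $ i = mollify d g x \<bullet> axis i 1" by (simp add: inner_axis)
  also have "\<dots> = (\<integral>y. (?\<kappa> (y - x) *\<^sub>R g y) \<bullet> axis i 1 \<partial>lborel)"
  unfolding mollify_translate by (rule integral_inner_left[symmetric]) (use ig' in auto)
  also have "\<dots> = (\<integral>y. g y $ i * ?\<kappa> (y - x) \<partial>lborel)" by (simp add: inner_axis mult.commute)
  also have "\<dots> = - (\<integral>y. f y * partial i (%y. ?\<kappa> (y - x)) y \<partial>lborel)"
  using weak[OF mker_test[OF d x], of i] by simp
  also have "partial i (%y. ?\<kappa> (y - x)) = (%y. grad ?\<kappa> (y - x) \<bullet> axis i 1)"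
  proof
  fix y
  have "partial i (%y. ?\<kappa> (y - x)) y = grad (%y. ?\<kappa> (y - x)) y $ i" by (simp add: grad_def)
  then show "partial i (%y. ?\<kappa> (y - x)) y = grad ?\<kappa> (y - x) \<bullet> axis i 1"
  unfolding grad_translate[OF C[of 0]] by (simp add: inner_axis)
  qed
  finally show ?thesis by (simp add: mult.commute)
  qed
  have "mollify d g x \<bullet> h = (\<Sum>i\<in>UNIV. h $ i * mollify d g x $ i)" by (simp add: inner_vec_def mult.commute)
  also have "\<dots> = - (\<Sum>i\<in>UNIV. \<integral>y. h $ i * ((grad ?\<kappa> (y - x) \<bullet> axis i 1) *\<^sub>R f y) \<partial>lborel)"
  unfolding comp using ig by (simp add: sum_negf)
  also have "(\<Sum>i\<in>UNIV. \<integral>y. h $ i * ((grad ?\<kappa> (y - x) \<bullet> axis i 1) *\<^sub>R f y) \<partial>lborel) =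
  (\<integral>y. (\<Sum>i\<in>UNIV. h $ i * ((grad ?\<kappa> (y - x) \<bullet> axis i 1) *\<^sub>R f y)) \<partial>lborel)"
  using ig by (intro Bochner_Integration.integral_sum[symmetric] integrable_mult_right)
  also have "(%y. \<Sum>i\<in>UNIV. h $ i * ((grad ?\<kappa> (y - x) \<bullet> axis i 1) *\<^sub>R f y)) = (%y. (grad ?\<kappa> (y - x) \<bullet> h) *\<^sub>R f y)"
  by (simp add: inner_axis inner_vec_def[of _ h] sum_distrib_left mult_ac)
  finally show ?thesis .
 qed
 show "\<exists>r>0. \<forall>y. norm (y - x) < r -->
  norm (mollify d f y - mollify d f x - mollify d g x \<bullet> (y - x)) <= e * norm (y - x)"
 proof (intro exI[of _ "min r (d / 2)"] conjI allI impI)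
  show "0 < min r (d / 2)" using r d by simp
  fix x' assume x': "norm (x' - x) < min r (d / 2)"
  define h where "h = x' - x"
  have h: "norm h < r" "norm h < d / 2" "x' = x + h" using x' by (auto simp: h_def)
  let ?D = "%y. ?\<kappa> (y - (x + h)) *\<^sub>R f y - ?\<kappa> (y - (x + 0)) *\<^sub>R f y + (grad ?\<kappa> (y - x) \<bullet> h) *\<^sub>R f y"
  have eqD: "mollify d f x' - mollify d f x - mollify d g x \<bullet> h = (\<integral>y. ?D y \<partial>lborel)"
  unfolding gx unfolding mollify_translate h(3) using i\<kappa>[OF h(2)] i\<kappa>[of 0] ig[of h] d by simp
  have "norm (\<integral>y. ?D y \<partial>lborel) <= (\<integral>y. e / (J + 1) * norm h * \<bar>indicator ?K y *\<^sub>R f y\<bar> \<partial>lborel)"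
  proof (rule order_trans[OF integral_norm_bound integral_mono])
  show "integrable lborel (%y. norm (?D y))"
  using i\<kappa>[OF h(2)] i\<kappa>[of 0] ig[of h] d by (intro integrable_norm Bochner_Integration.integrable_add Bochner_Integration.integrable_diff) auto
  show "integrable lborel (%y. e / (J + 1) * norm h * \<bar>indicator ?K y *\<^sub>R f y\<bar>)"
  using fK by (intro integrable_mult_right integrable_abs)
  fix y
  show "norm (?D y) <= e / (J + 1) * norm h * \<bar>indicator ?K y *\<^sub>R f y\<bar>"
  proof (cases "y \<in> ?K")
  case True
  let ?A = "?\<kappa> ((y - x) + (- h)) - ?\<kappa> (y - x) - grad ?\<kappa> (y - x) \<bullet> (- h)"
  have A: "\<bar>?A\<bar> <= e / (J + 1) * norm (- h)"
  by (rule r(2)) (use h in simp)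
  have "?D y = ?A * f y" by (simp add: algebra_simps)
  then have "norm (?D y) = \<bar>?A\<bar> * \<bar>f y\<bar>" by (simp only: real_norm_def abs_mult)
  also have "\<dots> <= e / (J + 1) * norm (- h) * \<bar>f y\<bar>" by (rule mult_right_mono[OF A]) simp
  finally show ?thesis using True by simp
  next
  case False
  then show ?thesis using \<kappa>supp[OF False h(2)] \<kappa>supp[OF False, of 0] d gsupp[OF False] by simp
  qed
  qed
  also have "\<dots> = e / (J + 1) * norm h * J"
  proof -
  have "(\<integral>y. c * \<bar>indicator ?K y *\<^sub>R f y\<bar> \<partial>lborel) = c * J" for c
  unfolding J_def by (simp only: integral_mult_right_zero)
  then show ?thesis .
  qed
  also have "\<dots> = e * norm h * (J / (J + 1))" by simp
  also have "\<dots> <= e * norm h * 1" using J e by (intro mult_left_mono) auto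
  finally have "norm (\<integral>y. ?D y \<partial>lborel) <= e * norm h" by simp
  then show "norm (mollify d f x' - mollify d f x - mollify d g x \<bullet> (x' - x)) <= e * norm (x' - x)"
  unfolding eqD[symmetric] by (simp only: h_def)
 qed
qed


lemma continuous_L1_approximation:
 fixes h :: "real^'n::finite => real"
 assumes [measurable]: "h \<in> borel_measurable borel" and K: "compact K" and h: "integrable lborel (%x. indicator K x *\<^sub>R h x)" and e: "0 < e"
 shows "\<exists>c. continuous_on UNIV c & (\<integral>\<^sup>+x. indicator K x * ennreal \<bar>h x - c x\<bar> \<partial>lborel) <= ennreal e"
proof -
 have [measurable]: "K \<in> sets borel" using K by (rule borel_compact)
 define h0 where "h0 x = indicator K x * h x" for x
 have [measurable]: "h0 \<in> borel_measurable borel" unfolding h0_def by measurable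
 have h0: "integrable lborel h0" using h by (simp add: h0_def[abs_def])
 define cl where "cl B t = max (- B) (min t B)" for B t :: real
 have cl_cont: "continuous_on UNIV (cl B)" for B unfolding cl_def by (intro continuous_intros)
 have [measurable]: "cl B \<in> borel_measurable borel" for B by (rule borel_measurable_continuous_onI[OF cl_cont])
 have "(%j. \<integral>x. \<bar>h0 x - cl (real j) (h0 x)\<bar> \<partial>lborel) \<longlonglongrightarrow> (\<integral>x. 0 \<partial>(lborel :: (real^'n) measure))"
 proof (rule integral_dominated_convergence)
  show "integrable lborel (%x. \<bar>h0 x\<bar>)" using h0 by (rule integrable_abs)
  show "AE x in lborel. (%j. \<bar>h0 x - cl (real j) (h0 x)\<bar>) \<longlonglongrightarrow> 0"
  proof (rule AE_I2)
  fix x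
  obtain j0 :: nat where j0: "\<bar>h0 x\<bar> <= real j0" using real_arch_simple by blast
  have "\<bar>h0 x - cl (real j) (h0 x)\<bar> = 0" if "j \<ge> j0" for j
  using j0 that by (auto simp: cl_def)
  then show "(%j. \<bar>h0 x - cl (real j) (h0 x)\<bar>) \<longlonglongrightarrow> 0"
  by (intro tendsto_eventually) (auto simp: eventually_sequentially)
  qed
  show "AE x in lborel. norm \<bar>h0 x - cl (real j) (h0 x)\<bar> <= \<bar>h0 x\<bar>" for j
  by (intro AE_I2) (auto simp: cl_def max_def min_def)
 qed measurable
 then have "\<forall>\<^sub>F j in sequentially. (\<integral>x. \<bar>h0 x - cl (real j) (h0 x)\<bar> \<partial>lborel) < e / 2"
  using e by (intro order_tendstoD) auto
 then obtain j where j: "(\<integral>x. \<bar>h0 x - cl (real j) (h0 x)\<bar> \<partial>lborel) < e / 2"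
  by (auto simp: eventually_sequentially)
 define B where "B = real j"
 have "h0 measurable_on UNIV"
  by (intro lebesgue_measurable_imp_measurable_on_real) (auto intro: measurable_completion)
 then obtain Nn g where neg: "negligible Nn" and g: "!!n. continuous_on UNIV (g n)" "!!x. x \<notin> Nn ==> (%n. g n x) \<longlonglongrightarrow> h0 x"
  unfolding measurable_on_def by auto
 have [measurable]: "g n \<in> borel_measurable borel" for n by (rule borel_measurable_continuous_onI[OF g(1)])
 have aeN: "AE x in lborel. x \<notin> Nn"
 proof -
  have "Nn \<in> null_sets lebesgue" using neg by (simp add: negligible_iff_null_sets)
  then have "AE x in lebesgue. x \<notin> Nn" by (rule AE_not_in)
  then show ?thesis by (simp add: AE_completion_iff)
 qed
 have iK: "integrable lborel (%x. (2 * B) * indicator K x)"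
  using emeasure_compact_finite[OF K] by (intro integrable_mult_right integrable_real_indicator) auto
 have "(%n. \<integral>x. indicator K x * \<bar>cl B (h0 x) - cl B (g n x)\<bar> \<partial>lborel) \<longlonglongrightarrow> (\<integral>x. 0 \<partial>(lborel :: (real^'n) measure))"
 proof (rule integral_dominated_convergence[OF _ _ iK])
  show "AE x in lborel. (%n. indicator K x * \<bar>cl B (h0 x) - cl B (g n x)\<bar>) \<longlonglongrightarrow> 0"
  using aeN
  proof eventually_elim
  case (elim x)
  have "(%n. cl B (g n x)) \<longlonglongrightarrow> cl B (h0 x)"
  using cl_cont by (intro isCont_tendsto_compose[OF _ g(2)[OF elim]]) (auto simp: continuous_on_eq_continuous_at)
  then have "(%n. indicator K x * \<bar>cl B (h0 x) - cl B (g n x)\<bar>) \<longlonglongrightarrow> indicator K x * \<bar>cl B (h0 x) - cl B (h0 x)\<bar>"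
  by (intro tendsto_intros)
  then show ?case by simp
  qed
  show "AE x in lborel. norm (indicator K x * \<bar>cl B (h0 x) - cl B (g n x)\<bar>) <= 2 * B * indicator K x" for n
  by (intro AE_I2) (auto simp: cl_def B_def indicator_def max_def min_def)
 qed measurable
 then have "\<forall>\<^sub>F n in sequentially. (\<integral>x. indicator K x * \<bar>cl B (h0 x) - cl B (g n x)\<bar> \<partial>lborel) < e / 2"
  using e by (intro order_tendstoD) auto
 then obtain n where n: "(\<integral>x. indicator K x * \<bar>cl B (h0 x) - cl B (g n x)\<bar> \<partial>lborel) < e / 2"
  by (auto simp: eventually_sequentially)
 have i1: "integrable lborel (%x. \<bar>h0 x - cl B (h0 x)\<bar>)"
  by (rule Bochner_Integration.integrable_bound[OF integrable_abs[OF h0]]) (auto simp: cl_def B_def max_def min_def)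
 have i2: "integrable lborel (%x. indicator K x * \<bar>cl B (h0 x) - cl B (g n x)\<bar>)"
  by (rule Bochner_Integration.integrable_bound[OF iK]) (auto simp: cl_def B_def indicator_def max_def min_def)
 have "(\<integral>\<^sup>+x. indicator K x * ennreal \<bar>h x - cl B (g n x)\<bar> \<partial>lborel) <=
  (\<integral>\<^sup>+x. ennreal (\<bar>h0 x - cl B (h0 x)\<bar> + indicator K x * \<bar>cl B (h0 x) - cl B (g n x)\<bar>) \<partial>lborel)"
 proof (intro nn_integral_mono)
  fix x
  have "indicator K x * \<bar>h x - cl B (g n x)\<bar> <= \<bar>h0 x - cl B (h0 x)\<bar> + indicator K x * \<bar>cl B (h0 x) - cl B (g n x)\<bar>"
  by (auto simp: indicator_def h0_def)
  from ennreal_leI[OF this]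
  show "indicator K x * ennreal \<bar>h x - cl B (g n x)\<bar> <= ennreal (\<bar>h0 x - cl B (h0 x)\<bar> + indicator K x * \<bar>cl B (h0 x) - cl B (g n x)\<bar>)"
  by (cases "x \<in> K") simp_all
 qed
 also have "\<dots> = ennreal (\<integral>x. \<bar>h0 x - cl B (h0 x)\<bar> + indicator K x * \<bar>cl B (h0 x) - cl B (g n x)\<bar> \<partial>lborel)"
  using i1 i2 by (intro nn_integral_eq_integral) auto
 also have "\<dots> <= ennreal e"
  using j n i1 i2 by (intro ennreal_leI) (simp add: B_def)
 finally have "(\<integral>\<^sup>+x. indicator K x * ennreal \<bar>h x - cl B (g n x)\<bar> \<partial>lborel) <= ennreal e" .
 moreover have "continuous_on UNIV (%x. cl B (g n x))"
  by (rule continuous_on_compose2[OF cl_cont g(1)]) auto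
 ultimately show ?thesis by blast
qed

lemma mollify_integrand_integrable:
 fixes h :: "real^'n::finite => 'b::{banach, second_countable_topology}"
 assumes h: "loc_int k h" and d: "0 < d" and x: "x \<in> half_space k"
 shows "integrable lborel (%y. mker d y *\<^sub>R h (x + y))"
proof -
 let ?K = "cbox (\<chi> i. x $ i + d) (\<chi> i. x $ i + 2 * d)"
 have K: "compact ?K" "?K \<subseteq> half_space k"
  using x d by (auto simp: half_space_def mem_box_cart compact_cbox dest!: spec[of _ k])
 obtain B where B: "!!y::real^'n. mker d y <= B" using mker_bounded[OF d] by blast
 have [measurable]: "h \<in> borel_measurable borel" using h by (simp add: loc_int_def)
 note [measurable] = mker_measurable[OF d]
 have hK: "integrable lborel (%x. indicator ?K x *\<^sub>R h x)" using h K by (auto simp: loc_int_def)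
 have z: "mker d (y - x) = 0" if "y \<notin> ?K" for y
 proof (rule ccontr)
  assume nz: "mker d (y - x) ~= 0"
  have "x $ i + d <= y $ i & y $ i <= x $ i + 2 * d" for i
  using mker_support[OF d nz, of i] by auto
  then show False using that by (simp add: mem_box_cart)
 qed
 have "integrable lborel (%y. mker d (y - x) *\<^sub>R h y)"
  by (intro integrable_mult_compact_support[OF hK, where B=B]) (simp_all add: mker_abs[OF d] B z)
 then have "integrable lborel (%y. mker d (x + y - x) *\<^sub>R h (x + y))"
  by (subst lborel_integral_translate(2)[of "%y. mker d (y - x) *\<^sub>R h y" x])
 then show ?thesis by simp
qed

lemma nn_integral_mker:
 assumes d: "0 < d" shows "(\<integral>\<^sup>+y. ennreal (mker d (y::real^'n::finite)) \<partial>lborel) = 1"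
 using nn_integral_eq_integral[OF mker_integrable[OF d] AE_I2[OF mker_nonneg[OF d]]]
 by (simp add: mker_integral[OF d])

lemma mollify_L1_convergence:
 fixes h :: "real^'n::finite => real"
 assumes h: "loc_int k h" and e: "0 < e"
 shows "\<exists>d>0. (\<integral>\<^sup>+x. indicator (hs_exh k m) x * ennreal \<bar>mollify d h x - h x\<bar> \<partial>hs_meas k 0) <= ennreal e"
proof -
 let ?n = "CARD('n)" let ?\<nu> = "hs_meas k 0"
 let ?K = "hs_exh k m" and ?K' = "hs_exh k (m + 2 * ?n)"
 have hm [measurable]: "h \<in> borel_measurable borel" using h by (simp add: loc_int_def)
 have cK: "compact ?K" "compact ?K'" by (rule compact_hs_exh)+
 have [measurable]: "?K \<in> sets borel" "?K' \<in> sets borel" using cK by (auto intro: borel_compact)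
 have hK': "integrable lborel (%x. indicator ?K' x *\<^sub>R h x)"
  using h cK hs_exh_subset[of k] by (auto simp: loc_int_def)
 obtain c where c: "continuous_on UNIV c" "(\<integral>\<^sup>+x. indicator ?K' x * ennreal \<bar>h x - c x\<bar> \<partial>lborel) <= ennreal (e / 3)"
  using continuous_L1_approximation[OF hm cK(2) hK', of "e / 3"] e by auto
 have [measurable]: "c \<in> borel_measurable borel" by (rule borel_measurable_continuous_onI[OF c(1)])
 define V where "V = measure ?\<nu> ?K"
 have "emeasure ?\<nu> ?K < \<infinity>" using compact_imp_bounded[OF cK(1)] by (intro emeasure_hs_meas_bounded) auto
 then have V: "emeasure ?\<nu> ?K = ennreal V" "0 <= V" by (auto simp: V_def emeasure_eq_ennreal_measure)
 define \<eta> where "\<eta> = e / (3 * (V + 1))"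
 have \<eta>: "0 < \<eta>" using e V(2) by (simp add: \<eta>_def)
 have uc: "uniformly_continuous_on ?K' c"
  by (intro compact_uniformly_continuous cK continuous_on_subset[OF c(1)]) auto
 from uc[unfolded uniformly_continuous_on_def, rule_format, OF \<eta>]
 obtain r where r: "0 < r" "!!x y. x \<in> ?K' ==> y \<in> ?K' ==> dist y x < r ==> dist (c y) (c x) < \<eta>" by blast
 define d where "d = min 1 (r / (2 * real ?n + 1) / 2)"
 have d: "0 < d" using r by (simp add: d_def)
 note [measurable] = mker_measurable[OF d] mollify_measurable[OF d hm]
 have dn: "norm y <= real (2 * ?n)" "norm y < r" "0 <= y $ k" if "mker d y ~= 0" for y :: "real^'n"
 proof -
  have 1: "norm y <= real ?n * (2 * d)" by (rule mker_norm[OF d that])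
  have "real ?n * (2 * d) <= real ?n * (2 * 1)" by (intro mult_left_mono) (auto simp: d_def)
  also have "\<dots> = real (2 * ?n)" by simp
  finally show "norm y <= real (2 * ?n)" using 1 by linarith
  have "real ?n * (2 * d) <= real ?n * (2 * (r / (2 * real ?n + 1) / 2))" by (intro mult_left_mono) (auto simp: d_def)
  also have "\<dots> < r" using r(1) by (simp add: field_simps add_pos_nonneg)
  finally show "norm y < r" using 1 by linarith
  show "0 <= y $ k" using mker_support[OF d that, of k] d by simp
 qed
 have KK: "x + y \<in> ?K'" "x \<in> ?K'" if "x \<in> ?K" "mker d y ~= 0" for x y
 proof -
  have x: "norm x <= real m" "1 / real (Suc m) <= x $ k" using that by (auto simp: hs_exh_def)
  have q: "1 / real (Suc (m + 2 * ?n)) <= 1 / real (Suc m)" by (simp add: field_simps)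
  show "x \<in> ?K'" using x q by (auto simp: hs_exh_def)
  have "norm (x + y) <= real m + real (2 * ?n)" using norm_triangle_ineq[of x y] x dn[OF that(2)] by linarith
  then show "x + y \<in> ?K'" using x q dn(3)[OF that(2)] by (auto simp: hs_exh_def)
 qed
 let ?u = "%x. indicator ?K' x * ennreal \<bar>h x - c x\<bar>"
 have pt: "indicator ?K x * ennreal \<bar>mollify d h x - h x\<bar> <=
  (\<integral>\<^sup>+y. ennreal (mker d y) * ?u (x + y) \<partial>lborel) + ennreal \<eta> * indicator ?K x + ?u x" for x
 proof (cases "x \<in> ?K")
  case True
  then have x\<Omega>: "x \<in> half_space k" using hs_exh_subset[of k m] by blast
  have i1: "integrable lborel (%y. mker d y * h (x + y))"
  using mollify_integrand_integrable[OF h d x\<Omega>] by simp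
  have i2: "integrable lborel (%y. mker d y * h x)"
  by (intro integrable_mult_left mker_integrable[OF d])
  have "mollify d h x - h x = (\<integral>y. mker d y * h (x + y) - mker d y * h x \<partial>lborel)"
  unfolding Bochner_Integration.integral_diff[OF i1 i2] using mker_integral[OF d, where 'n='n] by (simp add: mollify_def)
  then have "ennreal \<bar>mollify d h x - h x\<bar> <= (\<integral>\<^sup>+y. ennreal (norm (mker d y * h (x + y) - mker d y * h x)) \<partial>lborel)"
  using integral_norm_bound_ennreal[OF Bochner_Integration.integrable_diff[OF i1 i2]] by simp
  also have "\<dots> <= (\<integral>\<^sup>+y. ennreal (mker d y) * ?u (x + y) + ennreal (mker d y) * (ennreal \<eta> + ?u x) \<partial>lborel)"
  proof (intro nn_integral_mono)
  fix y
  show "ennreal (norm (mker d y * h (x + y) - mker d y * h x)) <=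
  ennreal (mker d y) * ?u (x + y) + ennreal (mker d y) * (ennreal \<eta> + ?u x)"
  proof (cases "mker d y = 0")
  case False
  note xy = KK[OF True False]
  have "dist (c (x + y)) (c x) < \<eta>" using dn(2)[OF False] by (intro r(2) xy) (simp add: dist_norm)
  then have "\<bar>h (x + y) - h x\<bar> <= \<bar>h (x + y) - c (x + y)\<bar> + (\<eta> + \<bar>h x - c x\<bar>)" by (simp add: dist_real_def)
  then have "mker d y * \<bar>h (x + y) - h x\<bar> <= mker d y * (\<bar>h (x + y) - c (x + y)\<bar> + (\<eta> + \<bar>h x - c x\<bar>))"
  by (intro mult_left_mono mker_nonneg[OF d])
  then have "ennreal (norm (mker d y * h (x + y) - mker d y * h x)) <=
  ennreal (mker d y * (\<bar>h (x + y) - c (x + y)\<bar> + (\<eta> + \<bar>h x - c x\<bar>)))"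
  by (intro ennreal_leI) (simp add: right_diff_distrib[symmetric] abs_mult mker_abs[OF d])
  then show ?thesis
  using xy \<eta> mker_nonneg[OF d, of y] by (simp add: ennreal_mult ennreal_plus distrib_left)
  qed simp
  qed
  also have "\<dots> = (\<integral>\<^sup>+y. ennreal (mker d y) * ?u (x + y) \<partial>lborel) + (ennreal \<eta> + ?u x)"
  by (subst nn_integral_add) (auto simp: nn_integral_multc nn_integral_mker[OF d])
  finally show ?thesis using True by (simp add: add.assoc)
 qed simp
 have u\<nu>: "(\<integral>\<^sup>+x. ?u x \<partial>?\<nu>) <= ennreal (e / 3)"
 proof -
  have "(\<integral>\<^sup>+x. ?u x \<partial>?\<nu>) <= (\<integral>\<^sup>+x. ?u x \<partial>lborel)"
  by (subst nn_integral_hs_meas, simp) (auto intro!: nn_integral_mono simp: indicator_def weight_def half_space_def)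
  then show ?thesis using c(2) by (rule order_trans)
 qed
 have "(\<integral>\<^sup>+x. indicator ?K x * ennreal \<bar>mollify d h x - h x\<bar> \<partial>?\<nu>) <=
  (\<integral>\<^sup>+x. (\<integral>\<^sup>+y. ennreal (mker d y) * ?u (x + y) \<partial>lborel) + ennreal \<eta> * indicator ?K x + ?u x \<partial>?\<nu>)"
  by (intro nn_integral_mono pt)
 also have "\<dots> = (\<integral>\<^sup>+x. (\<integral>\<^sup>+y. ennreal (mker d y) * ?u (x + y) \<partial>lborel) \<partial>?\<nu>) + ennreal \<eta> * emeasure ?\<nu> ?K + (\<integral>\<^sup>+x. ?u x \<partial>?\<nu>)"
  by (subst nn_integral_add, simp, simp, subst nn_integral_add, simp, simp) (simp add: nn_integral_cmult_indicator)
 also have "\<dots> <= ennreal (e / 3) + ennreal \<eta> * ennreal V + ennreal (e / 3)"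
  using u\<nu> shift_average_le[of ?u d 0 k] d unfolding V(1) by (intro add_mono) (auto intro: order_trans)
 also have "\<dots> = ennreal (e / 3 + \<eta> * V + e / 3)"
  using e \<eta> V(2) by (simp add: ennreal_mult[symmetric] ennreal_plus[symmetric] del: ennreal_plus)
 also have "\<dots> <= ennreal e"
 proof (intro ennreal_leI)
  have "\<eta> * V <= \<eta> * (V + 1)" using \<eta> by (intro mult_left_mono) auto
  also have "\<dots> = e / 3" proof -
  have "V + 1 ~= 0" using V(2) by simp
  then show ?thesis by (simp add: \<eta>_def divide_simps)
  qed
  finally show "e / 3 + \<eta> * V + e / 3 <= e" by simp
 qed
 finally show ?thesis using d by blast
qed

text \<open>Along a sequence with summable \<open>L\<^sup>1\<close> errors on an exhaustion, convergence almost everywhere follows from Borel--Cantelli type summability; this replaces the Lebesgue differentiation theorem.\<close>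

lemma mollify_converges_AE:
 fixes h :: "real^'n::finite => real"
 assumes h: "loc_int k h"
 shows "\<exists>d. (\<forall>j. 0 < d j) & (AE x in hs_meas k a. (%j::nat. mollify (d j) h x) \<longlonglongrightarrow> h x)"
proof -
 let ?\<nu> = "hs_meas k 0"
 have hm [measurable]: "h \<in> borel_measurable borel" using h by (simp add: loc_int_def)
 have "\<forall>j::nat. \<exists>d. 0 < d & (\<integral>\<^sup>+x. indicator (hs_exh k j) x * ennreal \<bar>mollify d h x - h x\<bar> \<partial>?\<nu>) <= ennreal ((1/2) ^ j)"
 proof
  fix j :: nat
  have "0 < (1/2 :: real) ^ j" by simp
  from mollify_L1_convergence[OF h this]
  show "\<exists>d. 0 < d & (\<integral>\<^sup>+x. indicator (hs_exh k j) x * ennreal \<bar>mollify d h x - h x\<bar> \<partial>?\<nu>) <= ennreal ((1/2) ^ j)" .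
 qed
 from choice[OF this] obtain d where d: "!!j::nat. 0 < d j"
  and le: "!!j. (\<integral>\<^sup>+x. indicator (hs_exh k j) x * ennreal \<bar>mollify (d j) h x - h x\<bar> \<partial>?\<nu>) <= ennreal ((1/2) ^ j)" by blast
 have [measurable]: "hs_exh k j \<in> sets borel" for j by (intro borel_compact compact_hs_exh)
 have [measurable]: "mollify (d j) h \<in> borel_measurable borel" for j by (intro mollify_measurable d hm)
 let ?t = "%j x. indicator (hs_exh k j) x * ennreal \<bar>mollify (d j) h x - h x\<bar>"
 have "(\<integral>\<^sup>+x. (\<Sum>j. ?t j x) \<partial>?\<nu>) = (\<Sum>j. \<integral>\<^sup>+x. ?t j x \<partial>?\<nu>)" by (rule nn_integral_suminf) measurable
 also have "\<dots> <= (\<Sum>j. ennreal ((1/2) ^ j))" by (intro suminf_le le) auto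
 also have "\<dots> < \<infinity>" by (subst suminf_ennreal2) (auto intro: summable_geometric)
 finally have "AE x in ?\<nu>. (\<Sum>j. ?t j x) ~= \<infinity>" by (intro nn_integral_PInf_AE) auto
 then have "AE x in lborel. x \<in> half_space k --> (\<Sum>j. ?t j x) ~= \<infinity>"
  by (subst (asm) AE_hs_meas) auto
 then have "AE x in hs_meas k a. x \<in> half_space k --> (\<Sum>j. ?t j x) ~= \<infinity>" by (rule AE_hs_measI)
 then have "AE x in hs_meas k a. (%j. mollify (d j) h x) \<longlonglongrightarrow> h x"
  using hs_meas_in
 proof eventually_elim
  case (elim x)
  have "x \<in> (\<Union>m. hs_exh k m)" using elim(2) unfolding UN_hs_exh .
  then obtain m where m: "x \<in> hs_exh k m" by blast
  have mj: "x \<in> hs_exh k j" if "m <= j" for j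
  using subsetD[OF lift_Suc_mono_le[of "hs_exh k", OF hs_exh_mono that] m] .
  let ?r = "%j. indicator (hs_exh k j) x * \<bar>mollify (d j) h x - h x\<bar>"
  have t: "?t j x = ennreal (?r j)" for j by (cases "x \<in> hs_exh k j") simp_all
  have "(\<Sum>j. ennreal (?r j)) ~= top" using elim(1) elim(2) unfolding t by (simp only: infinity_ennreal_def simp_thms)
  then have "summable ?r" by (intro summable_suminf_not_top) simp_all
  then have "?r \<longlonglongrightarrow> 0" by (rule summable_LIMSEQ_zero)
  then have "(%j. \<bar>mollify (d j) h x - h x\<bar>) \<longlonglongrightarrow> 0"
  by (rule Lim_transform_eventually) (auto simp: eventually_sequentially mj intro!: exI[of _ m])
  then show ?case by (simp add: tendsto_rabs_zero_iff LIM_zero_iff)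
 qed
 then show ?thesis using d by blast
qed

section \<open>From smooth functions to Sobolev functions\<close>

text \<open>A smooth approximation of the absolute value from below. It vanishes to second order at zero, which supplies the quadratic growth that the first variation needs, and has slope at most one, so that the energy does not increase.\<close>

definition sabs :: "real => real => real" where
 "sabs e t = sqrt (t\<^sup>2 + e\<^sup>2) - e"

lemma sabs_lipschitz: "\<bar>sabs e t - sabs e s\<bar> <= \<bar>t - s\<bar>"
 using norm_triangle_ineq3[of "(t, e)" "(s, e)"] by (simp add: sabs_def norm_Pair)

lemma sabs:
 assumes e: "0 < e"
 shows sabs_nonneg: "0 <= sabs e t" and sabs_le: "sabs e t <= \<bar>t\<bar>"
  and sabs_eq_0_iff: "sabs e t = 0 \<longleftrightarrow> t = 0" and sabs_quadratic: "sabs e t <= t\<^sup>2 / (2 * e)"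
  and sabs_ge: "\<bar>t\<bar> - e <= sabs e t"
  and sabs_derivative: "(sabs e has_real_derivative t / sqrt (t\<^sup>2 + e\<^sup>2)) (at t)"
  and sabs_slope: "\<bar>t / sqrt (t\<^sup>2 + e\<^sup>2)\<bar> <= 1"
proof -
 show "0 <= sabs e t" using e real_le_rsqrt[of e "t\<^sup>2 + e\<^sup>2"] by (simp add: sabs_def)
 show "sabs e t <= \<bar>t\<bar>" using sabs_lipschitz[of e t 0] e by (simp add: sabs_def)
 show "sabs e t = 0 \<longleftrightarrow> t = 0"
 proof
  assume "sabs e t = 0"
  then have "(sqrt (t\<^sup>2 + e\<^sup>2))\<^sup>2 = e\<^sup>2" by (simp add: sabs_def)
  then show "t = 0" by simp
 qed (use e in \<open>simp add: sabs_def\<close>)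
 have "(e + t\<^sup>2 / (2 * e))\<^sup>2 = e\<^sup>2 + t\<^sup>2 + (t\<^sup>2 / (2 * e))\<^sup>2" using e by (simp add: power2_sum)
 then have "t\<^sup>2 + e\<^sup>2 <= (e + t\<^sup>2 / (2 * e))\<^sup>2" by simp
 then have "sqrt (t\<^sup>2 + e\<^sup>2) <= e + t\<^sup>2 / (2 * e)" using e by (intro real_le_lsqrt) auto
 then show "sabs e t <= t\<^sup>2 / (2 * e)" by (simp add: sabs_def)
 have "\<bar>t\<bar> <= sqrt (t\<^sup>2 + e\<^sup>2)" by (intro real_le_rsqrt) simp
 then show "\<bar>t\<bar> - e <= sabs e t" by (simp add: sabs_def)
 have pos: "0 < t\<^sup>2 + e\<^sup>2" using e by (simp add: add_nonneg_pos)
 then show "(sabs e has_real_derivative t / sqrt (t\<^sup>2 + e\<^sup>2)) (at t)"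
  unfolding sabs_def[abs_def] by (auto intro!: derivative_eq_intros simp: field_simps)
 show "\<bar>t / sqrt (t\<^sup>2 + e\<^sup>2)\<bar> <= 1" using pos \<open>\<bar>t\<bar> <= sqrt (t\<^sup>2 + e\<^sup>2)\<close> by (simp add: abs_divide divide_le_eq_1)
qed

lemma sabs_measurable [measurable]: "sabs e \<in> borel_measurable borel"
 unfolding sabs_def[abs_def] by measurable

lemma sabs_tendsto: "(%j. t j) \<longlonglongrightarrow> s ==> (%j. sabs e (t j)) \<longlonglongrightarrow> sabs e s"
 unfolding sabs_def by (intro tendsto_intros)

lemma fatou_bound:
 fixes f :: "nat => 'a => real"
 assumes f: "!!j. integrable M (f j)" and g [measurable]: "g \<in> borel_measurable M"
  and nn: "!!j. AE x in M. 0 <= f j x" and lim: "AE x in M. (%j. f j x) \<longlonglongrightarrow> g x"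
  and le: "!!j. (\<integral>x. f j x \<partial>M) <= c j" and c: "c \<longlonglongrightarrow> C"
 shows "integrable M g" "(\<integral>x. g x \<partial>M) <= C"
proof -
 have [measurable]: "f j \<in> borel_measurable M" for j using f by auto
 have c0: "0 <= c j" for j using integral_nonneg_AE[OF nn[of j]] le[of j] by linarith
 then have C0: "0 <= C" using c by (intro LIMSEQ_le_const[OF c]) auto
 have nnA: "AE x in M. \<forall>j. 0 <= f j x" using nn by (simp add: AE_all_countable)
 have g0: "AE x in M. 0 <= g x"
  using nnA lim by eventually_elim (auto intro: LIMSEQ_le_const)
 have "(\<integral>\<^sup>+x. ennreal (g x) \<partial>M) = (\<integral>\<^sup>+x. liminf (%j. ennreal (f j x)) \<partial>M)"
  using lim by (intro nn_integral_cong_AE) (auto elim!: eventually_mono intro!: lim_imp_Liminf[symmetric] tendsto_ennrealI)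
 also have "\<dots> <= liminf (%j. \<integral>\<^sup>+x. ennreal (f j x) \<partial>M)" by (rule nn_integral_liminf) measurable
 also have "\<dots> <= liminf (%j. ennreal (c j))"
 proof (intro Liminf_mono always_eventually allI)
  fix j
  have "(\<integral>\<^sup>+x. ennreal (f j x) \<partial>M) = ennreal (\<integral>x. f j x \<partial>M)" by (rule nn_integral_eq_integral[OF f nn])
  also have "\<dots> <= ennreal (c j)" by (rule ennreal_leI[OF le])
  finally show "(\<integral>\<^sup>+x. ennreal (f j x) \<partial>M) <= ennreal (c j)" .
 qed
 also have "\<dots> = ennreal C" by (intro lim_imp_Liminf tendsto_ennrealI c) simp
 finally have *: "(\<integral>\<^sup>+x. ennreal (g x) \<partial>M) <= ennreal C" .
 show int: "integrable M g"
  using g0 * by (intro integrableI_nonneg) (auto simp: top_unique less_top[symmetric] le_less_trans[OF _ ennreal_less_top])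
 have "ennreal (\<integral>x. g x \<partial>M) <= ennreal C" using * by (subst nn_integral_eq_integral[OF int g0, symmetric])
 then show "(\<integral>x. g x \<partial>M) <= C" using C0 by (simp add: ennreal_le_iff)
qed

text \<open>Convexity of the power, with a free parameter that is sent to zero at the end to absorb the gradient of the cutoff.\<close>

lemma powr_add_le_split:
 fixes A B p \<theta> :: real
 assumes "0 <= A" "0 <= B" "1 <= p" "0 < \<theta>" "\<theta> < 1"
 shows "(A + B) powr p <= (1 - \<theta>) powr (1 - p) * A powr p + \<theta> powr (1 - p) * B powr p"
proof (cases "A + B = 0")
 case False
 then have t: "0 < A + B" using assms by simp
 let ?t = "A + B"
 have "(1 - \<theta>) * (?t powr p + p * ?t powr (p - 1) * (A / (1 - \<theta>) - ?t)) <= (1 - \<theta>) * (A / (1 - \<theta>)) powr p"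
  using assms by (intro mult_left_mono powr_tangent t) auto
 moreover have "\<theta> * (?t powr p + p * ?t powr (p - 1) * (B / \<theta> - ?t)) <= \<theta> * (B / \<theta>) powr p"
  using assms by (intro mult_left_mono powr_tangent t) auto
 moreover have "(1 - \<theta>) * (?t powr p + p * ?t powr (p - 1) * (A / (1 - \<theta>) - ?t)) = (1 - \<theta>) * ?t powr p + p * ?t powr (p - 1) * (A - (1 - \<theta>) * ?t)"
  using assms by (simp add: field_simps)
 moreover have "\<theta> * (?t powr p + p * ?t powr (p - 1) * (B / \<theta> - ?t)) = \<theta> * ?t powr p + p * ?t powr (p - 1) * (B - \<theta> * ?t)"
  using assms by (simp add: field_simps)
 moreover have "(1 - \<theta>) * (A / (1 - \<theta>)) powr p = (1 - \<theta>) powr (1 - p) * A powr p" "\<theta> * (B / \<theta>) powr p = \<theta> powr (1 - p) * B powr p"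
  using assms by (simp_all add: powr_divide powr_diff)
 ultimately have "((1 - \<theta>) * ?t powr p + p * ?t powr (p - 1) * (A - (1 - \<theta>) * ?t)) + (\<theta> * ?t powr p + p * ?t powr (p - 1) * (B - \<theta> * ?t))
  <= (1 - \<theta>) powr (1 - p) * A powr p + \<theta> powr (1 - p) * B powr p" by linarith
 then show ?thesis by (simp add: algebra_simps)
qed simp

text \<open>Squaring the positive part makes the cutoff differentiable everywhere.\<close>

definition cutoff :: "real => real^'n::finite => real" where
 "cutoff R x = (max 0 (1 - (norm x)\<^sup>2 / R\<^sup>2))\<^sup>2"

definition cutoff_grad :: "real => real^'n::finite => real^'n" where
 "cutoff_grad R x = (- 4 * max 0 (1 - (norm x)\<^sup>2 / R\<^sup>2) / R\<^sup>2) *\<^sub>R x"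

lemma square_pos_part_derivative: "((%t::real. (max 0 t)\<^sup>2) has_real_derivative 2 * max 0 t) (at t)"
proof -
 consider "t < 0" | "t > 0" | "t = 0" by linarith
 then show ?thesis
 proof cases
  case 1
  have "((%_. 0) has_real_derivative 0) (at t)" by simp
  then have "((%t::real. (max 0 t)\<^sup>2) has_real_derivative 0) (at t)"
  by (rule has_field_derivative_transform_within_open[where S="{..<0}"]) (use 1 in auto)
  then show ?thesis using 1 by simp
 next
  case 2
  have "((%t. t\<^sup>2) has_real_derivative 2 * t) (at t)" by (auto intro!: derivative_eq_intros)
  then have "((%t::real. (max 0 t)\<^sup>2) has_real_derivative 2 * t) (at t)"
  by (rule has_field_derivative_transform_within_open[where S="{0<..}"]) (use 2 in auto)
  then show ?thesis using 2 by simp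
 next
  case 3
  have "((%h::real. \<bar>h\<bar>) \<longlongrightarrow> 0) (at 0)" by (auto intro!: tendsto_eq_intros)
  then have "((%h::real. (max 0 h)\<^sup>2 / h) \<longlongrightarrow> 0) (at 0)"
  by (rule Lim_null_comparison[rotated]) (auto simp: power2_eq_square max_def intro!: always_eventually)
  then show ?thesis using 3 by (simp add: DERIV_def)
 qed
qed

lemma cutoff:
 assumes R: "0 < R"
 shows cutoff_bounds: "0 <= cutoff R x" "cutoff R x <= 1" and cutoff_far: "R < norm x ==> cutoff R x = 0"
  and cutoff_grad_far: "R < norm x ==> cutoff_grad R x = 0" and cutoff_grad_le: "norm (cutoff_grad R x) <= 4 / R"
  and cutoff_derivative: "(cutoff R has_derivative (%h. cutoff_grad R x \<bullet> h)) (at x)"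
proof -
 let ?m = "max 0 (1 - (norm x)\<^sup>2 / R\<^sup>2)"
 have m: "0 <= ?m" "?m <= 1" using R by auto
 show "0 <= cutoff R x" "cutoff R x <= 1" using m by (auto simp: cutoff_def power_le_one)
 have far: "?m = 0" if "R < norm x"
 proof -
  have "R\<^sup>2 <= (norm x)\<^sup>2" using that R by (intro power_mono) auto
  then show ?thesis using R by simp
 qed
 then show "R < norm x ==> cutoff R x = 0" "R < norm x ==> cutoff_grad R x = 0"
  by (simp_all add: cutoff_def cutoff_grad_def)
 show "norm (cutoff_grad R x) <= 4 / R"
 proof (cases "R < norm x")
  case True then show ?thesis using far R by (simp add: cutoff_grad_def)
 next
  case False
  have "norm (cutoff_grad R x) = 4 * ?m / R\<^sup>2 * norm x" using m by (simp add: cutoff_grad_def)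
  also have "\<dots> <= 4 * 1 / R\<^sup>2 * R" using m False R by (intro mult_mono divide_right_mono) auto
  also have "\<dots> = 4 / R" using R by (simp add: power2_eq_square)
  finally show ?thesis .
 qed
 have "((%x. 1 - (norm x)\<^sup>2 / R\<^sup>2) has_derivative (%h. - (2 * (x \<bullet> h)) / R\<^sup>2)) (at x)"
 proof -
  have "((%x. 1 - c * (x \<bullet> x)) has_derivative (%h. - (c * (2 * (x \<bullet> h))))) (at x)" for c
  by (auto intro!: derivative_eq_intros simp: inner_commute)
  from this[of "1 / R\<^sup>2"] show ?thesis by (simp add: power2_norm_eq_inner)
 qed
 from has_derivative_compose[OF this square_pos_part_derivative[of "1 - (norm x)\<^sup>2 / R\<^sup>2", unfolded has_field_derivative_def]]
 have "(cutoff R has_derivative (%h. 2 * ?m * (- (2 * (x \<bullet> h)) / R\<^sup>2))) (at x)" by (simp add: cutoff_def[abs_def])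
 moreover have "(%h. 2 * ?m * (- (2 * (x \<bullet> h)) / R\<^sup>2)) = (%h. cutoff_grad R x \<bullet> h)"
  by (auto simp: cutoff_grad_def)
 ultimately show "(cutoff R has_derivative (%h. cutoff_grad R x \<bullet> h)) (at x)" by simp
qed

lemma cutoff_measurable [measurable]: "cutoff R \<in> borel_measurable borel" "cutoff_grad R \<in> borel_measurable borel"
 unfolding cutoff_def[abs_def] cutoff_grad_def[abs_def] by measurable

lemma cutoff_tendsto:
 assumes "filterlim R at_top sequentially" shows "(%j. cutoff (R j) x) \<longlonglongrightarrow> 1"
proof -
 have "filterlim (%j. (R j)\<^sup>2) at_top sequentially" using assms by (intro filterlim_pow_at_top) auto
 then have "(%j. (norm x)\<^sup>2 / (R j)\<^sup>2) \<longlonglongrightarrow> 0" by (intro tendsto_divide_0[OF tendsto_const] filterlim_at_top_imp_at_infinity)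
 then have "(%j. (max 0 (1 - (norm x)\<^sup>2 / (R j)\<^sup>2))\<^sup>2) \<longlonglongrightarrow> (max 0 (1 - 0))\<^sup>2" by (intro tendsto_intros)
 then show ?thesis by (simp add: cutoff_def)
qed

text \<open>The dual norm is a supremum of linear functionals, each of which commutes with the integral.\<close>

lemma dual_norm_integral_le:
 fixes V :: "'a => real^'n::finite"
 assumes N: "is_norm N" and V: "integrable M V"
 shows "integrable M (%y. dual_norm N (V y))" "dual_norm N (\<integral>y. V y \<partial>M) <= (\<integral>y. dual_norm N (V y) \<partial>M)"
proof -
 obtain C where C: "0 < C" "!!x. dual_norm N x <= C * norm x" using is_norm_upper[OF is_norm_dual_norm[OF N]] by blast
 note [measurable] = is_norm_borel[OF is_norm_dual_norm[OF N]] borel_measurable_integrable[OF V]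
 note nn = is_normD(1)[OF is_norm_dual_norm[OF N]]
 show int: "integrable M (%y. dual_norm N (V y))"
 proof (rule Bochner_Integration.integrable_bound)
  show "integrable M (%y. C * norm (V y))" using V by (intro integrable_mult_right integrable_norm)
  show "AE y in M. norm (dual_norm N (V y)) <= norm (C * norm (V y))" using C nn by (intro AE_I2) (simp add: abs_mult)
 qed measurable
 show "dual_norm N (\<integral>y. V y \<partial>M) <= (\<integral>y. dual_norm N (V y) \<partial>M)"
 proof (rule dual_norm_le[OF N])
  fix z assume z: "N z <= 1"
  have "(\<integral>y. V y \<partial>M) \<bullet> z = (\<integral>y. V y \<bullet> z \<partial>M)" by (rule integral_inner_left[symmetric]) (use V in simp)
  also have "\<dots> <= (\<integral>y. dual_norm N (V y) \<partial>M)"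
  using V by (intro integral_mono int integrable_inner_left dual_norm_ge[OF N z]) auto
  finally show "(\<integral>y. V y \<partial>M) \<bullet> z <= (\<integral>y. dual_norm N (V y) \<partial>M)" .
 qed
qed

text \<open>Jensen's inequality for the kernel followed by \<open>shift_average_le\<close>. The function \<open>Q\<close> is used both for the absolute value and for the dual norm.\<close>

lemma mollify_contraction:
 fixes h :: "real^'n::finite => 'b::{banach, second_countable_topology}" and Q :: "'b => real"
 assumes h: "loc_int k h" and d: "0 < d" and a: "0 <= a" and p: "1 <= p"
  and [measurable]: "Q \<in> borel_measurable borel" and Q: "!!z. 0 <= Q z"
  and sub: "!!x. x \<in> half_space k ==> Q (mollify d h x) <= (\<integral>y. mker d y * Q (h (x + y)) \<partial>lborel)"
  and int: "integrable (hs_meas k a) (%x. Q (h x) powr p)"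
 shows "integrable (hs_meas k a) (%x. Q (mollify d h x) powr p)"
  "(\<integral>x. Q (mollify d h x) powr p \<partial>hs_meas k a) <= (\<integral>x. Q (h x) powr p \<partial>hs_meas k a)"
proof -
 let ?\<mu> = "hs_meas k a"
 have hm [measurable]: "h \<in> borel_measurable borel" using h by (simp add: loc_int_def)
 note [measurable] = mker_measurable[OF d] mollify_measurable[OF d hm]
 have "(\<integral>\<^sup>+x. ennreal (Q (mollify d h x) powr p) \<partial>?\<mu>) <=
  (\<integral>\<^sup>+x. (\<integral>\<^sup>+y. ennreal (mker d y) * ennreal (Q (h (x + y)) powr p) \<partial>lborel) \<partial>?\<mu>)"
  using hs_meas_in
 proof (intro nn_integral_mono_AE, eventually_elim)
  fix x assume x: "x \<in> half_space k"
  have "ennreal (Q (mollify d h x) powr p) <= ennreal ((\<integral>y. mker d y * Q (h (x + y)) \<partial>lborel) powr p)"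
  using sub[OF x] Q p by (intro ennreal_leI powr_mono2) auto
  also have "\<dots> <= (\<integral>\<^sup>+y. ennreal (mker d y) * ennreal (Q (h (x + y)) powr p) \<partial>lborel)"
  using Q p by (intro jensen_powr mker_integrable mker_nonneg mker_integral d) auto
  finally show "ennreal (Q (mollify d h x) powr p) <= (\<integral>\<^sup>+y. ennreal (mker d y) * ennreal (Q (h (x + y)) powr p) \<partial>lborel)" .
 qed
 also have "\<dots> <= (\<integral>\<^sup>+x. ennreal (Q (h x) powr p) \<partial>?\<mu>)" by (rule shift_average_le[OF _ d a]) measurable
 also have "\<dots> = ennreal (\<integral>x. Q (h x) powr p \<partial>?\<mu>)" using int by (intro nn_integral_eq_integral) auto
 finally have *: "(\<integral>\<^sup>+x. ennreal (Q (mollify d h x) powr p) \<partial>?\<mu>) <= ennreal (\<integral>x. Q (h x) powr p \<partial>?\<mu>)" .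
 show i: "integrable ?\<mu> (%x. Q (mollify d h x) powr p)"
  using * by (intro integrableI_nonneg) (auto simp: less_top[symmetric] top_unique le_less_trans[OF _ ennreal_less_top])
 have "ennreal (\<integral>x. Q (mollify d h x) powr p \<partial>?\<mu>) <= ennreal (\<integral>x. Q (h x) powr p \<partial>?\<mu>)"
  using * by (subst nn_integral_eq_integral[OF i, symmetric]) auto
 then show "(\<integral>x. Q (mollify d h x) powr p \<partial>?\<mu>) <= (\<integral>x. Q (h x) powr p \<partial>?\<mu>)"
  by (subst (asm) ennreal_le_iff) (auto intro!: integral_nonneg_AE)
qed

lemma x_ln_x_bounds:
 fixes s :: real
 assumes "0 <= s" shows "- (2 * sqrt s) <= s * ln s" "s * ln s <= s * s"
proof -
 show "- (2 * sqrt s) <= s * ln s"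
 proof (cases "s = 0")
  case False
  then have s: "0 < s" using assms by simp
  have "ln (1 / sqrt s) <= 1 / sqrt s"
  using ln_le_minus_one[of "1 / sqrt s"] s by simp
  then have "- ln s <= 2 / sqrt s" using s by (simp add: ln_div ln_sqrt)
  then have "s * (- ln s) <= s * (2 / sqrt s)" using s by (intro mult_left_mono) auto
  also have "s * (2 / sqrt s) = 2 * (s / sqrt s)" by simp
  also have "s / sqrt s = sqrt s" using s by (intro real_div_sqrt) simp
  finally show ?thesis by simp
 qed simp
 show "s * ln s <= s * s"
 proof (cases "s = 0")
  case False
  then show ?thesis using assms ln_le_minus_one[of s] by (intro mult_left_mono) auto
 qed simp
qed

lemma tendsto_x_ln_x:
 fixes t :: "'a => real"
 assumes t: "(t \<longlongrightarrow> s) F" and nn: "!!j. 0 <= t j" and s: "0 <= s"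
 shows "((%j. t j * ln (t j)) \<longlongrightarrow> s * ln s) F"
proof (cases "s = 0")
 case False
 then show ?thesis using t by (intro tendsto_intros) auto
next
 case True
 have "((%j. 2 * sqrt (t j) + t j * t j) \<longlongrightarrow> 2 * sqrt 0 + 0 * 0) F"
  using t True by (intro tendsto_intros) auto
 then have "((%j. 2 * sqrt (t j) + t j * t j) \<longlongrightarrow> 0) F" by simp
 moreover have "\<bar>t j * ln (t j)\<bar> <= 2 * sqrt (t j) + t j * t j" for j
  using x_ln_x_bounds[OF nn[of j]] nn[of j] real_sqrt_ge_zero[OF nn[of j]] mult_nonneg_nonneg[OF nn[of j] nn[of j]]
  unfolding abs_le_iff by linarith
 ultimately have "((%j. t j * ln (t j)) \<longlongrightarrow> 0) F"
  by (intro Lim_null_comparison[of "%j. t j * ln (t j)"]) (auto intro!: always_eventually)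
 then show ?thesis using True by simp
qed

text \<open>A lower bound for the entropy density by an integrable function, required for Fatou's lemma; it degenerates as \<open>e\<close> tends to zero, which is why this limit is taken last.\<close>

lemma sabs_entropy_lower:
 assumes e: "0 < e" and p: "1 <= p"
 shows "- (2 * (2 * e) powr (- (p / 2)) * \<bar>t\<bar> powr p) <= sabs e t powr p * ln (sabs e t powr p)"
proof -
 have "sqrt (sabs e t powr p) = sabs e t powr (p / 2)"
  by (simp add: powr_half_sqrt[symmetric] powr_powr)
 also have "\<dots> <= (t\<^sup>2 / (2 * e)) powr (p / 2)"
  using sabs_nonneg[OF e] sabs_quadratic[OF e] p by (intro powr_mono2) auto
 also have "\<dots> = (t\<^sup>2) powr (p / 2) / (2 * e) powr (p / 2)"
  using e by (subst powr_divide) auto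
 also have "(t\<^sup>2) powr (p / 2) = \<bar>t\<bar> powr p"
 proof (cases "t = 0")
  case False
  then have "t\<^sup>2 = \<bar>t\<bar> powr 2" by simp
  then have "(t\<^sup>2) powr (p / 2) = (\<bar>t\<bar> powr 2) powr (p / 2)" by (rule arg_cong)
  then show ?thesis by (simp only: powr_powr) simp
 qed (use p in simp)
 also have "\<bar>t\<bar> powr p / (2 * e) powr (p / 2) = (2 * e) powr (- (p / 2)) * \<bar>t\<bar> powr p"
  by (simp add: powr_minus_divide)
 finally have "2 * sqrt (sabs e t powr p) <= 2 * (2 * e) powr (- (p / 2)) * \<bar>t\<bar> powr p" by (simp add: mult_ac)
 then show ?thesis using x_ln_x_bounds(1)[of "sabs e t powr p"] by simp
qed

text \<open>A radial cost with the Young inequality attached to it. Truncation to \<open>N y < \<rho>\<close> keeps the second factor of Prekopa--Leindler boundedly supported.\<close>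

locale entropy_profile =
 fixes k :: "'n::finite" and a p K \<rho> Z :: real and N :: "real^'n => real" and v :: "real => real"
 assumes N: "is_norm N" and a: "0 <= a" and p: "1 <= p"
  and v_meas: "v \<in> borel_measurable borel"
  and v: "!!t. 0 <= t ==> 0 <= v t" and K: "0 <= K"
  and young: "!!A t. 0 <= A ==> 0 <= t ==> t < \<rho> ==> p * A * t - v t <= K * A powr p"
  and Z: "ennreal Z = (\<integral>\<^sup>+y. ennreal (exp (- v (N y))) * indicator {y. N y < \<rho>} y \<partial>hs_meas k a)" "0 < Z"
begin

abbreviation "\<Omega> \<equiv> half_space k"
abbreviation "\<mu> \<equiv> hs_meas k a"

lemma smooth_entropy_le:
 fixes w :: "real^'n => real" and gw :: "real^'n => real^'n"
 assumes e: "0 < e" and w_meas: "w \<in> borel_measurable borel" and gw_meas: "gw \<in> borel_measurable borel"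
  and w_le: "!!x. x \<in> \<Omega> ==> \<bar>w x\<bar> <= U" and L: "0 <= L"
  and w_lip: "!!x y. x \<in> \<Omega> ==> y \<in> \<Omega> ==> \<bar>w x - w y\<bar> <= L * norm (x - y)"
  and w_supp: "!!x. x \<in> \<Omega> ==> R < norm x ==> w x = 0" and R: "0 <= R"
  and w_diff: "!!x. x \<in> \<Omega> ==> (w has_derivative (%h. gw x \<bullet> h)) (at x)"
  and gw_int: "integrable \<mu> (%x. dual_norm N (gw x) powr p)"
 shows "integrable \<mu> (%x. sabs e (w x) powr p)"
  "integrable \<mu> (%x. sabs e (w x) powr p * ln (sabs e (w x) powr p))"
  "M = (\<integral>x. sabs e (w x) powr p \<partial>\<mu>) ==>
  (\<integral>x. sabs e (w x) powr p * ln (sabs e (w x) powr p) \<partial>\<mu>) <=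
  M * ln M - eff_dim TYPE('n) a * M - M * ln Z + K * (\<integral>x. dual_norm N (gw x) powr p \<partial>\<mu>)"
proof -
 note [measurable] = w_meas gw_meas v_meas is_norm_borel[OF is_norm_dual_norm[OF N]]
 define u where "u x = sabs e (w x)" for x
 define s where "s x = w x / sqrt ((w x)\<^sup>2 + e\<^sup>2)" for x
 define D where "D x = s x *\<^sub>R gw x" for x
 have [measurable]: "u \<in> borel_measurable borel" "s \<in> borel_measurable borel" unfolding u_def s_def by measurable
 have Dm [measurable]: "D \<in> borel_measurable borel" unfolding D_def by measurable
 have s1: "\<bar>s x\<bar> <= 1" for x unfolding s_def by (rule sabs_slope[OF e])
 have dn: "dual_norm N (D x) <= dual_norm N (gw x)" for x
  using s1[of x] is_normD(1)[OF is_norm_dual_norm[OF N], of "gw x"]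
  by (simp add: D_def is_norm_scale[OF is_norm_dual_norm[OF N]] mult_left_le_one_le)
 have dnp: "dual_norm N (D x) powr p <= dual_norm N (gw x) powr p" for x
  using dn p is_normD(1)[OF is_norm_dual_norm[OF N], of "D x"] by (intro powr_mono2) auto
 have D_int: "integrable \<mu> (%x. dual_norm N (D x) powr p)"
  by (rule Bochner_Integration.integrable_bound[OF gw_int]) (use dnp in auto)
 interpret fv: first_variation k a p L U "L\<^sup>2 / (2 * e)" R 0 K \<rho> N u D v
 proof (unfold_locales)
  fix x y assume x: "x \<in> \<Omega>" and y: "y \<in> \<Omega>" and u0: "u x = 0"
  then have "w x = 0" using sabs_eq_0_iff[OF e] by (simp add: u_def)
  then have "\<bar>w y\<bar> <= L * norm (x - y)" using w_lip[OF x y] by simp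
  then have "(w y)\<^sup>2 <= (L * norm (x - y))\<^sup>2" using L by (subst abs_le_square_iff[symmetric]) (simp add: abs_mult)
  then have "(w y)\<^sup>2 / (2 * e) <= (L * norm (x - y))\<^sup>2 / (2 * e)" using e by (intro divide_right_mono) auto
  then show "u y <= L\<^sup>2 / (2 * e) * (norm (x - y))\<^sup>2"
  using sabs_quadratic[OF e, of "w y"] by (simp add: u_def power_mult_distrib)
 next
  fix x assume x: "x \<in> \<Omega>"
  show "0 <= u x" using sabs_nonneg[OF e] by (simp add: u_def)
  show "u x <= U" using sabs_le[OF e, of "w x"] w_le[OF x] by (simp add: u_def)
  show "u x = 0" if "R < norm x" using w_supp[OF x that] sabs_eq_0_iff[OF e] by (simp add: u_def)
  have "((%x. sabs e (w x)) has_derivative (%h. s x * (gw x \<bullet> h))) (at x)"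
  using has_derivative_compose[OF w_diff[OF x] sabs_derivative[OF e, of "w x", unfolded has_field_derivative_def]]
  by (simp add: s_def)
  then show "(u has_derivative (%h. D x \<bullet> h)) (at x)" by (simp add: u_def[abs_def] D_def)
  fix y assume y: "y \<in> \<Omega>"
  show "\<bar>u x - u y\<bar> <= L * norm (x - y)"
  unfolding u_def by (rule order_trans[OF sabs_lipschitz w_lip[OF x y]])
 qed (use N a p K v young L R e D_int in auto)
 have Fe: "fv.F = (%x. sabs e (w x) powr p)" by (simp add: fun_eq_iff fv.F_def u_def)
 show "integrable \<mu> (%x. sabs e (w x) powr p)"
  using fv.F_integrable unfolding Fe .
 show "integrable \<mu> (%x. sabs e (w x) powr p * ln (sabs e (w x) powr p))"
  using fv.F_ln_F_integrable unfolding Fe .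
 assume M: "M = (\<integral>x. sabs e (w x) powr p \<partial>\<mu>)"
 have nnE: "0 <= (\<integral>x. dual_norm N (gw x) powr p \<partial>\<mu>)" by (intro integral_nonneg_AE) auto
 show "(\<integral>x. sabs e (w x) powr p * ln (sabs e (w x) powr p) \<partial>\<mu>) <=
  M * ln M - eff_dim TYPE('n) a * M - M * ln Z + K * (\<integral>x. dual_norm N (gw x) powr p \<partial>\<mu>)"
 proof (cases "M = 0")
  case True
  then have "AE x in \<mu>. sabs e (w x) powr p = 0"
  using integral_nonneg_eq_0_iff_AE[OF fv.F_integrable AE_I2[OF fv.F_nonneg]] M unfolding Fe by simp
  then have "(\<integral>x. sabs e (w x) powr p * ln (sabs e (w x) powr p) \<partial>\<mu>) = (\<integral>x. 0 \<partial>\<mu>)"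
  by (intro integral_cong_AE) (auto elim!: eventually_mono)
  then show ?thesis using True K nnE by simp
 next
  case False
  moreover have "0 <= M" unfolding M by (intro integral_nonneg_AE) auto
  ultimately have "0 < M" by simp
  have "(\<integral>x. fv.F x * ln (fv.F x) \<partial>\<mu>) <= M * ln M - eff_dim TYPE('n) a * M - M * ln Z + K * (\<integral>x. dual_norm N (D x) powr p \<partial>\<mu>)"
  using \<open>0 < M\<close> Z M by (intro fv.entropy_le) (auto simp: fv.F_def u_def)
  also have "K * (\<integral>x. dual_norm N (D x) powr p \<partial>\<mu>) <= K * (\<integral>x. dual_norm N (gw x) powr p \<partial>\<mu>)"
  by (intro mult_left_mono K integral_mono D_int gw_int dnp)
  finally show ?thesis by (simp add: fv.F_def u_def)
 qed
qed


lemma convex_half_space: "convex \<Omega>"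
proof (rule convexI)
 fix x y :: "real^'n" and s t :: real
 assume "x \<in> \<Omega>" "y \<in> \<Omega>" "0 <= s" "0 <= t" "s + t = 1"
 then show "s *\<^sub>R x + t *\<^sub>R y \<in> \<Omega>"
  by (cases "s = 0") (auto simp: half_space_def intro!: add_pos_nonneg)
qed

lemma truncated_mollification_entropy_le:
 fixes f :: "real^'n => real" and g :: "real^'n => real^'n"
 assumes f: "loc_int k f" and g: "loc_int k g"
  and weak: "!!\<phi> i. test_function \<Omega> \<phi> ==> (\<integral>x. f x * partial i \<phi> x \<partial>lborel) = - (\<integral>x. g x $ i * \<phi> x \<partial>lborel)"
  and mass: "integrable \<mu> (%x. \<bar>f x\<bar> powr p)" "(\<integral>x. \<bar>f x\<bar> powr p \<partial>\<mu>) = 1"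
  and energy: "integrable \<mu> (%x. dual_norm N (g x) powr p)"
  and e: "0 < e" and d: "0 < d" and R: "0 < R" and \<theta>: "0 < \<theta>" "\<theta> < 1"
  and C: "0 < C" "!!x. dual_norm N x <= C * norm x"
 defines "w \<equiv> %x. cutoff R x * mollify d f x"
 defines "M \<equiv> \<integral>x. sabs e (w x) powr p \<partial>\<mu>"
 shows "integrable \<mu> (%x. \<bar>w x\<bar> powr p)" "(\<integral>x. \<bar>w x\<bar> powr p \<partial>\<mu>) <= 1"
  "integrable \<mu> (%x. sabs e (w x) powr p)"
  "integrable \<mu> (%x. sabs e (w x) powr p * ln (sabs e (w x) powr p))"
  "(\<integral>x. sabs e (w x) powr p * ln (sabs e (w x) powr p) \<partial>\<mu>) <=
  M * ln M - eff_dim TYPE('n) a * M - M * ln Z +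
  K * ((1 - \<theta>) powr (1 - p) * (\<integral>x. dual_norm N (g x) powr p \<partial>\<mu>) + \<theta> powr (1 - p) * (C * (4 / R)) powr p)"
proof -
 have fm [measurable]: "f \<in> borel_measurable borel" and gm [measurable]: "g \<in> borel_measurable borel"
  using f g by (simp_all add: loc_int_def)
 note [measurable] = is_norm_borel[OF is_norm_dual_norm[OF N]] mollify_measurable[OF d fm] mollify_measurable[OF d gm]
 note dual = is_normD[OF is_norm_dual_norm[OF N]]
 define gw where "gw x = cutoff R x *\<^sub>R mollify d g x + mollify d f x *\<^sub>R cutoff_grad R x" for x
 have wm [measurable]: "w \<in> borel_measurable borel" unfolding w_def by measurable
 have gwm [measurable]: "gw \<in> borel_measurable borel" unfolding gw_def by measurable
 note cb = cutoff_bounds[OF R]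
 have fd: "integrable \<mu> (%x. \<bar>mollify d f x\<bar> powr p)" "(\<integral>x. \<bar>mollify d f x\<bar> powr p \<partial>\<mu>) <= 1"
 proof -
  have sub: "\<bar>mollify d f x\<bar> <= (\<integral>y. mker d y * \<bar>f (x + y)\<bar> \<partial>lborel)" for x
  using integral_abs_bound[of lborel "%y. mker d y *\<^sub>R f (x + y)"]
  by (simp add: mollify_def abs_mult mker_abs[OF d])
  show "integrable \<mu> (%x. \<bar>mollify d f x\<bar> powr p)"
  by (rule mollify_contraction(1)[OF f d a p, where Q=abs]) (use sub mass in auto)
  have "(\<integral>x. \<bar>mollify d f x\<bar> powr p \<partial>\<mu>) <= (\<integral>x. \<bar>f x\<bar> powr p \<partial>\<mu>)"
  by (rule mollify_contraction(2)[OF f d a p, where Q=abs]) (use sub mass in auto)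
  then show "(\<integral>x. \<bar>mollify d f x\<bar> powr p \<partial>\<mu>) <= 1" using mass by simp
 qed
 have gd: "integrable \<mu> (%x. dual_norm N (mollify d g x) powr p)"
  "(\<integral>x. dual_norm N (mollify d g x) powr p \<partial>\<mu>) <= (\<integral>x. dual_norm N (g x) powr p \<partial>\<mu>)"
 proof -
  have sub: "dual_norm N (mollify d g x) <= (\<integral>y. mker d y * dual_norm N (g (x + y)) \<partial>lborel)" if "x \<in> \<Omega>" for x
  using dual_norm_integral_le(2)[OF N mollify_integrand_integrable[OF g d that]]
  by (simp add: mollify_def dual(3) mker_abs[OF d])
  show "integrable \<mu> (%x. dual_norm N (mollify d g x) powr p)"
  by (rule mollify_contraction(1)[OF g d a p _ dual(1) sub energy]) measurable
  show "(\<integral>x. dual_norm N (mollify d g x) powr p \<partial>\<mu>) <= (\<integral>x. dual_norm N (g x) powr p \<partial>\<mu>)"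
  by (rule mollify_contraction(2)[OF g d a p _ dual(1) sub energy]) measurable
 qed
 have wle: "\<bar>w x\<bar> <= \<bar>mollify d f x\<bar>" for x
  using cb[of x] by (simp add: w_def abs_mult mult_left_le_one_le)
 have wle_p: "\<bar>w x\<bar> powr p <= \<bar>mollify d f x\<bar> powr p" for x
  using wle p by (intro powr_mono2) auto
 show wi: "integrable \<mu> (%x. \<bar>w x\<bar> powr p)"
  by (rule Bochner_Integration.integrable_bound[OF fd(1)]) (use wle_p in auto)
 have "(\<integral>x. \<bar>w x\<bar> powr p \<partial>\<mu>) <= (\<integral>x. \<bar>mollify d f x\<bar> powr p \<partial>\<mu>)"
  by (intro integral_mono wi fd wle_p)
 then show "(\<integral>x. \<bar>w x\<bar> powr p \<partial>\<mu>) <= 1" using fd(2) by simp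
 obtain B0 where B0: "!!x. x \<in> \<Omega> ==> norm x <= R ==> norm (mollify d f x) <= B0"
  using mollify_bounded[OF f d] by blast
 obtain B1 where B1: "!!x. x \<in> \<Omega> ==> norm x <= R ==> norm (mollify d g x) <= B1"
  using mollify_bounded[OF g d] by blast
 define U where "U = max B0 0"
 define L where "L = max B1 0 + U * (4 / R)"
 have U: "\<bar>w x\<bar> <= U" if "x \<in> \<Omega>" for x
  using wle[of x] B0[OF that] cutoff_far[OF R, of x] by (cases "norm x <= R") (auto simp: U_def w_def)
 have L0: "0 <= L" using R by (simp add: L_def U_def)
 have gwL: "norm (gw x) <= L" if "x \<in> \<Omega>" for x
 proof (cases "norm x <= R")
  case True
  have "norm (gw x) <= \<bar>cutoff R x\<bar> * norm (mollify d g x) + \<bar>mollify d f x\<bar> * norm (cutoff_grad R x)"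
  unfolding gw_def by (rule order_trans[OF norm_triangle_ineq]) simp
  also have "\<dots> <= 1 * max B1 0 + U * (4 / R)"
  using cb[of x] B1[OF that True] B0[OF that True] cutoff_grad_le[OF R, of x]
  by (intro add_mono mult_mono) (auto simp: U_def)
  finally show ?thesis by (simp add: L_def)
 next
  case False
  then show ?thesis using L0 by (simp add: gw_def cutoff_far[OF R] cutoff_grad_far[OF R])
 qed
 have wd: "(w has_derivative (%h. gw x \<bullet> h)) (at x)" if "x \<in> \<Omega>" for x
 proof -
  have "(w has_derivative (%h. cutoff R x * (mollify d g x \<bullet> h) + (cutoff_grad R x \<bullet> h) * mollify d f x)) (at x)"
  unfolding w_def by (rule has_derivative_mult[OF cutoff_derivative[OF R] mollify_has_derivative[OF f g weak d that]])
  then show ?thesis by (simp add: gw_def inner_add_left mult.commute)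
 qed
 have wlip: "\<bar>w x - w y\<bar> <= L * norm (x - y)" if "x \<in> \<Omega>" "y \<in> \<Omega>" for x y
 proof -
  have "norm (w x - w y) <= L * norm (x - y)"
  proof (rule differentiable_bound[OF convex_half_space _ _ that])
  show "(w has_derivative (%h. gw z \<bullet> h)) (at z within \<Omega>)" if "z \<in> \<Omega>" for z
  by (rule has_derivative_at_withinI[OF wd[OF that]])
  show "onorm (%h. gw z \<bullet> h) <= L" if "z \<in> \<Omega>" for z
  proof (rule onorm_le)
  fix h
  have "norm (gw z \<bullet> h) <= norm (gw z) * norm h" by (simp add: Cauchy_Schwarz_ineq2)
  also have "\<dots> <= L * norm h" by (intro mult_right_mono gwL that) simp
  finally show "norm (gw z \<bullet> h) <= L * norm h" .
  qed
  qed
  then show ?thesis by simp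
 qed
 have gw_bound: "dual_norm N (gw x) powr p <= (1 - \<theta>) powr (1 - p) * dual_norm N (mollify d g x) powr p +
  \<theta> powr (1 - p) * ((C * (4 / R)) powr p * \<bar>mollify d f x\<bar> powr p)" for x
 proof -
  have 1: "dual_norm N (gw x) <= dual_norm N (mollify d g x) + C * (4 / R) * \<bar>mollify d f x\<bar>"
  proof -
  have "dual_norm N (gw x) <= \<bar>cutoff R x\<bar> * dual_norm N (mollify d g x) + \<bar>mollify d f x\<bar> * dual_norm N (cutoff_grad R x)"
  unfolding gw_def by (rule order_trans[OF dual(4)]) (simp add: dual(3))
  also have "\<dots> <= 1 * dual_norm N (mollify d g x) + \<bar>mollify d f x\<bar> * (C * (4 / R))"
  proof (intro add_mono mult_mono)
  show "dual_norm N (cutoff_grad R x) <= C * (4 / R)"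
  by (rule order_trans[OF C(2) mult_left_mono[OF cutoff_grad_le[OF R]]]) (use C in simp)
  qed (use cb[of x] dual(1) in auto)
  finally show ?thesis by (simp add: mult.commute)
  qed
  have "dual_norm N (gw x) powr p <= (dual_norm N (mollify d g x) + C * (4 / R) * \<bar>mollify d f x\<bar>) powr p"
  using 1 dual(1) p by (intro powr_mono2) auto
  also have "\<dots> <= (1 - \<theta>) powr (1 - p) * dual_norm N (mollify d g x) powr p + \<theta> powr (1 - p) * (C * (4 / R) * \<bar>mollify d f x\<bar>) powr p"
  using dual(1) C R p \<theta> by (intro powr_add_le_split) auto
  also have "(C * (4 / R) * \<bar>mollify d f x\<bar>) powr p = (C * (4 / R)) powr p * \<bar>mollify d f x\<bar> powr p"
  by (subst powr_mult) (use C R in auto)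
  finally show ?thesis .
 qed
 have bi: "integrable \<mu> (%x. (1 - \<theta>) powr (1 - p) * dual_norm N (mollify d g x) powr p +
  \<theta> powr (1 - p) * ((C * (4 / R)) powr p * \<bar>mollify d f x\<bar> powr p))"
  using gd fd by (intro Bochner_Integration.integrable_add integrable_mult_right)
 have gwi: "integrable \<mu> (%x. dual_norm N (gw x) powr p)"
  by (rule Bochner_Integration.integrable_bound[OF bi]) (use gw_bound in \<open>auto intro: order_trans[OF _ abs_ge_self]\<close>)
 have "(\<integral>x. dual_norm N (gw x) powr p \<partial>\<mu>) <= (\<integral>x. (1 - \<theta>) powr (1 - p) * dual_norm N (mollify d g x) powr p +
  \<theta> powr (1 - p) * ((C * (4 / R)) powr p * \<bar>mollify d f x\<bar> powr p) \<partial>\<mu>)"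
  by (intro integral_mono gwi bi gw_bound)
 also have "\<dots> = (1 - \<theta>) powr (1 - p) * (\<integral>x. dual_norm N (mollify d g x) powr p \<partial>\<mu>) +
  \<theta> powr (1 - p) * ((C * (4 / R)) powr p * (\<integral>x. \<bar>mollify d f x\<bar> powr p \<partial>\<mu>))"
  using gd fd by simp
 also have "\<dots> <= (1 - \<theta>) powr (1 - p) * (\<integral>x. dual_norm N (g x) powr p \<partial>\<mu>) + \<theta> powr (1 - p) * ((C * (4 / R)) powr p * 1)"
  using gd(2) fd(2) by (intro add_mono mult_left_mono) auto
 finally have energy_le: "(\<integral>x. dual_norm N (gw x) powr p \<partial>\<mu>) <=
  (1 - \<theta>) powr (1 - p) * (\<integral>x. dual_norm N (g x) powr p \<partial>\<mu>) + \<theta> powr (1 - p) * (C * (4 / R)) powr p" by simp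
 have wsupp: "w x = 0" if "R < norm x" for x using cutoff_far[OF R that] by (simp add: w_def)
 note sm = smooth_entropy_le[OF e wm gwm U L0 wlip wsupp less_imp_le[OF R] wd gwi]
 show "integrable \<mu> (%x. sabs e (w x) powr p)"
  "integrable \<mu> (%x. sabs e (w x) powr p * ln (sabs e (w x) powr p))"
  by (rule sm; assumption)+
 have "(\<integral>x. sabs e (w x) powr p * ln (sabs e (w x) powr p) \<partial>\<mu>) <=
  M * ln M - eff_dim TYPE('n) a * M - M * ln Z + K * (\<integral>x. dual_norm N (gw x) powr p \<partial>\<mu>)"
  by (rule sm) (auto simp: M_def)
 also have "K * (\<integral>x. dual_norm N (gw x) powr p \<partial>\<mu>) <=
  K * ((1 - \<theta>) powr (1 - p) * (\<integral>x. dual_norm N (g x) powr p \<partial>\<mu>) + \<theta> powr (1 - p) * (C * (4 / R)) powr p)"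
  by (intro mult_left_mono energy_le K)
 finally show "(\<integral>x. sabs e (w x) powr p * ln (sabs e (w x) powr p) \<partial>\<mu>) <=
  M * ln M - eff_dim TYPE('n) a * M - M * ln Z +
  K * ((1 - \<theta>) powr (1 - p) * (\<integral>x. dual_norm N (g x) powr p \<partial>\<mu>) + \<theta> powr (1 - p) * (C * (4 / R)) powr p)" by simp
qed


theorem regularized_entropy_le:
 fixes f :: "real^'n => real" and g :: "real^'n => real^'n"
 assumes f: "loc_int k f" and g: "loc_int k g"
  and weak: "!!\<phi> i. test_function \<Omega> \<phi> ==> (\<integral>x. f x * partial i \<phi> x \<partial>lborel) = - (\<integral>x. g x $ i * \<phi> x \<partial>lborel)"
  and mass: "integrable \<mu> (%x. \<bar>f x\<bar> powr p)" "(\<integral>x. \<bar>f x\<bar> powr p \<partial>\<mu>) = 1"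
  and energy: "integrable \<mu> (%x. dual_norm N (g x) powr p)"
  and e: "0 < e"
 defines "M \<equiv> \<integral>x. sabs e (f x) powr p \<partial>\<mu>"
 shows "integrable \<mu> (%x. sabs e (f x) powr p * ln (sabs e (f x) powr p))" (is ?int)
  "(\<integral>x. sabs e (f x) powr p * ln (sabs e (f x) powr p) \<partial>\<mu>) <=
  M * ln M - eff_dim TYPE('n) a * M - M * ln Z + K * (\<integral>x. dual_norm N (g x) powr p \<partial>\<mu>)" (is ?le)
proof -
 have fm [measurable]: "f \<in> borel_measurable borel"
  using f by (simp_all add: loc_int_def)
 obtain C where C: "0 < C" "!!x. dual_norm N x <= C * norm x" using is_norm_upper[OF is_norm_dual_norm[OF N]] by blast
 obtain d where d: "!!j. 0 < d j" and dlim: "AE x in \<mu>. (%j::nat. mollify (d j) f x) \<longlonglongrightarrow> f x"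
  using mollify_converges_AE[OF f, of a] by blast
 define R where "R j = real j + 2" for j :: nat
 define \<theta> where "\<theta> j = 1 / (real j + 2)" for j :: nat
 have R: "0 < R j" and \<theta>: "0 < \<theta> j" "\<theta> j < 1" for j by (auto simp: R_def \<theta>_def)
 define w where "w j x = cutoff (R j) x * mollify (d j) f x" for j x
 define Mj where "Mj j = (\<integral>x. sabs e (w j x) powr p \<partial>\<mu>)" for j
 define E where "E = (\<integral>x. dual_norm N (g x) powr p \<partial>\<mu>)"
 define Ej where "Ej j = (1 - \<theta> j) powr (1 - p) * E + \<theta> j powr (1 - p) * (C * (4 / R j)) powr p" for j
 have tm1: "integrable \<mu> (%x. \<bar>w j x\<bar> powr p)" for j
  unfolding w_def by (rule truncated_mollification_entropy_le(1)[OF f g weak mass energy e d R \<theta> C])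
 have tm2: "(\<integral>x. \<bar>w j x\<bar> powr p \<partial>\<mu>) <= 1" for j
  unfolding w_def by (rule truncated_mollification_entropy_le(2)[OF f g weak mass energy e d R \<theta> C])
 have tm3: "integrable \<mu> (%x. sabs e (w j x) powr p)" for j
  unfolding w_def by (rule truncated_mollification_entropy_le(3)[OF f g weak mass energy e d R \<theta> C])
 have tm4: "integrable \<mu> (%x. sabs e (w j x) powr p * ln (sabs e (w j x) powr p))" for j
  unfolding w_def by (rule truncated_mollification_entropy_le(4)[OF f g weak mass energy e d R \<theta> C])
 have tm5: "(\<integral>x. sabs e (w j x) powr p * ln (sabs e (w j x) powr p) \<partial>\<mu>) <=
  Mj j * ln (Mj j) - eff_dim TYPE('n) a * Mj j - Mj j * ln Z + K * Ej j" for j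
  unfolding w_def Mj_def Ej_def E_def by (rule truncated_mollification_entropy_le(5)[OF f g weak mass energy e d R \<theta> C])
 note tm = tm1 tm2 tm3 tm4 tm5
 have wm: "w j \<in> borel_measurable borel" for j
  unfolding w_def using mollify_measurable[OF d fm] by measurable
 have sle: "sabs e t powr p <= \<bar>t\<bar> powr p" for t
  using sabs_le[OF e] sabs_nonneg[OF e] p by (intro powr_mono2) auto
 have Mj01: "Mj j \<in> {0..1}" for j
 proof -
  have "Mj j <= (\<integral>x. \<bar>w j x\<bar> powr p \<partial>\<mu>)" unfolding Mj_def by (intro integral_mono tm sle)
  then show ?thesis using tm(2)[of j] by (auto simp: Mj_def intro!: integral_nonneg_AE)
 qed
 obtain Ms r where r: "strict_mono (r :: nat => nat)" and Ms: "(Mj \<circ> r) \<longlonglongrightarrow> Ms"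
  using compact_Icc[of 0 "1::real"] Mj01 unfolding compact_def by (metis (no_types, lifting))
 have Ms': "(%j. Mj (r j)) \<longlonglongrightarrow> Ms" using Ms by (simp add: o_def)
 have wlim: "AE x in \<mu>. (%j. w (r j) x) \<longlonglongrightarrow> f x"
  using dlim
 proof eventually_elim
  case (elim x)
  have "filterlim R at_top sequentially" unfolding R_def by real_asymp
  then have "(%j. cutoff (R j) x) \<longlonglongrightarrow> 1" by (rule cutoff_tendsto)
  then have "(%j. w j x) \<longlonglongrightarrow> 1 * f x" unfolding w_def by (intro tendsto_mult elim)
  then show ?case using LIMSEQ_subseq_LIMSEQ[OF _ r] by (auto simp: o_def)
 qed
 have slim: "AE x in \<mu>. (%j. sabs e (w (r j) x) powr p) \<longlonglongrightarrow> sabs e (f x) powr p"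
  using wlim
 proof eventually_elim
  case (elim x)
  show ?case using p by (intro tendsto_powr' tendsto_const sabs_tendsto elim) (auto simp: sabs_nonneg[OF e])
 qed
 have alim: "AE x in \<mu>. (%j. \<bar>w (r j) x\<bar> powr p) \<longlonglongrightarrow> \<bar>f x\<bar> powr p"
  using wlim
 proof eventually_elim
  case (elim x)
  show ?case using p by (intro tendsto_powr' tendsto_const tendsto_rabs elim) auto
 qed
 have F1: "integrable \<mu> (%x. sabs e (f x) powr p)" "M <= Ms"
  unfolding M_def
  by (rule fatou_bound[OF tm(3) _ _ slim _ Ms'], simp, simp, simp add: Mj_def)+
 have "(\<integral>x. \<bar>f x\<bar> powr p - sabs e (f x) powr p \<partial>\<mu>) <= 1 - Ms"
 proof (rule fatou_bound(2))
  show "integrable \<mu> (%x. \<bar>w (r j) x\<bar> powr p - sabs e (w (r j) x) powr p)" for j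
  by (intro Bochner_Integration.integrable_diff tm)
  show "AE x in \<mu>. 0 <= \<bar>w (r j) x\<bar> powr p - sabs e (w (r j) x) powr p" for j using sle by simp
  show "AE x in \<mu>. (%j. \<bar>w (r j) x\<bar> powr p - sabs e (w (r j) x) powr p) \<longlonglongrightarrow> \<bar>f x\<bar> powr p - sabs e (f x) powr p"
  using alim slim by eventually_elim (rule tendsto_diff)
  show "(\<integral>x. \<bar>w (r j) x\<bar> powr p - sabs e (w (r j) x) powr p \<partial>\<mu>) <= 1 - Mj (r j)" for j
  using tm(1-3)[of "r j"] by (simp add: Mj_def)
  show "(%j. 1 - Mj (r j)) \<longlonglongrightarrow> 1 - Ms" by (intro tendsto_intros Ms')
 qed measurable
 then have MMs: "M = Ms" using F1 mass by (simp add: M_def)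
 have Elim: "(%j. Ej (r j)) \<longlonglongrightarrow> E"
 proof -
  have \<theta>0: "\<theta> \<longlonglongrightarrow> 0" unfolding \<theta>_def by real_asymp
  have "\<theta> j powr (1 - p) * (C * (4 / R j)) powr p = (C * 4) powr p * \<theta> j" for j
  proof -
  have "C * (4 / R j) = (C * 4) * \<theta> j" by (simp add: R_def \<theta>_def)
  then have "(C * (4 / R j)) powr p = (C * 4) powr p * \<theta> j powr p"
  using C \<theta>(1)[of j] by (simp only:) (subst powr_mult, auto)
  then have "\<theta> j powr (1 - p) * (C * (4 / R j)) powr p = (C * 4) powr p * (\<theta> j powr (1 - p) * \<theta> j powr p)" by simp
  also have "\<theta> j powr (1 - p) * \<theta> j powr p = \<theta> j" using \<theta>(1)[of j] by (simp flip: powr_add)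
  finally show ?thesis .
  qed
  then have "Ej = (%j. (1 - \<theta> j) powr (1 - p) * E + (C * 4) powr p * \<theta> j)" by (simp add: Ej_def fun_eq_iff)
  moreover have "(%j. (1 - \<theta> j) powr (1 - p) * E + (C * 4) powr p * \<theta> j) \<longlonglongrightarrow> (1 - 0) powr (1 - p) * E + (C * 4) powr p * 0"
  by (intro tendsto_intros \<theta>0) auto
  ultimately have "Ej \<longlonglongrightarrow> E" by simp
  then show ?thesis using LIMSEQ_subseq_LIMSEQ[OF _ r] by (auto simp: o_def)
 qed
 let ?h = "%t. sabs e t powr p * ln (sabs e t powr p)"
 define c where "c = 2 * (2 * e) powr (- (p / 2))"
 have hc: "0 <= ?h t + c * \<bar>t\<bar> powr p" for t
  using sabs_entropy_lower[OF e p, of t] by (simp add: c_def)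
 have c0: "0 <= c" by (simp add: c_def)
 let ?n = "eff_dim TYPE('n) a"
 let ?B = "%j. (Mj (r j) * ln (Mj (r j)) - ?n * Mj (r j) - Mj (r j) * ln Z + K * Ej (r j)) + c"
 have Ms0: "0 <= Ms" using Mj01 by (intro LIMSEQ_le_const[OF Ms']) auto
 have Blim: "?B \<longlonglongrightarrow> (Ms * ln Ms - ?n * Ms - Ms * ln Z + K * E) + c"
  using Mj01 by (intro tendsto_intros Ms' Elim tendsto_x_ln_x Ms0) auto
 have f3: "integrable \<mu> (%x. ?h (w (r j) x) + c * \<bar>w (r j) x\<bar> powr p)" for j
  by (intro Bochner_Integration.integrable_add integrable_mult_right tm)
 have l3: "AE x in \<mu>. (%j. ?h (w (r j) x) + c * \<bar>w (r j) x\<bar> powr p) \<longlonglongrightarrow> ?h (f x) + c * \<bar>f x\<bar> powr p"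
  using alim slim
 proof eventually_elim
  case (elim x)
  show ?case by (rule tendsto_add[OF tendsto_x_ln_x[OF elim(2)] tendsto_mult[OF tendsto_const elim(1)]]) auto
 qed
 have b3: "(\<integral>x. ?h (w (r j) x) + c * \<bar>w (r j) x\<bar> powr p \<partial>\<mu>) <= ?B j" for j
 proof -
  have "(\<integral>x. ?h (w (r j) x) + c * \<bar>w (r j) x\<bar> powr p \<partial>\<mu>) = (\<integral>x. ?h (w (r j) x) \<partial>\<mu>) + c * (\<integral>x. \<bar>w (r j) x\<bar> powr p \<partial>\<mu>)"
  using tm(1,4)[of "r j"] by simp
  also have "\<dots> <= (Mj (r j) * ln (Mj (r j)) - ?n * Mj (r j) - Mj (r j) * ln Z + K * Ej (r j)) + c * 1"
  using tm(2,5)[of "r j"] c0 by (intro add_mono mult_left_mono) auto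
  finally show ?thesis by simp
 qed
 have i3: "integrable \<mu> (%x. ?h (f x) + c * \<bar>f x\<bar> powr p)"
  and le3: "(\<integral>x. ?h (f x) + c * \<bar>f x\<bar> powr p \<partial>\<mu>) <= (Ms * ln Ms - ?n * Ms - Ms * ln Z + K * E) + c"
  by (rule fatou_bound[OF f3 _ _ l3 b3 Blim], measurable, use hc in simp)+
 have "integrable \<mu> (%x. (?h (f x) + c * \<bar>f x\<bar> powr p) - c * \<bar>f x\<bar> powr p)"
  by (intro Bochner_Integration.integrable_diff i3 integrable_mult_right mass)
 then show int: ?int by simp
 show ?le
  using le3 int mass MMs by (simp add: E_def)
qed


theorem entropy_le:
 fixes f :: "real^'n => real" and g :: "real^'n => real^'n"
 assumes f: "loc_int k f" and g: "loc_int k g"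
  and weak: "!!\<phi> i. test_function \<Omega> \<phi> ==> (\<integral>x. f x * partial i \<phi> x \<partial>lborel) = - (\<integral>x. g x $ i * \<phi> x \<partial>lborel)"
  and mass: "integrable \<mu> (%x. \<bar>f x\<bar> powr p)" "(\<integral>x. \<bar>f x\<bar> powr p \<partial>\<mu>) = 1"
  and energy: "integrable \<mu> (%x. dual_norm N (g x) powr p)"
 shows "(\<integral>\<^sup>+x. ennreal (\<bar>f x\<bar> powr p * ln (\<bar>f x\<bar> powr p)) \<partial>\<mu>) < \<infinity>"
  and "integrable \<mu> (%x. \<bar>f x\<bar> powr p * ln (\<bar>f x\<bar> powr p)) ==>
  (\<integral>x. \<bar>f x\<bar> powr p * ln (\<bar>f x\<bar> powr p) \<partial>\<mu>) <= K * (\<integral>x. dual_norm N (g x) powr p \<partial>\<mu>) - eff_dim TYPE('n) a - ln Z"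
proof -
 have fm [measurable]: "f \<in> borel_measurable borel"
  using f by (simp_all add: loc_int_def)
 let ?s = "%e x. sabs e (f x) powr p"
 note reg = regularized_entropy_le[OF f g weak mass energy]
 have sle: "?s e x <= \<bar>f x\<bar> powr p" if "0 < e" for e x
  using sabs_le[OF that] sabs_nonneg[OF that] p by (intro powr_mono2) auto
 let ?c = "2 powr p * (p * ln 2)"
 have pos: "\<bar>f x\<bar> powr p * ln (\<bar>f x\<bar> powr p) <= 2 powr p * \<bar>?s 1 x * ln (?s 1 x)\<bar> + ?c * \<bar>f x\<bar> powr p" for x
 proof -
  let ?t = "\<bar>f x\<bar>" and ?u = "sabs 1 (f x)"
  have c: "0 <= ?c" using p by simp
  consider "?t < 1" | "1 <= ?t" "?t < 2" | "2 <= ?t" by linarith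
  then show ?thesis
  proof cases
  case 1
  then have "?t powr p <= 1" using p by (intro powr_le1) auto
  moreover have "?t powr p * ln (?t powr p) <= ?t powr p * (?t powr p - 1)"
  using ln_le_minus_one[of "?t powr p"] by (cases "?t = 0") (auto intro!: mult_left_mono)
  moreover have "?t powr p * (?t powr p - 1) <= 0" if "?t powr p <= 1" using that by (intro mult_nonneg_nonpos) auto
  ultimately have "?t powr p * ln (?t powr p) <= 0" by linarith
  then show ?thesis using c by (intro order_trans[OF _ add_nonneg_nonneg]) auto
  next
  case 2
  have "ln (?t powr p) <= p * ln 2" using 2 p by (simp add: ln_powr)
  then have "?t powr p * ln (?t powr p) <= ?t powr p * (p * ln 2)" by (intro mult_left_mono) auto
  also have "\<dots> <= ?c * ?t powr p"
  using p ge_one_powr_ge_zero[of 2 p] mult_right_mono[of 1 "2 powr p" "p * ln 2 * ?t powr p"] by (simp add: mult_ac)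
  also have "\<dots> <= 2 powr p * \<bar>?s 1 x * ln (?s 1 x)\<bar> + ?c * ?t powr p" by simp
  finally show ?thesis .
  next
  case 3
  have u: "?t <= 2 * ?u" "1 <= ?u" using sabs_ge[of 1 "f x"] 3 by linarith+
  have up: "0 < ?s 1 x" "0 <= ln (?s 1 x)" using u p by (auto simp: ln_powr)
  have "?t powr p <= (2 * ?u) powr p" using u p by (intro powr_mono2) auto
  also have "\<dots> = 2 powr p * ?s 1 x" using u by (simp add: powr_mult)
  finally have t: "?t powr p <= 2 powr p * ?s 1 x" .
  have t1: "1 <= ?t powr p" using 3 p by (simp add: ge_one_powr_ge_zero)
  have "ln (?t powr p) <= ln (2 powr p * ?s 1 x)" using t t1 up(1) by (subst ln_le_cancel_iff) auto
  also have "\<dots> = p * ln 2 + ln (?s 1 x)" using up by (simp add: ln_mult ln_powr)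
  finally have l: "ln (?t powr p) <= p * ln 2 + ln (?s 1 x)" .
  have "?t powr p * ln (?t powr p) <= (2 powr p * ?s 1 x) * (p * ln 2 + ln (?s 1 x))"
  by (rule mult_mono[OF t l _ ln_ge_zero[OF t1]]) simp
  also have "\<dots> = 2 powr p * (?s 1 x * ln (?s 1 x)) + ?c * ?s 1 x" by (simp add: algebra_simps)
  also have "\<dots> <= 2 powr p * \<bar>?s 1 x * ln (?s 1 x)\<bar> + ?c * ?t powr p"
  using sle[of 1 x] c by (intro add_mono mult_left_mono) auto
  finally show ?thesis .
  qed
 qed
 have pi: "integrable \<mu> (%x. 2 powr p * \<bar>?s 1 x * ln (?s 1 x)\<bar> + ?c * \<bar>f x\<bar> powr p)"
  using reg(1)[of 1] mass by (intro Bochner_Integration.integrable_add integrable_mult_right integrable_abs) auto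
 have "(\<integral>\<^sup>+x. ennreal (\<bar>f x\<bar> powr p * ln (\<bar>f x\<bar> powr p)) \<partial>\<mu>) <=
  (\<integral>\<^sup>+x. ennreal (2 powr p * \<bar>?s 1 x * ln (?s 1 x)\<bar> + ?c * \<bar>f x\<bar> powr p) \<partial>\<mu>)"
  by (intro nn_integral_mono ennreal_leI pos)
 also have "\<dots> = ennreal (\<integral>x. 2 powr p * \<bar>?s 1 x * ln (?s 1 x)\<bar> + ?c * \<bar>f x\<bar> powr p \<partial>\<mu>)"
  using p by (intro nn_integral_eq_integral pi AE_I2 add_nonneg_nonneg mult_nonneg_nonneg) auto
 also have "\<dots> < \<infinity>" by simp
 finally show "(\<integral>\<^sup>+x. ennreal (\<bar>f x\<bar> powr p * ln (\<bar>f x\<bar> powr p)) \<partial>\<mu>) < \<infinity>" .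
 assume int: "integrable \<mu> (%x. \<bar>f x\<bar> powr p * ln (\<bar>f x\<bar> powr p))"
 define e where "e j = 1 / (real j + 1)" for j :: nat
 have e: "0 < e j" for j by (simp add: e_def)
 have e0: "e \<longlonglongrightarrow> 0" unfolding e_def by real_asymp
 have slim: "(%j. ?s (e j) x) \<longlonglongrightarrow> \<bar>f x\<bar> powr p" for x
 proof -
  have "(%j. sabs (e j) (f x)) \<longlonglongrightarrow> \<bar>f x\<bar>"
  proof (rule tendsto_sandwich)
  show "(%j. \<bar>f x\<bar> - e j) \<longlonglongrightarrow> \<bar>f x\<bar>" using tendsto_diff[OF tendsto_const e0, of "\<bar>f x\<bar>"] by simp
  show "(%j. \<bar>f x\<bar>) \<longlonglongrightarrow> \<bar>f x\<bar>" by simp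
  qed (auto intro!: always_eventually sabs_ge sabs_le e)
  then show ?thesis using p by (intro tendsto_powr' tendsto_const) (auto simp: sabs_nonneg[OF e])
 qed
 define M where "M j = (\<integral>x. ?s (e j) x \<partial>\<mu>)" for j
 have "M \<longlonglongrightarrow> (\<integral>x. \<bar>f x\<bar> powr p \<partial>\<mu>)"
  unfolding M_def by (rule integral_dominated_convergence[OF _ _ mass(1)]) (use slim sle[OF e] in auto)
 then have M1: "M \<longlonglongrightarrow> 1" using mass by simp
 have dom: "\<bar>s * ln s\<bar> <= \<bar>r * ln r\<bar> + r" if sr: "0 <= s" "s <= r" for s r :: real
 proof (cases "s = 0")
  case False
  then have s: "0 < s" using sr by simp
  have "s * ln s <= \<bar>r * ln r\<bar>"
  proof (cases "1 <= s")
  case True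
  then have "s * ln s <= r * ln r" using sr by (intro mult_mono) auto
  then show ?thesis by linarith
  next
  case False
  then have "s * ln s <= 0" using s by (intro mult_nonneg_nonpos) auto
  then show ?thesis by linarith
  qed
  moreover have "- (s * ln s) <= \<bar>r * ln r\<bar> + r"
  proof -
  have "- (s * ln s) = s * (- ln r) + s * ln (r / s)" using s sr by (simp add: ln_div algebra_simps)
  also have "s * ln (r / s) <= s * (r / s)" using s sr ln_le_minus_one[of "r / s"] by (intro mult_left_mono) auto
  also have "s * (r / s) = r" using s by simp
  also have "s * (- ln r) <= \<bar>r * ln r\<bar>"
  proof (cases "r <= 1")
  case True
  then have "s * (- ln r) <= r * (- ln r)" using s sr by (intro mult_right_mono) auto
  then show ?thesis by linarith
  next
  case False
  then have "s * (- ln r) <= 0" using s by (intro mult_nonneg_nonpos) auto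
  then show ?thesis by linarith
  qed
  finally show ?thesis by simp
  qed
  ultimately show ?thesis using sr by linarith
 qed (use sr in auto)
 let ?h = "%j x. ?s (e j) x * ln (?s (e j) x)"
 have "(%j. \<integral>x. ?h j x \<partial>\<mu>) \<longlonglongrightarrow> (\<integral>x. \<bar>f x\<bar> powr p * ln (\<bar>f x\<bar> powr p) \<partial>\<mu>)"
 proof (rule integral_dominated_convergence)
  show "integrable \<mu> (%x. \<bar>\<bar>f x\<bar> powr p * ln (\<bar>f x\<bar> powr p)\<bar> + \<bar>f x\<bar> powr p)"
  using int mass by (intro Bochner_Integration.integrable_add integrable_abs)
  show "AE x in \<mu>. norm (?h j x) <= \<bar>\<bar>f x\<bar> powr p * ln (\<bar>f x\<bar> powr p)\<bar> + \<bar>f x\<bar> powr p" for j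
  unfolding real_norm_def by (intro AE_I2 dom sle[OF e]) simp
  show "AE x in \<mu>. (%j. ?h j x) \<longlonglongrightarrow> \<bar>f x\<bar> powr p * ln (\<bar>f x\<bar> powr p)"
  by (intro AE_I2 tendsto_x_ln_x slim) auto
 qed measurable
 moreover have "(%j. M j * ln (M j) - eff_dim TYPE('n) a * M j - M j * ln Z + K * (\<integral>x. dual_norm N (g x) powr p \<partial>\<mu>)) \<longlonglongrightarrow>
  1 * ln 1 - eff_dim TYPE('n) a * 1 - 1 * ln Z + K * (\<integral>x. dual_norm N (g x) powr p \<partial>\<mu>)"
  by (intro tendsto_intros M1) auto
 moreover have "(\<integral>x. ?h j x \<partial>\<mu>) <= M j * ln (M j) - eff_dim TYPE('n) a * M j - M j * ln Z + K * (\<integral>x. dual_norm N (g x) powr p \<partial>\<mu>)" for j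
  unfolding M_def by (rule regularized_entropy_le(2)[OF f g weak mass energy e])
 ultimately have "(\<integral>x. \<bar>f x\<bar> powr p * ln (\<bar>f x\<bar> powr p) \<partial>\<mu>) <=
  1 * ln 1 - eff_dim TYPE('n) a * 1 - 1 * ln Z + K * (\<integral>x. dual_norm N (g x) powr p \<partial>\<mu>)"
  by (intro LIMSEQ_le) auto
 then show "(\<integral>x. \<bar>f x\<bar> powr p * ln (\<bar>f x\<bar> powr p) \<partial>\<mu>) <= K * (\<integral>x. dual_norm N (g x) powr p \<partial>\<mu>) - eff_dim TYPE('n) a - ln Z"
  by simp
qed

end

section \<open>The logarithmic Sobolev inequality\<close>

lemma sigma_finite_hs_meas: "sigma_finite_measure (hs_meas k a)"
 unfolding hs_meas_def
 by (subst sigma_finite_measure.sigma_finite_iff_density_finite[OF sigma_finite_lborel]) auto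

lemma nn_integral_tail_swap:
 fixes T :: "real^'n::finite => real" and w :: "real => ennreal"
 assumes [measurable]: "T \<in> borel_measurable borel" "w \<in> borel_measurable borel"
 shows "(\<integral>\<^sup>+x. (\<integral>\<^sup>+t. w t * indicator {T x..} t \<partial>lborel) \<partial>hs_meas k a) =
  (\<integral>\<^sup>+t. w t * emeasure (hs_meas k a) {x. T x <= t} \<partial>lborel)"
proof -
 interpret sigma_finite_measure "hs_meas k a" by (rule sigma_finite_hs_meas)
 interpret pair_sigma_finite lborel "hs_meas k a" ..
 have "(\<integral>\<^sup>+x. (\<integral>\<^sup>+t. w t * indicator {T x..} t \<partial>lborel) \<partial>hs_meas k a) =
  (\<integral>\<^sup>+x. (\<integral>\<^sup>+t. w t * indicator {x. T x <= t} x \<partial>lborel) \<partial>hs_meas k a)"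
  by (intro nn_integral_cong) (auto simp: indicator_def)
 also have "\<dots> = (\<integral>\<^sup>+t. (\<integral>\<^sup>+x. w t * indicator {x. T x <= t} x \<partial>hs_meas k a) \<partial>lborel)"
  by (rule Fubini') (simp add: indicator_def cong: if_cong)
 also have "\<dots> = (\<integral>\<^sup>+t. w t * emeasure (hs_meas k a) {x. T x <= t} \<partial>lborel)"
  by (intro nn_integral_cong, subst nn_integral_cmult) auto
 finally show ?thesis .
qed

text \<open>Fubini reduces a radial integral to the volumes of balls, which are known by homogeneity.\<close>

lemma nn_integral_norm_powr_tail:
 fixes k :: "'n::finite" and w :: "real => real"
 assumes N: "is_norm N" and a: "0 <= a" and q: "0 < q" and [measurable]: "w \<in> borel_measurable borel" and w: "!!t. 0 <= t ==> 0 <= w t"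
 shows "(\<integral>\<^sup>+x. (\<integral>\<^sup>+t. ennreal (w t) * indicator {N x powr q..} t \<partial>lborel) \<partial>hs_meas k a) =
  ennreal (half_ball_mass k a N) * (\<integral>\<^sup>+t. ennreal (indicator {0..} t * (w t * t powr (eff_dim TYPE('n) a / q))) \<partial>lborel)"
proof -
 note [measurable] = is_norm_borel[OF N]
 let ?m = "half_ball_mass k a N" and ?b = "eff_dim TYPE('n) a / q"
 have m: "0 < ?m" by (rule half_ball_mass_eq(2)[OF N a])
 have "emeasure (hs_meas k a) {x. N x powr q <= t} = ennreal (?m * t powr ?b)" if t: "0 < t" for t
 proof -
  have "N x powr q <= t \<longleftrightarrow> N x <= t powr (1 / q)" for x
  proof
  assume "N x powr q <= t"
  then have "(N x powr q) powr (1 / q) <= t powr (1 / q)" using q by (intro powr_mono2) auto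
  then show "N x <= t powr (1 / q)" using q is_normD(1)[OF N, of x] by (simp add: powr_powr)
  next
  assume "N x <= t powr (1 / q)"
  then have "N x powr q <= (t powr (1 / q)) powr q" using q is_normD(1)[OF N] by (intro powr_mono2) auto
  then show "N x powr q <= t" using q t by (simp add: powr_powr)
  qed
  then show ?thesis using emeasure_norm_ball[OF N a, of "t powr (1 / q)" k] t by (simp add: powr_powr mult.commute)
 qed
 moreover have "{x. N x powr q <= t} = {}" if "t < 0" for t using that by (auto simp: not_le intro: less_le_trans)
 ultimately have em: "ennreal (w t) * emeasure (hs_meas k a) {x. N x powr q <= t} =
  ennreal ?m * ennreal (indicator {0..} t * (w t * t powr ?b))" if "t ~= 0" for t
  using that m w[of t] by (cases "0 < t") (auto simp: ennreal_mult[symmetric] mult_ac)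
 have "(\<integral>\<^sup>+x. (\<integral>\<^sup>+t. ennreal (w t) * indicator {N x powr q..} t \<partial>lborel) \<partial>hs_meas k a) =
  (\<integral>\<^sup>+t. ennreal (w t) * emeasure (hs_meas k a) {x. N x powr q <= t} \<partial>lborel)"
  by (rule nn_integral_tail_swap) measurable
 also have "\<dots> = (\<integral>\<^sup>+t. ennreal ?m * ennreal (indicator {0..} t * (w t * t powr ?b)) \<partial>lborel)"
  using AE_lborel_singleton[of "0::real"] by (intro nn_integral_cong_AE) (auto elim!: eventually_mono simp: em)
 also have "\<dots> = ennreal ?m * (\<integral>\<^sup>+t. ennreal (indicator {0..} t * (w t * t powr ?b)) \<partial>lborel)"
  by (rule nn_integral_cmult) measurable
 finally show ?thesis .
qed

text \<open>The tail formula is applied with the weights \<open>exp (- t)\<close> and \<open>t exp (- t)\<close>, shifted by a boundary term, so that Euler's integral for Gamma appears.\<close>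

lemma exp_norm_powr_integral_unit:
 fixes k :: "'n::finite"
 assumes N: "is_norm N" and a: "0 <= a" and q: "0 < q"
 defines "b \<equiv> eff_dim TYPE('n) a / q" and "m \<equiv> half_ball_mass k a N"
 shows "integrable (hs_meas k a) (%x. exp (- (N x powr q)))"
  "(\<integral>x. exp (- (N x powr q)) \<partial>hs_meas k a) = Gamma (b + 1) * m"
  "integrable (hs_meas k a) (%x. N x powr q * exp (- (N x powr q)))"
  "(\<integral>x. N x powr q * exp (- (N x powr q)) \<partial>hs_meas k a) = b * (Gamma (b + 1) * m)"
proof -
 note [measurable] = is_norm_borel[OF N]
 let ?\<mu> = "hs_meas k a"
 have m: "0 < m" unfolding m_def by (rule half_ball_mass_eq(2)[OF N a])
 have b: "0 < b" using q a by (simp add: b_def eff_dim_def add_pos_nonneg)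
 have tail1: "(\<integral>\<^sup>+t. ennreal (exp (- t)) * indicator {s..} t \<partial>lborel) = ennreal (exp (- s))" for s :: real
 proof -
  have "(\<integral>\<^sup>+t. ennreal (exp (- t)) * indicator {s..} t \<partial>lborel) = 0 - (- exp (- s))"
  proof (rule nn_integral_FTC_atLeast)
  show "((%t. - exp (- t)) has_real_derivative exp (- t)) (at t)" for t :: real by (auto intro!: derivative_eq_intros)
  show "((%t::real. - exp (- t)) \<longlongrightarrow> 0) at_top" by real_asymp
  qed auto
  then show ?thesis by simp
 qed
 have tail2: "(\<integral>\<^sup>+t. ennreal (t * exp (- t)) * indicator {s..} t \<partial>lborel) = ennreal ((1 + s) * exp (- s))" if "0 <= s" for s :: real
 proof -
  have "(\<integral>\<^sup>+t. ennreal (t * exp (- t)) * indicator {s..} t \<partial>lborel) = 0 - (- ((1 + s) * exp (- s)))"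
  proof (rule nn_integral_FTC_atLeast)
  show "((%t. - ((1 + t) * exp (- t))) has_real_derivative t * exp (- t)) (at t)" for t :: real
  by (auto intro!: derivative_eq_intros simp: algebra_simps)
  show "((%t::real. - ((1 + t) * exp (- t))) \<longlongrightarrow> 0) at_top" by real_asymp
  qed (use that in auto)
  then show ?thesis by simp
 qed
 have e1: "(\<integral>\<^sup>+x. ennreal (exp (- (N x powr q))) \<partial>?\<mu>) = ennreal (Gamma (b + 1) * m)"
 proof -
  have "(\<integral>\<^sup>+x. ennreal (exp (- (N x powr q))) \<partial>?\<mu>) =
  (\<integral>\<^sup>+x. (\<integral>\<^sup>+t. ennreal (exp (- t)) * indicator {N x powr q..} t \<partial>lborel) \<partial>?\<mu>)"
  by (intro nn_integral_cong tail1[symmetric])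
  also have "\<dots> = ennreal m * (\<integral>\<^sup>+t. ennreal (indicator {0..} t * (exp (- t) * t powr b)) \<partial>lborel)"
  unfolding m_def b_def by (rule nn_integral_norm_powr_tail[OF N a q]) auto
  also have "(\<integral>\<^sup>+t. ennreal (indicator {0..} t * (exp (- t) * t powr b)) \<partial>lborel) = ennreal (Gamma (b + 1))"
  unfolding Gamma_conv_nn_integral_real[OF add_pos_pos[OF b zero_less_one]]
  by (intro nn_integral_cong) (auto simp: exp_minus divide_inverse mult_ac)
  finally show ?thesis using m b Gamma_real_pos[of "b + 1"] by (simp add: ennreal_mult[symmetric] mult.commute)
 qed
 have e2: "(\<integral>\<^sup>+x. ennreal ((1 + N x powr q) * exp (- (N x powr q))) \<partial>?\<mu>) = ennreal (Gamma (b + 2) * m)"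
 proof -
  have "(\<integral>\<^sup>+x. ennreal ((1 + N x powr q) * exp (- (N x powr q))) \<partial>?\<mu>) =
  (\<integral>\<^sup>+x. (\<integral>\<^sup>+t. ennreal (t * exp (- t)) * indicator {N x powr q..} t \<partial>lborel) \<partial>?\<mu>)"
  by (intro nn_integral_cong tail2[symmetric]) simp
  also have "\<dots> = ennreal m * (\<integral>\<^sup>+t. ennreal (indicator {0..} t * (t * exp (- t) * t powr b)) \<partial>lborel)"
  unfolding m_def b_def by (rule nn_integral_norm_powr_tail[OF N a q]) auto
  also have "(\<integral>\<^sup>+t. ennreal (indicator {0..} t * (t * exp (- t) * t powr b)) \<partial>lborel) = ennreal (Gamma (b + 2))"
  proof -
  have pos: "0 < b + 2" using b by simp
  have "indicator {0..} t * (t * exp (- t) * t powr b) = indicator {0..} t * t powr (b + 2 - 1) / exp t" for t :: real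
  proof (cases "0 < t")
  case True
  then have "t * t powr b = t powr (1 + b)" by (simp add: powr_add)
  then show ?thesis using True by (simp add: exp_minus divide_inverse mult_ac add.commute)
  qed (auto simp: indicator_def)
  then show ?thesis unfolding Gamma_conv_nn_integral_real[OF pos] by simp
  qed
  finally show ?thesis using m b Gamma_real_pos[of "b + 2"] by (simp add: ennreal_mult[symmetric] mult.commute)
 qed
 have G: "0 < Gamma (b + 1)" "0 < Gamma (b + 2)" using b by (auto intro!: Gamma_real_pos)
 show i1: "integrable ?\<mu> (%x. exp (- (N x powr q)))"
  using e1 by (intro integrableI_nonneg) auto
 show v1: "(\<integral>x. exp (- (N x powr q)) \<partial>?\<mu>) = Gamma (b + 1) * m"
  using e1 G m by (intro integral_eq_nn_integral[THEN trans]) auto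
 have i2: "integrable ?\<mu> (%x. (1 + N x powr q) * exp (- (N x powr q)))"
  using e2 by (intro integrableI_nonneg) auto
 have v2: "(\<integral>x. (1 + N x powr q) * exp (- (N x powr q)) \<partial>?\<mu>) = Gamma (b + 2) * m"
  using e2 G m by (intro integral_eq_nn_integral[THEN trans]) auto
 have eq: "(%x. N x powr q * exp (- (N x powr q))) = (%x. (1 + N x powr q) * exp (- (N x powr q)) - exp (- (N x powr q)))"
  by (auto simp: algebra_simps)
 show "integrable ?\<mu> (%x. N x powr q * exp (- (N x powr q)))" unfolding eq using i1 i2 by simp
 have "Gamma (b + 2) = (b + 1) * Gamma (b + 1)"
  using Gamma_plus1[of "b + 1"] b nonpos_Ints_nonpos[of "b + 1"] by (auto simp: add.assoc)
 then show "(\<integral>x. N x powr q * exp (- (N x powr q)) \<partial>?\<mu>) = b * (Gamma (b + 1) * m)"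
  unfolding eq Bochner_Integration.integral_diff[OF i2 i1] v1 v2 by (simp add: algebra_simps)
qed

lemma half_ball_mass_mult:
 fixes k :: "'n::finite"
 assumes N: "is_norm N" and a: "0 <= a" and c: "0 < c"
 shows "half_ball_mass k a (%x. c * N x) = c powr - eff_dim TYPE('n) a * half_ball_mass k a N"
proof -
 have "ennreal (half_ball_mass k a (%x. c * N x)) = emeasure (hs_meas k a) {x. N x <= 1 / c}"
  unfolding half_ball_mass_eq(1)[OF is_norm_mult_pos[OF N c] a] unit_ball_def using c by (simp add: field_simps)
 also have "\<dots> = ennreal ((1 / c) powr eff_dim TYPE('n) a * half_ball_mass k a N)"
  using c by (intro emeasure_norm_ball[OF N a]) simp
 also have "(1 / c) powr eff_dim TYPE('n) a = c powr - eff_dim TYPE('n) a" unfolding powr_minus_divide using c by (simp add: powr_divide)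
 finally show ?thesis
  using half_ball_mass_eq(2)[OF N a, of k] half_ball_mass_eq(2)[OF is_norm_mult_pos[OF N c] a, of k] by simp
qed

lemma exp_norm_powr_integral:
 fixes k :: "'n::finite"
 assumes N: "is_norm N" and a: "0 <= a" and q: "0 < q" and c: "0 < c"
 defines "b \<equiv> eff_dim TYPE('n) a / q" and "m \<equiv> half_ball_mass k a N"
 shows "integrable (hs_meas k a) (%x. exp (- (c * N x powr q)))"
  "(\<integral>x. exp (- (c * N x powr q)) \<partial>hs_meas k a) = c powr - b * (Gamma (b + 1) * m)"
  "integrable (hs_meas k a) (%x. N x powr q * exp (- (c * N x powr q)))"
  "(\<integral>x. N x powr q * exp (- (c * N x powr q)) \<partial>hs_meas k a) = b / c * (c powr - b * (Gamma (b + 1) * m))"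
proof -
 let ?s = "c powr (1 / q)"
 have s: "0 < ?s" using c by simp
 have eq: "(?s * N x) powr q = c * N x powr q" for x
  using q c is_normD(1)[OF N, of x] by (simp add: powr_mult powr_powr)
 have "?s powr - eff_dim TYPE('n) a = c powr - b" using q by (simp add: powr_powr b_def)
 then have mm: "half_ball_mass k a (%x. ?s * N x) = c powr - b * m"
  using half_ball_mass_mult[OF N a s, of k] by (simp add: m_def)
 note u = exp_norm_powr_integral_unit[OF is_norm_mult_pos[OF N s] a q, of k, folded b_def, unfolded eq mm]
 show "integrable (hs_meas k a) (%x. exp (- (c * N x powr q)))" by (rule u(1))
 show "(\<integral>x. exp (- (c * N x powr q)) \<partial>hs_meas k a) = c powr - b * (Gamma (b + 1) * m)"
  using u(2) by (simp add: mult_ac)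
 have "integrable (hs_meas k a) (%x. (1 / c) * (c * N x powr q * exp (- (c * N x powr q))))"
  by (intro integrable_mult_right u(3))
 then show "integrable (hs_meas k a) (%x. N x powr q * exp (- (c * N x powr q)))" using c by simp
 have "(\<integral>x. (1 / c) * (c * N x powr q * exp (- (c * N x powr q))) \<partial>hs_meas k a) = (1 / c) * (b * (Gamma (b + 1) * (c powr - b * m)))"
  unfolding integral_mult_right_zero u(4) ..
 then show "(\<integral>x. N x powr q * exp (- (c * N x powr q)) \<partial>hs_meas k a) = b / c * (c powr - b * (Gamma (b + 1) * m))"
  using c by (simp add: mult_ac)
qed

text \<open>The maximum over \<open>t\<close> is attained at the conjugate point; tangent inequalities for the power avoid calculus.\<close>

lemma young_powr:
 fixes p q c A t :: real
 assumes p: "1 < p" and q: "q = p / (p - 1)" and c: "0 < c" and A: "0 <= A" and t: "0 <= t"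
 shows "p * A * t - c * t powr q <= ((p - 1) / c) powr (p - 1) * A powr p"
proof -
 have q1: "1 < q" "p / q = p - 1" "1 / p + 1 / q = 1"
 proof -
  show "1 < q" unfolding q using p by (simp add: less_divide_eq)
  show "p / q = p - 1" unfolding q using p by simp
  have "1 / q = (p - 1) / p" unfolding q by simp
  then have "1 / p + 1 / q = (1 + (p - 1)) / p" by (simp only: add_divide_distrib)
  then show "1 / p + 1 / q = 1" using p by simp
 qed
 let ?d = "(c * q) powr (1 / q)"
 have d: "0 < ?d" using c q1 by simp
 have dq: "?d powr q = c * q" using c q1 by (simp add: powr_powr)
 have "(p * A / ?d) * (t * ?d) <= (p * A / ?d) powr p / p + (t * ?d) powr q / q"
  using p q1 A t d by (intro Youngs_inequality) auto
 also have "(t * ?d) powr q / q = c * t powr q" using t d q1 dq by (simp add: powr_mult)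
 also have "(p * A / ?d) powr p / p = ((p - 1) / c) powr (p - 1) * A powr p"
 proof -
  have "?d powr p = (c * q) powr (p - 1)" by (simp add: powr_powr q1(2))
  then have "(p * A / ?d) powr p / p = p powr p / p / (c * q) powr (p - 1) * A powr p"
  using p A d by (simp add: powr_mult powr_divide)
  also have "p powr p / p = p powr (p - 1)" using p by (simp add: powr_diff)
  also have "p powr (p - 1) / (c * q) powr (p - 1) = (p / (c * q)) powr (p - 1)"
  using p c q1 by (simp add: powr_divide)
  also have "p / (c * q) = (p - 1) / c" using p c by (simp add: q field_simps)
  finally show ?thesis .
 qed
 finally show ?thesis using d by simp
qed


lemma hs_exh_eventually:
 assumes "x \<in> half_space k" shows "\<exists>m0. \<forall>m\<ge>m0. x \<in> hs_exh k m"
proof -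
 have "x \<in> (\<Union>m. hs_exh k m)" using assms unfolding UN_hs_exh .
 then obtain m0 where m0: "x \<in> hs_exh k m0" by (rule UN_E)
 have "\<forall>m\<ge>m0. x \<in> hs_exh k m"
  using subsetD[OF lift_Suc_mono_le[of "hs_exh k", OF hs_exh_mono] m0] by (intro allI impI)
 then show ?thesis ..
qed

lemma locally_integrable_borel_representative:
 fixes f :: "real^'n::finite => real"
 assumes f: "!!m. set_integrable lebesgue (hs_exh k m) f"
 shows "(%x. indicator (half_space k) x *\<^sub>R f x) \<in> borel_measurable lebesgue"
  "\<exists>f0. f0 \<in> borel_measurable borel & (AE x in lebesgue. x \<in> half_space k --> f x = f0 x)"
proof -
 have lim: "(%m. indicator (hs_exh k m) x *\<^sub>R f x) \<longlonglongrightarrow> indicator (half_space k) x *\<^sub>R f x" for x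
 proof (cases "x \<in> half_space k")
  case True
  obtain m0 where "\<forall>m\<ge>m0. x \<in> hs_exh k m" using hs_exh_eventually[OF True] ..
  then show ?thesis using True by (intro tendsto_eventually) (auto simp: eventually_sequentially intro!: exI[of _ m0])
 next
  case False
  then have "x \<notin> hs_exh k m" for m using hs_exh_subset[of k m] by blast
  then show ?thesis using False by simp
 qed
 show fm: "(%x. indicator (half_space k) x *\<^sub>R f x) \<in> borel_measurable lebesgue"
  by (rule borel_measurable_LIMSEQ_real[OF lim]) (use f in \<open>auto simp: set_integrable_def\<close>)
 then obtain f0 where f0: "f0 \<in> borel_measurable lborel" "AE x in lborel. indicator (half_space k) x *\<^sub>R f x = f0 x"
  using completion_ex_borel_measurable_real by blast
 have "AE x in lebesgue. indicator (half_space k) x *\<^sub>R f x = f0 x" by (rule AE_completion[OF f0(2)])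
 then have "AE x in lebesgue. x \<in> half_space k --> f x = f0 x" by eventually_elim auto
 then show "\<exists>f0. f0 \<in> borel_measurable borel & (AE x in lebesgue. x \<in> half_space k --> f x = f0 x)" using f0(1) by auto
qed

lemma lebesgue_integral_AE_borel:
 fixes F :: "real^'n::finite => 'b::{banach, second_countable_topology}"
 assumes "AE x in lebesgue. F x = F0 x" and F: "F \<in> borel_measurable lebesgue" and F0: "F0 \<in> borel_measurable borel"
 shows "integrable lebesgue F \<longleftrightarrow> integrable lborel F0" "(\<integral>x. F x \<partial>lebesgue) = (\<integral>x. F0 x \<partial>lborel)"
proof -
 have m: "F0 \<in> borel_measurable lebesgue" using F0 by (auto intro: measurable_completion)
 show "integrable lebesgue F \<longleftrightarrow> integrable lborel F0"
  using integrable_cong_AE[OF F m assms(1)] F0 by (simp add: integrable_completion)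
 show "(\<integral>x. F x \<partial>lebesgue) = (\<integral>x. F0 x \<partial>lborel)"
  using integral_cong_AE[OF F m assms(1)] F0 by (simp add: integral_completion)
qed

lemma extended_integral_half_space:
 fixes h :: "real^'n::finite => real"
 assumes ae: "AE x in lebesgue. x \<in> half_space k --> h x = h0 x" and [measurable]: "h0 \<in> borel_measurable borel"
 shows "extended_integral lebesgue (half_space k) (%x. h x * weight k a x) =
  enn2ereal (\<integral>\<^sup>+x. ennreal (h0 x) \<partial>hs_meas k a) - enn2ereal (\<integral>\<^sup>+x. ennreal (- h0 x) \<partial>hs_meas k a)"
proof -
 have *: "(\<integral>\<^sup>+x\<in>half_space k. ennreal (s * (h x * weight k a x)) \<partial>lebesgue) = (\<integral>\<^sup>+x. ennreal (s * h0 x) \<partial>hs_meas k a)" for s :: real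
 proof -
  have "(\<integral>\<^sup>+x\<in>half_space k. ennreal (s * (h x * weight k a x)) \<partial>lebesgue) =
  (\<integral>\<^sup>+x. ennreal (indicator (half_space k) x * weight k a x) * ennreal (s * h0 x) \<partial>lebesgue)"
  using ae by (intro nn_integral_cong_AE) (auto elim!: eventually_mono simp: indicator_def ennreal_mult'[symmetric] weight_nonneg mult_ac)
  also have "\<dots> = (\<integral>\<^sup>+x. ennreal (s * h0 x) \<partial>hs_meas k a)"
  by (subst nn_integral_completion, measurable, subst nn_integral_hs_meas) auto
  finally show ?thesis .
 qed
 show ?thesis unfolding extended_integral_def using *[of 1] *[of "-1"] by simp
qed

lemma weighted_integral_half_space:
 fixes F :: "real^'n::finite => real"
 assumes ae: "AE x in lebesgue. x \<in> half_space k --> F x = F0 x" and F0 [measurable]: "F0 \<in> borel_measurable borel"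
 shows "set_integrable lebesgue (half_space k) (%x. F x * weight k a x) \<longleftrightarrow> integrable (hs_meas k a) F0"
  "(LINT x:half_space k|lebesgue. F x * weight k a x) = (\<integral>x. F0 x \<partial>hs_meas k a)"
proof -
 have ae': "AE x in lebesgue. indicator (half_space k) x *\<^sub>R (F0 x * weight k a x) = indicator (half_space k) x *\<^sub>R (F x * weight k a x)"
  using ae by eventually_elim (auto simp: indicator_def)
 have m0: "(%x. indicator (half_space k) x *\<^sub>R (F0 x * weight k a x)) \<in> borel_measurable lebesgue"
  by (rule measurable_completion) measurable
 have m: "(%x. indicator (half_space k) x *\<^sub>R (F x * weight k a x)) \<in> borel_measurable lebesgue"
  by (rule borel_measurable_AE[OF m0 ae'])
 show "set_integrable lebesgue (half_space k) (%x. F x * weight k a x) \<longleftrightarrow> integrable (hs_meas k a) F0"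
  unfolding integral_hs_meas(2)[OF F0, symmetric] set_integrable_def by (rule integrable_cong_AE[OF m0 m ae', symmetric])
 show "(LINT x:half_space k|lebesgue. F x * weight k a x) = (\<integral>x. F0 x \<partial>hs_meas k a)"
  unfolding integral_hs_meas(1)[OF F0, symmetric] set_lebesgue_integral_def
  by (rule integral_cong_AE[OF m0 m ae', symmetric])
qed

lemma test_function_partial:
 assumes "test_function \<Omega> \<phi>"
 shows test_function_partial_support: "x \<notin> \<Omega> ==> partial i \<phi> x = 0"
  and test_function_measurable: "\<phi> \<in> borel_measurable borel"
  and test_function_partial_measurable: "partial i \<phi> \<in> borel_measurable borel"
  and test_function_C_k: "C_k m \<phi>"
proof -
 show C: "C_k m \<phi>" for m using assms by (simp add: test_function_def)
 show "\<phi> \<in> borel_measurable borel" using C[of 0] by (intro borel_measurable_continuous_onI) simp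
 show "partial i \<phi> \<in> borel_measurable borel" using C[of "Suc 0"] by (intro borel_measurable_continuous_onI) simp
 assume x: "x \<notin> \<Omega>"
 have "grad \<phi> x = 0"
 proof (rule grad_zero_off_support[of "closure {x. \<phi> x ~= 0}"])
  show "x \<notin> closure {x. \<phi> x ~= 0}" using x assms by (auto simp: test_function_def)
  show "\<phi> y = 0" if "y \<notin> closure {x. \<phi> x ~= 0}" for y using that closure_subset[of "{x. \<phi> x ~= 0}"] by blast
 qed simp
 then show "partial i \<phi> x = 0" by (simp add: grad_def vec_eq_iff)
qed

text \<open>Borel representatives turn integrals over the Lebesgue completion into integrals over \<open>lborel\<close>, where product measures and translations are available.\<close>

lemma is_weak_gradient_borel_representative:
 fixes f :: "real^'n::finite => real" and g :: "real^'n => real^'n"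
 assumes w: "is_weak_gradient (half_space k) f g"
 shows "\<exists>f0 g0. loc_int k f0 & loc_int k g0 &
  (\<forall>\<phi> i. test_function (half_space k) \<phi> --> (\<integral>x. f0 x * partial i \<phi> x \<partial>lborel) = - (\<integral>x. g0 x $ i * \<phi> x \<partial>lborel)) &
  (AE x in lebesgue. x \<in> half_space k --> f x = f0 x) & (AE x in lebesgue. x \<in> half_space k --> g x = g0 x)"
proof -
 let ?\<Omega> = "half_space k"
 have fK: "set_integrable lebesgue K f" and gK: "set_integrable lebesgue K g" if "compact K" "K \<subseteq> ?\<Omega>" for K
  using w that by (auto simp: is_weak_gradient_def locally_integrable_def)
 have giK: "set_integrable lebesgue K (%x. g x $ i)" if "compact K" "K \<subseteq> ?\<Omega>" for K i
 proof -
  have "integrable lebesgue (%x. (indicator K x *\<^sub>R g x) \<bullet> axis i 1)"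
  using gK[OF that] unfolding set_integrable_def by (intro integrable_inner_left)
  then show ?thesis by (simp add: set_integrable_def inner_axis cong: if_cong)
 qed
 note ex = compact_hs_exh[of k] hs_exh_subset[of k]
 obtain f0 where f0 [measurable]: "f0 \<in> borel_measurable borel" and f0ae: "AE x in lebesgue. x \<in> ?\<Omega> --> f x = f0 x"
  using locally_integrable_borel_representative(2)[OF fK[OF ex]] by blast
 have "\<forall>i. \<exists>h. h \<in> borel_measurable borel & (AE x in lebesgue. x \<in> ?\<Omega> --> g x $ i = h x)"
  by (intro allI locally_integrable_borel_representative(2)[OF giK[OF ex]])
 from choice[OF this] obtain h where h [measurable]: "!!i. h i \<in> borel_measurable borel"
  and hae: "!!i. AE x in lebesgue. x \<in> ?\<Omega> --> g x $ i = h i x" by blast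
 define g0 where "g0 x = (\<chi> i. h i x)" for x
 have g0i: "g0 x $ i = h i x" for x i by (simp add: g0_def)
 have g0 [measurable]: "g0 \<in> borel_measurable borel"
 proof (subst borel_measurable_euclidean_space, safe)
  fix b :: "real^'n" assume "b \<in> Basis"
  then obtain i where "b = axis i 1" by (auto simp: Basis_vec_def)
  then show "(%x. g0 x \<bullet> b) \<in> borel_measurable borel" by (simp add: inner_axis g0i)
 qed
 have g0ae: "AE x in lebesgue. x \<in> ?\<Omega> --> g x = g0 x"
 proof -
  have "AE x in lebesgue. \<forall>i\<in>UNIV. x \<in> ?\<Omega> --> g x $ i = h i x" by (intro AE_finite_allI hae) simp
  then show ?thesis by eventually_elim (auto simp: vec_eq_iff g0i)
 qed
 have lf: "loc_int k f0"
  unfolding loc_int_def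
 proof (intro conjI allI impI f0)
  fix K assume K: "compact K" "K \<subseteq> ?\<Omega>"
  have [measurable]: "K \<in> sets borel" using K by (auto intro: borel_compact)
  have ae: "AE x in lebesgue. indicator K x *\<^sub>R f x = indicator K x *\<^sub>R f0 x"
  using f0ae by eventually_elim (use K in \<open>auto simp: indicator_def\<close>)
  have m: "(%x. indicator K x *\<^sub>R f x) \<in> borel_measurable lebesgue" using fK[OF K] by (auto simp: set_integrable_def)
  show "integrable lborel (%x. indicator K x *\<^sub>R f0 x)"
  using lebesgue_integral_AE_borel(1)[OF ae m] fK[OF K] by (simp add: set_integrable_def)
 qed
 have lg: "loc_int k g0"
  unfolding loc_int_def
 proof (intro conjI allI impI g0)
  fix K assume K: "compact K" "K \<subseteq> ?\<Omega>"
  have [measurable]: "K \<in> sets borel" using K by (auto intro: borel_compact)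
  have ae: "AE x in lebesgue. indicator K x *\<^sub>R g x = indicator K x *\<^sub>R g0 x"
  using g0ae by eventually_elim (use K in \<open>auto simp: indicator_def\<close>)
  have m: "(%x. indicator K x *\<^sub>R g x) \<in> borel_measurable lebesgue" using gK[OF K] by (auto simp: set_integrable_def)
  show "integrable lborel (%x. indicator K x *\<^sub>R g0 x)"
  using lebesgue_integral_AE_borel(1)[OF ae m] gK[OF K] by (simp add: set_integrable_def)
 qed
 have weak: "(\<integral>x. f0 x * partial i \<phi> x \<partial>lborel) = - (\<integral>x. g0 x $ i * \<phi> x \<partial>lborel)" if t: "test_function ?\<Omega> \<phi>" for \<phi> i
 proof -
  note [measurable] = test_function_measurable[OF t] test_function_partial_measurable[OF t]
  have [measurable]: "\<phi> \<in> borel_measurable lebesgue" "partial i \<phi> \<in> borel_measurable lebesgue"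
  by (rule measurable_completion, simp)+
  have [measurable]: "(%x. indicator ?\<Omega> x *\<^sub>R f x) \<in> borel_measurable lebesgue" "(%x. indicator ?\<Omega> x *\<^sub>R g x $ i) \<in> borel_measurable lebesgue"
  by (rule locally_integrable_borel_representative(1)[OF fK[OF ex]] locally_integrable_borel_representative(1)[OF giK[OF ex]])+
  have ae: "AE x in lebesgue. indicator ?\<Omega> x *\<^sub>R (f x * partial i \<phi> x) = f0 x * partial i \<phi> x"
  using f0ae by eventually_elim (auto simp: indicator_def test_function_partial_support[OF t])
  have m: "(%x. indicator ?\<Omega> x *\<^sub>R (f x * partial i \<phi> x)) \<in> borel_measurable lebesgue"
  proof -
  have "(%x. (indicator ?\<Omega> x *\<^sub>R f x) * partial i \<phi> x) \<in> borel_measurable lebesgue" by measurable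
  then show ?thesis by (simp add: mult.assoc)
  qed
  have ae2: "AE x in lebesgue. indicator ?\<Omega> x *\<^sub>R (g x $ i * \<phi> x) = g0 x $ i * \<phi> x"
  using g0ae by eventually_elim (auto simp: indicator_def test_function_support[OF t])
  have m2: "(%x. indicator ?\<Omega> x *\<^sub>R (g x $ i * \<phi> x)) \<in> borel_measurable lebesgue"
  proof -
  have "(%x. (indicator ?\<Omega> x *\<^sub>R g x $ i) * \<phi> x) \<in> borel_measurable lebesgue" by measurable
  then show ?thesis by (simp add: mult.assoc)
  qed
  have b1: "(%x. f0 x * partial i \<phi> x) \<in> borel_measurable borel" by measurable
  have b2: "(%x. g0 x $ i * \<phi> x) \<in> borel_measurable borel" unfolding g0i by measurable
  have "(\<integral>x. f0 x * partial i \<phi> x \<partial>lborel) = (LINT x:?\<Omega>|lebesgue. f x * partial i \<phi> x)"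
  unfolding set_lebesgue_integral_def by (rule lebesgue_integral_AE_borel(2)[OF ae m b1, symmetric])
  also have "\<dots> = - (LINT x:?\<Omega>|lebesgue. g x $ i * \<phi> x)"
  using w t by (simp add: is_weak_gradient_def)
  also have "(LINT x:?\<Omega>|lebesgue. g x $ i * \<phi> x) = (\<integral>x. g0 x $ i * \<phi> x \<partial>lborel)"
  unfolding set_lebesgue_integral_def by (rule lebesgue_integral_AE_borel(2)[OF ae2 m2 b2])
  finally show ?thesis .
 qed
 show ?thesis using lf lg weak f0ae g0ae by blast
qed

text \<open>The minimum over \<open>s\<close> of \<open>B E s - r ln s\<close> is at \<open>s = r / (B E)\<close>; if \<open>E = 0\<close>, letting \<open>s\<close> grow shows that the hypothesis cannot hold for a real \<open>X\<close>, in accordance with the value \<open>- \<infinity>\<close> of the right-hand side.\<close>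

lemma extended_ln_bound:
 fixes X \<alpha> B E r :: real
 assumes r: "0 < r" and B: "0 < B" and E: "0 <= E" and L: "0 < L"
  and le: "!!s. 0 < s ==> X <= \<alpha> - r * ln s + B * E * s"
  and val: "r * ln L = \<alpha> + r + r * ln (B / r)"
 shows "ereal X <= ereal r * extended_ln (L * E)"
proof (cases "E = 0")
 case True
 have "X <= \<alpha> - r * ln (exp ((\<alpha> - X + 1) / r))" using le[of "exp ((\<alpha> - X + 1) / r)"] True by simp
 then show ?thesis using r by simp
next
 case False
 then have E': "0 < E" using E by simp
 have "X <= \<alpha> - r * ln (r / (B * E)) + B * E * (r / (B * E))"
  using r B E' by (intro le) simp
 also have "\<dots> = \<alpha> + r + r * (ln (B / r) + ln E)"
  using r B E' by (simp add: ln_div ln_mult algebra_simps)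
 also have "\<dots> = r * ln (L * E)" using val L E' by (simp add: ln_mult algebra_simps)
 finally show ?thesis using L E' by (simp add: extended_ln_def)
qed


lemma emeasure_open_norm_ball:
 fixes k :: "'n::finite"
 assumes N: "is_norm N" and a: "0 <= a" and r: "0 < r"
 shows "emeasure (hs_meas k a) {x. N x < r} = ennreal (r powr eff_dim TYPE('n) a * half_ball_mass k a N)"
proof (rule antisym)
 note [measurable] = is_norm_borel[OF N]
 let ?n = "eff_dim TYPE('n) a" and ?m = "half_ball_mass k a N"
 have n: "0 < ?n" using a by (simp add: eff_dim_def add_pos_nonneg)
 show "emeasure (hs_meas k a) {x. N x < r} <= ennreal (r powr ?n * ?m)"
  unfolding emeasure_norm_ball[OF N a r, symmetric] by (intro emeasure_mono) auto
 let ?r = "%j::nat. r * (1 - 1 / (real j + 2))"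
 have lim: "(%j. ennreal (?r j powr ?n * ?m)) \<longlonglongrightarrow> ennreal (r powr ?n * ?m)"
 proof -
  have "(%j. 1 / (real j + 2)) \<longlonglongrightarrow> 0" by real_asymp
  then have "(%j. ennreal (?r j powr ?n * ?m)) \<longlonglongrightarrow> ennreal ((r * (1 - 0)) powr ?n * ?m)"
  using r by (intro tendsto_ennrealI tendsto_intros) auto
  then show ?thesis by simp
 qed
 have le: "ennreal (?r j powr ?n * ?m) <= emeasure (hs_meas k a) {x. N x < r}" for j
 proof -
  have p: "0 < ?r j" "?r j < r" using r by (auto simp: field_simps add_pos_nonneg)
  show ?thesis
  unfolding emeasure_norm_ball[OF N a p(1), symmetric] using p by (intro emeasure_mono) auto
 qed
 show "ennreal (r powr ?n * ?m) <= emeasure (hs_meas k a) {x. N x < r}"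
  by (rule LIMSEQ_le_const2[OF lim]) (use le in blast)
qed

lemma eff_dim_pos: "0 <= a ==> 0 < eff_dim TYPE('n::finite) a"
 by (simp add: eff_dim_def add_pos_nonneg)

text \<open>For \<open>p = 1\<close> the conjugate of the energy is the indicator function of a ball: the cost vanishes up to \<open>t = s\<close>, and \<open>K = s\<close>.\<close>

lemma entropy_profile_1:
 fixes k :: "'n::finite"
 assumes N: "is_norm N" and a: "0 <= a" and s: "0 < s"
 shows "entropy_profile k a 1 s s (s powr eff_dim TYPE('n) a * half_ball_mass k a N) N (%_. 0)"
proof (unfold_locales)
 note [measurable] = is_norm_borel[OF N]
 show "ennreal (s powr eff_dim TYPE('n) a * half_ball_mass k a N) =
  (\<integral>\<^sup>+y. ennreal (exp (- 0)) * indicator {y. N y < s} y \<partial>hs_meas k a)"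
  by (simp add: emeasure_open_norm_ball[OF N a s])
 show "1 * A * t - 0 <= s * A powr 1" if "0 <= A" "0 <= t" "t < s" for A t
  using that by (simp add: mult.commute mult_left_mono)
qed (use N a s half_ball_mass_eq(2)[OF N a, of k] in auto)

lemma entropy_profile_powr:
 fixes k :: "'n::finite"
 assumes N: "is_norm N" and a: "0 <= a" and p: "1 < p" and c: "0 < c" and \<rho>: "0 < \<rho>"
 defines "q \<equiv> p / (p - 1)"
 shows "entropy_profile k a p (((p - 1) / c) powr (p - 1)) \<rho>
  (\<integral>y. exp (- (c * N y powr q)) * indicator {y. N y < \<rho>} y \<partial>hs_meas k a) N (%t. c * t powr q)"
proof (unfold_locales)
 note [measurable] = is_norm_borel[OF N]
 let ?\<mu> = "hs_meas k a"
 have q: "0 < q" using p by (simp add: q_def)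
 note I = exp_norm_powr_integral[OF N a q c, of k]
 have i: "integrable ?\<mu> (%y. exp (- (c * N y powr q)) * indicator {y. N y < \<rho>} y)"
  by (rule Bochner_Integration.integrable_bound[OF I(1)]) (auto simp: indicator_def)
 have eq: "ennreal (\<integral>y. exp (- (c * N y powr q)) * indicator {y. N y < \<rho>} y \<partial>?\<mu>) =
  (\<integral>\<^sup>+y. ennreal (exp (- (c * N y powr q)) * indicator {y. N y < \<rho>} y) \<partial>?\<mu>)"
  by (rule nn_integral_eq_integral[OF i, symmetric]) (auto simp: indicator_def)
 also have "\<dots> = (\<integral>\<^sup>+y. ennreal (exp (- (c * N y powr q))) * indicator {y. N y < \<rho>} y \<partial>?\<mu>)"
  by (intro nn_integral_cong) (auto simp: indicator_def)
 finally show "ennreal (\<integral>y. exp (- (c * N y powr q)) * indicator {y. N y < \<rho>} y \<partial>?\<mu>) =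
  (\<integral>\<^sup>+y. ennreal (exp (- (c * N y powr q))) * indicator {y. N y < \<rho>} y \<partial>?\<mu>)" .
 have "(\<integral>y. exp (- (c * N y powr q)) * indicator {y. N y < \<rho>} y \<partial>?\<mu>) ~= 0"
 proof
  assume "(\<integral>y. exp (- (c * N y powr q)) * indicator {y. N y < \<rho>} y \<partial>?\<mu>) = 0"
  then have "AE y in ?\<mu>. exp (- (c * N y powr q)) * indicator {y. N y < \<rho>} y = (0::real)"
  using integral_nonneg_eq_0_iff_AE[OF i] by (simp add: indicator_def)
  then have "AE y in ?\<mu>. y \<notin> {y. N y < \<rho>}" by eventually_elim (auto simp: indicator_def)
  then have "emeasure ?\<mu> {y. N y < \<rho>} = 0" by (subst (asm) AE_iff_measurable[OF _ refl]) auto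
  moreover have "0 < \<rho> powr eff_dim TYPE('n) a * half_ball_mass k a N"
  using half_ball_mass_eq(2)[OF N a, of k] \<rho> by simp
  ultimately show False
  unfolding emeasure_open_norm_ball[OF N a \<rho>] ennreal_eq_0_iff by linarith
 qed
 moreover have "0 <= (\<integral>y. exp (- (c * N y powr q)) * indicator {y. N y < \<rho>} y \<partial>?\<mu>)"
  by (intro integral_nonneg_AE) (auto simp: indicator_def)
 ultimately show "0 < (\<integral>y. exp (- (c * N y powr q)) * indicator {y. N y < \<rho>} y \<partial>?\<mu>)" by linarith
 show "p * A * t - c * t powr q <= ((p - 1) / c) powr (p - 1) * A powr p" if "0 <= A" "0 <= t" "t < \<rho>" for A t
  by (rule young_powr[OF p q_def[THEN meta_eq_to_obj_eq] c that(1,2)])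
qed (use N a p c in auto)

lemma enn2ereal_diff:
 fixes A B :: ennreal
 assumes "A < \<infinity>" and "B ~= \<infinity>"
 shows "enn2ereal A - enn2ereal B = ereal (enn2real A - enn2real B)"
proof -
 obtain s where s: "A = ennreal s" "0 <= s" using assms(1) by (cases A) auto
 obtain t where t: "B = ennreal t" "0 <= t" using assms(2) by (cases B) auto
 show ?thesis by (simp add: s t)
qed

text \<open>Finiteness of the positive part is obtained first, from any single profile. If the negative part is infinite the claim is trivial; otherwise the bound of \<open>entropy_profile\<close> is optimised over the parameter. For \<open>p > 1\<close> the truncation radius is sent to infinity before, and the parameter is \<open>s = c\<^sup>1\<^sup>-\<^sup>p\<close>.\<close>

theorem log_sobolev_inequality:
 fixes k :: "'n::finite" and N :: "real^'n => real"
 assumes N: "is_norm N" and a: "0 <= a" and p: "1 <= p" and f: "f \<in> weighted_sobolev k a p N" and mass: "mass_p k a p f = 1"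
 shows "entropy_p k a p f <=
  ereal (eff_dim TYPE('n) a / p) * extended_ln (log_sobolev_const k a N p * gradient_energy k a p N f)"
proof -
 note [measurable] = is_norm_borel[OF N] is_norm_borel[OF is_norm_dual_norm[OF N]]
 let ?\<Omega> = "half_space k" and ?\<mu> = "hs_meas k a" and ?na = "eff_dim TYPE('n) a" and ?m = "half_ball_mass k a N"
 define g where "g = weak_gradient ?\<Omega> f"
 have w: "is_weak_gradient ?\<Omega> f g"
  unfolding g_def weak_gradient_def using f by (intro someI_ex[of "is_weak_gradient ?\<Omega> f"]) (simp add: weighted_sobolev_def)
 obtain f0 g0 where f0: "loc_int k f0" and g0: "loc_int k g0"
  and weak: "!!\<phi> i. test_function ?\<Omega> \<phi> ==> (\<integral>x. f0 x * partial i \<phi> x \<partial>lborel) = - (\<integral>x. g0 x $ i * \<phi> x \<partial>lborel)"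
  and fae: "AE x in lebesgue. x \<in> ?\<Omega> --> f x = f0 x" and gae: "AE x in lebesgue. x \<in> ?\<Omega> --> g x = g0 x"
  using is_weak_gradient_borel_representative[OF w] by blast
 have [measurable]: "f0 \<in> borel_measurable borel" "g0 \<in> borel_measurable borel"
  using f0 g0 by (simp_all add: loc_int_def)
 have fpae: "AE x in lebesgue. x \<in> ?\<Omega> --> \<bar>f x\<bar> powr p = \<bar>f0 x\<bar> powr p" using fae by eventually_elim auto
 have gpae: "AE x in lebesgue. x \<in> ?\<Omega> --> dual_norm N (g x) powr p = dual_norm N (g0 x) powr p" using gae by eventually_elim auto
 have m1: "integrable ?\<mu> (%x. \<bar>f0 x\<bar> powr p)" "(\<integral>x. \<bar>f0 x\<bar> powr p \<partial>?\<mu>) = 1"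
  using weighted_integral_half_space[OF fpae, of a] f mass by (simp_all add: weighted_sobolev_def mass_p_def)
 have e1: "integrable ?\<mu> (%x. dual_norm N (g0 x) powr p)" and e2: "gradient_energy k a p N f = (\<integral>x. dual_norm N (g0 x) powr p \<partial>?\<mu>)"
  using weighted_integral_half_space[OF gpae, of a] f by (simp_all add: weighted_sobolev_def gradient_energy_def g_def)
 define E where "E = (\<integral>x. dual_norm N (g0 x) powr p \<partial>?\<mu>)"
 have E: "0 <= E" unfolding E_def by (intro integral_nonneg_AE) auto
 let ?h = "%x. \<bar>f0 x\<bar> powr p * ln (\<bar>f0 x\<bar> powr p)"
 have ent: "entropy_p k a p f = enn2ereal (\<integral>\<^sup>+x. ennreal (?h x) \<partial>?\<mu>) - enn2ereal (\<integral>\<^sup>+x. ennreal (- ?h x) \<partial>?\<mu>)"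
 proof -
  have "AE x in lebesgue. x \<in> ?\<Omega> --> \<bar>f x\<bar> powr p * ln (\<bar>f x\<bar> powr p) = ?h x" using fae by eventually_elim auto
  then show ?thesis unfolding entropy_p_def by (rule extended_integral_half_space) measurable
 qed
 have m: "0 < ?m" by (rule half_ball_mass_eq(2)[OF N a])
 have na: "0 < ?na" by (rule eff_dim_pos[OF a])
 \<comment> \<open>finiteness of the positive part\<close>
 have pos: "(\<integral>\<^sup>+x. ennreal (?h x) \<partial>?\<mu>) < \<infinity>"
 proof (cases "p = 1")
  case True
  from entropy_profile.entropy_le(1)[OF entropy_profile_1[OF N a zero_less_one] f0 g0 weak] m1 e1 True
  show ?thesis by simp
 next
  case False
  then have "1 < p" using p by simp
  from entropy_profile.entropy_le(1)[OF entropy_profile_powr[OF N a this zero_less_one zero_less_one] f0 g0 weak m1 e1]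
  show ?thesis by simp
 qed
 show ?thesis
 proof (cases "(\<integral>\<^sup>+x. ennreal (- ?h x) \<partial>?\<mu>) = \<infinity>")
  case True
  obtain r where "(\<integral>\<^sup>+x. ennreal (?h x) \<partial>?\<mu>) = ennreal r" "0 <= r" using pos by (cases "\<integral>\<^sup>+x. ennreal (?h x) \<partial>?\<mu>") auto
  then show ?thesis unfolding ent True by simp
 next
  case False
  have int: "integrable ?\<mu> ?h"
  using pos False by (auto simp: real_integrable_def)
  have entX: "entropy_p k a p f = ereal (\<integral>x. ?h x \<partial>?\<mu>)"
  proof -
  have "(\<integral>x. ?h x \<partial>?\<mu>) = enn2real (\<integral>\<^sup>+x. ennreal (?h x) \<partial>?\<mu>) - enn2real (\<integral>\<^sup>+x. ennreal (- ?h x) \<partial>?\<mu>)"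
  by (rule real_lebesgue_integral_def[OF int])
  then show ?thesis unfolding ent using pos False by (simp add: enn2ereal_diff)
  qed
  have "ereal (\<integral>x. ?h x \<partial>?\<mu>) <= ereal (?na / p) * extended_ln (log_sobolev_const k a N p * E)"
  proof (cases "p = 1")
  case True
  have L: "log_sobolev_const k a N p = 1 / ?na * ?m powr (- (1 / ?na))" using True by (simp add: log_sobolev_const_def Let_def)
  have le: "(\<integral>x. ?h x \<partial>?\<mu>) <= (- ?na - ln ?m) - ?na * ln s + 1 * E * s" if s: "0 < s" for s
  proof -
  have "(\<integral>x. ?h x \<partial>?\<mu>) <= s * E - ?na - ln (s powr ?na * ?m)"
  using entropy_profile.entropy_le(2)[OF entropy_profile_1[OF N a s] f0 g0 weak] m1 e1 True int by (simp add: E_def)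
  also have "ln (s powr ?na * ?m) = ?na * ln s + ln ?m" using s m by (simp add: ln_mult ln_powr)
  finally show ?thesis by (simp add: mult.commute)
  qed
  have val: "?na * ln (1 / ?na * ?m powr (- (1 / ?na))) = (- ?na - ln ?m) + ?na + ?na * ln (1 / ?na)"
  using m na by (simp add: ln_mult ln_powr ln_div algebra_simps)
  have "0 < 1 / ?na * ?m powr (- (1 / ?na))" using m na by simp
  from extended_ln_bound[OF na zero_less_one E this le val] show ?thesis
  unfolding L using True by simp
  next
  case False
  then have p1: "1 < p" using p by simp
  define q where "q = p / (p - 1)"
  have q: "0 < q" using p1 by (simp add: q_def)
  define G where "G = Gamma (?na / q + 1) * ?m"
  have G: "0 < G" using m na q by (auto simp: G_def intro!: mult_pos_pos Gamma_real_pos add_pos_pos divide_pos_pos)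
  have L: "log_sobolev_const k a N p = p / ?na * ((p - 1) / exp 1) powr (p - 1) * G powr (- (p / ?na))"
  using False by (simp add: log_sobolev_const_def Let_def G_def q_def)
  have lec: "(\<integral>x. ?h x \<partial>?\<mu>) <= ((p - 1) / c) powr (p - 1) * E - ?na - ln (c powr - (?na / q) * G)" if c: "0 < c" for c
  proof -
  define Zn where "Zn n = (\<integral>y. exp (- (c * N y powr q)) * indicator {y. N y < real (Suc n)} y \<partial>?\<mu>)" for n
  note I = exp_norm_powr_integral[OF N a q c, of k, folded G_def]
  have "Zn \<longlonglongrightarrow> (\<integral>y. exp (- (c * N y powr q)) \<partial>?\<mu>)"
  unfolding Zn_def
  proof (rule integral_dominated_convergence[OF _ _ I(1)])
  show "AE y in ?\<mu>. (%n. exp (- (c * N y powr q)) * indicator {y. N y < real (Suc n)} y) \<longlonglongrightarrow> exp (- (c * N y powr q))"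
  proof (rule AE_I2)
  fix y
  obtain n0 :: nat where n0: "N y < real n0" using reals_Archimedean2 by blast
  show "(%n. exp (- (c * N y powr q)) * indicator {y. N y < real (Suc n)} y) \<longlonglongrightarrow> exp (- (c * N y powr q))"
  using n0 by (intro tendsto_eventually) (auto simp: eventually_sequentially intro!: exI[of _ n0])
  qed
  qed (auto simp: indicator_def)
  then have Zlim: "Zn \<longlonglongrightarrow> c powr - (?na / q) * G" unfolding I(2) .
  have "(%n. ((p - 1) / c) powr (p - 1) * E - ?na - ln (Zn n)) \<longlonglongrightarrow> ((p - 1) / c) powr (p - 1) * E - ?na - ln (c powr - (?na / q) * G)"
  using c G by (intro tendsto_intros Zlim) auto
  moreover have "(\<integral>x. ?h x \<partial>?\<mu>) <= ((p - 1) / c) powr (p - 1) * E - ?na - ln (Zn n)" for n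
  using entropy_profile.entropy_le(2)[OF entropy_profile_powr[OF N a p1 c, of "real (Suc n)"] f0 g0 weak m1 e1 int]
  unfolding E_def Zn_def q_def by simp
  ultimately show ?thesis by (intro LIMSEQ_le_const) auto
  qed
  have qp: "?na / q / (p - 1) = ?na / p" using p1 by (simp add: q_def)
  have le: "(\<integral>x. ?h x \<partial>?\<mu>) <= (- ?na - ln G) - ?na / p * ln s + (p - 1) powr (p - 1) * E * s" if s: "0 < s" for s
  proof -
  define c where "c = s powr (- 1 / (p - 1))"
  have c: "0 < c" using s by (simp add: c_def)
  have "((p - 1) / c) powr (p - 1) = (p - 1) powr (p - 1) * s"
  proof -
  have "(p - 1) / c = (p - 1) * s powr (1 / (p - 1))" by (simp add: c_def powr_minus_divide)
  then show ?thesis using s p1 by (simp add: powr_mult powr_powr)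
  qed
  moreover have "ln (c powr - (?na / q) * G) = ?na / p * ln s + ln G"
  proof -
  have "ln (c powr - (?na / q) * G) = (?na / q / (p - 1)) * ln s + ln G"
  using s c G by (simp add: ln_mult ln_powr c_def)
  then show ?thesis unfolding qp .
  qed
  ultimately show ?thesis using lec[OF c] by (simp add: mult_ac)
  qed
  have v1: "ln (p / ?na * ((p - 1) / exp 1) powr (p - 1) * G powr (- (p / ?na))) =
  ln (p / ?na) + (p - 1) * (ln (p - 1) - 1) - p / ?na * ln G"
  using p1 na G by (simp add: ln_mult ln_powr ln_div)
  have v2: "ln ((p - 1) powr (p - 1) / (?na / p)) = (p - 1) * ln (p - 1) + ln (p / ?na)"
  using p1 na by (simp add: ln_mult ln_powr ln_div)
  have val: "?na / p * ln (p / ?na * ((p - 1) / exp 1) powr (p - 1) * G powr (- (p / ?na))) =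
  (- ?na - ln G) + ?na / p + ?na / p * ln ((p - 1) powr (p - 1) / (?na / p))"
  unfolding v1 v2 using p1 na by (simp add: field_simps)
  have "0 < ?na / p" "0 < (p - 1) powr (p - 1)" "0 < p / ?na * ((p - 1) / exp 1) powr (p - 1) * G powr (- (p / ?na))"
  using p1 na G by simp_all
  from extended_ln_bound[OF this(1,2) E this(3) le val] show ?thesis unfolding L .
  qed
  then show ?thesis unfolding entX e2 E_def .
 qed
qed

section \<open>The gradient of a norm\<close>

lemma bounded_support_integrable:
 fixes f :: "'a::euclidean_space => 'b::{banach, second_countable_topology}"
 assumes [measurable]: "f \<in> borel_measurable borel" and B: "!!x. norm (f x) <= B" and r: "!!x. r < norm x ==> f x = 0"
 shows "integrable lborel f"
proof (rule Bochner_Integration.integrable_bound)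
 show "integrable lborel (%x::'a. B * indicator (cball 0 r) x)"
  using emeasure_lborel_cball_finite[of 0 r] by (intro integrable_mult_right integrable_real_indicator) auto
 show "AE x in lborel. norm (f x) <= norm (B * indicator (cball 0 r) x :: real)"
 proof (rule AE_I2)
  fix x
  show "norm (f x) <= norm (B * indicator (cball 0 r) x :: real)"
  using r[of x] B[of x] by (cases "r < norm x") (auto simp: indicator_def dist_norm)
 qed
qed simp

lemma C_k_lipschitz:
 fixes \<phi> :: "real^'n::finite => real"
 assumes C: "C_k (Suc m) \<phi>" and supp: "!!x. r < norm x ==> \<phi> x = 0"
 shows "\<exists>B\<ge>0. (\<forall>x. norm (grad \<phi> x) <= B) & (\<forall>x. \<bar>\<phi> x\<bar> <= B) & (\<forall>x y. \<bar>\<phi> x - \<phi> y\<bar> <= B * norm (x - y))"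
proof -
 have "bounded (grad \<phi> ` cball 0 r)" "bounded (\<phi> ` cball 0 r)"
  using grad_continuous[OF C] C_k_continuous[OF C]
  by (auto intro!: compact_imp_bounded compact_continuous_image intro: continuous_on_subset)
 then obtain B1 B2 where B1: "!!x. x \<in> cball 0 r ==> norm (grad \<phi> x) <= B1" and B2: "!!x. x \<in> cball 0 r ==> \<bar>\<phi> x\<bar> <= B2"
  unfolding bounded_iff by (metis imageI real_norm_def)
 have g0: "grad \<phi> x = 0" if "x \<notin> cball 0 r" for x
  by (rule grad_zero_off_support[OF closed_cball _ that]) (use supp in \<open>auto simp: dist_norm\<close>)
 let ?B = "\<bar>B1\<bar> + \<bar>B2\<bar>"
 have g: "norm (grad \<phi> x) <= ?B" for x using B1[of x] g0[of x] by (cases "x \<in> cball 0 r") auto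
 have f: "\<bar>\<phi> x\<bar> <= ?B" for x using B2[of x] supp[of x] by (cases "x \<in> cball 0 r") (auto simp: dist_norm not_le)
 have "norm (\<phi> x - \<phi> y) <= ?B * norm (x - y)" for x y
 proof (rule differentiable_bound[of UNIV _ "%x h. grad \<phi> x \<bullet> h"])
  show "(\<phi> has_derivative (%h. grad \<phi> x \<bullet> h)) (at x within UNIV)" for x
  using C_k_has_derivative[OF C] by simp
  show "onorm (%h. grad \<phi> x \<bullet> h) <= ?B" for x
  proof (rule onorm_le)
  fix h
  have "\<bar>grad \<phi> x \<bullet> h\<bar> <= norm (grad \<phi> x) * norm h" by (rule Cauchy_Schwarz_ineq2)
  also have "\<dots> <= ?B * norm h" using g by (rule mult_right_mono) simp
  finally show "norm (grad \<phi> x \<bullet> h) <= ?B * norm h" by simp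
  qed
 qed auto
 then show ?thesis using g f by (intro exI[of _ ?B]) auto
qed

text \<open>Difference quotients are moved from the test function to \<open>F\<close> by translation invariance. Only
 one-sided difference quotients of \<open>F\<close> along one sequence occur, which is why no two-sided
 derivative of \<open>F\<close> is needed.\<close>

lemma lipschitz_integration_by_parts:
 fixes F g \<theta> :: "real^'n::finite => real" and v :: "real^'n"
 assumes cont: "continuous_on UNIV F" and lip: "!!x h. 0 < h ==> \<bar>F (x + h *\<^sub>R v) - F x\<bar> <= L * h"
  and g [measurable]: "g \<in> borel_measurable borel"
  and lim: "AE x in lborel. (%j. real (Suc j) * (F (x + (1 / real (Suc j)) *\<^sub>R v) - F x)) \<longlonglongrightarrow> g x"
  and C: "C_k (Suc m) \<theta>" and supp: "!!x. r < norm x ==> \<theta> x = 0"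
 shows "(\<integral>x. F x * (grad \<theta> x \<bullet> v) \<partial>lborel) = - (\<integral>x. g x * \<theta> x \<partial>lborel)"
proof -
 have [measurable]: "F \<in> borel_measurable borel" "\<theta> \<in> borel_measurable borel" "grad \<theta> \<in> borel_measurable borel"
  using cont C_k_continuous[OF C] grad_continuous[OF C] by (auto intro: borel_measurable_continuous_onI)
 obtain B where B: "0 <= B" "!!x. \<bar>\<theta> x\<bar> <= B" "!!x y. \<bar>\<theta> x - \<theta> y\<bar> <= B * norm (x - y)"
  using C_k_lipschitz[OF C supp] by blast
 define R where "R = r + norm v"
 have "bounded (F ` cball 0 R)"
  using cont by (auto intro!: compact_imp_bounded compact_continuous_image intro: continuous_on_subset)
 then obtain A where "\<forall>y\<in>F ` cball 0 R. norm y <= A" unfolding bounded_iff by blast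
 then have A: "\<bar>F x\<bar> <= A" if "norm x <= R" for x using that by simp
 define h where "h j = 1 / real (Suc j)" for j
 have h: "0 < h j" "h j <= 1" "real (Suc j) * h j = 1" for j by (simp_all add: h_def)
 have h0: "h \<longlonglongrightarrow> 0" unfolding h_def by (rule LIMSEQ_Suc[OF lim_1_over_n])
 let ?q = "%j x. real (Suc j) * (\<theta> x - \<theta> (x - h j *\<^sub>R v))"
 have supp': "\<theta> (x - h j *\<^sub>R v) = 0" "\<theta> x = 0" if "R < norm x" for x j
 proof -
  have "norm x <= norm (x - h j *\<^sub>R v) + norm (h j *\<^sub>R v)" using norm_triangle_ineq[of "x - h j *\<^sub>R v" "h j *\<^sub>R v"] by simp
  also have "norm (h j *\<^sub>R v) <= norm v" using h(1)[of j] h(2)[of j] mult_right_mono[OF h(2)[of j] norm_ge_zero[of v]] by simp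
  finally show "\<theta> (x - h j *\<^sub>R v) = 0" "\<theta> x = 0" using that by (auto simp: R_def intro!: supp intro: order.strict_trans1)
  (smt (verit) norm_ge_zero)
 qed
 have qb: "\<bar>?q j x\<bar> <= B * norm v" for j x
 proof -
  have "\<bar>?q j x\<bar> = real (Suc j) * \<bar>\<theta> x - \<theta> (x - h j *\<^sub>R v)\<bar>" by (simp add: abs_mult)
  also have "\<dots> <= real (Suc j) * (B * norm (h j *\<^sub>R v))"
  using B(3)[of x "x - h j *\<^sub>R v"] by (intro mult_left_mono) auto
  also have "\<dots> = (real (Suc j) * h j) * (B * norm v)" using h(1)[of j] by simp
  finally show ?thesis unfolding h(3) by simp
 qed
 have q0: "\<bar>F x * ?q j x\<bar> <= (A * (B * norm v)) * indicator (cball 0 R) x" for j x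
 proof (cases "norm x <= R")
  case True
  then show ?thesis using A[OF True] qb[of j x] by (auto simp: abs_mult intro!: mult_mono)
 next
  case False
  then show ?thesis using supp'(1)[of x j] supp'(2)[of x] by simp
 qed
 have i0: "integrable lborel (%x::real^'n. K * indicator (cball 0 R) x)" for K :: real
  using emeasure_lborel_cball_finite[of 0 R] by (intro integrable_mult_right integrable_real_indicator) auto
 have l1: "(%j. \<integral>x. F x * ?q j x \<partial>lborel) \<longlonglongrightarrow> (\<integral>x. F x * (grad \<theta> x \<bullet> v) \<partial>lborel)"
 proof (rule integral_dominated_convergence[OF _ _ i0])
  show "AE x in lborel. (%j. F x * ?q j x) \<longlonglongrightarrow> F x * (grad \<theta> x \<bullet> v)"
  proof (intro AE_I2 tendsto_mult tendsto_const)
  fix x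
  have D: "((%t. \<theta> (x - t *\<^sub>R v)) has_derivative (%t. grad \<theta> x \<bullet> (- t *\<^sub>R v))) (at 0)"
  by (rule has_derivative_compose[where g=\<theta> and f="%t. x - t *\<^sub>R v"])
  (use C_k_has_derivative[OF C, of x] in \<open>auto intro!: derivative_eq_intros\<close>)
  have "((%t. \<theta> (x - t *\<^sub>R v)) has_real_derivative - (grad \<theta> x \<bullet> v)) (at 0)"
  proof -
  have "(%t. grad \<theta> x \<bullet> (- t *\<^sub>R v)) = (*) (- (grad \<theta> x \<bullet> v))" by (simp add: fun_eq_iff)
  then show ?thesis using D by (simp only: has_field_derivative_def)
  qed
  then have "((%t. (\<theta> (x - t *\<^sub>R v) - \<theta> x) / t) \<longlongrightarrow> - (grad \<theta> x \<bullet> v)) (at 0)"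
  by (simp add: has_field_derivative_iff)
  moreover have "filterlim h (at 0) sequentially"
  using h0 h(1) by (auto simp: filterlim_at intro!: always_eventually less_imp_neq[THEN not_sym])
  ultimately have "(%j. (\<theta> (x - h j *\<^sub>R v) - \<theta> x) / h j) \<longlonglongrightarrow> - (grad \<theta> x \<bullet> v)"
  by (rule filterlim_compose)
  from tendsto_minus[OF this] show "(%j. ?q j x) \<longlonglongrightarrow> grad \<theta> x \<bullet> v"
  by (simp add: h_def algebra_simps)
  qed
 qed (use q0 in auto)
 have iF: "integrable lborel (%x. F (x + w) * \<theta> x)" "integrable lborel (%x. F x * \<theta> (x - w))" for w
 proof -
  have *: "integrable lborel (%x. F (x + w) * \<theta> x)" for w
  proof -
  have "bounded ((%x. F (x + w)) ` cball 0 r)"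
  by (intro compact_imp_bounded compact_continuous_image continuous_on_compose2[OF cont] continuous_intros) auto
  then obtain A' where "\<forall>y\<in>(%x. F (x + w)) ` cball 0 r. norm y <= A'" unfolding bounded_iff by blast
  then have A': "\<bar>F (x + w)\<bar> <= A'" if "norm x <= r" for x using that by simp
  have "\<bar>F (x + w) * \<theta> x\<bar> <= \<bar>A'\<bar> * B" for x
  using A'[of x] B(1) B(2)[of x] supp[of x] by (cases "norm x <= r") (auto simp: abs_mult intro!: mult_mono)
  then show ?thesis using supp by (intro bounded_support_integrable[where r=r and B="\<bar>A'\<bar> * B"]) auto
  qed
  then show "integrable lborel (%x. F (x + w) * \<theta> x)" .
  show "integrable lborel (%x. F x * \<theta> (x - w))"
  using *[of w] lborel_integral_translate(2)[where t=w and f="%x. F x * \<theta> (x - w)"] by (simp add: add.commute)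
 qed
 have "(\<integral>x. F x * ?q j x \<partial>lborel) = - (\<integral>x. real (Suc j) * (F (x + h j *\<^sub>R v) - F x) * \<theta> x \<partial>lborel)" for j
 proof -
  have "(\<integral>x. F x * \<theta> (x - h j *\<^sub>R v) \<partial>lborel) = (\<integral>x. F (x + h j *\<^sub>R v) * \<theta> x \<partial>lborel)"
  using lborel_integral_translate(1)[where t="h j *\<^sub>R v" and f="%x. F x * \<theta> (x - h j *\<^sub>R v)"] by (simp add: add.commute)
  then have "real (Suc j) * ((\<integral>x. F x * \<theta> x \<partial>lborel) - (\<integral>x. F x * \<theta> (x - h j *\<^sub>R v) \<partial>lborel)) =
  - (real (Suc j) * ((\<integral>x. F (x + h j *\<^sub>R v) * \<theta> x \<partial>lborel) - (\<integral>x. F x * \<theta> x \<partial>lborel)))"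
  by (simp add: algebra_simps)
  moreover have "(\<integral>x. F x * ?q j x \<partial>lborel) = real (Suc j) * (\<integral>x. F x * \<theta> x - F x * \<theta> (x - h j *\<^sub>R v) \<partial>lborel)"
  unfolding integral_mult_right_zero[symmetric] by (intro Bochner_Integration.integral_cong) (auto simp: algebra_simps)
  moreover have "(\<integral>x. real (Suc j) * (F (x + h j *\<^sub>R v) - F x) * \<theta> x \<partial>lborel) =
  real (Suc j) * (\<integral>x. F (x + h j *\<^sub>R v) * \<theta> x - F x * \<theta> x \<partial>lborel)"
  unfolding integral_mult_right_zero[symmetric] by (intro Bochner_Integration.integral_cong) (auto simp: algebra_simps)
  ultimately show ?thesis using iF[of "h j *\<^sub>R v"] iF[of 0] by (simp add: Bochner_Integration.integral_diff)
 qed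
 moreover have "(%j. \<integral>x. real (Suc j) * (F (x + h j *\<^sub>R v) - F x) * \<theta> x \<partial>lborel) \<longlonglongrightarrow> (\<integral>x. g x * \<theta> x \<partial>lborel)"
 proof (rule integral_dominated_convergence[where w="%x. L * \<bar>\<theta> x\<bar>"])
  show "integrable lborel (%x. L * \<bar>\<theta> x\<bar>)"
  by (intro integrable_mult_right bounded_support_integrable[where r=r and B=B]) (use B supp in auto)
  show "AE x in lborel. (%j. real (Suc j) * (F (x + h j *\<^sub>R v) - F x) * \<theta> x) \<longlonglongrightarrow> g x * \<theta> x"
  using lim unfolding h_def by eventually_elim (intro tendsto_mult tendsto_const)
  show "AE x in lborel. norm (real (Suc j) * (F (x + h j *\<^sub>R v) - F x) * \<theta> x) <= L * \<bar>\<theta> x\<bar>" for j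
  proof (rule AE_I2)
  fix x
  have "real (Suc j) * \<bar>F (x + h j *\<^sub>R v) - F x\<bar> <= real (Suc j) * (L * h j)"
  using lip[OF h(1)] by (intro mult_left_mono) auto
  also have "\<dots> = L * (real (Suc j) * h j)" by (simp only: mult_ac)
  finally have "real (Suc j) * \<bar>F (x + h j *\<^sub>R v) - F x\<bar> <= L" unfolding h(3) by simp
  then show "norm (real (Suc j) * (F (x + h j *\<^sub>R v) - F x) * \<theta> x) <= L * \<bar>\<theta> x\<bar>"
  by (auto simp: abs_mult intro!: mult_right_mono)
  qed
 qed measurable
 ultimately have "(%j. \<integral>x. F x * ?q j x \<partial>lborel) \<longlonglongrightarrow> - (\<integral>x. g x * \<theta> x \<partial>lborel)"
  by (simp add: tendsto_minus)
 with l1 show ?thesis by (rule LIMSEQ_unique)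
qed

text \<open>The one-sided directional derivative of a norm. By convexity the difference quotients
 decrease to it.\<close>

definition nslope :: "(real^'n => real) => real^'n => real^'n => real" where
 "nslope N x y = (INF t\<in>{0<..}. (N (x + t *\<^sub>R y) - N x) / t)"

text \<open>At a point where \<open>N\<close> is not differentiable this is merely the vector of right partial derivatives.\<close>

definition norm_gradient :: "(real^'n::finite => real) => real^'n => real^'n" where
 "norm_gradient N x = (\<chi> i. nslope N x (axis i 1))"

context
 fixes N :: "real^'n::finite => real"
 assumes N: "is_norm N"
begin

lemma slope_mono:
 assumes "0 < s" "s <= t" shows "(N (x + s *\<^sub>R y) - N x) / s <= (N (x + t *\<^sub>R y) - N x) / t"
proof -
 have "x + s *\<^sub>R y = (1 - s / t) *\<^sub>R x + (s / t) *\<^sub>R (x + t *\<^sub>R y)"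
  using assms by (simp add: algebra_simps)
 then have "N (x + s *\<^sub>R y) <= N ((1 - s / t) *\<^sub>R x) + N ((s / t) *\<^sub>R (x + t *\<^sub>R y))"
  using is_norm_triangle[OF N] by metis
 also have "\<dots> = (1 - s / t) * N x + s / t * N (x + t *\<^sub>R y)"
  using assms by (simp add: is_norm_scale[OF N])
 finally show ?thesis using assms by (simp add: field_simps)
qed

lemma slope_bounds:
 assumes t: "0 < t" shows "- N y <= (N (x + t *\<^sub>R y) - N x) / t" "(N (x + t *\<^sub>R y) - N x) / t <= N y"
proof -
 have "N x <= N (x + t *\<^sub>R y) + N (- (t *\<^sub>R y))" using is_norm_triangle[OF N, of "x + t *\<^sub>R y" "- (t *\<^sub>R y)"] by simp
 moreover have "N (- (t *\<^sub>R y)) = t * N y" using t by (simp add: is_norm_minus[OF N] is_norm_scale[OF N])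
 ultimately show "- N y <= (N (x + t *\<^sub>R y) - N x) / t" using t by (simp add: field_simps)
 have "N (x + t *\<^sub>R y) <= N x + t * N y" using is_norm_triangle[OF N, of x "t *\<^sub>R y"] t by (simp add: is_norm_scale[OF N])
 then show "(N (x + t *\<^sub>R y) - N x) / t <= N y" using t by (simp add: field_simps)
qed

lemma slope_lipschitz: "0 < h ==> \<bar>N (x + h *\<^sub>R y) - N x\<bar> <= N y * h"
 using slope_bounds(1)[of h y x] slope_bounds(2)[of h x y] by (simp add: abs_le_iff pos_le_divide_eq pos_divide_le_eq)

lemma nslope_le: "0 < t ==> nslope N x y <= (N (x + t *\<^sub>R y) - N x) / t"
 unfolding nslope_def by (rule cINF_lower) (auto intro!: bdd_belowI2[of _ "- N y"] slope_bounds)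

lemma nslope_greatest: "(!!t. 0 < t ==> c <= (N (x + t *\<^sub>R y) - N x) / t) ==> c <= nslope N x y"
 unfolding nslope_def by (rule cINF_greatest) auto

lemma nslope_le_norm: "nslope N x y <= N y" and nslope_ge: "- N y <= nslope N x y"
 using nslope_le[of 1 x y] slope_bounds(2)[of 1 x y] nslope_greatest[of "- N y" x y] slope_bounds(1)[of _ y x] by (auto intro: order_trans)

lemma nslope_less:
 assumes "nslope N x y < c"
 shows "\<exists>s>0. \<forall>t. 0 < t --> t <= s --> (N (x + t *\<^sub>R y) - N x) / t < c"
proof -
 obtain s where "0 < s" "(N (x + s *\<^sub>R y) - N x) / s < c"
  using nslope_greatest[of c x y] assms by (meson not_le)
 then show ?thesis using slope_mono[of _ s x y] by (meson order.strict_trans1)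
qed

lemma nslope_tendsto: "((%t. (N (x + t *\<^sub>R y) - N x) / t) \<longlongrightarrow> nslope N x y) (at_right 0)"
proof (rule order_tendstoI)
 fix c assume "c < nslope N x y"
 then show "\<forall>\<^sub>F t in at_right 0. c < (N (x + t *\<^sub>R y) - N x) / t"
  using nslope_le[of _ x y] by (auto simp: eventually_at_filter intro!: always_eventually intro: order.strict_trans2)
next
 fix c assume "nslope N x y < c"
 then obtain s where "0 < s" "!!t. 0 < t ==> t <= s ==> (N (x + t *\<^sub>R y) - N x) / t < c"
  using nslope_less by blast
 then show "\<forall>\<^sub>F t in at_right 0. (N (x + t *\<^sub>R y) - N x) / t < c"
  unfolding eventually_at_right_field by (intro exI[of _ s]) auto
qed

lemma nslope_sequentially:
 "(%j. real (Suc j) * (N (x + (1 / real (Suc j)) *\<^sub>R y) - N x)) \<longlonglongrightarrow> nslope N x y"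
proof -
 have "filterlim (%j. 1 / real (Suc j)) (at_right 0) sequentially"
  using LIMSEQ_Suc[OF lim_1_over_n] by (auto simp: filterlim_at intro!: always_eventually)
 from filterlim_compose[OF nslope_tendsto this] show ?thesis by (simp add: mult.commute)
qed

lemma nslope_add: "nslope N x (y + z) <= nslope N x y + nslope N x z"
proof (rule field_le_epsilon)
 fix e :: real assume e: "0 < e"
 obtain s where s: "0 < s" "!!t. 0 < t ==> t <= s ==> (N (x + t *\<^sub>R y) - N x) / t < nslope N x y + e / 2"
  using nslope_less[of x y "nslope N x y + e / 2"] e by auto
 obtain s' where s': "0 < s'" "!!t. 0 < t ==> t <= s' ==> (N (x + t *\<^sub>R z) - N x) / t < nslope N x z + e / 2"
  using nslope_less[of x z "nslope N x z + e / 2"] e by auto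
 define t where "t = min s s'"
 have t: "0 < t" "t <= s" "t <= s'" using s(1) s'(1) by (auto simp: t_def)
 have eq: "x + (t / 2) *\<^sub>R (y + z) = (1 / 2) *\<^sub>R (x + t *\<^sub>R y) + (1 / 2) *\<^sub>R (x + t *\<^sub>R z)"
  by (simp add: vec_eq_iff field_simps)
 have "N (x + (t / 2) *\<^sub>R (y + z)) <= 1 / 2 * N (x + t *\<^sub>R y) + 1 / 2 * N (x + t *\<^sub>R z)"
  unfolding eq using is_norm_triangle[OF N, of "(1 / 2) *\<^sub>R (x + t *\<^sub>R y)" "(1 / 2) *\<^sub>R (x + t *\<^sub>R z)"] by (simp add: is_norm_scale[OF N])
 then have "(2 * N (x + (t / 2) *\<^sub>R (y + z)) - 2 * N x) / t <= (N (x + t *\<^sub>R y) - N x + (N (x + t *\<^sub>R z) - N x)) / t"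
  using t by (intro divide_right_mono) linarith+
 then have "(N (x + (t / 2) *\<^sub>R (y + z)) - N x) / (t / 2) <= (N (x + t *\<^sub>R y) - N x) / t + (N (x + t *\<^sub>R z) - N x) / t"
  by (simp add: add_divide_distrib[symmetric] right_diff_distrib[symmetric] mult.commute)
 also have "\<dots> <= (nslope N x y + e / 2) + (nslope N x z + e / 2)"
  using s(2)[OF t(1,2)] s'(2)[OF t(1,3)] by linarith
 finally show "nslope N x (y + z) <= nslope N x y + nslope N x z + e"
  using nslope_le[of "t / 2" x "y + z"] t by simp
qed

lemma nslope_scale:
 assumes c: "0 <= c" shows "nslope N x (c *\<^sub>R y) = c * nslope N x y"
proof (cases "c = 0")
 case True
 then show ?thesis using nslope_le_norm[of x 0] nslope_ge[of 0 x] by (simp add: is_norm_zero[OF N])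
next
 case False
 then have c: "0 < c" using c by simp
 show ?thesis
 proof (rule antisym)
  have "nslope N x (c *\<^sub>R y) / c <= nslope N x y"
  proof (rule nslope_greatest)
  fix t :: real assume "0 < t"
  then show "nslope N x (c *\<^sub>R y) / c <= (N (x + t *\<^sub>R y) - N x) / t"
  using nslope_le[of "t / c" x "c *\<^sub>R y"] c by (simp add: field_simps)
  qed
  then show "nslope N x (c *\<^sub>R y) <= c * nslope N x y" using c by (simp add: field_simps)
  show "c * nslope N x y <= nslope N x (c *\<^sub>R y)"
  proof (rule nslope_greatest)
  fix t :: real assume "0 < t"
  then show "c * nslope N x y <= (N (x + t *\<^sub>R c *\<^sub>R y) - N x) / t"
  using nslope_le[of "t * c" x y] c by (simp add: field_simps)
  qed
 qed
qed

lemma nslope_homogeneous: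
 assumes c: "0 < c" shows "nslope N (c *\<^sub>R x) y = nslope N x y"
proof -
 have eq: "(N (c *\<^sub>R x + t *\<^sub>R y) - N (c *\<^sub>R x)) / t = (N (x + (t / c) *\<^sub>R y) - N x) / (t / c)" for t
 proof -
  have "c *\<^sub>R x + t *\<^sub>R y = c *\<^sub>R (x + (t / c) *\<^sub>R y)" using c by (simp add: algebra_simps)
  then have "N (c *\<^sub>R x + t *\<^sub>R y) = c * N (x + (t / c) *\<^sub>R y)" using c by (simp add: is_norm_scale[OF N])
  then show ?thesis using c by (simp add: is_norm_scale[OF N] field_simps)
 qed
 show ?thesis
 proof (rule antisym)
  show "nslope N x y <= nslope N (c *\<^sub>R x) y"
  by (rule nslope_greatest) (unfold eq, rule nslope_le, use c in simp)
  show "nslope N (c *\<^sub>R x) y <= nslope N x y"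
  proof (rule nslope_greatest)
  fix t :: real assume "0 < t"
  then show "nslope N (c *\<^sub>R x) y <= (N (x + t *\<^sub>R y) - N x) / t"
  using nslope_le[of "t * c" "c *\<^sub>R x" y] c unfolding eq by simp
  qed
 qed
qed

text \<open>A sublinear functional that is odd on a basis is linear, and a directional derivative is
 sublinear.\<close>

lemma nslope_linear:
 assumes odd: "!!i. nslope N x (axis i 1) + nslope N x (- axis i 1) = 0"
 shows "nslope N x y = norm_gradient N x \<bullet> y"
proof -
 have coord: "nslope N x (c *\<^sub>R axis i 1) = c * nslope N x (axis i 1)" for i c
 proof (cases "0 <= c")
  case False
  then have "nslope N x ((- c) *\<^sub>R (- axis i 1)) = - c * nslope N x (- axis i 1)" by (intro nslope_scale) simp
  then show ?thesis using odd[of i] by (simp add: eq_neg_iff_add_eq_0[symmetric])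
 qed (rule nslope_scale)
 have upper: "nslope N x z <= norm_gradient N x \<bullet> z" for z
 proof -
  have "nslope N x (\<Sum>i\<in>I. z $ i *\<^sub>R axis i 1) <= (\<Sum>i\<in>I. z $ i * nslope N x (axis i 1))" if "finite I" for I
  using that
  proof induction
  case empty
  then show ?case using nslope_scale[of 0 x 0] by simp
  next
  case (insert i I)
  then show ?case using nslope_add[of x "z $ i *\<^sub>R axis i 1" "\<Sum>i\<in>I. z $ i *\<^sub>R axis i 1"] coord by simp
  qed
  from this[of UNIV] show ?thesis
  using basis_expansion[of z] by (simp add: norm_gradient_def inner_vec_def scalar_mult_eq_scaleR mult.commute)
 qed
 have "0 <= nslope N x y + nslope N x (- y)"
  using nslope_add[of x y "- y"] nslope_scale[of 0 x 0] by simp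
 then show ?thesis using upper[of y] upper[of "- y"] by simp
qed

lemma norm_gradient_measurable [measurable]: "norm_gradient N \<in> borel_measurable borel"
proof -
 note [measurable] = is_norm_borel[OF N]
 have "(%x. nslope N x y) \<in> borel_measurable borel" for y
  by (rule borel_measurable_LIMSEQ_real[OF nslope_sequentially]) measurable
 then show ?thesis
  unfolding norm_gradient_def
  by (subst borel_measurable_euclidean_space) (auto simp: Basis_vec_def inner_axis)
qed

lemma norm_gradient_homogeneous: "0 < c ==> norm_gradient N (c *\<^sub>R x) = norm_gradient N x"
 by (simp add: norm_gradient_def nslope_homogeneous)

lemma norm_gradient_bounded: "\<exists>C>0. \<forall>x. norm (norm_gradient N x) <= C"
proof (intro exI conjI allI)
 fix x
 have "\<bar>norm_gradient N x $ i\<bar> <= N (axis i 1)" for i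
  using nslope_le_norm[of x "axis i 1"] nslope_ge[of "axis i 1" x] by (simp add: norm_gradient_def)
 then have "(\<Sum>i\<in>UNIV. \<bar>norm_gradient N x $ i\<bar>) <= (\<Sum>i\<in>UNIV. N (axis i 1))" by (intro sum_mono)
 with norm_le_l1_cart[of "norm_gradient N x"] show "norm (norm_gradient N x) <= 1 + (\<Sum>i\<in>UNIV. N (axis i 1))" by linarith
 show "0 < 1 + (\<Sum>i\<in>UNIV. N (axis i 1))" by (intro add_pos_nonneg sum_nonneg is_norm_nonneg[OF N]) simp
qed

text \<open>Both the right and the left partial derivatives are weak derivatives of \<open>N\<close>; as they are ordered
 pointwise, they agree almost everywhere.\<close>

lemma nslope_odd_AE: "AE x in lborel. nslope N x (axis i 1) + nslope N x (- axis i 1) = 0"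
proof -
 let ?s = "%x. nslope N x (axis i 1) + nslope N x (- axis i 1)"
 note [measurable] = is_norm_borel[OF N]
 have [measurable]: "(%x. nslope N x y) \<in> borel_measurable borel" for y
  by (rule borel_measurable_LIMSEQ_real[OF nslope_sequentially]) measurable
 have s0: "0 <= ?s x" for x using nslope_add[of x "axis i 1" "- axis i 1"] nslope_scale[of 0 x 0] by simp
 have "AE x in lborel. x \<in> box (- (\<chi> i. real m)) (\<chi> i. real m) --> ?s x = 0" for m
 proof -
  let ?\<theta> = "bump (- (\<chi> i. real m)) (\<chi> i. real m) 1 :: real^'n => real"
  have "bounded (box (- (\<chi> i. real m)) (\<chi> i. real m) :: (real^'n) set)" by (rule bounded_box)
  then obtain r where r: "!!x. x \<in> box (- (\<chi> i. real m)) (\<chi> i. real m :: real^'n) ==> norm x <= r" unfolding bounded_iff by blast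
  have supp: "?\<theta> x = 0" if "r < norm x" for x using bump_nonzero_iff[of 1] r[of x] that by force
  have C: "C_k (Suc 0) ?\<theta>" by (rule C_k_bump)
  have parts: "(\<integral>x. N x * (grad ?\<theta> x \<bullet> y) \<partial>lborel) = - (\<integral>x. nslope N x y * ?\<theta> x \<partial>lborel)" for y
  proof (rule lipschitz_integration_by_parts[OF is_norm_continuous[OF N] _ _ _ C supp])
  show "\<bar>N (x + h *\<^sub>R y) - N x\<bar> <= N y * h" if "0 < h" for x h
  by (rule slope_lipschitz[OF that])
  qed (use nslope_sequentially in auto)
  have int: "integrable lborel (%x. nslope N x y * ?\<theta> x)" for y
  proof (rule bounded_support_integrable[where B="N y" and r=r])
  fix x
  show "norm (nslope N x y * ?\<theta> x) <= N y"
  using nslope_le_norm[of x y] nslope_ge[of y x] bump_bounds[of _ _ 1 x] is_norm_nonneg[OF N, of y]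
  mult_mono[of "\<bar>nslope N x y\<bar>" "N y" "?\<theta> x" 1] by (simp add: abs_mult abs_le_iff)
  qed (use supp in auto)
  have "(\<integral>x. ?s x * ?\<theta> x \<partial>lborel) = 0"
  using parts[of "axis i 1"] parts[of "- axis i 1"] int by (simp add: distrib_right)
  moreover have "integrable lborel (%x. ?s x * ?\<theta> x)" using int by (simp add: distrib_right)
  moreover have "AE x in lborel. 0 <= ?s x * ?\<theta> x" by (intro AE_I2 mult_nonneg_nonneg s0 bump_bounds)
  ultimately have "AE x in lborel. ?s x * ?\<theta> x = 0" using integral_nonneg_eq_0_iff_AE by blast
  then show ?thesis by eventually_elim (use bump_nonzero_iff[of 1] in auto)
 qed
 then have "AE x in lborel. \<forall>m. x \<in> box (- (\<chi> i. real m)) (\<chi> i. real m) --> ?s x = 0"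
  unfolding AE_all_countable by (intro allI)
 then show ?thesis
 proof eventually_elim
  fix x assume *: "\<forall>m. x \<in> box (- (\<chi> i. real m)) (\<chi> i. real m) --> ?s x = 0"
  obtain m :: nat where "norm x < real m" using reals_Archimedean2 by blast
  then have "\<bar>x $ j\<bar> < real m" for j using component_le_norm_cart[of x j] by linarith
  then have "x \<in> box (- (\<chi> i. real m)) (\<chi> i. real m)" by (auto simp: mem_box_cart abs_less_iff) (metis minus_less_iff)
  then show "?s x = 0" using * by blast
 qed
qed

lemma dual_norm_norm_gradient_AE: "AE x in lborel. dual_norm N (norm_gradient N x) = 1"
proof -
 have "AE x in lborel. \<forall>i. nslope N x (axis i 1) + nslope N x (- axis i 1) = 0"
 proof -
  have "AE x in lborel. \<forall>i\<in>UNIV. nslope N x (axis i 1) + nslope N x (- axis i 1) = 0"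
  by (intro AE_finite_allI nslope_odd_AE) simp
  then show ?thesis by simp
 qed
 moreover have "AE x in lborel. x ~= (0::real^'n)" by (rule AE_lborel_singleton)
 ultimately show ?thesis
 proof eventually_elim
  fix x assume odd: "\<forall>i. nslope N x (axis i 1) + nslope N x (- axis i 1) = 0" and x: "x ~= (0::real^'n)"
  have G: "norm_gradient N x \<bullet> y = nslope N x y" for y using nslope_linear[of x y] odd by simp
  have Nx: "0 < N x" using x by (rule is_norm_pos[OF N])
  have "N x <= nslope N x x"
  proof (rule nslope_greatest)
  fix t :: real assume "0 < t"
  moreover have eq: "x + t *\<^sub>R x = (1 + t) *\<^sub>R x" by (simp add: algebra_simps)
  have "N (x + t *\<^sub>R x) = \<bar>1 + t\<bar> * N x" unfolding eq by (rule is_norm_scale[OF N])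
  ultimately show "N x <= (N (x + t *\<^sub>R x) - N x) / t" by (simp add: field_simps)
  qed
  then have "N x <= dual_norm N (norm_gradient N x) * N x"
  using dual_norm_inner_le[OF N, of "norm_gradient N x" x] by (simp add: G)
  moreover have "dual_norm N (norm_gradient N x) <= 1"
  by (rule dual_norm_le[OF N]) (metis G nslope_le_norm order_trans)
  ultimately show "dual_norm N (norm_gradient N x) = 1" using Nx by simp
 qed
qed

lemma norm_sphere_AE: "AE x in lborel. N (x - x0) ~= t"
proof (cases "0 < t")
 case False
 have "{x. N (x - x0) = t} \<subseteq> {x0}"
 proof (intro subsetI, rule ccontr)
  fix x assume "x \<in> {x. N (x - x0) = t}" "x \<notin> {x0}"
  then show False using False is_norm_pos[OF N, of "x - x0"] by simp
 qed
 then show ?thesis using AE_lborel_singleton[of x0] by (auto elim!: eventually_mono)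
next
 case True
 note [measurable] = is_norm_borel[OF N]
 let ?S = "{x. N (x - x0) <= t}"
 have "convex ?S"
 proof (rule convexI)
  fix x y and u v :: real assume x: "x \<in> ?S" "y \<in> ?S" and u: "0 <= u" "0 <= v" "u + v = 1"
  have "u *\<^sub>R x + v *\<^sub>R y - x0 = u *\<^sub>R (x - x0) + v *\<^sub>R (y - x0) + (u + v - 1) *\<^sub>R x0" by (simp add: algebra_simps)
  then have "u *\<^sub>R x + v *\<^sub>R y - x0 = u *\<^sub>R (x - x0) + v *\<^sub>R (y - x0)" using u by simp
  then have "N (u *\<^sub>R x + v *\<^sub>R y - x0) <= u * N (x - x0) + v * N (y - x0)"
  using is_norm_triangle[OF N, of "u *\<^sub>R (x - x0)" "v *\<^sub>R (y - x0)"] u by (simp add: is_norm_scale[OF N])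
  also have "\<dots> <= u * t + v * t" using x u by (intro add_mono mult_left_mono) auto
  finally show "u *\<^sub>R x + v *\<^sub>R y \<in> ?S" using u by (simp add: distrib_right[symmetric])
 qed
 then have "negligible (frontier ?S)" by (rule negligible_convex_frontier)
 moreover have "{x. N (x - x0) = t} \<subseteq> frontier ?S"
 proof
  fix x assume "x \<in> {x. N (x - x0) = t}"
  then have x: "N (x - x0) = t" by simp
  have "x \<notin> interior ?S"
  proof
  assume "x \<in> interior ?S"
  then obtain e where e: "0 < e" "ball x e \<subseteq> ?S" unfolding mem_interior by blast
  define d where "d = e / (1 + norm (x - x0)) / 2"
  have d: "0 < d" "d * norm (x - x0) < e" using e(1)
  by (auto simp: d_def field_simps add_pos_nonneg)
  have "x + d *\<^sub>R (x - x0) \<in> ball x e" using d by (simp add: dist_norm)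
  then have "N (x + d *\<^sub>R (x - x0) - x0) <= t" using e by blast
  moreover have "x + d *\<^sub>R (x - x0) - x0 = (1 + d) *\<^sub>R (x - x0)" by (simp add: algebra_simps)
  ultimately have "(1 + d) * t <= t" using d x by (simp add: is_norm_scale[OF N])
  then show False using mult_pos_pos[OF d(1) True] by (simp add: distrib_right)
  qed
  moreover have "x \<in> closure ?S" using x closure_subset[of ?S] by auto
  ultimately show "x \<in> frontier ?S" by (simp add: frontier_def)
 qed
 ultimately have "negligible {x. N (x - x0) = t}" by (rule negligible_subset)
 then have "AE x in lebesgue. x \<notin> {x. N (x - x0) = t}" by (intro AE_not_in) (simp add: negligible_iff_null_sets)
 then show ?thesis by (simp add: AE_completion_iff)
qed

text \<open>The chain rule for a radial profile; the finitely many corners of the profile sit on null spheres.\<close>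

lemma radial_weak_gradient:
 fixes \<psi> \<psi>' :: "real => real"
 assumes L: "!!s t. 0 <= s ==> 0 <= t ==> \<bar>\<psi> s - \<psi> t\<bar> <= L * \<bar>s - t\<bar>"
  and cont: "continuous_on {0..} \<psi>" and [measurable]: "\<psi>' \<in> borel_measurable borel"
  and S: "finite S" and deriv: "!!t. 0 < t ==> t \<notin> S ==> (\<psi> has_real_derivative \<psi>' t) (at t)"
  and C: "C_k (Suc m) \<theta>" and supp: "!!x. r < norm x ==> \<theta> x = 0"
 shows "(\<integral>x. \<psi> (N (x - x0)) * partial i \<theta> x \<partial>lborel) =
  - (\<integral>x. (\<psi>' (N (x - x0)) * norm_gradient N (x - x0) $ i) * \<theta> x \<partial>lborel)"
proof -
 note [measurable] = is_norm_borel[OF N]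
 have [measurable]: "(%x. norm_gradient N (x - x0) $ i) \<in> borel_measurable borel"
 proof -
  have "(%x. norm_gradient N (x - x0)) \<in> borel_measurable borel" by measurable
  then have "(%x. norm_gradient N (x - x0) \<bullet> axis i 1) \<in> borel_measurable borel" by measurable
  then show ?thesis by (simp add: inner_axis)
 qed
 have L0: "0 <= L" using L[of 0 1] by simp
 have "(\<integral>x. \<psi> (N (x - x0)) * (grad \<theta> x \<bullet> axis i 1) \<partial>lborel) =
  - (\<integral>x. (\<psi>' (N (x - x0)) * norm_gradient N (x - x0) $ i) * \<theta> x \<partial>lborel)"
 proof (rule lipschitz_integration_by_parts[OF _ _ _ _ C supp])
  show "continuous_on UNIV (%x. \<psi> (N (x - x0)))"
  by (intro continuous_on_compose2[OF cont] continuous_on_compose2[OF is_norm_continuous[OF N, of UNIV]] continuous_intros)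
  (auto simp: is_norm_nonneg[OF N])
  show "\<bar>\<psi> (N (x + h *\<^sub>R axis i 1 - x0)) - \<psi> (N (x - x0))\<bar> <= (L * N (axis i 1)) * h" if h: "0 < h" for x h
  proof -
  have "\<bar>N (x - x0 + h *\<^sub>R axis i 1) - N (x - x0)\<bar> <= N (axis i 1) * h"
  by (rule slope_lipschitz[OF h])
  then have "L * \<bar>N (x - x0 + h *\<^sub>R axis i 1) - N (x - x0)\<bar> <= L * (N (axis i 1) * h)" using L0 by (rule mult_left_mono)
  moreover have eq: "x + h *\<^sub>R axis i 1 - x0 = x - x0 + h *\<^sub>R axis i 1" by simp
  moreover have "\<bar>\<psi> (N (x - x0 + h *\<^sub>R axis i 1)) - \<psi> (N (x - x0))\<bar> <= L * \<bar>N (x - x0 + h *\<^sub>R axis i 1) - N (x - x0)\<bar>"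
  by (intro L is_norm_nonneg[OF N])
  ultimately show ?thesis unfolding eq by linarith
  qed
  have "AE x in lborel. \<forall>t\<in>insert 0 S. N (x - x0) ~= t"
  using S norm_sphere_AE by (intro AE_finite_allI) auto
  then show "AE x in lborel. (%j. real (Suc j) * (\<psi> (N (x + (1 / real (Suc j)) *\<^sub>R axis i 1 - x0)) - \<psi> (N (x - x0))))
  \<longlonglongrightarrow> \<psi>' (N (x - x0)) * norm_gradient N (x - x0) $ i"
  proof eventually_elim
  fix x assume "\<forall>t\<in>insert 0 S. N (x - x0) ~= t"
  then have "0 < N (x - x0)" "N (x - x0) \<notin> S" using is_norm_nonneg[OF N, of "x - x0"] by auto
  from deriv[OF this] obtain \<Delta> where \<Delta>: "!!t. \<psi> t - \<psi> (N (x - x0)) = \<Delta> t * (t - N (x - x0))" "isCont \<Delta> (N (x - x0))" "\<Delta> (N (x - x0)) = \<psi>' (N (x - x0))"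
  by (auto simp: CARAT_DERIV)
  let ?z = "%j. x + (1 / real (Suc j)) *\<^sub>R axis i 1 - x0"
  have z: "?z j = x - x0 + (1 / real (Suc j)) *\<^sub>R axis i 1" for j by simp
  have "(%j. N (?z j)) \<longlonglongrightarrow> N (x - x0)"
  proof -
  have "(%j. x - x0 + (1 / real (Suc j)) *\<^sub>R (axis i 1 :: real^'n)) \<longlonglongrightarrow> x - x0 + 0 *\<^sub>R axis i 1"
  by (intro tendsto_intros LIMSEQ_Suc[OF lim_1_over_n])
  then have "?z \<longlonglongrightarrow> x - x0" unfolding z by simp
  moreover have "isCont N (x - x0)" using is_norm_continuous[OF N, of UNIV] by (simp add: continuous_on_eq_continuous_at)
  ultimately show ?thesis by (rule isCont_tendsto_compose[rotated])
  qed
  then have "(%j. \<Delta> (N (?z j))) \<longlonglongrightarrow> \<psi>' (N (x - x0))"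
  using isCont_tendsto_compose[OF \<Delta>(2)] \<Delta>(3) by metis
  moreover have "(%j. real (Suc j) * (N (?z j) - N (x - x0))) \<longlonglongrightarrow> nslope N (x - x0) (axis i 1)"
  unfolding z by (rule nslope_sequentially)
  ultimately have "(%j. \<Delta> (N (?z j)) * (real (Suc j) * (N (?z j) - N (x - x0)))) \<longlonglongrightarrow> \<psi>' (N (x - x0)) * nslope N (x - x0) (axis i 1)"
  by (rule tendsto_mult)
  then
  show "(%j. real (Suc j) * (\<psi> (N (?z j)) - \<psi> (N (x - x0)))) \<longlonglongrightarrow> \<psi>' (N (x - x0)) * norm_gradient N (x - x0) $ i"
  unfolding \<Delta>(1) norm_gradient_def by (simp only: vec_lambda_beta mult_ac)
  qed
 qed measurable
 then show ?thesis by (simp add: grad_def inner_axis)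
qed

end

section \<open>Equality for the exponential profiles\<close>

lemma integral_hs_meas_translate:
 fixes F :: "real^'n::finite => real"
 assumes [measurable]: "F \<in> borel_measurable borel" and v: "v $ k = 0"
 shows "integrable (hs_meas k a) (%x. F (x - v)) \<longleftrightarrow> integrable (hs_meas k a) F"
  "(\<integral>x. F (x - v) \<partial>hs_meas k a) = (\<integral>x. F x \<partial>hs_meas k a)"
proof -
 let ?\<mu> = "hs_meas k a"
 have eq: "distr ?\<mu> borel (%x. x - v) = ?\<mu>"
 proof (rule measure_eqI)
  fix A assume "A \<in> sets (distr ?\<mu> borel (%x. x - v))"
  then have [measurable]: "A \<in> sets borel" by simp
  have "emeasure (distr ?\<mu> borel (%x. x - v)) A = (\<integral>\<^sup>+x. indicator A (x - v) \<partial>?\<mu>)"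
  by (subst nn_integral_distr[of _ ?\<mu> borel "indicator A", symmetric]) simp_all
  also have "\<dots> = emeasure ?\<mu> A" by (subst nn_integral_hs_meas_translate[OF _ v]) simp_all
  finally show "emeasure (distr ?\<mu> borel (%x. x - v)) A = emeasure ?\<mu> A" .
 qed simp
 show "integrable ?\<mu> (%x. F (x - v)) \<longleftrightarrow> integrable ?\<mu> F"
  using integrable_distr_eq[of "%x. x - v" ?\<mu> borel F] unfolding eq by simp
 show "(\<integral>x. F (x - v) \<partial>?\<mu>) = (\<integral>x. F x \<partial>?\<mu>)"
  using integral_distr[of "%x. x - v" ?\<mu> borel F] unfolding eq by simp
qed

lemma extended_integral_half_space_integrable:
 fixes h :: "real^'n::finite => real"
 assumes int: "integrable (hs_meas k a) h"
 shows "extended_integral lebesgue (half_space k) (%x. h x * weight k a x) = ereal (\<integral>x. h x \<partial>hs_meas k a)"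
proof -
 have m: "h \<in> borel_measurable borel" using borel_measurable_integrable[OF int] by simp
 have "(\<integral>\<^sup>+x. ennreal (h x) \<partial>hs_meas k a) < \<infinity>" "(\<integral>\<^sup>+x. ennreal (- h x) \<partial>hs_meas k a) ~= \<infinity>"
  using int by (auto simp: real_integrable_def less_top)
 then show ?thesis
  unfolding real_lebesgue_integral_def[OF int] by (subst extended_integral_half_space[OF _ m]) (simp_all add: enn2ereal_diff)
qed

lemma bounded_borel_locally_integrable:
 fixes F :: "real^'n::finite => 'b::{banach, second_countable_topology}"
 assumes [measurable]: "F \<in> borel_measurable borel" and B: "!!x. norm (F x) <= B"
 shows "locally_integrable \<Omega> F"
 unfolding locally_integrable_def
proof (intro allI impI)
 fix K :: "(real^'n) set" assume K: "compact K & K \<subseteq> \<Omega>"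
 then have [measurable]: "K \<in> sets borel" by (auto intro: borel_compact)
 have "bounded K" using K by (auto intro: compact_imp_bounded)
 then obtain r where "\<forall>x\<in>K. norm x <= r" unfolding bounded_iff by blast
 then have r: "norm x <= r" if "x \<in> K" for x using that by blast
 have "integrable lborel (%x. indicator K x *\<^sub>R F x)"
 proof (rule bounded_support_integrable[where r=r and B=B])
  show "norm (indicator K x *\<^sub>R F x) <= B" for x using B[of x] order_trans[OF norm_ge_zero B[of x]] by (auto simp: indicator_def)
  show "indicator K x *\<^sub>R F x = 0" if "r < norm x" for x using r[of x] that by (auto simp: indicator_def)
 qed measurable
 then show "set_integrable lebesgue K F" by (simp add: set_integrable_def integrable_completion)
qed

lemma lebesgue_set_integral_of_support:
 fixes H :: "real^'n::finite => real"
 assumes "H \<in> borel_measurable borel" and "!!x. x \<notin> \<Omega> ==> H x = 0"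
 shows "(LINT x:\<Omega>|lebesgue. H x) = (\<integral>x. H x \<partial>lborel)"
proof -
 have eq: "(%x. indicator \<Omega> x *\<^sub>R H x) = H" using assms(2) by (force simp: fun_eq_iff indicator_def)
 show ?thesis unfolding set_lebesgue_integral_def eq using assms(1) by (simp add: integral_completion)
qed

lemma test_function_bounded_support:
 assumes "test_function \<Omega> \<phi>" obtains r where "!!x. r < norm x ==> \<phi> x = 0"
proof -
 have "bounded (closure {x. \<phi> x ~= 0})" using assms by (auto simp: test_function_def intro: compact_imp_bounded)
 then obtain r where "!!x. x \<in> closure {x. \<phi> x ~= 0} ==> norm x <= r" unfolding bounded_iff by blast
 then have "\<phi> x = 0" if "r < norm x" for x using that closure_subset[of "{x. \<phi> x ~= 0}"] by fastforce
 then show ?thesis using that by blast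
qed

lemma bounded_weak_gradientI:
 fixes F :: "real^'n::finite => real" and g :: "real^'n => real^'n"
 assumes F [measurable]: "F \<in> borel_measurable borel" "!!x. norm (F x) <= B"
  and g [measurable]: "g \<in> borel_measurable borel" "!!x. norm (g x) <= B'"
  and parts: "!!\<phi> i. test_function \<Omega> \<phi> ==> (\<integral>x. F x * partial i \<phi> x \<partial>lborel) = - (\<integral>x. g x $ i * \<phi> x \<partial>lborel)"
 shows "is_weak_gradient \<Omega> F g"
 unfolding is_weak_gradient_def
proof (intro conjI allI impI)
 show "locally_integrable \<Omega> F" "locally_integrable \<Omega> g" by (rule bounded_borel_locally_integrable, rule F(1), rule F(2)) (rule bounded_borel_locally_integrable[OF g])
 fix \<phi> i assume t: "test_function \<Omega> \<phi>"
 note [measurable] = test_function_measurable[OF t] test_function_partial_measurable[OF t]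
 have [measurable]: "(%x. g x $ i) \<in> borel_measurable borel"
 proof -
  have "(%x. g x \<bullet> axis i 1) \<in> borel_measurable borel" by measurable
  then show ?thesis by (simp add: inner_axis)
 qed
 have "(LINT x:\<Omega>|lebesgue. F x * partial i \<phi> x) = (\<integral>x. F x * partial i \<phi> x \<partial>lborel)"
  by (rule lebesgue_set_integral_of_support) (simp_all add: test_function_partial_support[OF t])
 moreover have "(LINT x:\<Omega>|lebesgue. g x $ i * \<phi> x) = (\<integral>x. g x $ i * \<phi> x \<partial>lborel)"
  by (rule lebesgue_set_integral_of_support) (simp_all add: test_function_support[OF t])
 ultimately show "(LINT x:\<Omega>|lebesgue. F x * partial i \<phi> x) = - (LINT x:\<Omega>|lebesgue. g x $ i * \<phi> x)"
  using parts[OF t] by simp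
qed

lemma ln_log_sobolev_const:
 fixes k :: "'n::finite" and N :: "real^'n => real"
 assumes N: "is_norm N" and a: "0 <= a" and p: "1 < p"
 defines "na \<equiv> eff_dim TYPE('n) a"
 defines "G \<equiv> Gamma (na / (p / (p - 1)) + 1) * half_ball_mass k a N"
 shows "0 < G" "0 < log_sobolev_const k a N p"
  "ln (log_sobolev_const k a N p) = ln p - ln na + (p - 1) * (ln (p - 1) - 1) - p / na * ln G"
proof -
 have na: "0 < na" unfolding na_def by (rule eff_dim_pos[OF a])
 show G: "0 < G"
  using half_ball_mass_eq(2)[OF N a, of k] na p
  by (auto simp: G_def intro!: mult_pos_pos Gamma_real_pos add_pos_pos divide_pos_pos)
 have L: "log_sobolev_const k a N p = p / na * ((p - 1) / exp 1) powr (p - 1) * G powr (- (p / na))"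
  using p by (simp add: log_sobolev_const_def Let_def G_def na_def)
 show "0 < log_sobolev_const k a N p" unfolding L using p na G by simp
 show "ln (log_sobolev_const k a N p) = ln p - ln na + (p - 1) * (ln (p - 1) - 1) - p / na * ln G"
  unfolding L using p na G by (simp add: ln_mult ln_powr ln_div)
qed

lemma exponential_profile:
 fixes b \<kappa> q :: real
 assumes q: "1 < q" and \<kappa>: "0 < \<kappa>"
 defines "\<psi> \<equiv> %t. b * exp (- \<kappa> * t powr q)" and "\<psi>' \<equiv> %t. - (b * \<kappa> * q) * (t powr (q - 1) * exp (- \<kappa> * t powr q))"
 shows "0 < t ==> (\<psi> has_real_derivative \<psi>' t) (at t)"
  and "0 <= t ==> \<bar>\<psi>' t\<bar> <= \<bar>b * \<kappa> * q\<bar> * (1 + 1 / \<kappa>)"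
  and "continuous_on {0..} \<psi>"
  and "0 <= s ==> 0 <= t ==> \<bar>\<psi> s - \<psi> t\<bar> <= \<bar>b * \<kappa> * q\<bar> * (1 + 1 / \<kappa>) * \<bar>s - t\<bar>"
proof -
 show D: "(\<psi> has_real_derivative \<psi>' t) (at t)" if "0 < t" for t
  unfolding \<psi>_def \<psi>'_def using that by (auto intro!: derivative_eq_intros)
 show B: "\<bar>\<psi>' t\<bar> <= \<bar>b * \<kappa> * q\<bar> * (1 + 1 / \<kappa>)" if t: "0 <= t" for t
 proof -
  have "t powr (q - 1) <= 1 + t powr q"
  proof (cases "t <= 1")
  case True
  then have "t powr (q - 1) <= 1" using t q by (intro powr_le1) auto
  then show ?thesis by (simp add: add_increasing2)
  next
  case False
  then have "t powr (q - 1) <= t powr q" by (intro powr_mono) auto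
  then show ?thesis by simp
  qed
  also have "t powr q <= 1 / \<kappa> * exp (\<kappa> * t powr q)"
  proof -
  have "\<kappa> * t powr q <= exp (\<kappa> * t powr q)" using exp_ge_add_one_self[of "\<kappa> * t powr q"] by linarith
  then show ?thesis using \<kappa> by (simp add: field_simps)
  qed
  also have "1 + 1 / \<kappa> * exp (\<kappa> * t powr q) <= (1 + 1 / \<kappa>) * exp (\<kappa> * t powr q)" using \<kappa> by (simp add: distrib_right)
  finally have "t powr (q - 1) <= (1 + 1 / \<kappa>) * exp (\<kappa> * t powr q)" by simp
  then have "t powr (q - 1) * exp (- \<kappa> * t powr q) <= (1 + 1 / \<kappa>) * exp (\<kappa> * t powr q) * exp (- \<kappa> * t powr q)"
  by (rule mult_right_mono) simp
  also have "\<dots> = 1 + 1 / \<kappa>" by (simp add: mult.assoc exp_add[symmetric])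
  finally have "\<bar>b * \<kappa> * q\<bar> * (t powr (q - 1) * exp (- \<kappa> * t powr q)) <= \<bar>b * \<kappa> * q\<bar> * (1 + 1 / \<kappa>)"
  by (rule mult_left_mono) simp
  then show ?thesis unfolding \<psi>'_def by (simp add: abs_mult)
 qed
 show cont: "continuous_on {0..} \<psi>"
  unfolding \<psi>_def using q by (intro continuous_intros continuous_on_powr') auto
 have le: "\<bar>\<psi> s - \<psi> t\<bar> <= \<bar>b * \<kappa> * q\<bar> * (1 + 1 / \<kappa>) * \<bar>s - t\<bar>" if st: "0 <= s" "s < t" for s t
 proof -
  have "\<exists>l z. s < z & z < t & DERIV \<psi> z :> l & \<psi> t - \<psi> s = (t - s) * l"
  proof (rule MVT[OF st(2)])
  show "continuous_on {s..t} \<psi>" using cont by (rule continuous_on_subset) (use st in auto)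
  show "\<psi> differentiable (at z)" if "s < z" "z < t" for z using D[of z] that st by (auto simp: real_differentiable_def)
  qed
  then obtain l z where z: "s < z" "DERIV \<psi> z :> l" "\<psi> t - \<psi> s = (t - s) * l" by blast
  have "l = \<psi>' z" by (rule DERIV_unique[OF z(2) D]) (use z st in simp)
  then have "\<bar>t - s\<bar> * \<bar>l\<bar> <= \<bar>t - s\<bar> * (\<bar>b * \<kappa> * q\<bar> * (1 + 1 / \<kappa>))" using B[of z] z st by (intro mult_left_mono) auto
  moreover have "\<bar>\<psi> t - \<psi> s\<bar> = \<bar>t - s\<bar> * \<bar>l\<bar>" unfolding z(3) by (rule abs_mult)
  ultimately show ?thesis by (simp add: abs_minus_commute mult.commute)
 qed
 show "\<bar>\<psi> s - \<psi> t\<bar> <= \<bar>b * \<kappa> * q\<bar> * (1 + 1 / \<kappa>) * \<bar>s - t\<bar>" if "0 <= s" "0 <= t"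
  using le[of s t] le[of t s] that by (cases s t rule: linorder_cases) (auto simp: abs_minus_commute)
qed

text \<open>Every quantity is an integral of \<open>exp (- c N\<^sup>q)\<close> or \<open>N\<^sup>q exp (- c N\<^sup>q)\<close> with \<open>c = p \<kappa>\<close>; the translation by \<open>x0\<close> preserves the half-space and its weight.\<close>

theorem exponential_equality:
 fixes k :: "'n::finite" and N :: "real^'n => real" and a p b \<kappa> :: real
 assumes N: "is_norm N" and a: "0 <= a" and p: "1 < p" and \<kappa>: "0 < \<kappa>" and x0: "x0 $ k = 0"
 defines "q \<equiv> p / (p - 1)"
 assumes b: "\<bar>b\<bar> powr (- p) = (LINT x:half_space k|lebesgue. exp (- p * \<kappa> * N x powr q) * weight k a x)"
 defines "f \<equiv> %x. b * exp (- \<kappa> * N (x - x0) powr q)"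
 shows "f \<in> weighted_sobolev k a p N" "mass_p k a p f = 1"
  "entropy_p k a p f =
  ereal (eff_dim TYPE('n) a / p) * extended_ln (log_sobolev_const k a N p * gradient_energy k a p N f)"
proof -
 let ?\<mu> = "hs_meas k a" and ?\<Omega> = "half_space k"
 define na where "na = eff_dim TYPE('n) a"
 define G where "G = Gamma (na / q + 1) * half_ball_mass k a N"
 note [measurable] = is_norm_borel[OF N] norm_gradient_measurable[OF N] is_norm_borel[OF is_norm_dual_norm[OF N]]
 have q: "1 < q" using p by (simp add: q_def)
 have qp: "p * (q - 1) = q" using p by (simp add: q_def field_simps)
 have na: "0 < na" unfolding na_def by (rule eff_dim_pos[OF a])
 define c where "c = p * \<kappa>"
 have c: "0 < c" using p \<kappa> by (simp add: c_def)
 note L = ln_log_sobolev_const[OF N a p, of k, folded na_def q_def, folded G_def]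
 have q0: "0 < q" using q by simp
 note I = exp_norm_powr_integral[OF N a q0 c, of k, folded na_def, folded G_def]
 define Z where "Z = c powr - (na / q) * G"
 have Z: "0 < Z" using c L(1) by (simp add: Z_def)
 have mf [measurable]: "f \<in> borel_measurable borel" unfolding f_def by measurable
 have "\<bar>b\<bar> powr (- p) = (\<integral>x. exp (- (c * N x powr q)) \<partial>?\<mu>)"
  unfolding b by (subst integral_hs_meas(1)) (simp_all add: c_def)
 then have bZ: "\<bar>b\<bar> powr (- p) = Z" unfolding I(2) Z_def .
 have b0: "b ~= 0" using bZ Z by auto
 have B: "\<bar>b\<bar> powr p = 1 / Z" unfolding bZ[symmetric] by (simp add: powr_minus_divide)
 let ?T = "%x. N (x - x0) powr q"
 have tr: "integrable ?\<mu> (%x. H (N (x - x0))) \<longleftrightarrow> integrable ?\<mu> (%x. H (N x))"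
  "(\<integral>x. H (N (x - x0)) \<partial>?\<mu>) = (\<integral>x. H (N x) \<partial>?\<mu>)" if [measurable]: "H \<in> borel_measurable borel" for H :: "real => real"
  using integral_hs_meas_translate[of "%x. H (N x)" x0 k a] x0 by simp_all
 have I1: "integrable ?\<mu> (%x. exp (- (c * ?T x)))" "(\<integral>x. exp (- (c * ?T x)) \<partial>?\<mu>) = Z"
  using tr[of "%t. exp (- (c * t powr q))"] I(1,2) by (simp_all add: Z_def)
 have I2: "integrable ?\<mu> (%x. ?T x * exp (- (c * ?T x)))" "(\<integral>x. ?T x * exp (- (c * ?T x)) \<partial>?\<mu>) = na / q / c * Z"
  using tr[of "%t. t powr q * exp (- (c * t powr q))"] I(3,4) by (simp_all add: Z_def)
 have fp: "\<bar>f x\<bar> powr p = exp (- (c * ?T x)) / Z" for x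
  by (simp add: f_def abs_mult powr_mult B exp_powr_real c_def mult_ac)
 have mass: "set_integrable lebesgue ?\<Omega> (%x. \<bar>f x\<bar> powr p * weight k a x)" and mass1: "mass_p k a p f = 1"
  unfolding mass_p_def using I1 Z by (simp_all add: integral_hs_meas fp)
 show "mass_p k a p f = 1" by (rule mass1)
 \<comment> \<open>the gradient\<close>
 define \<psi>' where "\<psi>' = (%t. - (b * \<kappa> * q) * (t powr (q - 1) * exp (- \<kappa> * t powr q)))"
 have [measurable]: "\<psi>' \<in> borel_measurable borel" unfolding \<psi>'_def by measurable
 note P = exponential_profile[OF q \<kappa>, where b=b]
 define g where "g x = \<psi>' (N (x - x0)) *\<^sub>R norm_gradient N (x - x0)" for x
 have [measurable]: "g \<in> borel_measurable borel" unfolding g_def by measurable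
 obtain C where C: "0 < C" "!!x. norm (norm_gradient N x) <= C" using norm_gradient_bounded[OF N] by blast
 have wg: "is_weak_gradient ?\<Omega> f g"
 proof (rule bounded_weak_gradientI)
  show "norm (f x) <= \<bar>b\<bar>" for x using \<kappa> by (simp add: f_def abs_mult mult_left_le)
  show "norm (g x) <= \<bar>b * \<kappa> * q\<bar> * (1 + 1 / \<kappa>) * C" for x
  unfolding g_def norm_scaleR real_norm_def \<psi>'_def
  using P(2)[OF is_norm_nonneg[OF N, of "x - x0"]] C \<kappa> by (intro mult_mono) auto
  fix \<phi> i assume t: "test_function ?\<Omega> \<phi>"
  obtain r where r: "!!x. r < norm x ==> \<phi> x = 0" using test_function_bounded_support[OF t] by blast
  have C\<phi>: "C_k (Suc 0) \<phi>" by (rule test_function_C_k[OF t])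
  have "(\<integral>x. (b * exp (- \<kappa> * N (x - x0) powr q)) * partial i \<phi> x \<partial>lborel) =
  - (\<integral>x. (\<psi>' (N (x - x0)) * norm_gradient N (x - x0) $ i) * \<phi> x \<partial>lborel)"
  proof (rule radial_weak_gradient[OF N P(4) P(3) _ finite.emptyI _ C\<phi> r])
  show "((%t. b * exp (- \<kappa> * t powr q)) has_real_derivative \<psi>' t) (at t)" if "0 < t" for t
  unfolding \<psi>'_def by (rule P(1)[OF that])
  qed auto
  then show "(\<integral>x. f x * partial i \<phi> x \<partial>lborel) = - (\<integral>x. g x $ i * \<phi> x \<partial>lborel)"
  by (simp add: f_def g_def \<psi>'_def)
 qed measurable
 have wgf: "is_weak_gradient ?\<Omega> f (weak_gradient ?\<Omega> f)" unfolding weak_gradient_def by (rule someI[of "is_weak_gradient ?\<Omega> f", OF wg])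
 have dual: "AE x in lebesgue. dual_norm N (norm_gradient N (x - x0)) = 1"
 proof -
  have "AE x in distr lborel borel (%x. x - x0). dual_norm N (norm_gradient N x) = 1"
  proof -
  have "distr lborel borel (%x. x - x0) = lborel"
  proof -
  have *: "(%x. x - x0) = (+) (- x0)" by (simp add: fun_eq_iff)
  show ?thesis unfolding * by (rule lborel_distr_plus)
  qed
  then show ?thesis using dual_norm_norm_gradient_AE[OF N] by metis
  qed
  then have "AE x in lborel. dual_norm N (norm_gradient N (x - x0)) = 1" by (subst (asm) AE_distr_iff) auto
  then show ?thesis by (simp add: AE_completion_iff)
 qed
 define K where "K = (\<kappa> * q) powr p / Z"
 have energy_eq: "AE x in lebesgue. x \<in> ?\<Omega> --> dual_norm N (weak_gradient ?\<Omega> f x) powr p = K * (?T x * exp (- (c * ?T x)))"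
  using weak_gradient_unique[OF wgf wg] dual
 proof eventually_elim
  fix x assume x: "x \<in> ?\<Omega> --> weak_gradient ?\<Omega> f x = g x" "dual_norm N (norm_gradient N (x - x0)) = 1"
  have "dual_norm N (g x) = \<bar>\<psi>' (N (x - x0))\<bar>" using x(2) by (simp add: g_def is_norm_scale[OF is_norm_dual_norm[OF N]])
  also have "\<dots> = \<bar>b\<bar> * (\<kappa> * q) * (N (x - x0) powr (q - 1) * exp (- \<kappa> * ?T x))" using \<kappa> q by (simp add: \<psi>'_def abs_mult)
  also have "\<dots> powr p = K * (?T x * exp (- (c * ?T x)))"
  using \<kappa> q by (simp add: powr_mult powr_powr qp B K_def c_def exp_powr_real mult_ac)
  finally show "x \<in> ?\<Omega> --> dual_norm N (weak_gradient ?\<Omega> f x) powr p = K * (?T x * exp (- (c * ?T x)))" using x(1) by simp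
 qed
 have E: "set_integrable lebesgue ?\<Omega> (%x. dual_norm N (weak_gradient ?\<Omega> f x) powr p * weight k a x)"
  "gradient_energy k a p N f = (\<kappa> * q) powr p * (na / q / c)"
  unfolding gradient_energy_def using weighted_integral_half_space[OF energy_eq, of a] I2 Z by (simp_all add: K_def)
 have "f \<in> borel_measurable (lebesgue_on ?\<Omega>)"
  using mf by (intro measurable_restrict_space1 measurable_completion) simp
 then show "f \<in> weighted_sobolev k a p N" using mass E(1) wg by (auto simp: weighted_sobolev_def)
 have h: "\<bar>f x\<bar> powr p * ln (\<bar>f x\<bar> powr p) = - ln Z / Z * exp (- (c * ?T x)) - c / Z * (?T x * exp (- (c * ?T x)))" for x
  using Z by (simp add: fp ln_div field_simps)
 have "entropy_p k a p f = ereal (\<integral>x. - ln Z / Z * exp (- (c * ?T x)) - c / Z * (?T x * exp (- (c * ?T x))) \<partial>?\<mu>)"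
  unfolding entropy_p_def h by (rule extended_integral_half_space_integrable) (use I1 I2 in auto)
 also have "(\<integral>x. - ln Z / Z * exp (- (c * ?T x)) - c / Z * (?T x * exp (- (c * ?T x))) \<partial>?\<mu>) = - ln Z - na / q"
  using I1 I2 Z c by (subst Bochner_Integration.integral_diff) auto
 also have "- ln Z = na / q * ln c - ln G" using c L(1) by (simp add: Z_def ln_mult ln_powr)
 also have "na / q * ln c - ln G - na / q = na / p * ln (log_sobolev_const k a N p * gradient_energy k a p N f)"
 proof -
  have "ln (gradient_energy k a p N f) = p * (ln \<kappa> + ln q) + ln na - ln q - ln c"
  unfolding E(2) using \<kappa> q na c by (simp add: ln_mult ln_powr ln_div)
  moreover have "ln q = ln p - ln (p - 1)" using p by (simp add: q_def ln_div)
  moreover have "ln c = ln p + ln \<kappa>" using p \<kappa> by (simp add: c_def ln_mult)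
  moreover have "ln (log_sobolev_const k a N p * gradient_energy k a p N f) = ln (log_sobolev_const k a N p) + ln (gradient_energy k a p N f)"
  unfolding E(2) using L(2) \<kappa> q na c by (intro ln_mult_pos) auto
  ultimately have 1: "ln (log_sobolev_const k a N p * gradient_energy k a p N f) = (p - 1) * (ln c - 1) - p / na * ln G"
  unfolding L(3) by (simp add: algebra_simps)
  have 2: "na / q = na / p * (p - 1)" using p by (simp add: q_def)
  show ?thesis unfolding 1 2 using p na by (simp add: field_simps)
 qed
 finally show "entropy_p k a p f = ereal (eff_dim TYPE('n) a / p) * extended_ln (log_sobolev_const k a N p * gradient_energy k a p N f)"
  using L(2) \<kappa> q na c by (simp add: na_def E(2) extended_ln_def)
qed

section \<open>Surface integrals as limits of shells\<close>

lemma lborel_integral_scale: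
 fixes F :: "'a::euclidean_space => real"
 assumes [measurable]: "F \<in> borel_measurable borel" and c: "0 < c"
 shows "(\<integral>x. F x \<partial>lborel) = c ^ DIM('a) * (\<integral>x. F (c *\<^sub>R x) \<partial>lborel)"
proof -
 have c0: "c ~= 0" using c by simp
 have "(\<integral>x. F x \<partial>lborel) = (\<integral>x. F x \<partial>density (distr lborel borel (%x. 0 + c *\<^sub>R x)) (%_. ennreal (\<bar>c\<bar> ^ DIM('a))))"
  by (rule arg_cong[where f="%M. integral\<^sup>L M F", OF lborel_affine[OF c0, of 0]])
 also have "\<dots> = (\<integral>x. \<bar>c\<bar> ^ DIM('a) *\<^sub>R F x \<partial>distr lborel borel (%x. 0 + c *\<^sub>R x))"
  by (rule integral_density) auto
 also have "\<dots> = (\<integral>x. \<bar>c\<bar> ^ DIM('a) *\<^sub>R F (0 + c *\<^sub>R x) \<partial>lborel)"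
  by (rule integral_distr) measurable
 finally show ?thesis using c by simp
qed

context
 fixes N :: "real^'n::finite => real"
 assumes N: "is_norm N"
begin

lemma indicator_ball_integrable:
 assumes [measurable]: "H \<in> borel_measurable borel" and C: "!!x. \<bar>H x\<bar> <= C"
 shows "integrable lborel (%x. indicator {x. N x <= s} x * H x :: real)"
proof -
 note [measurable] = is_norm_borel[OF N]
 obtain c where c: "0 < c" "!!x. norm x <= c * N x" using is_norm_lower[OF N] by blast
 show ?thesis
 proof (rule bounded_support_integrable[where B=C and r="c * s"])
  show "norm (indicator {x. N x <= s} x * H x) <= C" for x
  using C[of x] order_trans[OF abs_ge_zero C[of x]] by (simp add: indicator_def)
  show "indicator {x. N x <= s} x * H x = 0" if x: "c * s < norm x" for x
  proof -
  have "c * s < c * N x" using x c(2)[of x] by linarith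
  then show ?thesis using c(1) by (simp add: indicator_def)
  qed
 qed measurable
qed

lemma homogeneous_ball_integral:
 fixes H :: "real^'n => real"
 assumes [measurable]: "H \<in> borel_measurable borel" and hom: "!!c x. 0 < c ==> H (c *\<^sub>R x) = H x" and s: "0 < s"
 shows "(\<integral>x. indicator {x. N x <= s} x * H x \<partial>lborel) = s ^ CARD('n) * (\<integral>x. indicator {x. N x <= 1} x * H x \<partial>lborel)"
proof -
 note [measurable] = is_norm_borel[OF N]
 have "(\<integral>x. indicator {x. N x <= s} x * H x \<partial>lborel) =
  s ^ DIM(real^'n) * (\<integral>x. indicator {x. N x <= s} (s *\<^sub>R x) * H (s *\<^sub>R x) \<partial>lborel)"
  by (rule lborel_integral_scale[OF _ s]) measurable
 also have "(%x. indicator {x. N x <= s} (s *\<^sub>R x) * H (s *\<^sub>R x)) = (%x. indicator {x. N x <= 1} x * H x)"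
  using s by (auto simp: fun_eq_iff indicator_def is_norm_scale[OF N] hom)
 finally show ?thesis by simp
qed

lemma homogeneous_shell_limit:
 fixes H :: "real^'n => real"
 assumes m: "H \<in> borel_measurable borel" and hom: "!!c x. 0 < c ==> H (c *\<^sub>R x) = H x"
  and C: "!!x. \<bar>H x\<bar> <= C" and r: "0 < r"
 shows "(%j. real (Suc j) * (\<integral>x. indicator {x. r < N x & N x <= r + 1 / real (Suc j)} x * H x \<partial>lborel))
  \<longlonglongrightarrow> real CARD('n) * r ^ (CARD('n) - 1) * (\<integral>x. indicator {x. N x <= 1} x * H x \<partial>lborel)"
proof -
 let ?W = "\<integral>x. indicator {x. N x <= 1} x * H x \<partial>lborel"
 define h where "h j = 1 / real (Suc j)" for j
 have h: "0 < h j" for j by (simp add: h_def)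
 have h0: "filterlim h (at 0) sequentially"
  unfolding h_def using LIMSEQ_Suc[OF lim_1_over_n] by (auto simp: filterlim_at intro!: always_eventually)
 have "((%t. ((r + t) ^ CARD('n) - r ^ CARD('n)) / t) \<longlongrightarrow> real CARD('n) * r ^ (CARD('n) - 1)) (at 0)"
  using DERIV_pow[of "CARD('n)" r UNIV] by (simp add: DERIV_def)
 from tendsto_mult_right[OF filterlim_compose[OF this h0], of ?W]
 have lim: "(%j. ((r + h j) ^ CARD('n) - r ^ CARD('n)) / h j * ?W) \<longlonglongrightarrow> real CARD('n) * r ^ (CARD('n) - 1) * ?W" .
 have "real (Suc j) * (\<integral>x. indicator {x. r < N x & N x <= r + 1 / real (Suc j)} x * H x \<partial>lborel) =
  ((r + h j) ^ CARD('n) - r ^ CARD('n)) / h j * ?W" for j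
 proof -
  have "(%x. indicator {x. r < N x & N x <= r + h j} x * H x) =
  (%x. indicator {x. N x <= r + h j} x * H x - indicator {x. N x <= r} x * H x)"
  using h[of j] by (auto simp: fun_eq_iff indicator_def)
  then have "(\<integral>x. indicator {x. r < N x & N x <= r + h j} x * H x \<partial>lborel) =
  (\<integral>x. indicator {x. N x <= r + h j} x * H x \<partial>lborel) - (\<integral>x. indicator {x. N x <= r} x * H x \<partial>lborel)"
  by (simp add: Bochner_Integration.integral_diff[OF indicator_ball_integrable[OF m C] indicator_ball_integrable[OF m C]])
  also have "\<dots> = (r + h j) ^ CARD('n) * ?W - r ^ CARD('n) * ?W"
  by (subst (1 2) homogeneous_ball_integral[OF m hom]) (use r h[of j] in auto)
  finally have "(\<integral>x. indicator {x. r < N x & N x <= r + h j} x * H x \<partial>lborel) = ((r + h j) ^ CARD('n) - r ^ CARD('n)) * ?W"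
  by (simp add: left_diff_distrib)
  then show ?thesis by (simp add: h_def)
 qed
 with lim show ?thesis by simp
qed

lemma radial_projection_measurable [measurable]: "(%x. x0 + (r / N x) *\<^sub>R x) \<in> borel_measurable borel"
 using is_norm_borel[OF N] by measurable

text \<open>The outer normal measure of the sphere \<open>{N = r}\<close> is \<open>n r\<^sup>n\<^sup>-\<^sup>1\<close> times the radial image of
 \<open>norm_gradient N\<close> on the unit ball. The indicator of the ball is approximated by a radial profile that
 decreases linearly to zero on a thin shell; on that shell the test function may be replaced by
 its value at the radial projection, since it is Lipschitz.\<close>

lemma norm_ball_gauss_green:
 assumes r: "0 < r" and C\<phi>: "C_k (Suc m) \<phi>" and supp: "!!x. R < norm x ==> \<phi> x = 0"
 shows "(\<integral>x. indicator {x. N (x - x0) <= r} x * partial i \<phi> x \<partial>lborel) =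
  real CARD('n) * r ^ (CARD('n) - 1) * (\<integral>x. indicator {x. N x <= 1} x * (norm_gradient N x $ i * \<phi> (x0 + (r / N x) *\<^sub>R x)) \<partial>lborel)"
proof -
 note [measurable] = is_norm_borel[OF N] norm_gradient_measurable[OF N]
 have [measurable]: "\<phi> \<in> borel_measurable borel" "grad \<phi> \<in> borel_measurable borel"
  using C_k_continuous[OF C\<phi>] grad_continuous[OF C\<phi>] by (auto intro: borel_measurable_continuous_onI)
 have Gi [measurable]: "(%x. norm_gradient N x $ i) \<in> borel_measurable borel"
 proof -
  have "(%x. norm_gradient N x \<bullet> axis i 1) \<in> borel_measurable borel" by measurable
  then show ?thesis by (simp add: inner_axis)
 qed
 have pm [measurable]: "partial i \<phi> \<in> borel_measurable borel"
 proof -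
  have "(%x. grad \<phi> x \<bullet> axis i 1) \<in> borel_measurable borel" by measurable
  then show ?thesis by (simp add: inner_axis grad_def)
 qed
 obtain B where B: "0 <= B" "!!x. norm (grad \<phi> x) <= B" "!!x. \<bar>\<phi> x\<bar> <= B" "!!x y. \<bar>\<phi> x - \<phi> y\<bar> <= B * norm (x - y)"
  using C_k_lipschitz[OF C\<phi> supp] by blast
 obtain C where C: "0 < C" "!!x. norm (norm_gradient N x) <= C" using norm_gradient_bounded[OF N] by blast
 have Ci: "\<bar>norm_gradient N x $ i\<bar> <= C" for x using component_le_norm_cart[of "norm_gradient N x" i] C(2)[of x] by linarith
 obtain c where c: "0 < c" "!!x. norm x <= c * N x" using is_norm_lower[OF N] by blast
 define h where "h j = 1 / real (Suc j)" for j
 have h: "0 < h j" for j by (simp add: h_def)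
 have h0: "h \<longlonglongrightarrow> 0" unfolding h_def by (rule LIMSEQ_Suc[OF lim_1_over_n])
 let ?sh = "%j. {x. r < N x & N x <= r + h j}"
 define \<psi> where "\<psi> j t = max 0 (min 1 (1 - (t - r) / h j))" for j t
 define \<psi>' where "\<psi>' j t = - (indicator {r<..r + h j} t / h j)" for j t
 define H where "H x = norm_gradient N x $ i * \<phi> (x0 + (r / N x) *\<^sub>R x)" for x
 have Hm [measurable]: "H \<in> borel_measurable borel" unfolding H_def by measurable
 have Hhom: "H (t *\<^sub>R x) = H x" if "0 < t" for t x
  using that by (simp add: H_def norm_gradient_homogeneous[OF N] is_norm_scale[OF N])
 have HC: "\<bar>H x\<bar> <= C * B" for x using Ci B(1,3) C(1) unfolding H_def abs_mult by (intro mult_mono) auto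
 have parts: "(\<integral>x. \<psi> j (N (x - x0)) * partial i \<phi> x \<partial>lborel) =
  real (Suc j) * (\<integral>x. indicator (?sh j) x * (norm_gradient N x $ i * \<phi> (x0 + x)) \<partial>lborel)" for j
 proof -
  have "(\<integral>x. \<psi> j (N (x - x0)) * partial i \<phi> x \<partial>lborel) =
  - (\<integral>x. (\<psi>' j (N (x - x0)) * norm_gradient N (x - x0) $ i) * \<phi> x \<partial>lborel)"
  proof (rule radial_weak_gradient[OF N _ _ _ _ _ C\<phi> supp, where L="1 / h j" and S="{r, r + h j}"])
  have d: "(1 - (s - r) / h j) - (1 - (t - r) / h j) = (t - s) / h j" for s t by (simp add: diff_divide_distrib)
  show "\<bar>\<psi> j s - \<psi> j t\<bar> <= 1 / h j * \<bar>s - t\<bar>" for s t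
  proof -
  have "\<bar>\<psi> j s - \<psi> j t\<bar> <= \<bar>(1 - (s - r) / h j) - (1 - (t - r) / h j)\<bar>" unfolding \<psi>_def by (auto simp: max_def min_def)
  also have "\<dots> = 1 / h j * \<bar>s - t\<bar>" unfolding d using h[of j] by (simp add: abs_minus_commute)
  finally show ?thesis .
  qed
  show "continuous_on {0..} (\<psi> j)" unfolding \<psi>_def using h[of j] by (intro continuous_intros) auto
  show "\<psi>' j \<in> borel_measurable borel" unfolding \<psi>'_def by measurable
  fix t assume t: "0 < t" "t \<notin> {r, r + h j}"
  consider "t < r" | "r < t" "t < r + h j" | "r + h j < t" using t by fastforce
  then show "(\<psi> j has_real_derivative \<psi>' j t) (at t)"
  proof cases
  case 1
  have "\<forall>\<^sub>F u in nhds t. \<psi> j u = 1"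
  using eventually_nhds_in_open[of "{..<r}" t] 1 h[of j] by (auto elim!: eventually_mono simp: \<psi>_def max_def min_def field_simps)
  then show ?thesis using 1 by (subst DERIV_cong_ev[OF refl _ refl, where g="%_. 1"]) (auto simp: \<psi>'_def)
  next
  case 2
  have "\<forall>\<^sub>F u in nhds t. \<psi> j u = 1 - (u - r) / h j"
  using eventually_nhds_in_open[of "{r<..<r + h j}" t] 2 h[of j] by (auto elim!: eventually_mono simp: \<psi>_def max_def min_def field_simps)
  moreover have "((%u. 1 - (u - r) / h j) has_real_derivative \<psi>' j t) (at t)"
  using 2 h[of j] by (auto intro!: derivative_eq_intros simp: \<psi>'_def)
  ultimately show ?thesis by (subst DERIV_cong_ev[OF refl _ refl])
  next
  case 3
  have "\<forall>\<^sub>F u in nhds t. \<psi> j u = 0"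
  using eventually_nhds_in_open[of "{r + h j<..}" t] 3 h[of j] by (auto elim!: eventually_mono simp: \<psi>_def max_def min_def field_simps)
  then show ?thesis using 3 by (subst DERIV_cong_ev[OF refl _ refl, where g="%_. 0"]) (auto simp: \<psi>'_def)
  qed
  qed auto
  also have "\<dots> = - (\<integral>x. \<psi>' j (N x) * norm_gradient N x $ i * \<phi> (x0 + x) \<partial>lborel)"
  using lborel_integral_translate(1)[where t=x0 and f="%x. (\<psi>' j (N (x - x0)) * norm_gradient N (x - x0) $ i) * \<phi> x"] by simp
  also have "\<dots> = real (Suc j) * (\<integral>x. indicator (?sh j) x * (norm_gradient N x $ i * \<phi> (x0 + x)) \<partial>lborel)"
  unfolding integral_mult_right_zero[symmetric] Bochner_Integration.integral_minus[symmetric]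
  by (intro Bochner_Integration.integral_cong refl) (auto simp: \<psi>'_def h_def indicator_def)
  finally show ?thesis .
 qed
 have l1: "(%j. \<integral>x. \<psi> j (N (x - x0)) * partial i \<phi> x \<partial>lborel) \<longlonglongrightarrow> (\<integral>x. indicator {x. N (x - x0) <= r} x * partial i \<phi> x \<partial>lborel)"
 proof (rule integral_dominated_convergence[where w="%x. \<bar>partial i \<phi> x\<bar>"])
  have g0: "partial i \<phi> x = 0" if "R < norm x" for x
  proof -
  have "grad \<phi> x = 0" by (rule grad_zero_off_support[of "cball 0 R"]) (use supp that in \<open>auto simp: dist_norm\<close>)
  then show ?thesis by (simp add: grad_def vec_eq_iff)
  qed
  have gB: "\<bar>partial i \<phi> x\<bar> <= B" for x using component_le_norm_cart[of "grad \<phi> x" i] B(2)[of x] by (simp add: grad_def)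
  show "integrable lborel (%x. \<bar>partial i \<phi> x\<bar>)"
  by (intro integrable_abs bounded_support_integrable[where r=R and B=B]) (use g0 gB in auto)
  show "AE x in lborel. norm (\<psi> j (N (x - x0)) * partial i \<phi> x) <= \<bar>partial i \<phi> x\<bar>" for j
  by (intro AE_I2) (auto simp: \<psi>_def abs_mult intro!: mult_left_le_one_le)
  show "AE x in lborel. (%j. \<psi> j (N (x - x0)) * partial i \<phi> x) \<longlonglongrightarrow> indicator {x. N (x - x0) <= r} x * partial i \<phi> x"
  proof (intro AE_I2 tendsto_mult tendsto_const)
  fix x
  show "(%j. \<psi> j (N (x - x0))) \<longlonglongrightarrow> indicator {x. N (x - x0) <= r} x"
  proof (cases "N (x - x0) <= r")
  case True
  then have "(N (x - x0) - r) / h j <= 0" for j using h[of j] by (simp add: divide_le_0_iff)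
  then have "\<psi> j (N (x - x0)) = 1" for j unfolding \<psi>_def by (smt (verit, best))
  then show ?thesis using True by simp
  next
  case False
  then have "\<forall>\<^sub>F j in sequentially. h j < N (x - x0) - r" using order_tendstoD(2)[OF h0] by simp
  then have "\<forall>\<^sub>F j in sequentially. \<psi> j (N (x - x0)) = 0"
  proof eventually_elim
  fix j assume "h j < N (x - x0) - r"
  then have "1 <= (N (x - x0) - r) / h j" using h[of j] by (simp add: field_simps)
  then show "\<psi> j (N (x - x0)) = 0" by (simp add: \<psi>_def)
  qed
  then show ?thesis using False by (simp add: tendsto_eventually)
  qed
  qed
 qed (simp_all add: \<psi>_def)
 let ?S = "%j. real (Suc j) * (\<integral>x. indicator (?sh j) x * (norm_gradient N x $ i * \<phi> (x0 + x)) \<partial>lborel)"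
 let ?T = "%j. real (Suc j) * (\<integral>x. indicator (?sh j) x * H x \<partial>lborel)"
 let ?V = "%j. \<integral>x. indicator (?sh j) x * (1::real) \<partial>lborel"
 have ish: "integrable lborel (%x. indicator (?sh j) x * F x)" if [measurable]: "F \<in> borel_measurable borel" and F: "!!x. \<bar>F x\<bar> <= A" for F :: "real^'n => real" and A j
  by (rule Bochner_Integration.integrable_bound[OF indicator_ball_integrable[OF that, of "r + h j"]]) (auto simp: indicator_def)
 have close: "\<bar>?S j - ?T j\<bar> <= C * B * c * ?V j" for j
 proof -
  let ?F = "%x. norm_gradient N x $ i * \<phi> (x0 + x)"
  have i1: "integrable lborel (%x. indicator (?sh j) x * ?F x)"
  proof (rule ish)
  show "\<bar>norm_gradient N x $ i * \<phi> (x0 + x)\<bar> <= C * B" for x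
  unfolding abs_mult using Ci B(1,3) C(1) by (intro mult_mono) auto
  qed measurable
  have i2: "integrable lborel (%x. indicator (?sh j) x * H x)" by (rule ish[OF Hm HC])
  have i3: "integrable lborel (%x. indicator (?sh j) x * (1::real))"
  proof (rule ish)
  show "\<bar>1\<bar> <= (1::real)" for x :: "real^'n" by simp
  qed measurable
  have pt: "\<bar>indicator (?sh j) x * ?F x - indicator (?sh j) x * H x\<bar> <= (C * (B * c) * h j) * (indicator (?sh j) x * 1)" for x
  proof (cases "x \<in> ?sh j")
  case True
  then have Nx: "r < N x" "N x <= r + h j" by auto
  have "norm ((x0 + x) - (x0 + (r / N x) *\<^sub>R x)) = norm ((1 - r / N x) *\<^sub>R x)" by (simp add: algebra_simps)
  also have "\<dots> = (1 - r / N x) * norm x" using Nx r by simp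
  also have "\<dots> <= (1 - r / N x) * (c * N x)" using Nx r c(2) by (intro mult_left_mono) auto
  also have "\<dots> = c * (N x - r)" using Nx r by (simp add: field_simps)
  also have "\<dots> <= c * h j" using Nx c(1) by (intro mult_left_mono) auto
  finally have n: "norm ((x0 + x) - (x0 + (r / N x) *\<^sub>R x)) <= c * h j" .
  have "\<bar>?F x - H x\<bar> = \<bar>norm_gradient N x $ i\<bar> * \<bar>\<phi> (x0 + x) - \<phi> (x0 + (r / N x) *\<^sub>R x)\<bar>"
  by (simp add: H_def abs_mult[symmetric] right_diff_distrib)
  also have "\<dots> <= C * (B * (c * h j))"
  using Ci[of x] B(4)[of "x0 + x" "x0 + (r / N x) *\<^sub>R x"] mult_left_mono[OF n B(1)] C(1)
  by (intro mult_mono) auto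
  finally show ?thesis using True by (simp add: mult_ac)
  qed auto
  have "\<bar>?S j - ?T j\<bar> = real (Suc j) * \<bar>\<integral>x. indicator (?sh j) x * ?F x - indicator (?sh j) x * H x \<partial>lborel\<bar>"
  unfolding Bochner_Integration.integral_diff[OF i1 i2] by (simp only: right_diff_distrib[symmetric] abs_mult abs_of_nat)
  also have "\<dots> <= real (Suc j) * (\<integral>x. (C * (B * c) * h j) * (indicator (?sh j) x * 1) \<partial>lborel)"
  proof (rule mult_left_mono)
  have "\<bar>\<integral>x. indicator (?sh j) x * ?F x - indicator (?sh j) x * H x \<partial>lborel\<bar> <= (\<integral>x. \<bar>indicator (?sh j) x * ?F x - indicator (?sh j) x * H x\<bar> \<partial>lborel)"
  by (rule integral_abs_bound)
  also have "\<dots> <= (\<integral>x. (C * (B * c) * h j) * (indicator (?sh j) x * 1) \<partial>lborel)"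
  using i1 i2 i3 pt by (intro integral_mono integrable_abs Bochner_Integration.integrable_diff integrable_mult_right) auto
  finally show "\<bar>\<integral>x. indicator (?sh j) x * ?F x - indicator (?sh j) x * H x \<partial>lborel\<bar> <= (\<integral>x. (C * (B * c) * h j) * (indicator (?sh j) x * 1) \<partial>lborel)" .
  qed simp
  also have "\<dots> = (real (Suc j) * h j) * (C * B * c * ?V j)" by (simp only: integral_mult_right_zero mult_ac)
  also have "real (Suc j) * h j = 1" by (simp add: h_def)
  finally show ?thesis by simp
 qed
 have "(%j. real (Suc j) * ?V j) \<longlonglongrightarrow> real CARD('n) * r ^ (CARD('n) - 1) * (\<integral>x. indicator {x. N x <= 1} x * 1 \<partial>lborel)"
  unfolding h_def by (rule homogeneous_shell_limit[where C=1 and H="%_. 1", OF _ _ _ r]) auto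
 from tendsto_mult[OF h0 this]
 have lim0: "(%j. h j * (real (Suc j) * ?V j)) \<longlonglongrightarrow> 0" by simp
 have "h j * (real (Suc j) * ?V j) = ?V j" for j by (simp add: h_def)
 with lim0 have "?V \<longlonglongrightarrow> 0" by (simp only:)
 then have "(%j. C * B * c * ?V j) \<longlonglongrightarrow> 0" by (rule tendsto_mult_right_zero)
 then have "(%j. ?S j - ?T j) \<longlonglongrightarrow> 0" by (rule Lim_null_comparison[rotated]) (intro always_eventually allI, unfold real_norm_def, rule close)
 moreover have "?T \<longlonglongrightarrow> real CARD('n) * r ^ (CARD('n) - 1) * (\<integral>x. indicator {x. N x <= 1} x * H x \<partial>lborel)"
  unfolding h_def by (rule homogeneous_shell_limit[OF Hm Hhom HC r])
 ultimately have "(%j. ?S j - ?T j + ?T j) \<longlonglongrightarrow> 0 + real CARD('n) * r ^ (CARD('n) - 1) * (\<integral>x. indicator {x. N x <= 1} x * H x \<partial>lborel)"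
  by (rule tendsto_add)
 then have "?S \<longlonglongrightarrow> real CARD('n) * r ^ (CARD('n) - 1) * (\<integral>x. indicator {x. N x <= 1} x * H x \<partial>lborel)" by simp
 with l1[unfolded parts] show ?thesis unfolding H_def by (rule LIMSEQ_unique)
qed

text \<open>The weight is homogeneous of degree \<open>a\<close>, so on a thin shell it agrees with its degree-zero
 version up to a factor close to one. Comparing the growth rates of the two integrals over
 \<open>{N <= s}\<close> at \<open>s = 1\<close> gives the identity.\<close>

lemma projected_weight_integral:
 fixes k :: 'n
 assumes a: "0 <= a"
 defines "W \<equiv> %x. indicator (half_space k) x * weight k a ((1 / N x) *\<^sub>R x)"
 shows "W \<in> borel_measurable borel" and "\<exists>C. \<forall>x. \<bar>W x\<bar> <= C"
  and "real CARD('n) * (\<integral>x. indicator {x. N x <= 1} x * W x \<partial>lborel) = eff_dim TYPE('n) a * half_ball_mass k a N"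
proof -
 note [measurable] = is_norm_borel[OF N]
 let ?na = "eff_dim TYPE('n) a" and ?m = "half_ball_mass k a N" and ?\<mu> = "hs_meas k a"
 show Wm [measurable]: "W \<in> borel_measurable borel" unfolding W_def by measurable
 obtain c where c: "0 < c" "!!x. norm x <= c * N x" using is_norm_lower[OF N] by blast
 have Wb: "\<bar>W x\<bar> <= c powr a" for x
 proof (cases "x \<in> half_space k")
  case True
  then have "x ~= 0" "0 < x $ k" by (auto simp: half_space_def)
  then have "0 < N x" by (intro is_norm_pos[OF N])
  moreover have "x $ k <= c * N x" using component_le_norm_cart[of x k] c(2)[of x] by linarith
  ultimately have "(1 / N x) * x $ k <= c" by (simp add: field_simps)
  moreover have "0 < (1 / N x) * x $ k" using \<open>0 < N x\<close> \<open>0 < x $ k\<close> by simp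
  ultimately have "((1 / N x) * x $ k) powr a <= c powr a" using a by (intro powr_mono2) auto
  then show ?thesis using True by (simp add: W_def weight_def)
 qed (simp add: W_def)
 then show "\<exists>C. \<forall>x. \<bar>W x\<bar> <= C" by blast
 have Whom: "W (t *\<^sub>R x) = W x" if "0 < t" for t x
  using that by (auto simp: W_def half_space_def indicator_def is_norm_scale[OF N] zero_less_mult_iff)
 let ?u = "%x. indicator (half_space k) x * weight k a x :: real"
 have u: "integrable lborel (%x. indicator {x. N x <= s} x * ?u x)" "(\<integral>x. indicator {x. N x <= s} x * ?u x \<partial>lborel) = s powr ?na * ?m" if s: "0 < s" for s
 proof -
  have e: "emeasure ?\<mu> {x. N x <= s} = ennreal (s powr ?na * ?m)" by (rule emeasure_norm_ball[OF N a s])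
  have mp: "0 <= s powr ?na * ?m" using half_ball_mass_eq(2)[OF N a, of k] by simp
  have "integrable ?\<mu> (indicator {x. N x <= s} :: _ => real)" using e by (intro integrable_real_indicator) auto
  then have "set_integrable lebesgue (half_space k) (%x. indicator {x. N x <= s} x * weight k a x)"
  by (subst integral_hs_meas(2)) auto
  moreover have m: "(%x. indicator {x. N x <= s} x * ?u x) \<in> borel_measurable borel" by measurable
  moreover have eq: "(%x. indicator (half_space k) x *\<^sub>R (indicator {x. N x <= s} x * weight k a x)) = (%x. indicator {x. N x <= s} x * ?u x)"
  by (auto simp: fun_eq_iff)
  ultimately show "integrable lborel (%x. indicator {x. N x <= s} x * ?u x)"
  unfolding set_integrable_def eq by (simp add: integrable_completion)
  have "(LINT x:half_space k|lebesgue. indicator {x. N x <= s} x * weight k a x) = (\<integral>x. indicator {x. N x <= s} x \<partial>?\<mu>)"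
  by (rule integral_hs_meas(1)) measurable
  then show "(\<integral>x. indicator {x. N x <= s} x * ?u x \<partial>lborel) = s powr ?na * ?m"
  unfolding set_lebesgue_integral_def eq using m e mp by (simp add: integral_completion measure_def)
 qed
 define h where "h j = 1 / real (Suc j)" for j
 have h: "0 < h j" for j by (simp add: h_def)
 have h0: "filterlim h (at 0) sequentially" "h \<longlonglongrightarrow> 0"
  unfolding h_def using LIMSEQ_Suc[OF lim_1_over_n] by (auto simp: filterlim_at intro!: always_eventually)
 let ?sh = "%j. {x. 1 < N x & N x <= 1 + h j}"
 have us: "integrable lborel (%x. indicator (?sh j) x * ?u x)" "(\<integral>x. indicator (?sh j) x * ?u x \<partial>lborel) = ((1 + h j) powr ?na - 1) * ?m" for j
 proof -
  have eq: "(%x. indicator (?sh j) x * ?u x) = (%x. indicator {x. N x <= 1 + h j} x * ?u x - indicator {x. N x <= 1} x * ?u x)"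
  using h[of j] by (auto simp: fun_eq_iff indicator_def)
  have hp: "0 < 1 + h j" using h[of j] by simp
  show "integrable lborel (%x. indicator (?sh j) x * ?u x)" "(\<integral>x. indicator (?sh j) x * ?u x \<partial>lborel) = ((1 + h j) powr ?na - 1) * ?m"
  unfolding eq using u[OF hp] u[OF zero_less_one] by (simp_all add: left_diff_distrib)
 qed
 have Ws: "integrable lborel (%x. indicator (?sh j) x * W x)" for j
  by (rule Bochner_Integration.integrable_bound[OF indicator_ball_integrable[OF Wm Wb, of "1 + h j"]]) (auto simp: indicator_def)
 have cmp: "(1 + h j) powr (- a) * (indicator (?sh j) x * ?u x) <= indicator (?sh j) x * W x"
  "indicator (?sh j) x * W x <= indicator (?sh j) x * ?u x" for j x
 proof -
  have "(1 + h j) powr (- a) * weight k a x <= weight k a ((1 / N x) *\<^sub>R x) & weight k a ((1 / N x) *\<^sub>R x) <= weight k a x"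
  if x: "x \<in> ?sh j" "x \<in> half_space k"
  proof -
  have Nx: "1 < N x" "N x <= 1 + h j" using x by auto
  have eq: "weight k a ((1 / N x) *\<^sub>R x) = N x powr (- a) * weight k a x"
  using Nx x(2) by (simp add: weight_def half_space_def powr_divide powr_minus_divide)
  have "(1 + h j) powr (- a) <= N x powr (- a)" using Nx a by (intro powr_mono2') auto
  moreover have "N x powr (- a) <= 1" using Nx a powr_mono2'[of "- a" 1 "N x"] by simp
  ultimately show ?thesis unfolding eq
  using mult_right_mono[OF _ weight_nonneg[of k a x], of "N x powr (- a)" 1] mult_right_mono[OF _ weight_nonneg[of k a x], of "(1 + h j) powr (- a)" "N x powr (- a)"] by simp
  qed
  then show "(1 + h j) powr (- a) * (indicator (?sh j) x * ?u x) <= indicator (?sh j) x * W x" "indicator (?sh j) x * W x <= indicator (?sh j) x * ?u x"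
  by (auto simp: indicator_def W_def)
 qed
 let ?L = "%j. real (Suc j) * (\<integral>x. indicator (?sh j) x * W x \<partial>lborel)"
 let ?U = "%j. ((1 + h j) powr ?na - 1) / h j * ?m"
 have "((%t. ((1 + t) powr ?na - 1 powr ?na) / t) \<longlongrightarrow> ?na * 1 powr (?na - 1)) (at 0)"
  using has_real_derivative_powr[of 1 ?na] by (simp add: DERIV_def)
 from tendsto_mult_right[OF filterlim_compose[OF this h0(1)], of ?m]
 have U: "?U \<longlonglongrightarrow> ?na * ?m" by simp
 have "?L j <= ?U j" for j
 proof -
  have "(\<integral>x. indicator (?sh j) x * W x \<partial>lborel) <= ((1 + h j) powr ?na - 1) * ?m"
  unfolding us(2)[symmetric] by (intro integral_mono Ws us(1) cmp)
  from mult_left_mono[OF this, of "real (Suc j)"] show ?thesis by (simp add: h_def)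
 qed
 moreover have "(1 + h j) powr (- a) * ?U j <= ?L j" for j
 proof -
  have "(1 + h j) powr (- a) * (((1 + h j) powr ?na - 1) * ?m) <= (\<integral>x. indicator (?sh j) x * W x \<partial>lborel)"
  unfolding us(2)[symmetric] integral_mult_right_zero[symmetric] by (intro integral_mono Ws us(1) cmp integrable_mult_right)
  from mult_left_mono[OF this, of "real (Suc j)"] show ?thesis by (simp add: h_def mult_ac)
 qed
 moreover have "(%j. (1 + h j) powr (- a) * ?U j) \<longlonglongrightarrow> (1 + 0) powr (- a) * (?na * ?m)"
  by (intro tendsto_mult U tendsto_powr tendsto_add tendsto_const h0(2)) auto
 moreover have "?L \<longlonglongrightarrow> real CARD('n) * 1 ^ (CARD('n) - 1) * (\<integral>x. indicator {x. N x <= 1} x * W x \<partial>lborel)"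
  unfolding h_def by (rule homogeneous_shell_limit[OF Wm Whom Wb zero_less_one])
 ultimately have "real CARD('n) * (\<integral>x. indicator {x. N x <= 1} x * W x \<partial>lborel) <= ?na * ?m"
  "?na * ?m <= real CARD('n) * (\<integral>x. indicator {x. N x <= 1} x * W x \<partial>lborel)"
  using U by (auto intro: LIMSEQ_le)
 then show "real CARD('n) * (\<integral>x. indicator {x. N x <= 1} x * W x \<partial>lborel) = ?na * ?m" by simp
qed

end

section \<open>Polar decompositions determine the total variation\<close>

lemma bounded_borel_sets: "A \<in> bounded_borel (half_space k) ==> A \<in> sets borel & A \<subseteq> half_space k"
 by (auto simp: bounded_borel_def)

lemma sets_restrict_half_space: "sets (restrict_space borel (half_space k)) = {E \<in> sets borel. E \<subseteq> half_space k}"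
 using half_space_measurable[of k] by (auto simp: sets_restrict_space image_iff)

lemma total_variation_measure_space:
 fixes k :: "'n::finite"
 shows "(%x. x) \<in> measurable (total_variation (half_space k) D) borel" and "space (total_variation (half_space k) D) = half_space k"
proof -
 let ?S = "{E \<in> sets borel. E \<subseteq> half_space k}"
 let ?R = "restrict_space borel (half_space k) :: (real^'n) measure"
 let ?V = "%E. SUP A\<in>{A::nat => (real^'n) set. range A \<subseteq> bounded_borel (half_space k) & disjoint_family A & (\<Union>i. A i) = E}.
  \<Sum>i. ennreal (norm (D (A i)))"
 have P: "?S \<subseteq> Pow (half_space k)" by auto
 have sp: "space ?R = half_space k" by (simp add: space_restrict_space)
 have "sigma_sets (half_space k) ?S = ?S"
  using sets.sigma_sets_eq[of ?R] unfolding sets_restrict_half_space sp .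
 then have s: "sets (measure_of (half_space k) ?S ?V) = sets ?R"
  using P by (simp add: sets_measure_of sets_restrict_half_space)
 have "(%x. x) \<in> measurable ?R borel" by (rule measurable_restrict_space1) simp
 then have "(%x. x) \<in> measurable (measure_of (half_space k) ?S ?V) borel" using measurable_cong_sets[OF s refl] by blast
 then show "(%x. x) \<in> measurable (total_variation (half_space k) D) borel"
  unfolding total_variation_def by (rule measurable_completion)
 show "space (total_variation (half_space k) D) = half_space k"
  unfolding total_variation_def using P by (simp add: space_measure_of)
qed

text \<open>A finite measure on the half-space with a unit field, hence a vector measure given directly in polar form.\<close>

locale polar_measure = finite_measure \<mu> for \<mu> :: "(real^'n::finite) measure" +
 fixes k :: 'n and \<nu> :: "real^'n => real^'n"
 assumes sets_\<mu>: "sets \<mu> = sets (restrict_space borel (half_space k))"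
  and \<nu>_borel: "\<nu> \<in> borel_measurable borel" and \<nu>_unit: "AE y in \<mu>. norm (\<nu> y) = 1"
begin

definition D where "D A = (LINT y:A|\<mu>. \<nu> y)"

lemma space_\<mu>: "space \<mu> = half_space k"
 using sets_eq_imp_space_eq[OF sets_\<mu>] by (simp add: space_restrict_space)

lemma borel_\<mu>: "F \<in> borel_measurable borel ==> F \<in> borel_measurable \<mu>"
 using measurable_restrict_space1 measurable_cong_sets[OF sets_\<mu> refl] by blast

lemma bounded_borel_\<mu>: "A \<in> bounded_borel (half_space k) ==> A \<in> sets \<mu>"
 using bounded_borel_sets by (auto simp: sets_\<mu> sets_restrict_half_space)

lemma \<nu>_integrable: "A \<in> sets \<mu> ==> integrable \<mu> (%y. indicator A y *\<^sub>R \<nu> y)"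
 using \<nu>_unit borel_\<mu>[OF \<nu>_borel]
 by (intro integrable_const_bound[where B=1]) (auto elim!: eventually_mono simp: indicator_def)

lemma norm_D_le: assumes A: "A \<in> sets \<mu>" shows "ennreal (norm (D A)) <= emeasure \<mu> A"
proof -
 have "ennreal (norm (D A)) <= (\<integral>\<^sup>+y. ennreal (norm (indicator A y *\<^sub>R \<nu> y)) \<partial>\<mu>)"
  unfolding D_def set_lebesgue_integral_def by (rule integral_norm_bound_ennreal[OF \<nu>_integrable[OF A]])
 also have "\<dots> = (\<integral>\<^sup>+y. indicator A y \<partial>\<mu>)"
  using \<nu>_unit by (intro nn_integral_cong_AE) (auto elim!: eventually_mono simp: indicator_def)
 finally show ?thesis using A by simp
qed

lemma D_near_direction:
 assumes A: "A \<in> sets \<mu>" and d: "!!y. y \<in> A ==> norm (\<nu> y - d) <= e" and e: "0 <= e"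
 shows "(1 - 2 * e) * measure \<mu> A <= norm (D A)"
proof (cases "measure \<mu> A = 0")
 case False
 then have mA: "0 < measure \<mu> A" using measure_nonneg[of \<mu> A] by linarith
 have "\<exists>y\<in>A. norm (\<nu> y) = 1"
 proof (rule ccontr)
  assume "\<not> (\<exists>y\<in>A. norm (\<nu> y) = 1)"
  then have "AE y in \<mu>. y \<notin> A" using \<nu>_unit by (auto elim!: eventually_mono)
  then have "emeasure \<mu> A = 0" using A AE_iff_measurable[of A \<mu> "%y. y \<notin> A"] sets.sets_into_space[OF A] by auto
  then show False using False by (simp add: measure_def)
 qed
 then obtain y where y: "y \<in> A" "norm (\<nu> y) = 1" by blast
 have dn: "1 - e <= norm d" using d[OF y(1)] y(2) norm_triangle_ineq2[of "\<nu> y" d] by linarith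
 have id: "integrable \<mu> (%y. indicator A y *\<^sub>R d)"
  using A by (intro integrable_const_bound[where B="norm d"]) (auto simp: indicator_def)
 have space: "A \<inter> space \<mu> = A" using sets.sets_into_space[OF A] by blast
 have iv: "(\<integral>y. indicator A y *\<^sub>R d \<partial>\<mu>) = measure \<mu> A *\<^sub>R d"
  using A by (subst integral_scaleR_left) (auto simp: space intro!: integrable_real_indicator emeasure_finite[THEN less_top[THEN iffD1]])
 have "D A - measure \<mu> A *\<^sub>R d = (\<integral>y. indicator A y *\<^sub>R \<nu> y - indicator A y *\<^sub>R d \<partial>\<mu>)"
  unfolding D_def set_lebesgue_integral_def Bochner_Integration.integral_diff[OF \<nu>_integrable[OF A] id] iv ..
 also have "norm \<dots> <= (\<integral>y. norm (indicator A y *\<^sub>R \<nu> y - indicator A y *\<^sub>R d) \<partial>\<mu>)" by (rule integral_norm_bound)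
 also have "\<dots> <= (\<integral>y. e * indicator A y \<partial>\<mu>)"
 proof (intro integral_mono integrable_norm Bochner_Integration.integrable_diff \<nu>_integrable[OF A] id integrable_mult_right)
  show "integrable \<mu> (indicator A :: _ => real)" using A by (intro integrable_const_bound[where B=1]) auto
  show "norm (indicator A y *\<^sub>R \<nu> y - indicator A y *\<^sub>R d) <= e * indicator A y" for y
  using d[of y] by (auto simp: indicator_def)
 qed
 also have "\<dots> = e * measure \<mu> A" by (simp add: space)
 finally have "norm (measure \<mu> A *\<^sub>R d) - e * measure \<mu> A <= norm (D A)"
  using norm_triangle_ineq2[of "measure \<mu> A *\<^sub>R d" "D A"] by (simp add: norm_minus_commute)
 moreover have "(1 - e) * measure \<mu> A <= norm (measure \<mu> A *\<^sub>R d)" using dn mA by (simp add: mult.commute)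
 ultimately show ?thesis by (simp add: algebra_simps)
qed simp

text \<open>Cutting a set into countably many pieces on which the direction \<open>\<nu>\<close> is almost constant makes
 the triangle inequality nearly sharp.\<close>

lemma fine_partition:
 assumes E: "E \<in> sets \<mu>" and e: "0 < e"
 shows "\<exists>A :: nat => (real^'n) set. range A \<subseteq> bounded_borel (half_space k) & disjoint_family A & (\<Union>i. A i) = E &
  (\<forall>i. \<exists>d. \<forall>y\<in>A i. norm (\<nu> y - d) <= e)"
proof -
 note [measurable] = \<nu>_borel
 obtain Q :: "(real^'n) set" where Q: "countable Q" "!!X. open X ==> X ~= {} ==> \<exists>d\<in>Q. d \<in> X" by (rule countable_dense_setE) blast
 have "Q ~= {}" using Q(2)[of UNIV] by auto
 then have rQ: "range (from_nat_into Q) = Q" using Q(1) by (rule range_from_nat_into)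
 define S where "S i = {y. norm (\<nu> y - from_nat_into Q (fst (prod_decode i))) <= e} \<inter> hs_exh k (snd (prod_decode i))" for i
 have [measurable]: "hs_exh k m \<in> sets borel" for m by (rule borel_compact[OF compact_hs_exh])
 have Sm: "S i \<in> sets borel" for i unfolding S_def by measurable
 have US: "y \<in> (\<Union>i. S i)" if y: "y \<in> half_space k" for y
 proof -
  obtain d where "d \<in> Q" "d \<in> ball (\<nu> y) e" using Q(2)[of "ball (\<nu> y) e"] e by auto
  moreover obtain j where "d = from_nat_into Q j" using \<open>d \<in> Q\<close> rQ by blast
  moreover obtain m where "y \<in> hs_exh k m" using hs_exh_eventually[OF y] by blast
  ultimately have "y \<in> S (prod_encode (j, m))" by (auto simp: S_def dist_norm)
  then show ?thesis by (rule UN_I[OF UNIV_I])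
 qed
 have Eb: "E \<in> sets borel" "E \<subseteq> half_space k" using E by (auto simp: sets_\<mu> sets_restrict_half_space)
 define A where "A i = E \<inter> disjointed S i" for i
 have AS: "A i \<subseteq> S i" for i using disjointed_subset[of S i] by (auto simp: A_def)
 have 1: "A i \<in> bounded_borel (half_space k)" for i
 proof -
  have "disjointed S i \<in> sets borel" using sets.range_disjointed_sets[of S borel] Sm by auto
  then have "A i \<in> sets borel" using Eb by (simp add: A_def)
  moreover have "A i \<subseteq> hs_exh k (snd (prod_decode i))" using AS[of i] by (auto simp: S_def)
  ultimately show ?thesis
  unfolding bounded_borel_def mem_Collect_eq
  by (intro conjI exI[of _ "hs_exh k (snd (prod_decode i))"] compact_hs_exh hs_exh_subset)
 qed
 have 2: "disjoint_family A" using disjoint_family_disjointed[of S] by (auto simp: A_def disjoint_family_on_def)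
 have 3: "(\<Union>i. A i) = E"
 proof -
  have "(\<Union>i. A i) = E \<inter> (\<Union>i. disjointed S i)" unfolding A_def by blast
  also have "\<dots> = E" unfolding UN_disjointed_eq by (rule Int_absorb2, rule subset_trans[OF Eb(2)], rule subsetI, rule US)
  finally show ?thesis .
 qed
 have 4: "\<exists>d. \<forall>y\<in>A i. norm (\<nu> y - d) <= e" for i
 proof (intro exI ballI)
  fix y assume "y \<in> A i"
  then have "y \<in> S i" using AS by blast
  then show "norm (\<nu> y - from_nat_into Q (fst (prod_decode i))) <= e" by (simp add: S_def)
 qed
 show ?thesis by (rule exI[of _ A], intro conjI image_subsetI allI 1 2 3 4)
qed

text \<open>The upper bound is the triangle inequality with \<open>\<bar>\<nu>\<bar> = 1\<close>; for the lower bound, a partition on which \<open>\<nu>\<close> varies by at most \<open>e\<close> loses only a factor \<open>1 - 2 e\<close>.\<close>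

lemma total_variation_eq:
 assumes D': "!!A. A \<in> bounded_borel (half_space k) ==> D' A = D A"
 shows "total_variation (half_space k) D' = completion \<mu>"
proof -
 let ?P = "%E. {A::nat => (real^'n) set. range A \<subseteq> bounded_borel (half_space k) & disjoint_family A & (\<Union>i. A i) = E}"
 let ?V = "%E. SUP A\<in>?P E. \<Sum>i. ennreal (norm (D' (A i)))"
 have V: "?V E = emeasure \<mu> E" if E: "E \<in> sets \<mu>" for E
 proof (rule antisym)
  show "?V E <= emeasure \<mu> E"
  proof (rule SUP_least)
  fix A :: "nat => (real^'n) set" assume "A \<in> ?P E"
  then have A: "A i \<in> bounded_borel (half_space k)" "disjoint_family A" "(\<Union>i. A i) = E" for i by (simp_all add: image_subset_iff)
  have "(\<Sum>i. ennreal (norm (D' (A i)))) <= (\<Sum>i. emeasure \<mu> (A i))"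
  unfolding D'[OF A(1)] by (intro suminf_le norm_D_le bounded_borel_\<mu> A(1)) auto
  also have "\<dots> = emeasure \<mu> E"
  unfolding A(3)[symmetric] by (rule suminf_emeasure) (intro image_subsetI bounded_borel_\<mu> A(1), rule A(2))
  finally show "(\<Sum>i. ennreal (norm (D' (A i)))) <= emeasure \<mu> E" .
  qed
  have le: "ennreal ((1 - 2 * e) * measure \<mu> E) <= ?V E" if e: "0 < e" "2 * e <= 1" for e
  proof -
  from fine_partition[OF E e(1)] obtain A :: "nat => (real^'n) set"
  where P: "range A \<subseteq> bounded_borel (half_space k) & disjoint_family A & (\<Union>i. A i) = E & (\<forall>i. \<exists>d. \<forall>y\<in>A i. norm (\<nu> y - d) <= e)" ..
  then have A: "disjoint_family A" "(\<Union>i. A i) = E" "\<forall>i. \<exists>d. \<forall>y\<in>A i. norm (\<nu> y - d) <= e" by simp_all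
  from P have "range A \<subseteq> bounded_borel (half_space k)" ..
  then have Ab: "A i \<in> bounded_borel (half_space k)" for i by (simp add: image_subset_iff)
  have "ennreal ((1 - 2 * e) * measure \<mu> E) = ennreal (1 - 2 * e) * (\<Sum>i. emeasure \<mu> (A i))"
  proof -
  have "(\<Sum>i. emeasure \<mu> (A i)) = emeasure \<mu> E"
  unfolding A(2)[symmetric] by (rule suminf_emeasure) (intro image_subsetI bounded_borel_\<mu> Ab, rule A(1))
  then show ?thesis by (simp only: ennreal_mult''[OF measure_nonneg] emeasure_eq_measure)
  qed
  also have "\<dots> = (\<Sum>i. ennreal ((1 - 2 * e) * measure \<mu> (A i)))"
  unfolding ennreal_suminf_cmult[symmetric] by (simp only: ennreal_mult''[OF measure_nonneg] emeasure_eq_measure)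
  also have "\<dots> <= (\<Sum>i. ennreal (norm (D' (A i))))"
  proof (intro suminf_le ennreal_leI)
  fix i
  obtain d where "!!y. y \<in> A i ==> norm (\<nu> y - d) <= e" using A(3) by blast
  then show "(1 - 2 * e) * measure \<mu> (A i) <= norm (D' (A i))"
  unfolding D'[OF Ab] using e by (intro D_near_direction bounded_borel_\<mu> Ab) auto
  qed auto
  also have "\<dots> <= ?V E" by (rule SUP_upper) (use Ab A in \<open>simp add: image_subset_iff\<close>)
  finally show ?thesis .
  qed
  have "(%j. 1 / (real j + 3)) \<longlonglongrightarrow> 0" by real_asymp
  then have "(%j. ennreal ((1 - 2 * (1 / (real j + 3))) * measure \<mu> E)) \<longlonglongrightarrow> ennreal ((1 - 2 * 0) * measure \<mu> E)"
  by (intro tendsto_ennrealI tendsto_intros)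
  then have "ennreal ((1 - 2 * 0) * measure \<mu> E) <= ?V E"
  by (rule LIMSEQ_le_const2) (intro exI allI impI le, auto simp: field_simps)
  then show "emeasure \<mu> E <= ?V E" by (simp add: emeasure_eq_measure)
 qed
 have S: "{E \<in> sets borel. E \<subseteq> half_space k} = sets \<mu>" by (simp add: sets_\<mu> sets_restrict_half_space)
 have "measure_of (space \<mu>) (sets \<mu>) ?V = measure_of (space \<mu>) (sets \<mu>) (emeasure \<mu>)"
  by (rule measure_of_eq) (auto simp: sets.space_closed sets.sigma_sets_eq V)
 then have "measure_of (space \<mu>) (sets \<mu>) ?V = \<mu>" by (simp only: measure_of_of_measure)
 then have "measure_of (half_space k) {E \<in> sets borel. E \<subseteq> half_space k} ?V = \<mu>"
  unfolding space_\<mu> S[symmetric] .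
 then show ?thesis unfolding total_variation_def by (rule arg_cong)
qed

lemma polar_integral:
 assumes A: "A \<in> bounded_borel (half_space k)"
 shows "set_integrable (completion \<mu>) A \<nu>" "(LINT y:A|completion \<mu>. \<nu> y) = D A"
proof -
 note i = \<nu>_integrable[OF bounded_borel_\<mu>[OF A]]
 note m = borel_measurable_integrable[OF i]
 show "set_integrable (completion \<mu>) A \<nu>" unfolding set_integrable_def integrable_completion[OF m] by (rule i)
 show "(LINT y:A|completion \<mu>. \<nu> y) = D A" unfolding set_lebesgue_integral_def D_def integral_completion[OF m] ..
qed

lemma vector_radon_measure_D: "vector_radon_measure (half_space k) D"
 unfolding vector_radon_measure_def
proof (intro allI impI)
 fix A :: "nat => (real^'n) set"
 assume A: "range A \<subseteq> bounded_borel (half_space k) & disjoint_family A & (\<Union>i. A i) \<in> bounded_borel (half_space k)"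
 then have A1: "A i \<in> bounded_borel (half_space k)" and A2: "disjoint_family A" and A3: "(\<Union>i. A i) \<in> bounded_borel (half_space k)" for i
  by (simp_all add: image_subset_iff)
 have Am: "A i \<in> sets \<mu>" for i by (rule bounded_borel_\<mu>[OF A1])
 have sm: "(%i. measure \<mu> (A i)) sums measure \<mu> (\<Union>i. A i)" by (rule finite_measure_UNION) (intro image_subsetI Am, rule A2)
 have le: "norm (D (A i)) <= measure \<mu> (A i)" for i using norm_D_le[OF Am[of i]] by (simp add: emeasure_eq_measure)
 have "summable (%i. D (A i))" by (rule summable_comparison_test'[OF sums_summable[OF sm] le])
 moreover have "D (\<Union>i. A i) = (\<Sum>i. D (A i))"
  unfolding D_def
 proof (rule lebesgue_integral_countable_add)
  show "A i \<inter> A j = {}" if "i ~= j" for i j using A2 that by (simp add: disjoint_family_on_def)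
  show "set_integrable \<mu> (\<Union>i. A i) \<nu>" unfolding set_integrable_def by (rule \<nu>_integrable[OF bounded_borel_\<mu>[OF A3]])
 qed (rule Am)
 ultimately show "(%i. D (A i)) sums D (\<Union>i. A i)" using summable_sums by metis
qed

lemma is_BV_derivative_D:
 assumes f: "locally_integrable (half_space k) f"
  and parts: "!!\<phi> i. test_function (half_space k) \<phi> ==>
  (LINT x:half_space k|lebesgue. f x * partial i \<phi> x) = - (\<integral>y. \<phi> y * \<nu> y $ i \<partial>\<mu>)"
 shows "is_BV_derivative (half_space k) f D \<nu>"
proof -
 have TV: "total_variation (half_space k) D = completion \<mu>" by (rule total_variation_eq) simp
 have "\<nu> \<in> borel_measurable (completion \<mu>)" by (rule measurable_completion[OF borel_\<mu>[OF \<nu>_borel]])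
 then have "is_polar_field (half_space k) D \<nu>"
  unfolding is_polar_field_def TV using \<nu>_unit polar_integral by (simp add: AE_completion)
 moreover have "(\<integral>y. \<phi> y * \<nu> y $ i \<partial>completion \<mu>) = (\<integral>y. \<phi> y * \<nu> y $ i \<partial>\<mu>)" if t: "test_function (half_space k) \<phi>" for \<phi> i
 proof (rule integral_completion, rule borel_\<mu>)
  note [measurable] = test_function_measurable[OF t] \<nu>_borel
  have "(%y. \<phi> y * (\<nu> y \<bullet> axis i 1)) \<in> borel_measurable borel" by measurable
  then show "(%y. \<phi> y * \<nu> y $ i) \<in> borel_measurable borel" by (simp add: inner_axis)
 qed
 ultimately show ?thesis
  unfolding is_BV_derivative_def TV using f parts vector_radon_measure_D by simp
qed

text \<open>Test functions determine the two vector measures on relatively compact sets. The total variation depends on these values only, and the density of a vector measure is unique.\<close>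

lemma is_BV_derivative_unique:
 assumes BV: "is_BV_derivative (half_space k) f D \<nu>" and BV': "is_BV_derivative (half_space k) f D' \<nu>'"
 shows "total_variation (half_space k) D' = completion \<mu>" "AE y in completion \<mu>. \<nu>' y = \<nu> y"
proof -
 have TV: "total_variation (half_space k) D = completion \<mu>" by (rule total_variation_eq) simp
 let ?T = "total_variation (half_space k) D'"
 have p': "set_integrable ?T A \<nu>'" "D' A = (LINT x:A|?T. \<nu>' x)" if "A \<in> bounded_borel (half_space k)" for A
  using BV' that by (auto simp: is_BV_derivative_def is_polar_field_def)
 have comp: "set_integrable M A (%x. u x $ i)" "(LINT x:A|M. u x $ i) = (LINT x:A|M. u x) $ i"
  if "set_integrable M A u" for M A i and u :: "real^'n => real^'n"
 proof -
  have *: "indicator A x *\<^sub>R (u x $ i) = (indicator A x *\<^sub>R u x) $ i" for x by simp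
  show "set_integrable M A (%x. u x $ i)"
  using integrable_bounded_linear[OF bounded_linear_vec_nth that[unfolded set_integrable_def]] unfolding set_integrable_def * .
  show "(LINT x:A|M. u x $ i) = (LINT x:A|M. u x) $ i"
  using integral_bounded_linear[OF bounded_linear_vec_nth that[unfolded set_integrable_def]] unfolding set_lebesgue_integral_def * .
 qed
 have D': "D' A = D A" if A: "A \<in> bounded_borel (half_space k)" for A
 proof -
  have "(LINT x:A|?T. \<nu>' x $ i) = (LINT x:A|completion \<mu>. \<nu> x $ i)" for i
  proof (rule set_integral_determined_by_tests[OF _ _ _ _ _ _ _ A])
  show "(%x. x) \<in> measurable ?T borel" "half_space k \<subseteq> space ?T" by (simp_all add: total_variation_measure_space)
  show "(%x. x) \<in> measurable (completion \<mu>) borel" by (rule measurable_completion[OF borel_\<mu>]) simp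
  show "half_space k \<subseteq> space (completion \<mu>)" by (simp add: space_\<mu>)
  show "(LINT x|?T. \<phi> x * \<nu>' x $ i) = (LINT x|completion \<mu>. \<phi> x * \<nu> x $ i)" if "test_function (half_space k) \<phi>" for \<phi>
  proof -
  have 1: "(LINT x:half_space k|lebesgue. f x * partial i \<phi> x) = - (LINT x|?T. \<phi> x * \<nu>' x $ i)"
  using BV' that unfolding is_BV_derivative_def by simp
  have 2: "(LINT x:half_space k|lebesgue. f x * partial i \<phi> x) = - (LINT x|completion \<mu>. \<phi> x * \<nu> x $ i)"
  using BV that unfolding is_BV_derivative_def TV by simp
  show ?thesis using trans[OF 1[symmetric] 2] by (simp only: neg_equal_iff_equal)
  qed
  qed (simp_all add: comp p' polar_integral)
  then have "D' A $ i = D A $ i" for i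
  using comp(2)[OF p'(1)[OF A], of i] comp(2)[OF polar_integral(1)[OF A], of i] p'(2)[OF A] polar_integral(2)[OF A] by simp
  then show ?thesis by (simp add: vec_eq_iff)
 qed
 show T: "?T = completion \<mu>" by (rule total_variation_eq[OF D'])
 have "AE y in completion \<mu>. \<forall>i\<in>UNIV. \<forall>m. indicator (hs_exh k m) y * (\<nu>' y $ i - \<nu> y $ i) = 0"
 proof (intro AE_finite_allI, simp, unfold AE_all_countable, intro allI)
  fix i m
  let ?X = "hs_exh k m"
  have X: "?X \<in> bounded_borel (half_space k)"
  unfolding bounded_borel_def mem_Collect_eq
  by (intro conjI exI[of _ ?X] borel_compact compact_hs_exh hs_exh_subset subset_refl)
  have ia: "set_integrable (completion \<mu>) B (%y. \<nu>' y $ i)" "set_integrable (completion \<mu>) B (%y. \<nu> y $ i)"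
  "(LINT y:B|completion \<mu>. \<nu>' y $ i) = (LINT y:B|completion \<mu>. \<nu> y $ i)" if B: "B \<in> bounded_borel (half_space k)" for B
  using comp[OF p'(1)[OF B], of i] comp[OF polar_integral(1)[OF B], of i] p'(2)[OF B] polar_integral(2)[OF B] D'[OF B] unfolding T by simp_all
  show "AE y in completion \<mu>. indicator ?X y * (\<nu>' y $ i - \<nu> y $ i) = 0"
  proof (rule AE_zero_of_set_integrals)
  show "sigma_finite_measure \<mu>" ..
  show "integrable (completion \<mu>) (%y. indicator ?X y * (\<nu>' y $ i - \<nu> y $ i))"
  using set_integral_diff(1)[OF ia(1,2)[OF X]] by (simp add: set_integrable_def)
  fix B assume B: "B \<in> sets \<mu>"
  then have "B \<in> sets borel" by (simp add: sets_\<mu> sets_restrict_half_space)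
  then have BX: "B \<inter> ?X \<in> sets borel" by (rule sets.Int[OF _ borel_compact[OF compact_hs_exh]])
  have "B \<inter> ?X \<in> bounded_borel (half_space k)"
  unfolding bounded_borel_def mem_Collect_eq
  by (intro conjI BX exI[of _ ?X] compact_hs_exh hs_exh_subset Int_lower2)
  then have "(LINT y:B \<inter> ?X|completion \<mu>. \<nu>' y $ i - \<nu> y $ i) = 0"
  using ia[of "B \<inter> ?X"] by (simp add: set_integral_diff(2))
  moreover have eq: "(%y. indicator B y *\<^sub>R (indicator ?X y * (\<nu>' y $ i - \<nu> y $ i))) = (%y. indicator (B \<inter> ?X) y *\<^sub>R (\<nu>' y $ i - \<nu> y $ i))"
  by (auto simp: fun_eq_iff indicator_def)
  ultimately show "(LINT y:B|completion \<mu>. indicator ?X y * (\<nu>' y $ i - \<nu> y $ i)) = 0"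
  unfolding set_lebesgue_integral_def eq by simp
  qed
 qed
 moreover have "AE y in completion \<mu>. y \<in> space (completion \<mu>)" by (rule AE_space)
 ultimately show "AE y in completion \<mu>. \<nu>' y = \<nu> y"
 proof eventually_elim
  fix y assume *: "\<forall>i\<in>UNIV. \<forall>m. indicator (hs_exh k m) y * (\<nu>' y $ i - \<nu> y $ i) = 0" and y: "y \<in> space (completion \<mu>)"
  obtain m where "y \<in> hs_exh k m" using y hs_exh_eventually[of y k] unfolding space_completion space_\<mu> by blast
  then have "\<nu>' y $ i = \<nu> y $ i" for i using *[rule_format, of i m] by simp
  then show "\<nu>' y = \<nu> y" by (simp add: vec_eq_iff)
 qed
qed

end

section \<open>Equality for the indicator of a ball\<close>

theorem ball_equality:
 fixes k :: "'n::finite" and N :: "real^'n => real" and a b \<kappa> :: real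
 assumes N: "is_norm N" and a: "0 <= a" and \<kappa>: "0 < \<kappa>" and x0: "x0 $ k = 0"
 defines "na \<equiv> eff_dim TYPE('n) a"
 assumes b: "\<bar>b\<bar> = \<kappa> powr na * half_ball_mass k a N powr (- 1)"
 defines "f \<equiv> %x. b * indicator (unit_ball N) (\<kappa> *\<^sub>R (x - x0))"
 shows "mass_p k a 1 f = 1" and "locally_BV (half_space k) f"
  and "is_BV_derivative (half_space k) f D \<nu> ==>
  integrable (total_variation (half_space k) D) (%x. weight k a x * dual_norm N (\<nu> x)) &
  entropy_p k a 1 f = ereal na * extended_ln (log_sobolev_const k a N 1 *
  (LINT x|total_variation (half_space k) D. weight k a x * dual_norm N (\<nu> x)))"
proof -
 let ?\<Omega> = "half_space k" and ?G = "norm_gradient N" and ?m = "half_ball_mass k a N" and ?n = "CARD('n)"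
 note [measurable] = is_norm_borel[OF N] norm_gradient_measurable[OF N] is_norm_borel[OF is_norm_dual_norm[OF N]]
  radial_projection_measurable[OF N] half_space_measurable
 define r where "r = 1 / \<kappa>"
 have r: "0 < r" using \<kappa> by (simp add: r_def)
 have m: "0 < ?m" by (rule half_ball_mass_eq(2)[OF N a])
 have na: "0 < na" unfolding na_def by (rule eff_dim_pos[OF a])
 have b1: "\<bar>b\<bar> * (r powr na * ?m) = 1"
  unfolding b r_def using \<kappa> m by (simp add: powr_divide powr_minus_divide)
 have b0: "0 < \<bar>b\<bar>" using b1 by auto
 let ?I = "%x. indicator {x. N x <= r} (x - x0) :: real"
 have f: "f = (%x. b * ?I x)"
 proof -
  have "N (\<kappa> *\<^sub>R (x - x0)) = \<kappa> * N (x - x0)" for x using \<kappa> by (simp only: is_norm_scale[OF N] abs_of_pos)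
  then have "indicator (unit_ball N) (\<kappa> *\<^sub>R (x - x0)) = ?I x" for x
  unfolding indicator_def unit_ball_def mem_Collect_eq using \<kappa> by (simp only: r_def pos_le_divide_eq mult.commute)
  then show ?thesis by (simp only: f_def)
 qed
 have fm [measurable]: "f \<in> borel_measurable borel" unfolding f by measurable
 have e: "emeasure (hs_meas k a) {x. N x <= r} = ennreal (r powr na * ?m)"
  unfolding na_def by (rule emeasure_norm_ball[OF N a r])
 have "integrable (hs_meas k a) (indicator {x. N x <= r} :: _ => real)" using e by (intro integrable_real_indicator) auto
 moreover have "(\<integral>x. indicator {x. N x <= r} x \<partial>hs_meas k a) = r powr na * ?m"
  using e m by (simp add: measure_def)
 ultimately have I: "integrable (hs_meas k a) ?I" "(\<integral>x. ?I x \<partial>hs_meas k a) = r powr na * ?m"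
  using integral_hs_meas_translate[of "indicator {x. N x <= r}" x0 k a] x0 by simp_all
 have fp: "\<bar>f x\<bar> powr 1 = \<bar>b\<bar> * ?I x" for x by (simp add: f abs_mult)
 show "mass_p k a 1 f = 1"
  unfolding mass_p_def fp by (subst integral_hs_meas(1)) (simp_all add: I b1)
 have ent: "entropy_p k a 1 f = ereal (ln \<bar>b\<bar>)"
 proof -
  have h: "\<bar>f x\<bar> powr 1 * ln (\<bar>f x\<bar> powr 1) = (\<bar>b\<bar> * ln \<bar>b\<bar>) * ?I x" for x unfolding fp by (simp add: indicator_def)
  have "entropy_p k a 1 f = ereal (\<integral>x. (\<bar>b\<bar> * ln \<bar>b\<bar>) * ?I x \<partial>hs_meas k a)"
  unfolding entropy_p_def h by (rule extended_integral_half_space_integrable) (intro integrable_mult_right I(1))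
  also have "(\<integral>x. (\<bar>b\<bar> * ln \<bar>b\<bar>) * ?I x \<partial>hs_meas k a) = (\<bar>b\<bar> * (r powr na * ?m)) * ln \<bar>b\<bar>" by (simp add: I)
  finally show ?thesis unfolding b1 by simp
 qed
 \<comment> \<open>the total variation is the radial image of the density of the gradient of the norm\<close>
 define K where "K = \<bar>b\<bar> * (real ?n * r ^ (?n - 1))"
 have K: "0 < K" using b0 r by (simp add: K_def)
 obtain C where C: "0 < C" "!!x. norm (?G x) <= C" using norm_gradient_bounded[OF N] by blast
 define w where "w x = indicator {x. N x <= 1} x * (K * (indicator ?\<Omega> x * norm (?G x)))" for x
 have wm [measurable]: "w \<in> borel_measurable borel" unfolding w_def by measurable
 have w0: "0 <= w x" for x using K by (simp add: w_def)
 have wi: "integrable lborel w"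
  unfolding w_def
 proof (rule indicator_ball_integrable[OF N])
  show "\<bar>K * (indicator ?\<Omega> x * norm (?G x))\<bar> <= K * C" for x
  using K C(1) C(2)[of x] by (auto simp: indicator_def abs_mult)
 qed measurable
 define P where "P x = (if x \<in> ?\<Omega> then x0 + (r / N x) *\<^sub>R x else axis k 1)" for x
 have N\<Omega>: "0 < N x" if "x \<in> ?\<Omega>" for x
 proof (rule is_norm_pos[OF N])
  show "x ~= 0" using that by (auto simp: half_space_def)
 qed
 have P\<Omega>: "P x \<in> ?\<Omega>" for x
  using N\<Omega>[of x] r x0 by (auto simp: P_def half_space_def)
 have Pm [measurable]: "P \<in> borel_measurable borel" unfolding P_def by measurable
 let ?d = "density lborel (%x. ennreal (w x))" and ?R = "restrict_space borel ?\<Omega>"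
 have "P \<in> measurable lborel ?R" by (rule measurable_restrict_space2) (use P\<Omega> in auto)
 moreover have "sets ?d = sets lborel" by simp
 ultimately have PR: "P \<in> measurable ?d ?R" using measurable_cong_sets[of ?d lborel ?R ?R] by blast
 define \<mu> where "\<mu> = distr ?d ?R P"
 have FR: "F \<in> borel_measurable ?R" if "F \<in> borel_measurable borel" for F :: "real^'n => 'b::topological_space"
  using that by (rule measurable_restrict_space1)
 have int: "integrable \<mu> F \<longleftrightarrow> integrable lborel (%x. w x * F (P x))" "(\<integral>y. F y \<partial>\<mu>) = (\<integral>x. w x * F (P x) \<partial>lborel)"
  if [measurable]: "F \<in> borel_measurable borel" for F :: "real^'n => real"
 proof -
  have m: "(%x. F (P x)) \<in> borel_measurable lborel" "w \<in> borel_measurable lborel" using wm by simp_all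
  have nn: "AE x in lborel. 0 <= w x" using w0 by simp
  show "integrable \<mu> F \<longleftrightarrow> integrable lborel (%x. w x * F (P x))"
  unfolding \<mu>_def integrable_distr_eq[OF PR FR[OF that]] integrable_density[OF m nn] by simp
  show "(\<integral>y. F y \<partial>\<mu>) = (\<integral>x. w x * F (P x) \<partial>lborel)"
  unfolding \<mu>_def integral_distr[OF PR FR[OF that]] integral_density[OF m nn] by simp
 qed
 define \<nu>0 where "\<nu>0 y = (- sgn b / norm (?G (y - x0))) *\<^sub>R ?G (y - x0)" for y
 have \<nu>m [measurable]: "\<nu>0 \<in> borel_measurable borel" unfolding \<nu>0_def by measurable
 have GP: "?G (P x - x0) = ?G x" if "x \<in> ?\<Omega>" for x
 proof -
  have "P x - x0 = (r / N x) *\<^sub>R x" using that by (simp add: P_def)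
  then show ?thesis using norm_gradient_homogeneous[OF N, of "r / N x" x] N\<Omega>[OF that] r by simp
 qed
 have "finite_measure ?d"
 proof (rule finite_measureI)
  have "emeasure ?d (space ?d) = (\<integral>\<^sup>+x. ennreal (w x) \<partial>lborel)" by (simp add: emeasure_density)
  also have "\<dots> = ennreal (\<integral>x. w x \<partial>lborel)" by (rule nn_integral_eq_integral[OF wi]) (simp add: w0)
  finally show "emeasure ?d (space ?d) ~= \<infinity>" by simp
 qed
 then have fin: "finite_measure \<mu>" unfolding \<mu>_def using PR by (rule finite_measure.finite_measure_distr)
 have unit: "AE y in \<mu>. norm (\<nu>0 y) = 1"
 proof -
  have ms: "{y \<in> space ?R. norm (\<nu>0 y) = 1} \<in> sets ?R"
  proof -
  have nm: "(%y. norm (\<nu>0 y)) \<in> borel_measurable borel" by (rule borel_measurable_continuous_on[of norm]) (auto intro!: continuous_intros \<nu>m)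
  have "{y \<in> space ?R. norm (\<nu>0 y) = 1} = (%y. norm (\<nu>0 y)) -` {1} \<inter> space ?R" by blast
  then show ?thesis using measurable_sets[OF FR[OF nm], of "{1}"] by simp
  qed
  have dm: "(%x. ennreal (w x)) \<in> borel_measurable lborel" using wm by simp
  have "AE x in lborel. 0 < ennreal (w x) --> norm (\<nu>0 (P x)) = 1"
  proof (rule AE_I2, rule impI)
  fix x assume "0 < ennreal (w x)"
  then have "w x ~= 0" by auto
  moreover have "w x = 0" if "x \<notin> ?\<Omega> \<or> ?G x = 0" using that by (elim disjE) (simp_all add: w_def)
  ultimately have x: "x \<in> ?\<Omega>" "?G x ~= 0" by blast+
  have "norm (\<nu>0 (P x)) = \<bar>sgn b\<bar> / norm (?G x) * norm (?G x)" by (simp add: \<nu>0_def GP[OF x(1)])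
  also have "\<dots> = 1" using x(2) b0 by (simp add: abs_sgn_eq)
  finally show "norm (\<nu>0 (P x)) = 1" .
  qed
  then have "AE x in ?d. norm (\<nu>0 (P x)) = 1" by (simp only: AE_density[OF dm])
  then show ?thesis unfolding \<mu>_def by (simp only: AE_distr_iff[OF PR ms])
 qed
 interpret polar: polar_measure \<mu> k \<nu>0
 proof (rule polar_measure.intro[OF fin], unfold_locales)
  show "sets \<mu> = sets ?R" by (simp add: \<mu>_def)
 qed (fact \<nu>m unit)+
 have flocal: "locally_integrable ?\<Omega> f"
  by (rule bounded_borel_locally_integrable[OF fm, where B="\<bar>b\<bar>"]) (auto simp: f indicator_def)
 have parts: "(LINT x:?\<Omega>|lebesgue. f x * partial i \<phi> x) = - (\<integral>y. \<phi> y * \<nu>0 y $ i \<partial>\<mu>)" if t: "test_function ?\<Omega> \<phi>" for \<phi> i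
 proof -
  note [measurable] = test_function_measurable[OF t] test_function_partial_measurable[OF t]
  obtain R where R: "!!x. R < norm x ==> \<phi> x = 0" using test_function_bounded_support[OF t] by blast
  have C\<phi>: "C_k (Suc 0) \<phi>" by (rule test_function_C_k[OF t])
  let ?J = "\<integral>x. indicator {x. N x <= 1} x * (?G x $ i * \<phi> (x0 + (r / N x) *\<^sub>R x)) \<partial>lborel"
  have "(LINT x:?\<Omega>|lebesgue. f x * partial i \<phi> x) = (\<integral>x. f x * partial i \<phi> x \<partial>lborel)"
  by (rule lebesgue_set_integral_of_support) (simp_all add: test_function_partial_support[OF t])
  also have "\<dots> = b * (\<integral>x. indicator {x. N (x - x0) <= r} x * partial i \<phi> x \<partial>lborel)"
  unfolding integral_mult_right_zero[symmetric] by (intro Bochner_Integration.integral_cong) (auto simp: f indicator_def)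
  also have "\<dots> = b * (real ?n * r ^ (?n - 1) * ?J)" by (simp only: norm_ball_gauss_green[OF N r C\<phi> R])
  also have "b * (real ?n * r ^ (?n - 1) * ?J) = (sgn b * K) * ?J"
  proof -
  have "sgn b * \<bar>b\<bar> = b" by (simp add: sgn_if abs_if)
  moreover have "(sgn b * K) * ?J = (sgn b * \<bar>b\<bar>) * (real ?n * r ^ (?n - 1) * ?J)" by (simp only: K_def mult.assoc)
  ultimately show ?thesis by (simp only:)
  qed
  finally have lhs: "(LINT x:?\<Omega>|lebesgue. f x * partial i \<phi> x) = (sgn b * K) * ?J" .
  have pt: "w x * (\<phi> (P x) * \<nu>0 (P x) $ i) = - (sgn b * K) * (indicator {x. N x <= 1} x * (?G x $ i * \<phi> (x0 + (r / N x) *\<^sub>R x)))" for x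
  proof (cases "x \<in> ?\<Omega>")
  case True
  then have Px: "P x = x0 + (r / N x) *\<^sub>R x" by (simp add: P_def)
  have "norm (?G x) * (\<nu>0 (P x) $ i) = - sgn b * ?G x $ i"
  by (cases "?G x = 0") (simp_all add: \<nu>0_def GP[OF True])
  then have "indicator {x. N x <= 1} x * K * \<phi> (P x) * (norm (?G x) * (\<nu>0 (P x) $ i)) = indicator {x. N x <= 1} x * K * \<phi> (P x) * (- sgn b * ?G x $ i)" by (rule arg_cong)
  then show ?thesis using True unfolding Px by (simp add: w_def mult_ac)
  next
  case False
  then have "x $ k <= 0" by (simp add: half_space_def)
  then have "(r / N x) * x $ k <= 0" using r is_norm_nonneg[OF N, of x] by (intro mult_nonneg_nonpos divide_nonneg_nonneg) auto
  then have "(x0 + (r / N x) *\<^sub>R x) $ k <= 0" using x0 by simp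
  then have "x0 + (r / N x) *\<^sub>R x \<notin> ?\<Omega>" by (simp add: half_space_def)
  then show ?thesis using False by (simp add: w_def test_function_support[OF t])
  qed
  have "(%y. \<phi> y * (\<nu>0 y \<bullet> axis i 1)) \<in> borel_measurable borel" by measurable
  then have "(%y. \<phi> y * \<nu>0 y $ i) \<in> borel_measurable borel" by (simp add: inner_axis)
  from int(2)[OF this] have "(\<integral>y. \<phi> y * \<nu>0 y $ i \<partial>\<mu>) = - (sgn b * K) * ?J" unfolding pt integral_mult_right_zero .
  with lhs show ?thesis by simp
 qed
 have BV: "is_BV_derivative ?\<Omega> f polar.D \<nu>0" by (rule polar.is_BV_derivative_D[OF flocal]) (rule parts)
 then show "locally_BV ?\<Omega> f" unfolding locally_BV_def by blast
 let ?h = "%y. weight k a y * dual_norm N (\<nu>0 y)"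
 let ?W = "%x. indicator ?\<Omega> x * weight k a ((1 / N x) *\<^sub>R x) :: real"
 note W = projected_weight_integral[OF N a, of k]
 have hm: "?h \<in> borel_measurable borel" by measurable
 have ae: "AE x in lborel. w x * ?h (P x) = (K * r powr a) * (indicator {x. N x <= 1} x * ?W x)"
  using dual_norm_norm_gradient_AE[OF N]
 proof eventually_elim
  fix x assume d: "dual_norm N (?G x) = 1"
  show "w x * ?h (P x) = (K * r powr a) * (indicator {x. N x <= 1} x * ?W x)"
  proof (cases "x \<in> ?\<Omega>")
  case True
  have G0: "?G x ~= 0" using d is_norm_zero[OF is_norm_dual_norm[OF N]] by auto
  have dual: "norm (?G x) * dual_norm N (\<nu>0 (P x)) = 1"
  proof -
  have "dual_norm N (\<nu>0 (P x)) = \<bar>- sgn b / norm (?G x)\<bar> * dual_norm N (?G x)"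
  unfolding \<nu>0_def GP[OF True] by (rule is_norm_scale[OF is_norm_dual_norm[OF N]])
  also have "\<dots> = 1 / norm (?G x)" using b0 unfolding d by (simp add: abs_divide abs_sgn_eq)
  finally show ?thesis using G0 by simp
  qed
  have "P x $ k = r * ((1 / N x) *\<^sub>R x) $ k" using True x0 by (simp add: P_def)
  then have "weight k a (P x) = r powr a * weight k a ((1 / N x) *\<^sub>R x)" by (simp only: weight_def powr_mult)
  then have "w x * ?h (P x) = indicator {x. N x <= 1} x * (K * (r powr a * weight k a ((1 / N x) *\<^sub>R x))) * (norm (?G x) * dual_norm N (\<nu>0 (P x)))"
  using True by (simp add: w_def mult_ac)
  then show ?thesis unfolding dual using True by (simp add: mult_ac)
  qed (simp add: w_def)
 qed
 obtain C' where C': "!!x. \<bar>?W x\<bar> <= C'" using W(2) by blast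
 have iW: "integrable lborel (%x. (K * r powr a) * (indicator {x. N x <= 1} x * ?W x))"
  by (intro integrable_mult_right indicator_ball_integrable[OF N W(1) C'])
 have m1: "(%x. w x * ?h (P x)) \<in> borel_measurable lborel" by measurable
 have h_int: "integrable \<mu> ?h"
  unfolding int(1)[OF hm] integrable_cong_AE[OF m1 borel_measurable_integrable[OF iW] ae] by (rule iW)
 have h_val: "(\<integral>y. ?h y \<partial>\<mu>) = na * \<kappa>"
 proof -
  have "(\<integral>y. ?h y \<partial>\<mu>) = K * r powr a * (\<integral>x. indicator {x. N x <= 1} x * ?W x \<partial>lborel)"
  unfolding int(2)[OF hm] integral_cong_AE[OF m1 borel_measurable_integrable[OF iW] ae] by (rule integral_mult_right_zero)
  also have "\<dots> = \<bar>b\<bar> * (r ^ (?n - 1) * r powr a) * (real ?n * (\<integral>x. indicator {x. N x <= 1} x * ?W x \<partial>lborel))"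
  by (simp only: K_def mult_ac)
  also have "\<dots> = \<bar>b\<bar> * (r ^ (?n - 1) * r powr a) * (na * ?m)" unfolding W(3) na_def ..
  also have "r ^ (?n - 1) * r powr a = r powr na * \<kappa>"
  proof -
  have "r * (r ^ (?n - 1) * r powr a) = (r ^ (?n - 1) * r) * r powr a" by (simp only: mult_ac)
  also have "r ^ (?n - 1) * r = r ^ ?n" by (rule power_minus_mult) simp
  also have "r ^ ?n * r powr a = r powr na" using r by (simp add: na_def eff_dim_def powr_add powr_realpow)
  finally show ?thesis using \<kappa> by (simp add: r_def field_simps)
  qed
  also have "\<bar>b\<bar> * (r powr na * \<kappa>) * (na * ?m) = (\<bar>b\<bar> * (r powr na * ?m)) * (na * \<kappa>)" by (simp only: mult_ac)
  finally show ?thesis unfolding b1 by simp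
 qed
 show "integrable (total_variation ?\<Omega> D) (%x. weight k a x * dual_norm N (\<nu> x)) &
  entropy_p k a 1 f = ereal na * extended_ln (log_sobolev_const k a N 1 *
  (LINT x|total_variation ?\<Omega> D. weight k a x * dual_norm N (\<nu> x)))"
  if BV': "is_BV_derivative ?\<Omega> f D \<nu>"
 proof -
  note u = polar.is_BV_derivative_unique[OF BV BV']
  have "\<nu> \<in> borel_measurable (completion \<mu>)" using BV' unfolding is_BV_derivative_def is_polar_field_def u(1) by blast
  then have [measurable]: "(%y. dual_norm N (\<nu> y)) \<in> borel_measurable (completion \<mu>)" by measurable
  have [measurable]: "weight k a \<in> borel_measurable (completion \<mu>)" by (rule measurable_completion[OF polar.borel_\<mu>]) measurable
  have m2: "(%y. weight k a y * dual_norm N (\<nu> y)) \<in> borel_measurable (completion \<mu>)" by measurable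
  have m3: "?h \<in> borel_measurable \<mu>" by (rule polar.borel_\<mu>[OF hm])
  have eq: "AE y in completion \<mu>. weight k a y * dual_norm N (\<nu> y) = ?h y" using u(2) by eventually_elim simp
  have "integrable (completion \<mu>) (%y. weight k a y * dual_norm N (\<nu> y))"
  unfolding integrable_cong_AE[OF m2 measurable_completion[OF m3] eq] integrable_completion[OF m3] by (rule h_int)
  moreover have "(\<integral>y. weight k a y * dual_norm N (\<nu> y) \<partial>completion \<mu>) = na * \<kappa>"
  unfolding integral_cong_AE[OF m2 measurable_completion[OF m3] eq] integral_completion[OF m3] by (rule h_val)
  moreover have "ereal (ln \<bar>b\<bar>) = ereal na * extended_ln (log_sobolev_const k a N 1 * (na * \<kappa>))"
  proof -
  have L: "log_sobolev_const k a N 1 * (na * \<kappa>) = ?m powr (- (1 / na)) * \<kappa>"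
  using na by (simp add: log_sobolev_const_def Let_def na_def)
  have "ln \<bar>b\<bar> = na * ln \<kappa> - ln ?m" unfolding b using \<kappa> m by (simp add: ln_mult ln_powr ln_div)
  also have "\<dots> = na * ln (?m powr (- (1 / na)) * \<kappa>)" using \<kappa> m na by (simp add: ln_mult ln_powr field_simps)
  finally show ?thesis unfolding L using \<kappa> m by (simp add: extended_ln_def)
  qed
  ultimately show ?thesis unfolding u(1) ent by simp
 qed
qed

theorem proposition1p4:
  fixes k :: "'n::finite" and N :: "real^'n \<Rightarrow> real" and a p :: real
  assumes "is_norm N" and "0 \<le> a" and "1 \<le> p"
  defines "\<Omega> \<equiv> half_space k" and "na \<equiv> eff_dim TYPE('n) a" and "q \<equiv> p / (p - 1)"
  shows
    "(\<forall>f \<in> weighted_sobolev k a p N. mass_p k a p f = 1 \<longrightarrow>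
        entropy_p k a p f \<le>
          ereal (na / p) * extended_ln (log_sobolev_const k a N p * gradient_energy k a p N f))
     \<and>
     (\<forall>f b \<kappa> x0. 1 < p \<and> 0 < \<kappa> \<and> x0 $ k = 0 \<and>
        \<bar>b\<bar> powr (- p) = (LINT x:\<Omega>|lebesgue. exp (- p * \<kappa> * N x powr q) * weight k a x) \<and>
        f = (\<lambda>x. b * exp (- \<kappa> * N (x - x0) powr q)) \<longrightarrow>
        f \<in> weighted_sobolev k a p N \<and> mass_p k a p f = 1 \<and>
        entropy_p k a p f =
          ereal (na / p) * extended_ln (log_sobolev_const k a N p * gradient_energy k a p N f))
     \<and>
     (\<forall>f b \<kappa> x0. p = 1 \<and> 0 < \<kappa> \<and> x0 $ k = 0 \<and>
        \<bar>b\<bar> = \<kappa> powr (na / p) * half_ball_mass k a N powr (- (1 / p)) \<and>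
        f = (\<lambda>x. b * indicator (unit_ball N) (\<kappa> *\<^sub>R (x - x0))) \<longrightarrow>
        mass_p k a p f = 1 \<and> locally_BV \<Omega> f \<and>
        (\<forall>D \<nu>. is_BV_derivative \<Omega> f D \<nu> \<longrightarrow>
           integrable (total_variation \<Omega> D) (\<lambda>x. weight k a x * dual_norm N (\<nu> x)) \<and>
           entropy_p k a p f =
             ereal (na / p) * extended_ln (log_sobolev_const k a N p *
               (LINT x|total_variation \<Omega> D. weight k a x * dual_norm N (\<nu> x)))))"
proof (intro conjI ballI allI impI; (elim conjE)?)
  fix f assume "f \<in> weighted_sobolev k a p N" "mass_p k a p f = 1"
  then show "entropy_p k a p f \<le> ereal (na / p) * extended_ln (log_sobolev_const k a N p * gradient_energy k a p N f)"
    unfolding na_def by (intro log_sobolev_inequality assms)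
next
  fix f b \<kappa> x0
  assume p: "1 < p" and \<kappa>: "0 < \<kappa>" and x0: "x0 $ k = 0"
    and b: "\<bar>b\<bar> powr (- p) = (LINT x:\<Omega>|lebesgue. exp (- p * \<kappa> * N x powr q) * weight k a x)"
    and f: "f = (\<lambda>x. b * exp (- \<kappa> * N (x - x0) powr q))"
  note eq = exponential_equality[OF assms(1,2) p \<kappa> x0 b[unfolded \<Omega>_def q_def], folded q_def, folded f]
  show "f \<in> weighted_sobolev k a p N" "mass_p k a p f = 1"
    "entropy_p k a p f = ereal (na / p) * extended_ln (log_sobolev_const k a N p * gradient_energy k a p N f)"
    unfolding na_def by (rule eq)+
next
  fix f b \<kappa> x0
  assume p: "p = 1" and \<kappa>: "0 < \<kappa>" and x0: "x0 $ k = 0"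
    and b: "\<bar>b\<bar> = \<kappa> powr (na / p) * half_ball_mass k a N powr (- (1 / p))"
    and f: "f = (\<lambda>x. b * indicator (unit_ball N) (\<kappa> *\<^sub>R (x - x0)))"
  have b': "\<bar>b\<bar> = \<kappa> powr eff_dim TYPE('n) a * half_ball_mass k a N powr (- 1)" using b p by (simp add: na_def)
  note eq = ball_equality[OF assms(1,2) \<kappa> x0 b', folded f]
  show "mass_p k a p f = 1" "locally_BV \<Omega> f" unfolding p \<Omega>_def by (rule eq)+
  fix D \<nu> assume "is_BV_derivative \<Omega> f D \<nu>"
  from eq(3)[OF this[unfolded \<Omega>_def]]
  show "integrable (total_variation \<Omega> D) (\<lambda>x. weight k a x * dual_norm N (\<nu> x))"
    "entropy_p k a p f = ereal (na / p) * extended_ln (log_sobolev_const k a N p *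
       (LINT x|total_variation \<Omega> D. weight k a x * dual_norm N (\<nu> x)))"
    unfolding p \<Omega>_def na_def by simp_all
qed


end
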